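(* Let $k\geq 1$. For $j \in \{1,2\}$, let $\{(X_1^{(j)}(\omega_j),\ldots,X_k^{(j)}(\omega_j))\}_{\omega_j\in\Omega_j}$ and $f_j\colon \Omega_j \to \{1,2,\ldots,\infty\}$ be, respectively, a measurable field of $k$-tuples of matrices and a measurable function defined on a standard measure space $(\Omega_j,\mathfrak{M}_j,\mu_j)$ such that: (F1) for any $\omega_j \in \Omega_j$, the $k$-tuple $(X_1^{(j)}(\omega_j),\ldots,X_k^{(j)}(\omega_j))$ is irreducible; (F2) for any two distinct points $\omega_j$ and $\omega_j'$ of $\Omega_j$, the $k$-tuples $(X_1^{(j)}(\omega_j),\ldots,X_k^{(j)}(\omega_j))$ and $(X_1^{(j)}(\omega_j'),\ldots,X_k^{(j)}(\omega_j'))$ are unitarily inequivalent. Then the $k$-tuples $$\mathbf{T}_1 = \Bigl(\int^{\oplus}_{\Omega_1} f_1(\omega_1) \odot X_1^{(1)}(\omega_1)\,d\mu_1(\omega_1),\ldots,\int^{\oplus}_{\Omega_1} f_1(\omega_1) \odot X_k^{(1)}(\omega_1)\,d\mu_1(\omega_1)\Bigr)$$ and $$\mathbf{T}_2 = \Bigl(\int^{\oplus}_{\Omega_2} f_2(\omega_2) \odot X_1^{(2)}(\omega_2)\,d\mu_2(\omega_2),\ldots,\int^{\oplus}_{\Omega_2} f_2(\omega_2) \odot X_k^{(2)}(\omega_2)\,d\mu_2(\omega_2)\Bigr)$$ are unitarily equivalent if and only if there exist measurable sets $Z_1 \subset \Omega_1$, $Z_2 \subset \Omega_2$ and a Borel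 isomorphism $\Phi\colon \Omega_1 \setminus Z_1 \to \Omega_2 \setminus Z_2$ such that: (E1) $\mu_1(Z_1) = 0$ and $\mu_2(Z_2) = 0$; (E2) for each measurable set $B \subset \Omega_1 \setminus Z_1$, $\mu_2(\Phi(B)) = 0$ if and only if $\mu_1(B) = 0$; (E3) the $k$-tuples $(X_1^{(2)}(\Phi(\omega_1)),\ldots,X_k^{(2)}(\Phi(\omega_1)))$ and $(X_1^{(1)}(\omega_1),\ldots,X_k^{(1)}(\omega_1))$ are unitarily equivalent and $f_2(\Phi(\omega_1)) = f_1(\omega_1)$ for any $\omega_1 \in \Omega_1 \setminus Z_1$.
   Context: All Hilbert spaces and matrices are complex. A $k$-tuple of operators consists of closed densely defined operators acting in a common Hilbert space; a $k$-tuple of matrices consists of square matrices of the same degree $n\geq1$. Two $k$-tuples $(T_1,\ldots,T_k)$, $(T_1',\ldots,T_k')$ are unitarily equivalent if there is a single unitary operator $U$ with $UT_sU^{-1}=T_s'$ for all $s\in\{1,\ldots,k\}$. A $k$-tuple $(A_1,\ldots,A_k)$ of $n\times n$ matrices is irreducible if the only unitary $n\times n$ matrices commuting with all $A_s$ are the scalar multiples of the identity. For a matrix $A$ and a positive integer $m$, $m\odot A$ is the direct sum of $m$ copies of $A$; $\infty\odot A$ is the direct sum of countably infinitely many copies of $A$. A standard measure space is a $\sigma$-finite measure space which, after removing a null set, is a standard Borel space. A Borel isomorphism is a bijection which is measurable in both directions. A field of $k$-tuples is measurable if each of the $k$ fields of its coordinates is measurable; a field of matrices $\{X(\omega)\}$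 is measurable if the degree of $X(\omega)$ is a measurable function of $\omega$ and on each set of constant degree the entries are measurable. The direct integral $\int^{\oplus}_{\Omega}T(\omega)\,d\mu(\omega)$ of a measurable field of operators is the operator acting as $(T\xi)(\omega)=T(\omega)\xi(\omega)$ on those vectors $\xi$ of the direct integral Hilbert space with $\xi(\omega)$ in the domain of $T(\omega)$ for almost all $\omega$ and $\int\|T(\omega)\xi(\omega)\|^2d\mu(\omega)<\infty$. *)

theory Defs
  imports "HOL-Analysis.Analysis" "Jordan_Normal_Form.Schur_Decomposition"
begin

section \<open>Standard measure spaces\<close>

definition standard_borel :: "'a measure \<Rightarrow> bool" where
  "standard_borel M \<longleftrightarrow>
     (\<exists>X. completely_metrizable_space X \<and> second_countable X \<and>
          space M = topspace X \<and> sets M = sigma_sets (topspace X) {U. openin X U})"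

definition standard_measure_space :: "'a measure \<Rightarrow> bool" where
  "standard_measure_space M \<longleftrightarrow>
     sigma_finite_measure M \<and>
     (\<exists>N\<in>null_sets M. standard_borel (restrict_space M (space M - N)))"

definition borel_isomorphism :: "'a measure \<Rightarrow> 'b measure \<Rightarrow> ('a \<Rightarrow> 'b) \<Rightarrow> bool" where
  "borel_isomorphism M N \<Phi> \<longleftrightarrow>
     bij_betw \<Phi> (space M) (space N) \<and> \<Phi> \<in> measurable M N \<and>
     inv_into (space M) \<Phi> \<in> measurable N M"

section \<open>Hilbert spaces, operators and unitary equivalence\<close>

text \<open>Fibres of varying dimension and quotient spaces have no common type, so a complex Hilbert
  space is given by an explicit carrier with its operations; the inner product is linear in the
  first argument. An operator, possibly unbounded, is represented by its graph. Only concrete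
  Hilbert spaces and operators constructed below are used, so the axioms are not part of the
  data.\<close>

record 'a hilb =
  hcarrier :: "'a set"
  hzero :: 'a
  hadd :: "'a \<Rightarrow> 'a \<Rightarrow> 'a"
  hscale :: "complex \<Rightarrow> 'a \<Rightarrow> 'a"
  hinner :: "'a \<Rightarrow> 'a \<Rightarrow> complex"

type_synonym 'a operator = "('a \<times> 'a) set"

definition hnorm2 :: "'a hilb \<Rightarrow> 'a \<Rightarrow> real" where
  "hnorm2 H x = Re (hinner H x x)"

definition unitary_op :: "'a hilb \<Rightarrow> 'b hilb \<Rightarrow> ('a \<Rightarrow> 'b) \<Rightarrow> bool" where
  "unitary_op H K U \<longleftrightarrow>
     bij_betw U (hcarrier H) (hcarrier K) \<and>
     (\<forall>x\<in>hcarrier H. \<forall>y\<in>hcarrier H. U (hadd H x y) = hadd K (U x) (U y)) \<and>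
     (\<forall>c. \<forall>x\<in>hcarrier H. U (hscale H c x) = hscale K c (U x)) \<and>
     (\<forall>x\<in>hcarrier H. \<forall>y\<in>hcarrier H. hinner K (U x) (U y) = hinner H x y)"

text \<open>A \<open>k\<close>-tuple is a family indexed by \<open>{1..k}\<close>. The image of the graph of \<open>T\<close> under
  \<open>map_prod U U\<close> is the graph of \<open>U T U\<inverse>\<close>, with domain \<open>U (dom T)\<close>.\<close>

definition unitarily_equivalent ::
  "nat \<Rightarrow> 'a hilb \<Rightarrow> (nat \<Rightarrow> 'a operator) \<Rightarrow> 'b hilb \<Rightarrow> (nat \<Rightarrow> 'b operator) \<Rightarrow> bool" where
  "unitarily_equivalent k H T K T' \<longleftrightarrow>
     (\<exists>U. unitary_op H K U \<and> (\<forall>s\<in>{1..k}. map_prod U U ` T s = T' s))"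

section \<open>Tuples of matrices\<close>

definition cspace :: "nat \<Rightarrow> complex vec hilb" where
  "cspace n = \<lparr>hcarrier = carrier_vec n, hzero = 0\<^sub>v n, hadd = (\<lambda>v w. v + w),
               hscale = (\<lambda>c v. c \<cdot>\<^sub>v v), hinner = (\<lambda>v w. v \<bullet>c w)\<rparr>"

definition mat_op :: "complex mat \<Rightarrow> complex vec operator" where
  "mat_op A = {(v, A *\<^sub>v v) | v. v \<in> carrier_vec (dim_col A)}"

definition mat_tuple :: "nat \<Rightarrow> (nat \<Rightarrow> complex mat) \<Rightarrow> bool" where
  "mat_tuple k A \<longleftrightarrow> (\<exists>n\<ge>1. \<forall>s\<in>{1..k}. A s \<in> carrier_mat n n)"

text \<open>The common degree of a \<open>k\<close>-tuple of matrices, for \<open>k \<ge> 1\<close>.\<close>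

definition tuple_degree :: "(nat \<Rightarrow> complex mat) \<Rightarrow> nat" where
  "tuple_degree A = dim_row (A 1)"

definition mats_unitarily_equivalent ::
  "nat \<Rightarrow> (nat \<Rightarrow> complex mat) \<Rightarrow> (nat \<Rightarrow> complex mat) \<Rightarrow> bool" where
  "mats_unitarily_equivalent k A B \<longleftrightarrow>
     unitarily_equivalent k (cspace (tuple_degree A)) (\<lambda>s. mat_op (A s))
                            (cspace (tuple_degree B)) (\<lambda>s. mat_op (B s))"

definition unitary_mat :: "nat \<Rightarrow> complex mat \<Rightarrow> bool" where
  "unitary_mat n U \<longleftrightarrow>
     U \<in> carrier_mat n n \<and> mat_adjoint U * U = 1\<^sub>m n \<and> U * mat_adjoint U = 1\<^sub>m n"

definition irreducible_tuple :: "nat \<Rightarrow> (nat \<Rightarrow> complex mat) \<Rightarrow> bool" where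
  "irreducible_tuple k A \<longleftrightarrow>
     (\<forall>U. unitary_mat (tuple_degree A) U \<and> (\<forall>s\<in>{1..k}. U * A s = A s * U) \<longrightarrow>
        (\<exists>c. U = c \<cdot>\<^sub>m 1\<^sub>m (tuple_degree A)))"

definition measurable_mat_field :: "'w measure \<Rightarrow> ('w \<Rightarrow> complex mat) \<Rightarrow> bool" where
  "measurable_mat_field M X \<longleftrightarrow>
     (\<lambda>\<omega>. dim_row (X \<omega>)) \<in> measurable M (count_space UNIV) \<and>
     (\<forall>n. \<forall>i<n. \<forall>j<n. (\<lambda>\<omega>. X \<omega> $$ (i, j))
        \<in> borel_measurable (restrict_space M {\<omega> \<in> space M. dim_row (X \<omega>) = n}))"

definition measurable_mat_tuple_field ::
  "nat \<Rightarrow> 'w measure \<Rightarrow> (nat \<Rightarrow> 'w \<Rightarrow> complex mat) \<Rightarrow> bool" where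
  "measurable_mat_tuple_field k M X \<longleftrightarrow>
     (\<forall>\<omega>\<in>space M. mat_tuple k (\<lambda>s. X s \<omega>)) \<and>
     (\<forall>s\<in>{1..k}. measurable_mat_field M (X s))"

section \<open>Direct sums of copies\<close>

text \<open>The Hilbert direct sum of \<open>m\<close> copies of \<open>H\<close>. Its elements are sequences indexed by all of
  \<open>nat\<close>, padded with zeros from position \<open>m\<close> on.\<close>

definition copies_space :: "enat \<Rightarrow> 'a hilb \<Rightarrow> (nat \<Rightarrow> 'a) hilb" where
  "copies_space m H =
     \<lparr>hcarrier = {v. (\<forall>j. v j \<in> hcarrier H) \<and> (\<forall>j. m \<le> enat j \<longrightarrow> v j = hzero H) \<and>
                     summable (\<lambda>j. hnorm2 H (v j))},
      hzero = (\<lambda>_. hzero H),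
      hadd = (\<lambda>v w j. hadd H (v j) (w j)),
      hscale = (\<lambda>c v j. hscale H c (v j)),
      hinner = (\<lambda>v w. \<Sum>j. hinner H (v j) (w j))\<rparr>"

definition copies_op :: "enat \<Rightarrow> 'a hilb \<Rightarrow> 'a operator \<Rightarrow> (nat \<Rightarrow> 'a) operator" where
  "copies_op m H T =
     {(v, w). v \<in> hcarrier (copies_space m H) \<and> w \<in> hcarrier (copies_space m H) \<and>
              (\<forall>j. enat j < m \<longrightarrow> (v j, w j) \<in> T)}"

section \<open>Direct integrals\<close>

text \<open>A measurable structure on a field \<open>H\<close> of Hilbert spaces is given by a fundamental family \<open>e\<close>
  of sections: a section \<open>\<xi>\<close> is measurable iff all functions \<open>\<omega> \<mapsto> \<langle>\<xi>(\<omega>), e i \<omega>\<rangle>\<close> are.\<close>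

definition L2_sections :: "'w measure \<Rightarrow> ('w \<Rightarrow> 'a hilb) \<Rightarrow> ('i \<Rightarrow> 'w \<Rightarrow> 'a) \<Rightarrow> ('w \<Rightarrow> 'a) set" where
  "L2_sections M H e =
     {\<xi>. (\<forall>\<omega>\<in>space M. \<xi> \<omega> \<in> hcarrier (H \<omega>)) \<and>
         (\<forall>i. (\<lambda>\<omega>. hinner (H \<omega>) (\<xi> \<omega>) (e i \<omega>)) \<in> borel_measurable M) \<and>
         (\<integral>\<^sup>+\<omega>. ennreal (hnorm2 (H \<omega>) (\<xi> \<omega>)) \<partial>M) < \<infinity>}"

definition section_class ::
  "'w measure \<Rightarrow> ('w \<Rightarrow> 'a hilb) \<Rightarrow> ('i \<Rightarrow> 'w \<Rightarrow> 'a) \<Rightarrow> ('w \<Rightarrow> 'a) \<Rightarrow> ('w \<Rightarrow> 'a) set" where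
  "section_class M H e \<xi> = {\<eta> \<in> L2_sections M H e. AE \<omega> in M. \<eta> \<omega> = \<xi> \<omega>}"

text \<open>The operations on classes are computed on representatives; the result does not depend on the
  choice.\<close>

definition class_rep :: "('w \<Rightarrow> 'a) set \<Rightarrow> 'w \<Rightarrow> 'a" where
  "class_rep A = (SOME \<xi>. \<xi> \<in> A)"

definition direct_integral_space ::
  "'w measure \<Rightarrow> ('w \<Rightarrow> 'a hilb) \<Rightarrow> ('i \<Rightarrow> 'w \<Rightarrow> 'a) \<Rightarrow> ('w \<Rightarrow> 'a) set hilb" where
  "direct_integral_space M H e =
     \<lparr>hcarrier = section_class M H e ` L2_sections M H e,
      hzero = section_class M H e (\<lambda>\<omega>. hzero (H \<omega>)),
      hadd = (\<lambda>A B. section_class M H e (\<lambda>\<omega>. hadd (H \<omega>) (class_rep A \<omega>) (class_rep B \<omega>))),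
      hscale = (\<lambda>c A. section_class M H e (\<lambda>\<omega>. hscale (H \<omega>) c (class_rep A \<omega>))),
      hinner = (\<lambda>A B. \<integral>\<omega>. hinner (H \<omega>) (class_rep A \<omega>) (class_rep B \<omega>) \<partial>M)\<rparr>"

text \<open>As \<open>T \<omega>\<close> is a graph, \<open>(\<xi> \<omega>, \<eta> \<omega>) \<in> T \<omega>\<close> says that \<open>\<xi>(\<omega>)\<close> lies in the domain of \<open>T(\<omega>)\<close> and
  \<open>\<eta>(\<omega>) = T(\<omega>)\<xi>(\<omega>)\<close>; square integrability of \<open>T(\<omega>)\<xi>(\<omega>)\<close> is membership of \<open>\<eta>\<close> in
  \<open>L2_sections\<close>.\<close>

definition direct_integral_op ::
  "'w measure \<Rightarrow> ('w \<Rightarrow> 'a hilb) \<Rightarrow> ('i \<Rightarrow> 'w \<Rightarrow> 'a) \<Rightarrow> ('w \<Rightarrow> 'a operator)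
     \<Rightarrow> ('w \<Rightarrow> 'a) set operator" where
  "direct_integral_op M H e T =
     {(section_class M H e \<xi>, section_class M H e \<eta>) | \<xi> \<eta>.
        \<xi> \<in> L2_sections M H e \<and> \<eta> \<in> L2_sections M H e \<and> (AE \<omega> in M. (\<xi> \<omega>, \<eta> \<omega>) \<in> T \<omega>)}"

section \<open>The direct integral of a field of multiples of matrices\<close>

definition mult_fibre :: "('w \<Rightarrow> enat) \<Rightarrow> (nat \<Rightarrow> 'w \<Rightarrow> complex mat) \<Rightarrow> 'w \<Rightarrow> (nat \<Rightarrow> complex vec) hilb" where
  "mult_fibre f X \<omega> = copies_space (f \<omega>) (cspace (tuple_degree (\<lambda>s. X s \<omega>)))"

text \<open>The fundamental family consists of the coordinate vectors: the \<open>i\<close>-th unit vector in the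
  \<open>j\<close>-th copy where the fibre has this coordinate, and \<open>0\<close> elsewhere. Thus a section is
  measurable iff its coordinate functions are.\<close>

definition mult_frame ::
  "('w \<Rightarrow> enat) \<Rightarrow> (nat \<Rightarrow> 'w \<Rightarrow> complex mat) \<Rightarrow> nat \<times> nat \<Rightarrow> 'w \<Rightarrow> nat \<Rightarrow> complex vec" where
  "mult_frame f X = (\<lambda>(j, i) \<omega> l. let n = tuple_degree (\<lambda>s. X s \<omega>) in
     if l = j \<and> enat j < f \<omega> \<and> i < n then unit_vec n i else 0\<^sub>v n)"

definition mult_integral_space ::
  "'w measure \<Rightarrow> ('w \<Rightarrow> enat) \<Rightarrow> (nat \<Rightarrow> 'w \<Rightarrow> complex mat) \<Rightarrow> ('w \<Rightarrow> nat \<Rightarrow> complex vec) set hilb" where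
  "mult_integral_space M f X = direct_integral_space M (mult_fibre f X) (mult_frame f X)"

text \<open>The \<open>s\<close>-th entry is the direct integral of \<open>f(\<omega>) \<odot> X\<^sub>s(\<omega>)\<close>.\<close>

definition mult_integral_tuple ::
  "'w measure \<Rightarrow> ('w \<Rightarrow> enat) \<Rightarrow> (nat \<Rightarrow> 'w \<Rightarrow> complex mat)
     \<Rightarrow> nat \<Rightarrow> ('w \<Rightarrow> nat \<Rightarrow> complex vec) set operator" where
  "mult_integral_tuple M f X s =
     direct_integral_op M (mult_fibre f X) (mult_frame f X)
       (\<lambda>\<omega>. copies_op (f \<omega>) (cspace (tuple_degree (\<lambda>s. X s \<omega>))) (mat_op (X s \<omega>)))"

end

theory Submission
  imports Defs
begin

text \<open>Let \<open>U\<close> be a unitary intertwining the two tuples. The squared Frobenius norms of all *-polynomials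
  with rational coefficients in a tuple form a Borel invariant with values in \<open>nat \<Rightarrow> real\<close>, which
  separates irreducible tuples up to unitary equivalence. If \<open>x\<close> and \<open>y\<close> are inequivalent, then by a
  finite-dimensional bicommutant theorem some *-polynomial is close to \<open>1\<close> at \<open>x\<close> and close to \<open>0\<close>
  at \<open>y\<close>, hence also near these points; this forces \<open>U\<close> to map the sections supported near \<open>x\<close> to
  sections vanishing near \<open>y\<close>. By inner regularity \<open>U\<close> commutes with multiplication by Borel functions
  of the invariant. Therefore the images of the two measures under the invariant have the same null
  sets, and the multiplicities agree because a unitary cannot fit the sections of a fibre into one of
  smaller dimension. The invariant has a Borel inverse off a null set, which yields the Borel
  isomorphism.

  Conversely, a Borel isomorphism induces a unitary between the spaces of sections once
  intertwiners of the equivalent tuples are chosen measurably, with the square root of the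
  Radon--Nikodym derivative correcting the measure. The intertwiners are obtained by Gram--Schmidt
  from the linear equations defining them; by irreducibility every nonzero solution is a multiple of
  a unitary.\<close>

unbundle no vec_syntax

section \<open>Matrices and intertwiners\<close>

text \<open>The direct integrals may be unbounded, so polynomials are not applied to them directly.
  All comparisons go through the form \<open>S \<xi> \<eta>\<close>, the inner product of
  \<open>U \<xi>\<close> with \<open>\<eta>\<close>: generators move between its arguments along
  their graphs, over sets where degrees and generators are bounded, and countably many such sets
  fill both spaces. Adjoints are only taken fibrewise.

  The constant 1/9 is a squared norm: two errors of norm 1/3 add up to 2/3 < 1, which both
  contradicts equal invariants and makes the estimate for \<open>S\<close> a contraction.

  A separating polynomial depends on both points. For a compact set of invariants on the right,
  finitely many polynomials serve one point on the left, and there are only countably many finite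
  sets of polynomials. This is the reason for compact sets and inner regularity.

  Null sets and multiplicities are compared in one direction only; the inverse unitary supplies the
  other.\<close>

lemma mat_adjoint_carrier [simp, intro]:
  "A \<in> carrier_mat n m \<Longrightarrow> mat_adjoint A \<in> carrier_mat m n"
  by (auto simp: mat_adjoint_def mat_of_rows_def)

lemma mat_adjoint_dim [simp]:
  "dim_row (mat_adjoint A) = dim_col A" "dim_col (mat_adjoint A) = dim_row A"
  by (auto simp: mat_adjoint_def mat_of_rows_def)

lemma mat_adjoint_index [simp]:
  fixes A :: "complex mat"
  assumes "i < dim_col A" "j < dim_row A"
  shows "mat_adjoint A $$ (i, j) = cnj (A $$ (j, i))"
  using assms by (auto simp: mat_adjoint_def mat_of_rows_def)

lemma mat_adjoint_adjoint [simp]: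
  fixes A :: "complex mat"
  shows "mat_adjoint (mat_adjoint A) = A"
  by (rule eq_matI) auto

lemma mat_mult_index:
  assumes "A \<in> carrier_mat n l" "B \<in> carrier_mat l m" "i < n" "j < m"
  shows "(A * B) $$ (i, j) = (\<Sum>q<l. A $$ (i, q) * B $$ (q, j))"
  using assms by (auto simp: scalar_prod_def atLeast0LessThan)

lemma mat_adjoint_mult:
  fixes A B :: "complex mat"
  assumes "A \<in> carrier_mat n l" "B \<in> carrier_mat l m"
  shows "mat_adjoint (A * B) = mat_adjoint B * mat_adjoint A"
proof (rule eq_matI)
  fix i j assume "i < dim_row (mat_adjoint B * mat_adjoint A)" "j < dim_col (mat_adjoint B * mat_adjoint A)"
  then have ij: "i < m" "j < n" using assms by auto
  have "mat_adjoint (A * B) $$ (i, j) = cnj ((A * B) $$ (j, i))"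
    using ij assms by (intro mat_adjoint_index) auto
  also have "\<dots> = (\<Sum>q<l. cnj (A $$ (j, q)) * cnj (B $$ (q, i)))"
    using ij by (simp add: mat_mult_index[OF assms] del: index_mult_mat)
  also have "\<dots> = (\<Sum>q<l. mat_adjoint B $$ (i, q) * mat_adjoint A $$ (q, j))"
    using ij assms by (auto intro!: sum.cong)
  also have "\<dots> = (mat_adjoint B * mat_adjoint A) $$ (i, j)"
    using ij assms by (subst mat_mult_index[of _ m l _ n]) auto
  finally show "mat_adjoint (A * B) $$ (i, j) = (mat_adjoint B * mat_adjoint A) $$ (i, j)" .
qed (use assms in auto)

lemma mat_adjoint_one [simp]: "mat_adjoint (1\<^sub>m n :: complex mat) = 1\<^sub>m n"
  by (rule eq_matI) auto

lemma mat_adjoint_smult: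
  fixes A :: "complex mat"
  shows "mat_adjoint (c \<cdot>\<^sub>m A) = cnj c \<cdot>\<^sub>m mat_adjoint A"
  by (rule eq_matI) auto

lemma mat_adjoint_add:
  fixes A B :: "complex mat"
  assumes "A \<in> carrier_mat n m" "B \<in> carrier_mat n m"
  shows "mat_adjoint (A + B) = mat_adjoint A + mat_adjoint B"
  using assms by (intro eq_matI) auto

lemma mat_vec_index:
  assumes "A \<in> carrier_mat n m" "v \<in> carrier_vec m" "i < n"
  shows "(A *\<^sub>v v) $ i = (\<Sum>q<m. A $$ (i, q) * v $ q)"
  using assms by (auto simp: scalar_prod_def atLeast0LessThan)

lemma cscalar_index:
  fixes v w :: "complex vec"
  assumes "w \<in> carrier_vec n"
  shows "v \<bullet>c w = (\<Sum>q<n. v $ q * cnj (w $ q))"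
  using assms by (auto simp: scalar_prod_def atLeast0LessThan intro!: sum.cong)

lemma cscalar_adjoint:
  fixes v w :: "complex vec"
  assumes A: "A \<in> carrier_mat n m" and v: "v \<in> carrier_vec m" and w: "w \<in> carrier_vec n"
  shows "(A *\<^sub>v v) \<bullet>c w = v \<bullet>c (mat_adjoint A *\<^sub>v w)"
proof -
  have "(A *\<^sub>v v) \<bullet>c w = (\<Sum>i<n. \<Sum>q<m. A $$ (i, q) * v $ q * cnj (w $ i))"
    by (simp add: cscalar_index[OF w] mat_vec_index[OF A v] sum_distrib_right)
  also have "\<dots> = (\<Sum>q<m. \<Sum>i<n. A $$ (i, q) * v $ q * cnj (w $ i))"
    by (rule sum.swap)
  also have "\<dots> = (\<Sum>q<m. v $ q * cnj ((mat_adjoint A *\<^sub>v w) $ q))"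
    using A by (intro sum.cong refl)
      (simp add: mat_vec_index[of _ m n] w sum_distrib_left mult_ac del: index_mult_mat_vec)
  also have "\<dots> = v \<bullet>c (mat_adjoint A *\<^sub>v w)"
    using A by (subst cscalar_index[of _ m]) (auto intro!: mult_mat_vec_carrier w)
  finally show ?thesis .
qed

lemma cscalar_self:
  fixes v :: "complex vec"
  assumes "v \<in> carrier_vec n"
  shows "v \<bullet>c v = of_real (\<Sum>q<n. (cmod (v $ q))\<^sup>2)"
  by (simp add: cscalar_index[OF assms] complex_norm_square[symmetric] del: of_real_power)

lemma cscalar_self_eq_0:
  fixes v :: "complex vec"
  assumes "v \<in> carrier_vec n" "v \<bullet>c v = 0"
  shows "v = 0\<^sub>v n"
  using assms conjugate_square_eq_0_vec by blast

text \<open>A kernel vector \<open>v\<close> would be an eigenvector for \<open>-\<i>\<close>.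
  Moving \<open>H\<close> across the inner product then gives \<open>-\<i> * t = \<i> * t\<close>
  for the squared length \<open>t\<close> of \<open>v\<close>.\<close>

lemma hermitian_shift_invertible:
  fixes H :: "complex mat"
  assumes H: "H \<in> carrier_mat n n" and herm: "mat_adjoint H = H"
  obtains Q where "Q \<in> carrier_mat n n"
    "(H + \<i> \<cdot>\<^sub>m 1\<^sub>m n) * Q = 1\<^sub>m n" "Q * (H + \<i> \<cdot>\<^sub>m 1\<^sub>m n) = 1\<^sub>m n"
proof -
  let ?P = "H + \<i> \<cdot>\<^sub>m 1\<^sub>m n"
  have P: "?P \<in> carrier_mat n n" using H by auto
  have "Determinant.det ?P \<noteq> 0"
  proof
    assume "Determinant.det ?P = 0"
    then obtain v where v: "v \<in> carrier_vec n" "v \<noteq> 0\<^sub>v n" "?P *\<^sub>v v = 0\<^sub>v n"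
      using det_0_iff_vec_prod_zero_field[OF P] by auto
    have Pv: "?P *\<^sub>v v = H *\<^sub>v v + \<i> \<cdot>\<^sub>v v"
      using H v by (subst add_mult_distrib_mat_vec[of _ n n]) auto
    have idx: "(H *\<^sub>v v) $ q = - \<i> * v $ q" if "q < n" for q
    proof -
      have "(?P *\<^sub>v v) $ q = 0" using v(3) that by simp
      then have "(H *\<^sub>v v) $ q + \<i> * v $ q = 0" unfolding Pv using v(1) H that by simp
      then show ?thesis by (simp add: add_eq_0_iff)
    qed
    have Hv: "H *\<^sub>v v = (- \<i>) \<cdot>\<^sub>v v"
      using H v idx by (intro eq_vecI) (auto simp del: index_mult_mat_vec)
    define t where "t = (\<Sum>q<n. (cmod (v $ q))\<^sup>2)"
    have 1: "(H *\<^sub>v v) \<bullet>c v = - \<i> * of_real t"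
      unfolding Hv using v(1) cscalar_self[OF v(1)] t_def by simp
    have "(H *\<^sub>v v) \<bullet>c v = v \<bullet>c (H *\<^sub>v v)"
      using cscalar_adjoint[OF H v(1) v(1)] herm by simp
    also have "\<dots> = \<i> * of_real t"
    proof -
      have "v \<bullet>c ((- \<i>) \<cdot>\<^sub>v v) = (\<Sum>q<n. v $ q * cnj (((- \<i>) \<cdot>\<^sub>v v) $ q))"
        using v(1) by (intro cscalar_index) auto
      also have "\<dots> = (\<Sum>q<n. \<i> * complex_of_real ((cmod (v $ q))\<^sup>2))"
        using v(1) by (intro sum.cong) (auto simp: complex_norm_square simp del: of_real_power)
      finally show ?thesis unfolding Hv t_def by (simp add: sum_distrib_left)
    qed
    finally have "t = 0" using 1 by (auto simp: complex_eq_iff)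
    then have "v \<bullet>c v = 0" using cscalar_self[OF v(1)] t_def by simp
    then show False using cscalar_self_eq_0 v by blast
  qed
  then have "?P \<in> Units (ring_mat TYPE(complex) n ())" by (rule det_non_zero_imp_unit[OF P])
  then show thesis using that by (auto simp: Units_def ring_mat_def)
qed

text \<open>The Cayley transform \<open>(H - i)(H + i)\<inverse>\<close> is a unitary in the commutant; this is how
  irreducibility, which only speaks of unitaries, applies to hermitian matrices.\<close>

lemma irreducible_hermitian_scalar:
  fixes H :: "complex mat"
  assumes irr: "irreducible_tuple k X" and n: "tuple_degree X = n"
    and X: "\<And>s. s \<in> {1..k} \<Longrightarrow> X s \<in> carrier_mat n n"
    and H: "H \<in> carrier_mat n n" and herm: "mat_adjoint H = H"
    and comm: "\<And>s. s \<in> {1..k} \<Longrightarrow> H * X s = X s * H"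
  obtains c where "H = c \<cdot>\<^sub>m 1\<^sub>m n"
proof -
  let ?P = "H + \<i> \<cdot>\<^sub>m 1\<^sub>m n"
  let ?N = "H + (-\<i>) \<cdot>\<^sub>m 1\<^sub>m n"
  have P: "?P \<in> carrier_mat n n" and N: "?N \<in> carrier_mat n n" using H by auto
  have I: "(c \<cdot>\<^sub>m 1\<^sub>m n) \<in> carrier_mat n n" for c :: complex by auto
  obtain Q where Q: "Q \<in> carrier_mat n n" "?P * Q = 1\<^sub>m n" "Q * ?P = 1\<^sub>m n"
    using hermitian_shift_invertible[OF H herm] .
  have distl: "(H + c \<cdot>\<^sub>m 1\<^sub>m n) * B = H * B + c \<cdot>\<^sub>m B" if "B \<in> carrier_mat n n" for B c
    using that H by (subst add_mult_distrib_mat[OF H I that])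
      (subst mult_smult_assoc_mat[of _ n n _ n], auto)
  have distr: "B * (H + c \<cdot>\<^sub>m 1\<^sub>m n) = B * H + c \<cdot>\<^sub>m B" if "B \<in> carrier_mat n n" for B c
    using that H by (subst mult_add_distrib_mat[OF that H I])
      (subst mult_smult_distrib[of _ n n _ n], auto)
  have aP: "mat_adjoint ?P = ?N"
    using H by (subst mat_adjoint_add[of _ n n]) (auto simp: herm mat_adjoint_smult)
  have PX: "?P * X s = X s * ?P" "?N * X s = X s * ?N" if "s \<in> {1..k}" for s
    using X[OF that] comm[OF that] by (simp_all add: distl distr)
  have PN: "?P * ?N = ?N * ?P"
    using H by (simp add: distl distr) (auto simp: algebra_simps intro!: eq_matI)
  define U where "U = ?N * Q"
  have U: "U \<in> carrier_mat n n" using Q N by (auto simp: U_def)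
  have aQ: "mat_adjoint Q * ?N = 1\<^sub>m n"
    using mat_adjoint_mult[OF P Q(1)] Q(2) aP by simp
  have aU: "mat_adjoint U = mat_adjoint Q * ?P"
    unfolding U_def by (subst mat_adjoint_mult[OF N Q(1)]) (simp flip: aP)
  have aQc: "mat_adjoint Q \<in> carrier_mat n n" using Q by auto
  \<comment> \<open>Unitarity comes down to \<open>?P\<close> and \<open>?N\<close>, which are
    adjoint to each other, commuting.\<close>
  have "mat_adjoint U * U = mat_adjoint Q * (?P * (?N * Q))"
    unfolding aU unfolding U_def by (rule assoc_mult_mat[OF aQc P mult_carrier_mat[OF N Q(1)]])
  also have "?P * (?N * Q) = ?P * ?N * Q"
    using P N Q by (simp add: assoc_mult_mat[of _ n n _ n _ n])
  also have "\<dots> = ?N * (?P * Q)" unfolding PN by (rule assoc_mult_mat[OF N P Q(1)])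
  also have "mat_adjoint Q * (?N * (?P * Q)) = 1\<^sub>m n" unfolding Q(2) using N aQ by simp
  finally have UU: "mat_adjoint U * U = 1\<^sub>m n" .
  then have UU': "U * mat_adjoint U = 1\<^sub>m n"
    using U mat_mult_left_right_inverse[of "mat_adjoint U" n U] by auto
  have "U * X s = X s * U" if s: "s \<in> {1..k}" for s
  proof -
    \<comment> \<open>\<open>Q\<close> inherits the commutation from its inverse \<open>?P\<close>:
      insert \<open>?P * Q\<close> on the right, move \<open>?P\<close> past \<open>X s\<close>,
      cancel \<open>Q * ?P\<close>.\<close>
    have "Q * X s = Q * (X s * (?P * Q))" unfolding Q(2) using X[OF s] by simp
    also have "X s * (?P * Q) = X s * ?P * Q" using X[OF s] P Q
      by (simp add: assoc_mult_mat[of _ n n _ n _ n])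
    also have "\<dots> = ?P * (X s * Q)" unfolding PX(1)[OF s, symmetric]
      by (rule assoc_mult_mat[OF P X[OF s] Q(1)])
    also have "Q * (?P * (X s * Q)) = Q * ?P * (X s * Q)"
      using assoc_mult_mat[OF Q(1) P mult_carrier_mat[OF X[OF s] Q(1)]] by simp
    also have "\<dots> = X s * Q" unfolding Q(3) using X[OF s] Q by simp
    finally have QX: "Q * X s = X s * Q" .
    have "U * X s = ?N * (Q * X s)" unfolding U_def by (rule assoc_mult_mat[OF N Q(1) X[OF s]])
    also have "\<dots> = ?N * X s * Q" unfolding QX by (rule assoc_mult_mat[OF N X[OF s] Q(1), symmetric])
    also have "\<dots> = X s * (?N * Q)" unfolding PX(2)[OF s] by (rule assoc_mult_mat[OF X[OF s] N Q(1)])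
    finally show ?thesis unfolding U_def .
  qed
  then obtain c where c: "U = c \<cdot>\<^sub>m 1\<^sub>m n"
    using irr UU UU' U unfolding irreducible_tuple_def unitary_mat_def n by blast
  \<comment> \<open>The Cayley transform is undone: \<open>U\<close> being the scalar
    \<open>c\<close> means that \<open>?N\<close> is \<open>c\<close> times \<open>?P\<close>, which
    is linear in the entries of \<open>H\<close>.\<close>
  have "?N = ?N * (Q * ?P)" unfolding Q(3) using N by simp
  also have "\<dots> = U * ?P" unfolding U_def by (rule assoc_mult_mat[OF N Q(1) P, symmetric])
  also have "\<dots> = c \<cdot>\<^sub>m ?P" unfolding c
    by (subst mult_smult_assoc_mat[OF one_carrier_mat P]) (simp add: left_mult_one_mat[OF P])
  finally have e: "?N = c \<cdot>\<^sub>m ?P" .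
  have ee: "H $$ (i, j) - (if i = j then \<i> else 0) = c * (H $$ (i, j) + (if i = j then \<i> else 0))"
    if "i < n" "j < n" for i j
    using arg_cong[OF e, of "\<lambda>A. A $$ (i, j)"] that H by (auto split: if_splits)
  show thesis
  proof (cases "n = 0")
    case True then show thesis using H by (intro that[of 0] eq_matI) auto
  next
    case False
    \<comment> \<open>For \<open>c = 1\<close> a diagonal entry would read
      \<open>-\<i> = \<i>\<close>. Hence the linear equation can be solved for the diagonal value
      \<open>\<i> * (1 + c) / (1 - c)\<close>.\<close>
    have c1: "c \<noteq> 1" using ee[of 0 0] False by auto
    have "H $$ (i, j) = (if i = j then \<i> * (1 + c) / (1 - c) else 0)" if "i < n" "j < n" for i j
      using ee[OF that] c1 by (auto simp: field_simps split: if_splits)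
    then show thesis using H by (intro that[of "\<i> * (1 + c) / (1 - c)"] eq_matI) auto
  qed
qed

section \<open>Traces and the Frobenius norm\<close>

lemma adjoint_mult_diag:
  fixes A :: "complex mat"
  assumes "A \<in> carrier_mat n m" "i < m"
  shows "(mat_adjoint A * A) $$ (i, i) = of_real (\<Sum>q<n. (cmod (A $$ (q, i)))\<^sup>2)"
  using assms by (subst mat_mult_index[of _ m n _ m])
    (auto simp: complex_norm_square mult_ac simp del: of_real_power intro!: sum.cong)

lemma mult_adjoint_diag:
  fixes A :: "complex mat"
  assumes "A \<in> carrier_mat n m" "i < n"
  shows "(A * mat_adjoint A) $$ (i, i) = of_real (\<Sum>q<m. (cmod (A $$ (i, q)))\<^sup>2)"
  using assms by (subst mat_mult_index[of _ n m _ n])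
    (auto simp: complex_norm_square mult_ac simp del: of_real_power intro!: sum.cong)

text \<open>The squared Frobenius norm. Without the square root it is a finite sum of measurable
  terms and a trace.\<close>

definition frob :: "complex mat \<Rightarrow> real" where
  "frob A = (\<Sum>i<dim_row A. \<Sum>j<dim_col A. (cmod (A $$ (i, j)))\<^sup>2)"

lemma frob_carrier:
  "A \<in> carrier_mat n m \<Longrightarrow> frob A = (\<Sum>i<n. \<Sum>j<m. (cmod (A $$ (i, j)))\<^sup>2)"
  by (auto simp: frob_def)

lemma frob_nonneg [simp]: "0 \<le> frob A"
  by (auto simp: frob_def intro!: sum_nonneg)

lemma frob_adjoint [simp]: "frob (mat_adjoint A) = frob A"
  unfolding frob_def by (simp, subst sum.swap, auto)

lemma frob_eq_0:
  assumes "A \<in> carrier_mat n m" "frob A = 0"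
  shows "A = 0\<^sub>m n m"
proof -
  have "A $$ (i, j) = 0" if "i < n" "j < m" for i j
    using assms(2) that unfolding frob_carrier[OF assms(1)]
    by (auto simp: sum_nonneg_eq_0_iff sum_nonneg)
  then show ?thesis using assms by (intro eq_matI) auto
qed

text \<open>The two products have the same trace, namely \<open>frob V\<close>. Comparing both
  traces later forces \<open>m = n\<close> and yields the normalising factor of an
  intertwiner.\<close>

lemma isometric_adjoint_square:
  fixes V :: "complex mat"
  assumes V: "V \<in> carrier_mat m n"
    and c: "mat_adjoint V * V = c \<cdot>\<^sub>m 1\<^sub>m n" and d: "V * mat_adjoint V = d \<cdot>\<^sub>m 1\<^sub>m m"
  shows "of_real (frob V) = c * of_nat n" "of_real (frob V) = d * of_nat m"
proof -
  have "complex_of_real (frob V) = (\<Sum>i<n. (mat_adjoint V * V) $$ (i, i))"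
    unfolding frob_carrier[OF V] by (subst sum.swap) (auto simp: adjoint_mult_diag[OF V])
  then show "of_real (frob V) = c * of_nat n" unfolding c by simp
  have "complex_of_real (frob V) = (\<Sum>i<m. (V * mat_adjoint V) $$ (i, i))"
    unfolding frob_carrier[OF V] by (auto simp: mult_adjoint_diag[OF V])
  then show "of_real (frob V) = d * of_nat m" unfolding d by simp
qed

section \<open>Unitary equivalence in terms of matrices\<close>

lemma mat_vec_eqD:
  fixes A B :: "complex mat"
  assumes "A \<in> carrier_mat n m" "B \<in> carrier_mat n m"
    and "\<And>v. v \<in> carrier_vec m \<Longrightarrow> A *\<^sub>v v = B *\<^sub>v v"
  shows "A = B"
proof (rule eq_matI)
  fix i j assume ij: "i < dim_row B" "j < dim_col B"
  have "(A *\<^sub>v unit_vec m j) $ i = (B *\<^sub>v unit_vec m j) $ i"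
    by (subst assms(3)) auto
  then show "A $$ (i, j) = B $$ (i, j)" using ij assms(1,2) by (simp add: scalar_prod_right_unit)
qed (use assms in auto)

text \<open>The columns are the images of the unit vectors. The formula follows by admitting the
  coordinates of \<open>v\<close> one at a time, since additivity is only available for two summands
  in the carrier.\<close>

lemma linear_isometry_mat:
  assumes add: "\<And>v w. v \<in> carrier_vec n \<Longrightarrow> w \<in> carrier_vec n \<Longrightarrow> U (v + w) = U v + U w"
    and sc: "\<And>c v. v \<in> carrier_vec n \<Longrightarrow> U (c \<cdot>\<^sub>v v) = c \<cdot>\<^sub>v U v"
    and U: "\<And>v. v \<in> carrier_vec n \<Longrightarrow> U v \<in> carrier_vec m"
  obtains V :: "complex mat" where "V \<in> carrier_mat m n" "\<And>v. v \<in> carrier_vec n \<Longrightarrow> U v = V *\<^sub>v v"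
proof -
  define V where "V = mat m n (\<lambda>(i, j). U (unit_vec n j) $ i)"
  have V: "V \<in> carrier_mat m n" by (simp add: V_def)
  have part: "U (vec n (\<lambda>i. if i < t then v $ i else 0)) $ q = (\<Sum>j<t. V $$ (q, j) * v $ j)"
    if "v \<in> carrier_vec n" "t \<le> n" "q < m" for v t q
    using that(2)
  proof (induction t)
    case 0
    have "U (0 \<cdot>\<^sub>v 0\<^sub>v n) = 0 \<cdot>\<^sub>v U (0\<^sub>v n)" by (rule sc) auto
    moreover have "vec n (\<lambda>i. if i < 0 then v $ i else 0) = 0 \<cdot>\<^sub>v 0\<^sub>v n" by auto
    moreover have "U (0\<^sub>v n) \<in> carrier_vec m" by (rule U) auto
    ultimately show ?case using that by simp
  next
    case (Suc t)
    have e: "vec n (\<lambda>i. if i < Suc t then v $ i else 0)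
        = vec n (\<lambda>i. if i < t then v $ i else 0) + v $ t \<cdot>\<^sub>v unit_vec n t"
      using Suc.prems by (intro eq_vecI) (auto simp: less_Suc_eq)
    have u: "U (unit_vec n t) \<in> carrier_vec m" "U (vec n (\<lambda>i. if i < t then v $ i else 0)) \<in> carrier_vec m"
      by (auto intro!: U)
    have "U (vec n (\<lambda>i. if i < Suc t then v $ i else 0))
        = U (vec n (\<lambda>i. if i < t then v $ i else 0)) + v $ t \<cdot>\<^sub>v U (unit_vec n t)"
      unfolding e by (subst add) (auto simp: sc)
    then show ?case using Suc u that by (simp add: V_def mult.commute)
  qed
  have "U v = V *\<^sub>v v" if v: "v \<in> carrier_vec n" for v
  proof (rule eq_vecI)
    fix i assume "i < dim_vec (V *\<^sub>v v)"
    then have i: "i < m" using V by simp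
    have "v = vec n (\<lambda>i. if i < n then v $ i else 0)" using v by (intro eq_vecI) auto
    then show "U v $ i = (V *\<^sub>v v) $ i"
      using part[OF v order_refl i] mat_vec_index[OF V v i] by simp
  qed (use U[OF v] V in auto)
  then show thesis using that V by blast
qed

lemma cscalar_unit:
  fixes v :: "complex vec"
  assumes "v \<in> carrier_vec n" "i < n"
  shows "v \<bullet>c unit_vec n i = v $ i"
proof -
  have "v \<bullet>c unit_vec n i = (\<Sum>q<n. v $ q * cnj (unit_vec n i $ q))"
    using assms by (intro cscalar_index) auto
  also have "\<dots> = (\<Sum>q<n. if q = i then v $ i else 0)"
    by (intro sum.cong) (auto simp: unit_vec_def)
  finally show ?thesis using assms by simp
qed

text \<open>A unitary between the coordinate spaces is given by a matrix whose two products with its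
  adjoint are identities; equality of their traces gives equality of the degrees.\<close>

lemma mats_unitarily_equivalentD:
  assumes A: "\<And>s. s \<in> {1..k} \<Longrightarrow> A s \<in> carrier_mat n n"
    and B: "\<And>s. s \<in> {1..k} \<Longrightarrow> B s \<in> carrier_mat m m"
    and dA: "tuple_degree A = n" and dB: "tuple_degree B = m"
    and eq: "mats_unitarily_equivalent k A B"
  shows "m = n" "\<exists>V. unitary_mat n V \<and> (\<forall>s\<in>{1..k}. V * A s = B s * V)"
proof -
  obtain U where U: "unitary_op (cspace n) (cspace m) U"
    and im: "\<And>s. s \<in> {1..k} \<Longrightarrow> map_prod U U ` mat_op (A s) = mat_op (B s)"
    using eq unfolding mats_unitarily_equivalent_def unitarily_equivalent_def dA dB by auto
  note Ud = U[unfolded unitary_op_def cspace_def, simplified]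
  have bij: "bij_betw U (carrier_vec n) (carrier_vec m)" using Ud by auto
  have "U v \<in> carrier_vec m" if "v \<in> carrier_vec n" for v using bij that by (auto simp: bij_betw_def)
  then obtain V where V: "V \<in> carrier_mat m n" and UV: "\<And>v. v \<in> carrier_vec n \<Longrightarrow> U v = V *\<^sub>v v"
    using linear_isometry_mat[of n U m] Ud by blast
  have aV: "mat_adjoint V \<in> carrier_mat n m" using V by auto
  have "(mat_adjoint V * V) *\<^sub>v v = 1\<^sub>m n *\<^sub>v v" if v: "v \<in> carrier_vec n" for v
  proof (rule eq_vecI)
    fix i assume "i < dim_vec (1\<^sub>m n *\<^sub>v v)"
    then have i: "i < n" by simp
    have "((mat_adjoint V * V) *\<^sub>v v) $ i = (mat_adjoint V *\<^sub>v (V *\<^sub>v v)) \<bullet>c unit_vec n i"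
      using V v aV i by (subst cscalar_unit[of _ n])
        (auto simp: assoc_mult_mat_vec[OF aV V v] intro!: mult_mat_vec_carrier[OF aV])
    also have "\<dots> = (V *\<^sub>v v) \<bullet>c (V *\<^sub>v unit_vec n i)"
      using V v cscalar_adjoint[OF aV mult_mat_vec_carrier[OF V v], of "unit_vec n i"] by simp
    also have "\<dots> = v \<bullet>c unit_vec n i" using Ud v by (auto simp flip: UV)
    finally show "((mat_adjoint V * V) *\<^sub>v v) $ i = (1\<^sub>m n *\<^sub>v v) $ i"
      using v i cscalar_unit[OF v i] by simp
  qed (use V in auto)
  then have VV: "mat_adjoint V * V = 1\<^sub>m n"
    using V by (intro mat_vec_eqD[of _ n n]) auto
  \<comment> \<open>Surjectivity of \<open>U\<close> enters here: every \<open>w\<close> is the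
    image of some \<open>v\<close>, so the identity for the other product can be applied in the
    middle.\<close>
  have "(V * mat_adjoint V) *\<^sub>v w = 1\<^sub>m m *\<^sub>v w" if w: "w \<in> carrier_vec m" for w
  proof -
    obtain v where v: "v \<in> carrier_vec n" "w = V *\<^sub>v v"
      using bij w UV by (auto simp: bij_betw_def)
    have "(V * mat_adjoint V) *\<^sub>v w = V *\<^sub>v ((mat_adjoint V * V) *\<^sub>v v)"
      unfolding v(2) assoc_mult_mat_vec[OF V aV mult_mat_vec_carrier[OF V v(1)]]
        assoc_mult_mat_vec[OF aV V v(1)] ..
    then show ?thesis using VV v w by simp
  qed
  then have VV': "V * mat_adjoint V = 1\<^sub>m m"
    using V by (intro mat_vec_eqD[of _ m m]) auto
  show mn: "m = n"
  proof -
    have one: "1 \<cdot>\<^sub>m A = A" for A :: "complex mat" by (rule eq_matI) auto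
    have "complex_of_nat n = of_nat m"
      using isometric_adjoint_square[OF V, of 1 1] VV VV' by (simp add: one)
    then show ?thesis by simp
  qed
  have "V * A s = B s * V" if s: "s \<in> {1..k}" for s
  proof (rule mat_vec_eqD)
    show "V * A s \<in> carrier_mat m n" "B s * V \<in> carrier_mat m n" using V A[OF s] B[OF s] by auto
    fix v :: "complex vec" assume v: "v \<in> carrier_vec n"
    have "(v, A s *\<^sub>v v) \<in> mat_op (A s)" using A[OF s] v by (auto simp: mat_op_def)
    then have "(U v, U (A s *\<^sub>v v)) \<in> mat_op (B s)" using im[OF s] by (metis map_prod_imageI)
    then have "U (A s *\<^sub>v v) = B s *\<^sub>v U v" by (auto simp: mat_op_def)
    then show "V * A s *\<^sub>v v = B s * V *\<^sub>v v"
      using v A[OF s] B[OF s] V by (simp add: UV)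
  qed
  then show "\<exists>V. unitary_mat n V \<and> (\<forall>s\<in>{1..k}. V * A s = B s * V)"
    using V VV VV' mn unfolding unitary_mat_def by auto
qed

lemma mats_unitarily_equivalentI:
  assumes A: "\<And>s. s \<in> {1..k} \<Longrightarrow> A s \<in> carrier_mat n n"
    and B: "\<And>s. s \<in> {1..k} \<Longrightarrow> B s \<in> carrier_mat n n"
    and dA: "tuple_degree A = n" and dB: "tuple_degree B = n"
    and V: "unitary_mat n V" and VA: "\<And>s. s \<in> {1..k} \<Longrightarrow> V * A s = B s * V"
  shows "mats_unitarily_equivalent k A B"
proof -
  have Vc: "V \<in> carrier_mat n n" and V1: "mat_adjoint V * V = 1\<^sub>m n" and V2: "V * mat_adjoint V = 1\<^sub>m n"
    using V by (auto simp: unitary_mat_def)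
  have aV: "mat_adjoint V \<in> carrier_mat n n" using Vc by auto
  have i1: "mat_adjoint V *\<^sub>v (V *\<^sub>v v) = v" if "v \<in> carrier_vec n" for v
    using assoc_mult_mat_vec[OF aV Vc that] V1 that by simp
  have i2: "V *\<^sub>v (mat_adjoint V *\<^sub>v v) = v" if "v \<in> carrier_vec n" for v
    using assoc_mult_mat_vec[OF Vc aV that] V2 that by simp
  have bij: "bij_betw ((*\<^sub>v) V) (carrier_vec n) (carrier_vec n)"
    by (rule bij_betwI[where g = "(*\<^sub>v) (mat_adjoint V)"])
       (use i1 i2 Vc aV in \<open>auto intro!: mult_mat_vec_carrier\<close>)
  have un: "unitary_op (cspace n) (cspace n) ((*\<^sub>v) V)"
    unfolding unitary_op_def cspace_def
    using bij Vc aV i1 by (auto simp: mult_add_distrib_mat_vec[OF Vc] mult_mat_vec[OF Vc]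
      cscalar_adjoint[OF Vc] simp del: assoc_mult_mat_vec)
  have "map_prod ((*\<^sub>v) V) ((*\<^sub>v) V) ` mat_op (A s) = mat_op (B s)" if s: "s \<in> {1..k}" for s
  proof -
    have e: "V *\<^sub>v (A s *\<^sub>v v) = B s *\<^sub>v (V *\<^sub>v v)" if "v \<in> carrier_vec n" for v
      using assoc_mult_mat_vec[OF Vc A[OF s] that] assoc_mult_mat_vec[OF B[OF s] Vc that] VA[OF s]
      by simp
    show ?thesis
    proof (intro equalityI subsetI)
      fix p assume "p \<in> map_prod ((*\<^sub>v) V) ((*\<^sub>v) V) ` mat_op (A s)"
      then obtain v where v: "v \<in> carrier_vec n" "p = (V *\<^sub>v v, V *\<^sub>v (A s *\<^sub>v v))"
        using A[OF s] by (auto simp: mat_op_def)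
      have "V *\<^sub>v v \<in> carrier_vec (dim_col (B s))" using B[OF s] Vc v(1) by auto
      then show "p \<in> mat_op (B s)" unfolding v(2) e[OF v(1)] mat_op_def by blast
    next
      fix p assume "p \<in> mat_op (B s)"
      then obtain w where w: "w \<in> carrier_vec n" "p = (w, B s *\<^sub>v w)"
        using B[OF s] by (auto simp: mat_op_def)
      have v: "mat_adjoint V *\<^sub>v w \<in> carrier_vec n" using aV w by auto
      have "p = map_prod ((*\<^sub>v) V) ((*\<^sub>v) V) (mat_adjoint V *\<^sub>v w, A s *\<^sub>v (mat_adjoint V *\<^sub>v w))"
        unfolding w(2) map_prod_simp e[OF v] i2[OF w(1)] ..
      then show "p \<in> map_prod ((*\<^sub>v) V) ((*\<^sub>v) V) ` mat_op (A s)"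
        using v A[OF s] unfolding mat_op_def by blast
    qed
  qed
  then show ?thesis unfolding mats_unitarily_equivalent_def unitarily_equivalent_def dA dB
    using un by blast
qed

text \<open>Schur's lemma. The product of \<open>J\<close> with its adjoint, in either order, is
  hermitian and commutes with one of the tuples, hence is a scalar. The scalars agree and are
  nonzero, and the traces then give \<open>n = m\<close>.\<close>

lemma intertwiner_multiple_of_unitary:
  fixes J :: "complex mat"
  assumes irrX: "irreducible_tuple k X" and irrY: "irreducible_tuple k Y"
    and n: "tuple_degree X = n" and m: "tuple_degree Y = m"
    and X: "\<And>s. s \<in> {1..k} \<Longrightarrow> X s \<in> carrier_mat n n"
    and Y: "\<And>s. s \<in> {1..k} \<Longrightarrow> Y s \<in> carrier_mat m m"
    and J: "J \<in> carrier_mat n m" and J0: "J \<noteq> 0\<^sub>m n m"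
    and JY: "\<And>s. s \<in> {1..k} \<Longrightarrow> J * Y s = X s * J"
    and JYa: "\<And>s. s \<in> {1..k} \<Longrightarrow> J * mat_adjoint (Y s) = mat_adjoint (X s) * J"
  shows "n = m" "unitary_mat n (complex_of_real (sqrt (real n / frob J)) \<cdot>\<^sub>m J)"
proof -
  have aJ: "mat_adjoint J \<in> carrier_mat m n" using J by auto
  have aJX: "mat_adjoint J * X s = Y s * mat_adjoint J" if s: "s \<in> {1..k}" for s
  proof -
    have "mat_adjoint (J * mat_adjoint (Y s)) = Y s * mat_adjoint J"
      using J Y[OF s] by (subst mat_adjoint_mult[of _ n m _ m]) auto
    moreover have "mat_adjoint (mat_adjoint (X s) * J) = mat_adjoint J * X s"
      using J X[OF s] by (subst mat_adjoint_mult[of _ n n _ m]) auto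
    ultimately show ?thesis using JYa[OF s] by simp
  qed
  obtain c where c: "J * mat_adjoint J = c \<cdot>\<^sub>m 1\<^sub>m n"
  proof (rule irreducible_hermitian_scalar[OF irrX n X])
    show "J * mat_adjoint J \<in> carrier_mat n n" using J aJ by auto
    show "mat_adjoint (J * mat_adjoint J) = J * mat_adjoint J"
      by (subst mat_adjoint_mult[OF J aJ]) simp
    fix s assume s: "s \<in> {1..k}"
    have "J * mat_adjoint J * X s = J * (mat_adjoint J * X s)"
      by (rule assoc_mult_mat[OF J aJ X[OF s]])
    also have "\<dots> = J * Y s * mat_adjoint J"
      unfolding aJX[OF s] by (rule assoc_mult_mat[OF J Y[OF s] aJ, symmetric])
    also have "\<dots> = X s * (J * mat_adjoint J)"
      unfolding JY[OF s] by (rule assoc_mult_mat[OF X[OF s] J aJ])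
    finally show "J * mat_adjoint J * X s = X s * (J * mat_adjoint J)" .
  qed auto
  obtain d where d: "mat_adjoint J * J = d \<cdot>\<^sub>m 1\<^sub>m m"
  proof (rule irreducible_hermitian_scalar[OF irrY m Y])
    show "mat_adjoint J * J \<in> carrier_mat m m" using J aJ by auto
    show "mat_adjoint (mat_adjoint J * J) = mat_adjoint J * J"
      by (subst mat_adjoint_mult[OF aJ J]) simp
    fix s assume s: "s \<in> {1..k}"
    have "mat_adjoint J * J * Y s = mat_adjoint J * (J * Y s)"
      by (rule assoc_mult_mat[OF aJ J Y[OF s]])
    also have "\<dots> = mat_adjoint J * X s * J"
      unfolding JY[OF s] by (rule assoc_mult_mat[OF aJ X[OF s] J, symmetric])
    also have "\<dots> = Y s * (mat_adjoint J * J)"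
      unfolding aJX[OF s] by (rule assoc_mult_mat[OF Y[OF s] aJ J])
    finally show "mat_adjoint J * J * Y s = Y s * (mat_adjoint J * J)" .
  qed auto
  have F0: "frob J \<noteq> 0" using frob_eq_0[OF J] J0 by blast
  note fr = isometric_adjoint_square[OF J d c]
  \<comment> \<open>The product of \<open>J\<close>, its adjoint and \<open>J\<close> is evaluated
    in both bracketings.\<close>
  have "c \<cdot>\<^sub>m J = J * mat_adjoint J * J"
    unfolding c by (subst mult_smult_assoc_mat[OF one_carrier_mat J]) (simp add: left_mult_one_mat[OF J])
  also have "\<dots> = d \<cdot>\<^sub>m J"
    unfolding assoc_mult_mat[OF J aJ J] d
    by (subst mult_smult_distrib[OF J one_carrier_mat]) (simp add: right_mult_one_mat[OF J])
  finally have e: "c \<cdot>\<^sub>m J = d \<cdot>\<^sub>m J" .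
  obtain i j where ij: "i < n" "j < m" "J $$ (i, j) \<noteq> 0"
    using J J0 by (metis (no_types, lifting) carrier_matD eq_matI index_zero_mat)
  have cd: "c = d" using arg_cong[OF e, of "\<lambda>A. A $$ (i, j)"] ij J by simp
  have d0: "d \<noteq> 0" using fr F0 by auto
  have "of_nat n = (of_nat m :: complex)" using fr cd d0 by simp
  then show nm: "n = m" by simp
  have n0: "n \<noteq> 0" using ij by auto
  \<comment> \<open>The common scalar is \<open>frob J / n\<close> by the trace, so this factor
    satisfies \<open>t * t * d = 1\<close>.\<close>
  define t where "t = complex_of_real (sqrt (real n / frob J))"
  have dF: "d = of_real (frob J / real n)" using fr(1) nm n0 by (simp add: field_simps)
  have "t * t = of_real (real n / frob J)"
    unfolding t_def of_real_mult[symmetric] by (simp add: frob_nonneg)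
  then have ttd: "t * t * d = 1" unfolding dF using F0 n0 by simp
  have aU: "mat_adjoint (t \<cdot>\<^sub>m J) = t \<cdot>\<^sub>m mat_adjoint J" by (simp add: mat_adjoint_smult t_def)
  have smm: "a \<cdot>\<^sub>m (b \<cdot>\<^sub>m A) = (a * b) \<cdot>\<^sub>m A" for a b and A :: "complex mat" by (rule eq_matI) auto
  have one: "1 \<cdot>\<^sub>m A = A" for A :: "complex mat" by (rule eq_matI) auto
  have m1: "(t \<cdot>\<^sub>m A) * (t \<cdot>\<^sub>m B) = (t * t) \<cdot>\<^sub>m (A * B)"
    if "A \<in> carrier_mat p q" "B \<in> carrier_mat q r" for A B p q r
    using that by (subst mult_smult_assoc_mat[of _ p q _ r]) (auto simp: mult_smult_distrib[of _ p q _ r] smm)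
  show "unitary_mat n (complex_of_real (sqrt (real n / frob J)) \<cdot>\<^sub>m J)"
    unfolding t_def[symmetric] unitary_mat_def aU m1[OF aJ J] m1[OF J aJ] c d cd smm ttd one
    using J nm by auto
qed

text \<open>Orthogonal projection onto a linear set of functions, by induction on the coordinates.
  If some \<open>b\<close> in \<open>A\<close> is nonzero at the new coordinate \<open>y\<close>,
  the elements vanishing at \<open>y\<close> form a subspace of codimension one, handled by
  induction, and one further orthogonal direction completes it.\<close>

lemma subspace_projection:
  fixes A :: "('i \<Rightarrow> complex) set"
  assumes "finite I"
    and "\<And>a b. a \<in> A \<Longrightarrow> b \<in> A \<Longrightarrow> (\<lambda>x. a x + b x) \<in> A"
    and "\<And>c a. a \<in> A \<Longrightarrow> (\<lambda>x. c * a x) \<in> A"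
    and "A \<noteq> {}"
  shows "\<exists>q\<in>A. \<forall>a\<in>A. (\<Sum>x\<in>I. (w x - q x) * cnj (a x)) = 0"
  using assms
proof (induction I arbitrary: A w rule: finite_induct)
  case empty
  then show ?case by auto
next
  case (insert y I)
  note add = insert.prems(1) and sc = insert.prems(2)
  have diff: "(\<lambda>x. a x + c * b x) \<in> A" if "a \<in> A" "b \<in> A" for a b c
    using add[OF that(1) sc[OF that(2), of c]] .
  show ?case
  proof (cases "\<forall>a\<in>A. a y = 0")
    case True
    obtain q where q: "q \<in> A" "\<forall>a\<in>A. (\<Sum>x\<in>I. (w x - q x) * cnj (a x)) = 0"
      using insert.IH[OF add sc insert.prems(3), of w] by blast
    then show ?thesis using True insert.hyps by (intro bexI[of _ q]) auto
  next
    case False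
    then obtain b where b: "b \<in> A" "b y \<noteq> 0" by auto
    let ?A0 = "{a \<in> A. a y = 0}"
    have "(\<lambda>x. 0 * b x) \<in> A" using sc[OF b(1)] .
    then have ne: "?A0 \<noteq> {}" by auto
    have add0: "\<And>a b. a \<in> ?A0 \<Longrightarrow> b \<in> ?A0 \<Longrightarrow> (\<lambda>x. a x + b x) \<in> ?A0"
      and sc0: "\<And>c a. a \<in> ?A0 \<Longrightarrow> (\<lambda>x. c * a x) \<in> ?A0"
      using add sc by auto
    have IH: "\<exists>q\<in>?A0. \<forall>a\<in>?A0. (\<Sum>x\<in>I. (w x - q x) * cnj (a x)) = 0" for w
      by (rule insert.IH[OF add0 sc0 ne])
    obtain q0 where q0: "q0 \<in> ?A0" "\<forall>a\<in>?A0. (\<Sum>x\<in>I. (b x - q0 x) * cnj (a x)) = 0"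
      using IH[of b] by blast
    \<comment> \<open>The component of \<open>b\<close> orthogonal to \<open>?A0\<close>; it keeps
      the nonzero value at \<open>y\<close> because \<open>q0\<close> vanishes there.\<close>
    define b' where "b' = (\<lambda>x. b x + (-1) * q0 x)"
    have b'A: "b' \<in> A" unfolding b'_def using diff[OF b(1), of q0 "-1"] q0 by simp
    have b'y: "b' y \<noteq> 0" using b q0 by (auto simp: b'_def)
    have b'0: "(\<Sum>x\<in>insert y I. b' x * cnj (a x)) = 0" if "a \<in> ?A0" for a
      using q0(2) that insert.hyps by (auto simp: b'_def)
    obtain q1 where q1: "q1 \<in> ?A0" "\<forall>a\<in>?A0. (\<Sum>x\<in>I. (w x - q1 x) * cnj (a x)) = 0"
      using IH[of w] by blast
    have q10: "(\<Sum>x\<in>insert y I. (w x - q1 x) * cnj (a x)) = 0" if "a \<in> ?A0" for a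
      using q1(2) that insert.hyps by auto
    define B where "B = (\<Sum>x\<in>insert y I. b' x * cnj (b' x))"
    have "B = of_real (\<Sum>x\<in>insert y I. (cmod (b' x))\<^sup>2)"
      by (simp add: B_def complex_norm_square del: of_real_power)
    moreover have "(\<Sum>x\<in>insert y I. (cmod (b' x))\<^sup>2) > 0"
      using b'y insert.hyps by (intro sum_pos2[of _ y]) auto
    ultimately have B0: "B \<noteq> 0" by (metis less_irrefl of_real_eq_0_iff)
    define t where "t = (\<Sum>x\<in>insert y I. (w x - q1 x) * cnj (b' x)) / B"
    define q where "q = (\<lambda>x. q1 x + t * b' x)"
    have qA: "q \<in> A" unfolding q_def using diff[of q1 b' t] q1 b'A by simp
    have "(\<Sum>x\<in>insert y I. (w x - q x) * cnj (a x)) = 0" if a: "a \<in> A" for a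
    proof -
      \<comment> \<open>With this \<open>r\<close>, subtracting \<open>r\<close> times
        \<open>b'\<close> from \<open>a\<close> leaves an element of \<open>?A0\<close>.\<close>
      define r where "r = a y / b' y"
      define a0 where "a0 = (\<lambda>x. a x + (-r) * b' x)"
      have a0: "a0 \<in> ?A0" unfolding a0_def using diff[OF a b'A, of "-r"] b'y by (simp add: r_def)
      have aa: "cnj (a x) = cnj (a0 x) + cnj r * cnj (b' x)" for x by (simp add: a0_def)
      have "(\<Sum>x\<in>insert y I. (w x - q x) * cnj (a x))
          = (\<Sum>x\<in>insert y I. (w x - q1 x) * cnj (a0 x) - t * (b' x * cnj (a0 x))
              + cnj r * ((w x - q1 x) * cnj (b' x) - t * (b' x * cnj (b' x))))"
        unfolding q_def aa by (intro sum.cong refl) (simp add: algebra_simps)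
      also have "\<dots> = (\<Sum>x\<in>insert y I. (w x - q1 x) * cnj (a0 x)) - t * (\<Sum>x\<in>insert y I. b' x * cnj (a0 x))
          + cnj r * ((\<Sum>x\<in>insert y I. (w x - q1 x) * cnj (b' x)) - t * B)"
        unfolding B_def sum.distrib sum_subtractf sum_distrib_left[symmetric] ..
      also have "\<dots> = 0" unfolding q10[OF a0] b'0[OF a0] t_def using B0 by simp
      finally show ?thesis .
    qed
    then show ?thesis using qA by blast
  qed
qed

lemma sum_lessThan_add:
  fixes h :: "nat \<Rightarrow> 'a::comm_monoid_add"
  shows "(\<Sum>l<n + m. h l) = (\<Sum>l<n. h l) + (\<Sum>l<m. h (n + l))"
  by (induction m) (auto simp: add.assoc)

section \<open>Polynomials separating irreducible tuples\<close>

text \<open>Orthogonal projection onto the algebra commutes with left multiplication by the generators,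
  so each of its ``coefficient matrices'' \<open>J\<close> lies in the commutant.\<close>

lemma finite_bicommutant:
  fixes A :: "(nat \<times> nat \<Rightarrow> complex) set" and z :: "'s \<Rightarrow> nat \<Rightarrow> nat \<Rightarrow> complex"
  assumes add: "\<And>a b. a \<in> A \<Longrightarrow> b \<in> A \<Longrightarrow> (\<lambda>x. a x + b x) \<in> A"
    and sc: "\<And>c a. a \<in> A \<Longrightarrow> (\<lambda>x. c * a x) \<in> A"
    and one: "(\<lambda>(i, j). if i = j then 1 else 0) \<in> A"
    and mul: "\<And>a s. a \<in> A \<Longrightarrow> (\<lambda>(i, j). \<Sum>l<N. z s i l * a (l, j)) \<in> A"
    and star: "\<And>s. \<exists>s'. \<forall>i<N. \<forall>j<N. z s' i j = cnj (z s j i)"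
    and comm: "\<And>J. (\<And>s i j. i < N \<Longrightarrow> j < N \<Longrightarrow>
        (\<Sum>l<N. J i l * z s l j) = (\<Sum>l<N. z s i l * J l j)) \<Longrightarrow>
        (\<forall>i<N. \<forall>j<N. (\<Sum>l<N. J i l * D l j) = (\<Sum>l<N. D i l * J l j))"
  shows "\<exists>a\<in>A. \<forall>i<N. \<forall>j<N. a (i, j) = D i j"
proof -
  define I where "I = {..<N} \<times> {..<N}"
  define ip where "ip u v = (\<Sum>x\<in>I. u x * cnj (v x))" for u v :: "nat \<times> nat \<Rightarrow> complex"
  define e :: "nat \<Rightarrow> nat \<Rightarrow> nat \<times> nat \<Rightarrow> complex" where "e a b = (\<lambda>x. if x = (a, b) then 1 else 0)" for a b
  have finI: "finite I" by (simp add: I_def)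
  have ip_sum: "ip (\<lambda>x. \<Sum>l\<in>F. c l * u l x) v = (\<Sum>l\<in>F. c l * ip (u l) v)" for F :: "nat set" and c u v
    unfolding ip_def by (simp add: sum_distrib_right sum_distrib_left mult.assoc) (rule sum.swap)
  have ip_diff: "ip (\<lambda>x. u x - u' x) v = ip u v - ip u' v" for u u' v
    unfolding ip_def by (simp add: left_diff_distrib sum_subtractf)
  have ip_e: "ip (e a b) v = cnj (v (a, b))" if "a < N" "b < N" for a b v
  proof -
    have "ip (e a b) v = (\<Sum>x\<in>I. if x = (a, b) then cnj (v (a, b)) else 0)"
      unfolding ip_def e_def by (intro sum.cong) auto
    then show ?thesis using that finI by (simp add: I_def)
  qed
  have ip2: "ip u v = (\<Sum>i<N. \<Sum>j<N. u (i, j) * cnj (v (i, j)))" for u v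
    unfolding ip_def I_def by (simp add: sum.cartesian_product case_prod_unfold)
  have zero: "(\<lambda>x. 0) \<in> A" using sc[OF one, of 0] by simp
  have sumA: "(\<lambda>x. \<Sum>l\<in>F. c l * u l x) \<in> A" if "finite F" "\<And>l. l \<in> F \<Longrightarrow> u l \<in> A" for F :: "nat set" and c u
    using that by (induction F rule: finite_induct) (auto simp: zero intro!: add sc)
  \<comment> \<open>An element of \<open>A\<close> orthogonal to \<open>A\<close> is orthogonal to
    itself. Identities between projections are proved by this criterion.\<close>
  have uniq: "r x = 0" if "r \<in> A" "\<And>a. a \<in> A \<Longrightarrow> ip r a = 0" "x \<in> I" for r x
  proof -
    have "ip r r = of_real (\<Sum>x\<in>I. (cmod (r x))\<^sup>2)"
      by (simp add: ip_def complex_norm_square del: of_real_power)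
    then have "(\<Sum>x\<in>I. (cmod (r x))\<^sup>2) = 0" using that(1,2) by (metis of_real_eq_0_iff)
    then show ?thesis using that(3) finI by (simp add: sum_nonneg_eq_0_iff)
  qed
  have "\<exists>q\<in>A. \<forall>a\<in>A. ip (\<lambda>x. e i j x - q x) a = 0" for i j
    unfolding ip_def by (rule subspace_projection[OF finI]) (use add sc one in auto)
  \<comment> \<open>\<open>q i j\<close> is the projection of the matrix unit \<open>e i j\<close>
    onto \<open>A\<close>. Pairing it with an element of \<open>A\<close> therefore reads off the
    conjugate entry at \<open>(i, j)\<close>.\<close>
  then obtain q where qA: "\<And>i j. q i j \<in> A"
    and qorth: "\<And>i j a. a \<in> A \<Longrightarrow> ip (\<lambda>x. e i j x - q i j x) a = 0"
    by metis
  have qe: "ip (q i j) a = cnj (a (i, j))" if "a \<in> A" "i < N" "j < N" for i j a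
    using qorth[OF that(1), of i j] ip_e[OF that(2,3)] by (simp add: ip_diff)
  \<comment> \<open>For fixed \<open>b\<close> and \<open>c\<close>, the matrix with entry
    \<open>q a b (i, c)\<close> in row \<open>i\<close> and column \<open>a\<close> commutes with
    all \<open>z s\<close>. The reason is that \<open>A\<close> is invariant under left
    multiplication by \<open>z s\<close> and by its adjoint, so projecting commutes with that
    multiplication.\<close>
  have key: "(\<Sum>l<N. q l b (i, c) * z s l a) = (\<Sum>l<N. z s i l * q a b (l, c))"
    if "a < N" "b < N" "i < N" "c < N" for a b i c s
  proof -
    obtain s' where s': "\<And>i j. i < N \<Longrightarrow> j < N \<Longrightarrow> z s' i j = cnj (z s j i)" using star by blast
    let ?zq = "\<lambda>(i, j). \<Sum>l<N. z s i l * q a b (l, j)"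
    have "ip ?zq v = ip (q a b) (\<lambda>(i, j). \<Sum>l<N. z s' i l * v (l, j))" for v
    proof -
      have "ip ?zq v = (\<Sum>i<N. \<Sum>j<N. \<Sum>l<N. z s i l * q a b (l, j) * cnj (v (i, j)))"
        unfolding ip2 by (simp add: sum_distrib_right)
      also have "\<dots> = (\<Sum>i<N. \<Sum>l<N. \<Sum>j<N. z s i l * q a b (l, j) * cnj (v (i, j)))"
        by (intro sum.cong refl sum.swap)
      also have "\<dots> = (\<Sum>l<N. \<Sum>i<N. \<Sum>j<N. z s i l * q a b (l, j) * cnj (v (i, j)))"
        by (rule sum.swap)
      also have "\<dots> = (\<Sum>l<N. \<Sum>j<N. \<Sum>i<N. z s i l * q a b (l, j) * cnj (v (i, j)))"
        by (intro sum.cong refl sum.swap)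
      also have "\<dots> = (\<Sum>l<N. \<Sum>j<N. q a b (l, j) * cnj (\<Sum>i<N. z s' l i * v (i, j)))"
        by (intro sum.cong refl) (simp add: sum_distrib_left s' mult_ac)
      also have "\<dots> = ip (q a b) (\<lambda>(i, j). \<Sum>l<N. z s' i l * v (l, j))"
        unfolding ip2 by simp
      finally show ?thesis .
    qed
    then have zq: "ip ?zq v = (\<Sum>l<N. z s l a * cnj (v (l, b)))" if "v \<in> A" for v
      using qe[OF mul[OF that] \<open>a < N\<close> \<open>b < N\<close>, of s'] s' \<open>a < N\<close> by simp
    have "(\<lambda>x. (\<Sum>l<N. z s l a * q l b x) + (-1) * ?zq x) \<in> A"
      by (intro add sc sumA mul qA) auto
    then have "(\<lambda>x. (\<Sum>l<N. z s l a * q l b x) - ?zq x) \<in> A" by simp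
    then have "(\<Sum>l<N. z s l a * q l b (i, c)) - ?zq (i, c) = 0"
    proof (rule uniq)
      fix v assume v: "v \<in> A"
      show "ip (\<lambda>x. (\<Sum>l<N. z s l a * q l b x) - ?zq x) v = 0"
        unfolding ip_diff ip_sum zq[OF v] using qe[OF v _ \<open>b < N\<close>] by simp
    qed (use that in \<open>auto simp: I_def\<close>)
    then show ?thesis by (simp add: mult.commute)
  qed
  have D: "(\<Sum>l<N. q l b (i, c) * D l j) = (\<Sum>l<N. D i l * q j b (l, c))"
    if "b < N" "c < N" "i < N" "j < N" for b c i j
    using comm[of "\<lambda>i a. q a b (i, c)"] key that by blast
  \<comment> \<open>The identity is the sum of the diagonal matrix units and lies in
    \<open>A\<close>, so it equals the sum of their projections.\<close>
  have one_q: "(\<Sum>j<N. q j j (l, c)) = (if l = c then 1 else 0)" if "l < N" "c < N" for l c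
  proof -
    let ?one = "\<lambda>(i, j). if i = j then 1 else 0 :: complex"
    have "(\<lambda>x. (\<Sum>l<N. 1 * q l l x) + (-1) * ?one x) \<in> A"
      by (intro add sc sumA one qA) auto
    then have "(\<lambda>x. (\<Sum>l<N. 1 * q l l x) - ?one x) \<in> A" by simp
    then have "(\<Sum>j<N. 1 * q j j (l, c)) - ?one (l, c) = 0"
    proof (rule uniq)
      fix v assume v: "v \<in> A"
      have "ip ?one v = (\<Sum>i<N. \<Sum>j<N. if j = i then cnj (v (i, i)) else 0)"
        unfolding ip2 by (intro sum.cong refl) auto
      also have "\<dots> = (\<Sum>i<N. cnj (v (i, i)))" by (intro sum.cong) auto
      finally show "ip (\<lambda>x. (\<Sum>l<N. 1 * q l l x) - ?one x) v = 0"
        unfolding ip_diff ip_sum using qe[OF v] by simp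
    qed (use that in \<open>auto simp: I_def\<close>)
    then show ?thesis by simp
  qed
  \<comment> \<open>\<open>r\<close> is the projection of \<open>D\<close>. Since \<open>D\<close>
    commutes with the matrices from \<open>key\<close>, it can be pulled out in front of the
    projection of the identity, which leaves \<open>D\<close> itself.\<close>
  define r where "r = (\<lambda>x. \<Sum>j<N. 1 * (\<Sum>l<N. D l j * q l j x))"
  have "r \<in> A" unfolding r_def by (intro sumA qA) auto
  moreover have "r (i, c) = D i c" if "i < N" "c < N" for i c
  proof -
    have "r (i, c) = (\<Sum>j<N. \<Sum>l<N. D i l * q j j (l, c))"
      unfolding r_def using D[OF _ that(2,1)] by (simp add: mult.commute)
    also have "\<dots> = (\<Sum>l<N. D i l * (\<Sum>j<N. q j j (l, c)))"
      unfolding sum_distrib_left by (rule sum.swap)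
    also have "\<dots> = (\<Sum>l<N. if l = c then D i c else 0)"
      using one_q that by (intro sum.cong) auto
    finally show ?thesis using that by simp
  qed
  ultimately show ?thesis by blast
qed

text \<open>Noncommutative polynomials with coefficients in \<open>\<rat>(i)\<close>, in letters indexed by \<open>nat \<times> bool\<close>.\<close>

datatype pexp = POne | PLet nat bool pexp | PAdd pexp pexp | PSc rat rat pexp

instance pexp :: countable
  by countable_datatype

primrec pev :: "nat \<Rightarrow> (nat \<Rightarrow> bool \<Rightarrow> complex mat) \<Rightarrow> pexp \<Rightarrow> complex mat" where
  "pev n L POne = 1\<^sub>m n"
| "pev n L (PLet s b p) = L s b * pev n L p"
| "pev n L (PAdd p q) = pev n L p + pev n L q"
| "pev n L (PSc a b p) = Complex (of_rat a) (of_rat b) \<cdot>\<^sub>m pev n L p"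

lemma pev_carrier [simp, intro]:
  assumes "\<And>s b. L s b \<in> carrier_mat n n"
  shows "pev n L p \<in> carrier_mat n n"
  using assms by (induction p) (auto intro!: mult_carrier_mat)

lemma exists_rat_complex_near:
  assumes "\<epsilon> > 0"
  obtains a b where "cmod (c - Complex (of_rat a) (of_rat b)) < \<epsilon>"
proof -
  have "\<exists>q. \<bar>x - real_of_rat q\<bar> < \<epsilon> / 2" for x :: real
  proof -
    obtain r where "r \<in> \<rat>" "x < r" "r < x + \<epsilon> / 2"
      using Rats_dense_in_real[of x "x + \<epsilon> / 2"] assms by auto
    then obtain q where "x < of_rat q" "of_rat q < x + \<epsilon> / 2" by (auto elim!: Rats_cases)
    then have "\<bar>x - real_of_rat q\<bar> < \<epsilon> / 2" by (simp add: abs_less_iff)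
    then show ?thesis by blast
  qed
  then obtain a b where "\<bar>Re c - real_of_rat a\<bar> < \<epsilon> / 2" "\<bar>Im c - real_of_rat b\<bar> < \<epsilon> / 2" by meson
  moreover have "cmod (c - Complex (of_rat a) (of_rat b)) \<le> \<bar>Re c - real_of_rat a\<bar> + \<bar>Im c - real_of_rat b\<bar>"
    using cmod_le[of "c - Complex (of_rat a) (of_rat b)"] by simp
  ultimately show thesis by (intro that[of a b]) linarith
qed

text \<open>The bicommutant theorem is applied to the block sum of the two families of letters.
  Without nonzero intertwiners, a matrix commuting with the block sum has no off-diagonal blocks,
  hence commutes with the projection \<open>D\<close> onto the first block. So \<open>D\<close> is a
  limit of polynomials, and a polynomial near \<open>D\<close> is near 1 in the first block and near
  0 in the second.\<close>

lemma separating_pexp: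
  fixes L L' :: "nat \<Rightarrow> bool \<Rightarrow> complex mat"
  assumes L: "\<And>s b. L s b \<in> carrier_mat n n" and L': "\<And>s b. L' s b \<in> carrier_mat m m"
    and star: "\<And>s b. L s (\<not> b) = mat_adjoint (L s b)" and star': "\<And>s b. L' s (\<not> b) = mat_adjoint (L' s b)"
    and disj: "\<And>J. J \<in> carrier_mat n m \<Longrightarrow> (\<And>s b. J * L' s b = L s b * J) \<Longrightarrow> J = 0\<^sub>m n m"
    and e: "\<epsilon> > 0"
  obtains p where "frob (pev n L p - 1\<^sub>m n) < \<epsilon>" "frob (pev m L' p) < \<epsilon>"
proof -
  define N where "N = n + m"
  define bl :: "complex mat \<Rightarrow> complex mat \<Rightarrow> nat \<times> nat \<Rightarrow> complex" where
    "bl A B = (\<lambda>(i, j). if i < n \<and> j < n then A $$ (i, j)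
       else if n \<le> i \<and> n \<le> j then B $$ (i - n, j - n) else 0)" for A B
  define z where "z = (\<lambda>(s, b) i j. bl (L s b) (L' s b) (i, j))"
  define fe where "fe p = bl (pev n L p) (pev m L' p)" for p
  note pc = pev_carrier[of L n, OF L] pev_carrier[of L' m, OF L']
  note sumN = sum_lessThan_add[of _ n m, folded N_def]
  have fe_let: "fe (PLet s b p) (i, j) = (\<Sum>l<N. z (s, b) i l * fe p (l, j))" if "i < N" "j < N" for s b p i j
    using that pc(1)[of p] pc(2)[of p] L[of s b] L'[of s b]
    by (auto simp: fe_def z_def bl_def N_def sum_lessThan_add mat_mult_index[of _ n n _ n] mat_mult_index[of _ m m _ m]
        simp del: index_mult_mat)
  have fe_add: "fe (PAdd p q) (i, j) = fe p (i, j) + fe q (i, j)" if "i < N" "j < N" for p q i j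
    using that pc[of p] pc[of q] by (auto simp: fe_def bl_def N_def)
  have fe_sc: "fe (PSc a b p) (i, j) = Complex (of_rat a) (of_rat b) * fe p (i, j)" if "i < N" "j < N" for a b p i j
    using that pc[of p] by (auto simp: fe_def bl_def N_def)
  \<comment> \<open>The closure of the rational polynomials, entrywise. It is a complex subspace, as
    \<open>finite_bicommutant\<close> demands, although the coefficients themselves lie in a
    countable field.\<close>
  define A where "A = {g. \<forall>\<epsilon>>0. \<exists>p. \<forall>i<N. \<forall>j<N. cmod (g (i, j) - fe p (i, j)) < \<epsilon>}"
  have AD: "\<exists>p. \<forall>i<N. \<forall>j<N. cmod (g (i, j) - fe p (i, j)) < \<epsilon>" if "g \<in> A" "\<epsilon> > 0" for g \<epsilon>
    using that by (simp add: A_def)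
  define D where "D i j = (if i = j \<and> i < n then 1 else 0 :: complex)" for i j :: nat
  have "\<exists>a\<in>A. \<forall>i<N. \<forall>j<N. a (i, j) = D i j"
  proof (rule finite_bicommutant[where z = z])
    show "(\<lambda>x. a x + b x) \<in> A" if ab: "a \<in> A" "b \<in> A" for a b
      unfolding A_def
    proof (intro CollectI allI impI)
      fix \<epsilon> :: real assume "\<epsilon> > 0"
      then have h: "\<epsilon> / 2 > 0" by simp
      obtain p where p: "\<And>i j. i < N \<Longrightarrow> j < N \<Longrightarrow> cmod (a (i, j) - fe p (i, j)) < \<epsilon> / 2"
        using AD[OF ab(1) h] by blast
      obtain q where q: "\<And>i j. i < N \<Longrightarrow> j < N \<Longrightarrow> cmod (b (i, j) - fe q (i, j)) < \<epsilon> / 2"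
        using AD[OF ab(2) h] by blast
      have "cmod (a (i, j) + b (i, j) - fe (PAdd p q) (i, j)) < \<epsilon>" if "i < N" "j < N" for i j
      proof -
        have "cmod (a (i, j) + b (i, j) - fe (PAdd p q) (i, j))
            = cmod ((a (i, j) - fe p (i, j)) + (b (i, j) - fe q (i, j)))"
          using fe_add[OF that] by (simp add: algebra_simps)
        also have "\<dots> \<le> cmod (a (i, j) - fe p (i, j)) + cmod (b (i, j) - fe q (i, j))"
          by (rule norm_triangle_ineq)
        finally show ?thesis using p[OF that] q[OF that] by simp
      qed
      then show "\<exists>p. \<forall>i<N. \<forall>j<N. cmod (a (i, j) + b (i, j) - fe p (i, j)) < \<epsilon>" by blast
    qed
    show "(\<lambda>x. c * a x) \<in> A" if a: "a \<in> A" for c a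
      unfolding A_def
    proof (intro CollectI allI impI)
      fix \<epsilon> :: real assume e: "\<epsilon> > 0"
      define G where "G = (\<Sum>i<N. \<Sum>j<N. cmod (a (i, j)))"
      have G: "cmod (a (i, j)) \<le> G" if "i < N" "j < N" for i j
      proof -
        have "cmod (a (i, j)) \<le> (\<Sum>j<N. cmod (a (i, j)))" using that by (intro member_le_sum) auto
        also have "\<dots> \<le> G" unfolding G_def
          using that by (intro member_le_sum[of i _ "\<lambda>i. \<Sum>j<N. cmod (a (i, j))"] sum_nonneg) auto
        finally show ?thesis .
      qed
      have G0: "G \<ge> 0" unfolding G_def by (intro sum_nonneg) auto
      \<comment> \<open>The error splits as \<open>(c - r) * a + r * (a - p)\<close> with
        \<open>r\<close> the rational approximation of \<open>c\<close>. The cap 1 in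
        \<open>d2\<close> gives the bound \<open>cmod c + 1\<close> for \<open>r\<close>; the added
        ones keep the denominators positive.\<close>
      define d1 where "d1 = \<epsilon> / (2 * (cmod c + 1))"
      define d2 where "d2 = min 1 (\<epsilon> / (2 * (G + 1)))"
      have d: "d1 > 0" "d2 > 0" using e G0 by (auto simp: d1_def d2_def add_nonneg_pos)
      obtain p where p: "\<And>i j. i < N \<Longrightarrow> j < N \<Longrightarrow> cmod (a (i, j) - fe p (i, j)) < d1"
        using a d unfolding A_def by blast
      obtain u v where uv: "cmod (c - Complex (of_rat u) (of_rat v)) < d2"
        using exists_rat_complex_near[OF d(2)] .
      let ?r = "Complex (of_rat u) (of_rat v)"
      have "cmod (c * a (i, j) - fe (PSc u v p) (i, j)) < \<epsilon>" if "i < N" "j < N" for i j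
      proof -
        have r: "cmod ?r \<le> cmod c + 1"
          using uv norm_triangle_ineq2[of ?r c] by (simp add: d2_def norm_minus_commute)
        have "cmod (c * a (i, j) - fe (PSc u v p) (i, j))
            = cmod ((c - ?r) * a (i, j) + ?r * (a (i, j) - fe p (i, j)))"
          using fe_sc[OF that] by (simp add: algebra_simps)
        also have "\<dots> \<le> cmod (c - ?r) * cmod (a (i, j)) + cmod ?r * cmod (a (i, j) - fe p (i, j))"
          by (metis norm_triangle_ineq norm_mult)
        also have "\<dots> \<le> d2 * G + cmod ?r * cmod (a (i, j) - fe p (i, j))"
          using uv G[OF that] d by (intro add_mono mult_mono) (auto intro: less_imp_le)
        also have "\<dots> < d2 * (G + 1) + cmod ?r * cmod (a (i, j) - fe p (i, j))" using d by simp
        also have "\<dots> \<le> d2 * (G + 1) + (cmod c + 1) * d1"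
          using r p[OF that] d G0 by (intro add_mono mult_mono) (auto intro: less_imp_le)
        also have "\<dots> \<le> \<epsilon> / 2 + \<epsilon> / 2"
        proof (rule add_mono)
          have "d2 * (G + 1) \<le> (\<epsilon> / (2 * (G + 1))) * (G + 1)"
            using G0 by (intro mult_right_mono) (auto simp: d2_def)
          also have "\<dots> = \<epsilon> / 2"
          proof -
            have "\<epsilon> / (2 * g) * g = \<epsilon> / 2" if "g > 0" for g using that by simp
            from this[of "G + 1"] show ?thesis using G0 by (simp only: add_nonneg_pos zero_less_one)
          qed
          finally show "d2 * (G + 1) \<le> \<epsilon> / 2" .
          have "cmod c + 1 \<noteq> 0" using norm_ge_zero[of c] by linarith
          moreover have "g * (\<epsilon> / (2 * g)) = \<epsilon> / 2" if "g \<noteq> 0" for g using that by simp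
          ultimately show "(cmod c + 1) * d1 \<le> \<epsilon> / 2" unfolding d1_def by (metis order_refl)
        qed
        finally show ?thesis by simp
      qed
      then show "\<exists>p. \<forall>i<N. \<forall>j<N. cmod (c * a (i, j) - fe p (i, j)) < \<epsilon>" by blast
    qed
    have "fe POne (i, j) = (if i = j then 1 else 0)" if "i < N" "j < N" for i j
      using that by (auto simp: fe_def bl_def N_def)
    then have o: "cmod ((if i = j then 1 else 0) - fe POne (i, j)) = 0" if "i < N" "j < N" for i j
      using that by simp
    show "(\<lambda>(i, j). if i = j then 1 else 0) \<in> A"
      unfolding A_def
    proof (intro CollectI allI impI exI)
      fix \<epsilon> :: real and i j assume "\<epsilon> > 0" "i < N" "j < N"
      then show "cmod ((case (i, j) of (i, j) \<Rightarrow> if i = j then 1 else 0) - fe POne (i, j)) < \<epsilon>"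
        using o[of i j] by (simp only: prod.case)
    qed
    show "(\<lambda>(i, j). \<Sum>l<N. z t i l * a (l, j)) \<in> A" if a: "a \<in> A" for a t
      unfolding A_def
    proof (intro CollectI allI impI)
      obtain s b where t: "t = (s, b)" by (cases t)
      fix \<epsilon> :: real assume e: "\<epsilon> > 0"
      define G where "G = (\<Sum>i<N. \<Sum>l<N. cmod (z t i l))"
      have G0: "G \<ge> 0" unfolding G_def by (intro sum_nonneg) auto
      define d where "d = \<epsilon> / (G + 1)"
      have d: "d > 0" using e G0 by (simp add: d_def add_nonneg_pos)
      obtain p where p: "\<And>i j. i < N \<Longrightarrow> j < N \<Longrightarrow> cmod (a (i, j) - fe p (i, j)) < d"
        using a d unfolding A_def by blast
      have "cmod ((\<Sum>l<N. z t i l * a (l, j)) - fe (PLet s b p) (i, j)) < \<epsilon>" if "i < N" "j < N" for i j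
      proof -
        have "cmod ((\<Sum>l<N. z t i l * a (l, j)) - fe (PLet s b p) (i, j))
            = cmod (\<Sum>l<N. z t i l * (a (l, j) - fe p (l, j)))"
          using fe_let[OF that] t by (simp add: right_diff_distrib sum_subtractf)
        also have "\<dots> \<le> (\<Sum>l<N. cmod (z t i l) * d)"
          using p[OF _ that(2)]
          by (intro sum_norm_le) (simp add: norm_mult mult_left_mono less_imp_le)
        also have "\<dots> \<le> G * d"
        proof -
          have "(\<Sum>l<N. cmod (z t i l)) \<le> G" unfolding G_def
            using that by (intro member_le_sum[of i _ "\<lambda>i. \<Sum>l<N. cmod (z t i l)"] sum_nonneg) auto
          then show ?thesis using d by (simp add: sum_distrib_right[symmetric])
        qed
        also have "\<dots> < (G + 1) * d" using d by simp
        also have "\<dots> = \<epsilon>" using G0 by (simp add: d_def)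
        finally show ?thesis .
      qed
      then show "\<exists>p. \<forall>i<N. \<forall>j<N. cmod ((case (i, j) of (i, j) \<Rightarrow> \<Sum>l<N. z t i l * a (l, j)) - fe p (i, j)) < \<epsilon>"
        by auto
    qed
    show "\<exists>s'. \<forall>i<N. \<forall>j<N. z s' i j = cnj (z s j i)" for s
    proof -
      obtain u b where s: "s = (u, b)" by (cases s)
      have "z (u, \<not> b) i j = cnj (z s j i)" if "i < N" "j < N" for i j
        using that L[of u b] L'[of u b] unfolding s z_def bl_def by (auto simp: N_def star star')
      then show ?thesis by blast
    qed
    fix J assume J: "\<And>s i j. i < N \<Longrightarrow> j < N \<Longrightarrow> (\<Sum>l<N. J i l * z s l j) = (\<Sum>l<N. z s i l * J l j)"
    define J12 where "J12 = mat n m (\<lambda>(i, j). J i (n + j))"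
    \<comment> \<open>The adjoint of the lower left block: it is again an \<open>n\<close> by
      \<open>m\<close> matrix intertwining in the same direction, so that \<open>disj\<close>
      applies to it as well.\<close>
    define J21 where "J21 = mat n m (\<lambda>(i, j). cnj (J (n + j) i))"
    have c12: "J12 \<in> carrier_mat n m" and c21: "J21 \<in> carrier_mat n m" by (auto simp: J12_def J21_def)
    have "J12 = 0\<^sub>m n m"
    proof (rule disj[OF c12])
      fix s b
      show "J12 * L' s b = L s b * J12"
      proof (rule eq_matI)
        fix i j assume "i < dim_row (L s b * J12)" "j < dim_col (L s b * J12)"
        then have ij: "i < n" "j < m" using L[of s b] c12 by auto
        have "(J12 * L' s b) $$ (i, j) = (\<Sum>l<N. J i l * z (s, b) l (n + j))"
          unfolding mat_mult_index[OF c12 L' ij] using ij L'[of s b]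
          by (auto simp: sumN z_def bl_def J12_def)
        also have "\<dots> = (\<Sum>l<N. z (s, b) i l * J l (n + j))"
          using ij by (intro J) (auto simp: N_def)
        also have "\<dots> = (L s b * J12) $$ (i, j)"
          unfolding mat_mult_index[OF L c12 ij] using ij L[of s b]
          by (auto simp: sumN z_def bl_def J12_def)
        finally show "(J12 * L' s b) $$ (i, j) = (L s b * J12) $$ (i, j)" .
      qed (use L[of s b] L'[of s b] c12 in auto)
    qed
    then have J12: "J i (n + j) = 0" if "i < n" "j < m" for i j
      using that by (auto simp: J12_def dest!: arg_cong[where f = "\<lambda>A. A $$ (i, j)"])
    have "J21 = 0\<^sub>m n m"
    proof (rule disj[OF c21])
      fix s b
      show "J21 * L' s b = L s b * J21"
      proof (rule eq_matI)
        fix i j assume "i < dim_row (L s b * J21)" "j < dim_col (L s b * J21)"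
        then have ij: "i < n" "j < m" using L[of s b] c21 by auto
        have L2: "L s b $$ (x, y) = cnj (L s (\<not> b) $$ (y, x))" if "x < n" "y < n" for x y
          using star[of s b] L[of s b] that by simp
        have L2': "L' s b $$ (x, y) = cnj (L' s (\<not> b) $$ (y, x))" if "x < m" "y < m" for x y
          using star'[of s b] L'[of s b] that by simp
        have "(J21 * L' s b) $$ (i, j) = cnj (\<Sum>l<N. z (s, \<not> b) (n + j) l * J l i)"
          unfolding mat_mult_index[OF c21 L' ij] using ij
          by (auto simp: sumN z_def bl_def J21_def L2' mult.commute)
        also have "(\<Sum>l<N. z (s, \<not> b) (n + j) l * J l i) = (\<Sum>l<N. J (n + j) l * z (s, \<not> b) l i)"
          using ij by (intro J[symmetric]) (auto simp: N_def)
        also have "cnj \<dots> = (L s b * J21) $$ (i, j)"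
          unfolding mat_mult_index[OF L c21 ij] using ij
          by (auto simp: sumN z_def bl_def J21_def L2 mult.commute)
        finally show "(J21 * L' s b) $$ (i, j) = (L s b * J21) $$ (i, j)" .
      qed (use L[of s b] L'[of s b] c21 in auto)
    qed
    then have J21: "J (n + j) i = 0" if "i < n" "j < m" for i j
      using that by (auto simp: J21_def dest!: arg_cong[where f = "\<lambda>A. A $$ (i, j)"])
    show "\<forall>i<N. \<forall>j<N. (\<Sum>l<N. J i l * D l j) = (\<Sum>l<N. D i l * J l j)"
    proof (intro allI impI)
      fix i j assume ij: "i < N" "j < N"
      have "(\<Sum>l<N. J i l * D l j) = (\<Sum>l<N. if l = j then (if j < n then J i j else 0) else 0)"
        by (intro sum.cong) (auto simp: D_def)
      moreover have "(\<Sum>l<N. D i l * J l j) = (\<Sum>l<N. if l = i then (if i < n then J i j else 0) else 0)"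
        by (intro sum.cong) (auto simp: D_def)
      moreover have "J i j = 0" if "i < n" "\<not> j < n" using J12[of i "j - n"] that ij by (simp add: N_def)
      moreover have "J i j = 0" if "j < n" "\<not> i < n" using J21[of j "i - n"] that ij by (simp add: N_def)
      ultimately show "(\<Sum>l<N. J i l * D l j) = (\<Sum>l<N. D i l * J l j)" using ij by auto
    qed
  qed
  then obtain a where a: "a \<in> A" "\<And>i j. i < N \<Longrightarrow> j < N \<Longrightarrow> a (i, j) = D i j" by blast
  \<comment> \<open>A block of degree at most \<open>N\<close> with entries below
    \<open>\<delta>\<close> has \<open>frob\<close> at most
    \<open>N\<^sup>2 * \<delta>\<^sup>2\<close>. The extra 1 makes this strictly less than
    \<open>\<epsilon>\<close>, also for \<open>N = 0\<close>.\<close>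
  define \<delta> where "\<delta> = sqrt (\<epsilon> / (real N ^ 2 + 1))"
  have d0: "\<delta> > 0" using e by (simp add: \<delta>_def add_nonneg_pos)
  then obtain p where "\<forall>i<N. \<forall>j<N. cmod (a (i, j) - fe p (i, j)) < \<delta>"
    using AD[OF a(1)] by blast
  then have p: "cmod (D i j - fe p (i, j)) < \<delta>" if "i < N" "j < N" for i j
    using a(2) that by simp
  have bound: "frob B < \<epsilon>" if B: "B \<in> carrier_mat r r" "r \<le> N" and b: "\<And>i j. i < r \<Longrightarrow> j < r \<Longrightarrow> cmod (B $$ (i, j)) < \<delta>" for B r
  proof -
    have "frob B \<le> (\<Sum>i<r. \<Sum>j<r. \<delta>\<^sup>2)"
      unfolding frob_carrier[OF B(1)] using b by (intro sum_mono power_mono) (auto intro: less_imp_le)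
    also have "\<dots> = (real r)\<^sup>2 * \<delta>\<^sup>2" by (simp add: power2_eq_square)
    also have "\<dots> \<le> (real N)\<^sup>2 * \<delta>\<^sup>2" using B(2) by (intro mult_right_mono power_mono) auto
    also have "\<dots> < (real N ^ 2 + 1) * \<delta>\<^sup>2" using d0 by simp
    also have "\<dots> = \<epsilon>"
    proof -
      have "real N ^ 2 + 1 > 0" by (simp add: add_nonneg_pos)
      then show ?thesis using e by (simp add: \<delta>_def)
    qed
    finally show ?thesis .
  qed
  show thesis
  proof (rule that[of p]; rule bound)
    fix i j assume ij: "i < n" "j < n"
    have "(pev n L p - 1\<^sub>m n) $$ (i, j) = - (D i j - fe p (i, j))"
      using ij pc(1)[of p] by (auto simp: D_def fe_def bl_def)
    then show "cmod ((pev n L p - 1\<^sub>m n) $$ (i, j)) < \<delta>" using p[of i j] ij by (simp only: norm_minus_cancel) (simp add: N_def)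
  next
    fix i j assume ij: "i < m" "j < m"
    have "pev m L' p $$ (i, j) = - (D (n + i) (n + j) - fe p (n + i, n + j))"
      using ij pc(1)[of p] by (auto simp: D_def fe_def bl_def)
    then show "cmod (pev m L' p $$ (i, j)) < \<delta>"
      using p[of "n + i" "n + j"] ij by (simp only: norm_minus_cancel) (simp add: N_def)
  qed (use pc in \<open>auto simp: N_def\<close>)
qed

text \<open>Indices are taken modulo \<open>k\<close>, so that every natural number is a valid index and the letter
  \<open>s\<close> stands for the matrix number \<open>s + 1\<close>.\<close>

definition letters :: "nat \<Rightarrow> (nat \<Rightarrow> complex mat) \<Rightarrow> nat \<Rightarrow> bool \<Rightarrow> complex mat" where
  "letters k X s b = (let A = X (Suc (s mod k)) in if b then mat_adjoint A else A)"

abbreviation tev :: "nat \<Rightarrow> (nat \<Rightarrow> complex mat) \<Rightarrow> pexp \<Rightarrow> complex mat" where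
  "tev k X \<equiv> pev (tuple_degree X) (letters k X)"

lemma mat_tuple_carrier:
  assumes "mat_tuple k X" "k \<ge> 1"
  shows "s \<in> {1..k} \<Longrightarrow> X s \<in> carrier_mat (tuple_degree X) (tuple_degree X)" "tuple_degree X \<ge> 1"
proof -
  obtain n where n: "n \<ge> 1" "\<And>s. s \<in> {1..k} \<Longrightarrow> X s \<in> carrier_mat n n"
    using assms unfolding mat_tuple_def by blast
  then have "X 1 \<in> carrier_mat n n" using assms(2) by simp
  then have "tuple_degree X = n" by (auto simp: tuple_degree_def)
  then show "s \<in> {1..k} \<Longrightarrow> X s \<in> carrier_mat (tuple_degree X) (tuple_degree X)" "tuple_degree X \<ge> 1"
    using n by auto
qed

lemma Suc_mod_range: "k \<ge> 1 \<Longrightarrow> Suc (s mod k) \<in> {1..k}"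
  by (simp add: Suc_leI)

lemma letters_carrier:
  assumes "mat_tuple k X" "k \<ge> 1"
  shows "letters k X s b \<in> carrier_mat (tuple_degree X) (tuple_degree X)"
  using mat_tuple_carrier(1)[OF assms Suc_mod_range[OF assms(2), of s]]
  by (auto simp: letters_def Let_def)

lemma letters_not: "letters k X s (\<not> b) = mat_adjoint (letters k X s b)"
  by (auto simp: letters_def Let_def)

lemma tev_carrier:
  assumes "mat_tuple k X" "k \<ge> 1"
  shows "tev k X p \<in> carrier_mat (tuple_degree X) (tuple_degree X)"
  using letters_carrier[OF assms] by (rule pev_carrier)

text \<open>Turns closeness of a polynomial to the identity into smallness of another
  polynomial.\<close>

abbreviation PMinus1 :: "pexp \<Rightarrow> pexp" where
  "PMinus1 p \<equiv> PAdd p (PSc (-1) 0 POne)"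

lemma pev_PMinus1:
  assumes "\<And>s b. L s b \<in> carrier_mat n n"
  shows "pev n L (PMinus1 p) = pev n L p - 1\<^sub>m n"
  using pev_carrier[of L n p, OF assms] by (intro eq_matI) (auto simp: complex_eq_iff)

text \<open>By Schur's lemma a nonzero intertwiner would make the tuples equivalent, so
  \<open>separating_pexp\<close> applies. The bound is the square of 1/3.\<close>

lemma separating_tuple:
  assumes k: "k \<ge> 1" and X: "mat_tuple k X" and Y: "mat_tuple k Y"
    and irrX: "irreducible_tuple k X" and irrY: "irreducible_tuple k Y"
    and ne: "\<not> mats_unitarily_equivalent k Y X"
  obtains p where "frob (tev k X (PMinus1 p)) < 1 / 9" "frob (tev k Y p) < 1 / 9"
proof (rule separating_pexp[of "letters k X" "tuple_degree X" "letters k Y" "tuple_degree Y" "1 / 9"])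
  fix J assume J: "J \<in> carrier_mat (tuple_degree X) (tuple_degree Y)"
    and JL: "\<And>s b. J * letters k Y s b = letters k X s b * J"
  show "J = 0\<^sub>m (tuple_degree X) (tuple_degree Y)"
  proof (rule ccontr)
    assume J0: "J \<noteq> 0\<^sub>m (tuple_degree X) (tuple_degree Y)"
    have JY: "J * Y s = X s * J" and JYa: "J * mat_adjoint (Y s) = mat_adjoint (X s) * J" if "s \<in> {1..k}" for s
    proof -
      have "s - 1 < k" using that by auto
      then have "Suc ((s - 1) mod k) = s" using that by simp
      then show "J * Y s = X s * J" "J * mat_adjoint (Y s) = mat_adjoint (X s) * J"
        using JL[of "s - 1" False] JL[of "s - 1" True] by (auto simp: letters_def)
    qed
    note u = intertwiner_multiple_of_unitary[OF irrX irrY refl refl mat_tuple_carrier(1)[OF X k]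
        mat_tuple_carrier(1)[OF Y k] J J0 JY JYa, simplified]
    define V where "V = complex_of_real (sqrt (real (tuple_degree X) / frob J)) \<cdot>\<^sub>m J"
    have "mats_unitarily_equivalent k Y X"
    proof (rule mats_unitarily_equivalentI[where V = V])
      show "tuple_degree Y = tuple_degree X" using u by simp
      show "unitary_mat (tuple_degree X) V" using u(2) by (simp add: V_def)
      fix s assume s: "s \<in> {1..k}"
      show "Y s \<in> carrier_mat (tuple_degree X) (tuple_degree X)" using mat_tuple_carrier(1)[OF Y k s] u(1) by simp
      show "X s \<in> carrier_mat (tuple_degree X) (tuple_degree X)" using mat_tuple_carrier(1)[OF X k s] .
      show "V * Y s = X s * V"
        unfolding V_def mult_smult_assoc_mat[OF J mat_tuple_carrier(1)[OF Y k s]]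
          mult_smult_distrib[OF mat_tuple_carrier(1)[OF X k s] J] JY[OF s] ..
    qed simp_all
    then show False using ne by simp
  qed
next
  fix p assume "frob (tev k X p - 1\<^sub>m (tuple_degree X)) < 1 / 9" "frob (tev k Y p) < 1 / 9"
  then show thesis using that[of p] pev_PMinus1[of "letters k X", OF letters_carrier[OF X k]] by (simp only:)
qed (use letters_carrier X Y k letters_not in auto)

lemma frob_unitary_left:
  assumes V: "unitary_mat n V" and A: "A \<in> carrier_mat n m"
  shows "frob (V * A) = frob A"
proof -
  have Vc: "V \<in> carrier_mat n n" and aV: "mat_adjoint V \<in> carrier_mat n n"
    and V1: "mat_adjoint V * V = 1\<^sub>m n" using V by (auto simp: unitary_mat_def)
  have aA: "mat_adjoint A \<in> carrier_mat m n" using A by auto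
  have VA: "V * A \<in> carrier_mat n m" using Vc A by auto
  have "mat_adjoint (V * A) * (V * A) = mat_adjoint A * mat_adjoint V * (V * A)"
    by (simp add: mat_adjoint_mult[OF Vc A])
  also have "\<dots> = mat_adjoint A * (mat_adjoint V * (V * A))" by (rule assoc_mult_mat[OF aA aV VA])
  also have "mat_adjoint V * (V * A) = A"
    using assoc_mult_mat[OF aV Vc A] V1 A by simp
  finally have e: "mat_adjoint (V * A) * (V * A) = mat_adjoint A * A" .
  have "complex_of_real (frob (V * A)) = (\<Sum>i<m. (mat_adjoint (V * A) * (V * A)) $$ (i, i))"
    unfolding frob_carrier[OF VA] by (subst sum.swap) (auto simp: adjoint_mult_diag[OF VA])
  also have "\<dots> = (\<Sum>i<m. (mat_adjoint A * A) $$ (i, i))" unfolding e ..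
  also have "\<dots> = of_real (frob A)"
    unfolding frob_carrier[OF A] by (subst sum.swap) (auto simp: adjoint_mult_diag[OF A])
  finally show ?thesis by simp
qed

lemma unitary_mat_adjoint: "unitary_mat n V \<Longrightarrow> unitary_mat n (mat_adjoint V)"
  by (auto simp: unitary_mat_def)

lemma frob_unitary_right:
  assumes V: "unitary_mat n V" and A: "A \<in> carrier_mat m n"
  shows "frob (A * V) = frob A"
proof -
  have "frob (A * V) = frob (mat_adjoint (A * V))" by simp
  also have "mat_adjoint (A * V) = mat_adjoint V * mat_adjoint A"
    using A V by (intro mat_adjoint_mult) (auto simp: unitary_mat_def)
  also have "frob \<dots> = frob (mat_adjoint A)"
    using A by (intro frob_unitary_left[OF unitary_mat_adjoint[OF V]]) auto
  finally show ?thesis by simp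
qed

text \<open>Take adjoints of the intertwining relation and multiply by \<open>V\<close> from both
  sides. So a unitary intertwiner of two tuples also intertwines the adjoint letters.\<close>

lemma intertwiner_adjoint:
  assumes V: "unitary_mat n V" and A: "A \<in> carrier_mat n n" and B: "B \<in> carrier_mat n n"
    and VA: "V * A = B * V"
  shows "V * mat_adjoint A = mat_adjoint B * V"
proof -
  have Vc: "V \<in> carrier_mat n n" and aV: "mat_adjoint V \<in> carrier_mat n n"
    and V1: "mat_adjoint V * V = 1\<^sub>m n" and V2: "V * mat_adjoint V = 1\<^sub>m n"
    using V by (auto simp: unitary_mat_def)
  have aA: "mat_adjoint A \<in> carrier_mat n n" and aB: "mat_adjoint B \<in> carrier_mat n n" using A B by auto
  have "mat_adjoint A * mat_adjoint V = mat_adjoint V * mat_adjoint B"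
    using VA mat_adjoint_mult[OF Vc A] mat_adjoint_mult[OF B Vc] by simp
  then have e: "V * (mat_adjoint A * mat_adjoint V) * V = V * (mat_adjoint V * mat_adjoint B) * V" by simp
  have "V * (mat_adjoint A * mat_adjoint V) * V = V * (mat_adjoint A * (mat_adjoint V * V))"
    using assoc_mult_mat[OF Vc mult_carrier_mat[OF aA aV] Vc] assoc_mult_mat[OF aA aV Vc] by simp
  moreover have "V * (mat_adjoint V * mat_adjoint B) * V = V * mat_adjoint V * mat_adjoint B * V"
    using assoc_mult_mat[OF Vc aV aB] by simp
  ultimately show ?thesis
    using e V1 V2 left_mult_one_mat[OF aB] right_mult_one_mat[OF aA] by simp
qed

lemma pev_intertwiner:
  assumes V: "V \<in> carrier_mat n n" and L: "\<And>s b. L s b \<in> carrier_mat n n" and L': "\<And>s b. L' s b \<in> carrier_mat n n"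
    and VL: "\<And>s b. V * L s b = L' s b * V"
  shows "V * pev n L p = pev n L' p * V"
proof (induction p)
  case POne
  then show ?case using V by simp
next
  case (PLet s b p)
  note c = pev_carrier[of L n p, OF L] pev_carrier[of L' n p, OF L']
  have "V * (L s b * pev n L p) = L' s b * V * pev n L p"
    using assoc_mult_mat[OF V L[of s b] c(1)] VL[of s b] by simp
  also have "\<dots> = L' s b * (pev n L' p * V)"
    unfolding assoc_mult_mat[OF L' V c(1)] PLet ..
  finally show ?case using assoc_mult_mat[OF L'[of s b] c(2) V] by simp
next
  case (PAdd p q)
  then show ?case
    using mult_add_distrib_mat[OF V pev_carrier[of L n p, OF L] pev_carrier[of L n q, OF L]]
      add_mult_distrib_mat[OF pev_carrier[of L' n p, OF L'] pev_carrier[of L' n q, OF L'] V] by simp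
next
  case (PSc a b p)
  then show ?case
    using mult_smult_distrib[OF V pev_carrier[of L n p, OF L]]
      mult_smult_assoc_mat[OF pev_carrier[of L' n p, OF L'] V] by simp
qed

lemma equivalent_frob_tev:
  assumes k: "k \<ge> 1" and X: "mat_tuple k X" and Y: "mat_tuple k Y"
    and eq: "mats_unitarily_equivalent k X Y"
  shows "frob (tev k X p) = frob (tev k Y p)"
proof -
  note D = mats_unitarily_equivalentD[OF mat_tuple_carrier(1)[OF X k] mat_tuple_carrier(1)[OF Y k] refl refl eq, simplified]
  define n where "n = tuple_degree X"
  have nY: "tuple_degree Y = n" using D by (simp add: n_def)
  obtain V where V: "unitary_mat n V" "\<And>s. s \<in> {1..k} \<Longrightarrow> V * X s = Y s * V"
    using D unfolding n_def by auto
  have c: "X s \<in> carrier_mat n n" "Y s \<in> carrier_mat n n" if "s \<in> {1..k}" for s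
    using mat_tuple_carrier(1)[OF X k that] mat_tuple_carrier(1)[OF Y k that] nY by (auto simp: n_def)
  have Vc: "V \<in> carrier_mat n n" using V by (simp add: unitary_mat_def)
  have L: "V * letters k X s b = letters k Y s b * V" for s b
    using V(2)[OF Suc_mod_range[OF k]] intertwiner_adjoint[OF V(1) c(1) c(2), OF Suc_mod_range[OF k] Suc_mod_range[OF k], of s s]
    by (auto simp: letters_def Let_def)
  have cX: "tev k X p \<in> carrier_mat n n" and cY: "tev k Y p \<in> carrier_mat n n"
    using tev_carrier[OF X k] tev_carrier[OF Y k] nY by (simp_all add: n_def)
  have "V * tev k X p = tev k Y p * V"
    using pev_intertwiner[OF Vc, of "letters k X" "letters k Y" p] letters_carrier[OF X k] letters_carrier[OF Y k] L nY
    by (simp add: n_def)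
  then show ?thesis using frob_unitary_left[OF V(1) cX] frob_unitary_right[OF V(1) cY] by simp
qed

definition tuple_invariant :: "nat \<Rightarrow> (nat \<Rightarrow> complex mat) \<Rightarrow> nat \<Rightarrow> real" where
  "tuple_invariant k X i = frob (tev k X (from_nat i))"

lemma cmod_entry_le_frob:
  assumes "A \<in> carrier_mat n m" "i < n" "j < m"
  shows "(cmod (A $$ (i, j)))\<^sup>2 \<le> frob A"
proof -
  have "(cmod (A $$ (i, j)))\<^sup>2 \<le> (\<Sum>j<m. (cmod (A $$ (i, j)))\<^sup>2)" using assms by (intro member_le_sum) auto
  also have "\<dots> \<le> frob A" unfolding frob_carrier[OF assms(1)]
    using assms by (intro member_le_sum[of i _ "\<lambda>i. \<Sum>j<m. (cmod (A $$ (i, j)))\<^sup>2"] sum_nonneg) auto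
  finally show ?thesis .
qed

text \<open>If inequivalent tuples had equal invariants, the separating polynomial at
  \<open>X\<close> would lie within distance 1/3 of the identity and of 0 at once; its entry
  \<open>(0, 0)\<close> shows that this is impossible.\<close>

lemma tuple_invariant_eq_iff:
  assumes k: "k \<ge> 1" and X: "mat_tuple k X" and Y: "mat_tuple k Y"
    and irrX: "irreducible_tuple k X" and irrY: "irreducible_tuple k Y"
  shows "tuple_invariant k X = tuple_invariant k Y \<longleftrightarrow> mats_unitarily_equivalent k Y X"
proof
  assume eq: "tuple_invariant k X = tuple_invariant k Y"
  have eqp: "frob (tev k X p) = frob (tev k Y p)" for p
    using fun_cong[OF eq, of "to_nat p"] by (simp add: tuple_invariant_def)
  show "mats_unitarily_equivalent k Y X"
  proof (rule ccontr)
    assume "\<not> ?thesis"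
    then obtain p where p: "frob (tev k X (PMinus1 p)) < 1 / 9" "frob (tev k Y p) < 1 / 9"
      using separating_tuple[OF k X Y irrX irrY] by blast
    define P where "P = tev k X p"
    define n where "n = tuple_degree X"
    have n: "0 < n" using mat_tuple_carrier(2)[OF X k] by (simp add: n_def)
    have P: "P \<in> carrier_mat n n" using tev_carrier[OF X k] by (simp add: P_def n_def)
    have PM: "tev k X (PMinus1 p) = P - 1\<^sub>m n"
      unfolding P_def n_def by (rule pev_PMinus1) (rule letters_carrier[OF X k])
    have f: "frob (P - 1\<^sub>m n) < 1 / 9" "frob P < 1 / 9" using p eqp[of p] PM by (simp_all add: P_def)
    have "P - 1\<^sub>m n \<in> carrier_mat n n" using P by auto
    then have "(cmod ((P - 1\<^sub>m n) $$ (0, 0)))\<^sup>2 \<le> frob (P - 1\<^sub>m n)" "(cmod (P $$ (0, 0)))\<^sup>2 \<le> frob P"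
      using P n cmod_entry_le_frob by blast+
    then have "(cmod (P $$ (0, 0) - 1))\<^sup>2 < (1 / 3)\<^sup>2" "(cmod (P $$ (0, 0)))\<^sup>2 < (1 / 3)\<^sup>2"
      using f P n by (simp_all add: power2_eq_square)
    then have "cmod (P $$ (0, 0) - 1) < 1 / 3" "cmod (P $$ (0, 0)) < 1 / 3"
      by (auto dest!: power2_less_imp_less)
    moreover have "1 \<le> cmod (P $$ (0, 0) - 1) + cmod (P $$ (0, 0))"
      using norm_triangle_ineq4[of "P $$ (0, 0)" "P $$ (0, 0) - 1"] by simp
    ultimately show False by simp
  qed
next
  assume "mats_unitarily_equivalent k Y X"
  from equivalent_frob_tev[OF k Y X this] show "tuple_invariant k X = tuple_invariant k Y"
    by (auto simp: tuple_invariant_def)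
qed

section \<open>Norm bounds for matrices and polynomials\<close>

lemma mat_vec_frob_le:
  assumes A: "A \<in> carrier_mat n m" and v: "v \<in> carrier_vec m"
  shows "(\<Sum>i<n. (cmod ((A *\<^sub>v v) $ i))\<^sup>2) \<le> frob A * (\<Sum>q<m. (cmod (v $ q))\<^sup>2)"
proof -
  have "(cmod ((A *\<^sub>v v) $ i))\<^sup>2 \<le> (\<Sum>q<m. (cmod (A $$ (i, q)))\<^sup>2) * (\<Sum>q<m. (cmod (v $ q))\<^sup>2)" if "i < n" for i
  proof -
    have "cmod ((A *\<^sub>v v) $ i) \<le> (\<Sum>q<m. cmod (A $$ (i, q)) * cmod (v $ q))"
      unfolding mat_vec_index[OF A v that] by (intro sum_norm_le) (simp add: norm_mult)
    then have "(cmod ((A *\<^sub>v v) $ i))\<^sup>2 \<le> (\<Sum>q<m. cmod (A $$ (i, q)) * cmod (v $ q))\<^sup>2"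
      by (intro power_mono) auto
    also have "\<dots> \<le> (\<Sum>q<m. (cmod (A $$ (i, q)))\<^sup>2) * (\<Sum>q<m. (cmod (v $ q))\<^sup>2)"
      by (rule Cauchy_Schwarz_ineq_sum)
    finally show ?thesis .
  qed
  then have "(\<Sum>i<n. (cmod ((A *\<^sub>v v) $ i))\<^sup>2) \<le> (\<Sum>i<n. (\<Sum>q<m. (cmod (A $$ (i, q)))\<^sup>2) * (\<Sum>q<m. (cmod (v $ q))\<^sup>2))"
    by (intro sum_mono) auto
  then show ?thesis by (simp add: frob_carrier[OF A] sum_distrib_right)
qed

lemma frob_mult_le:
  assumes A: "A \<in> carrier_mat n l" and B: "B \<in> carrier_mat l m"
  shows "frob (A * B) \<le> frob A * frob B"
proof -
  have "frob (A * B) = (\<Sum>j<m. \<Sum>i<n. (cmod ((A *\<^sub>v col B j) $ i))\<^sup>2)"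
    using A B by (subst frob_carrier[of _ n m]) (auto intro!: sum.cong trans[OF sum.swap])
  also have "\<dots> \<le> (\<Sum>j<m. frob A * (\<Sum>q<l. (cmod (col B j $ q))\<^sup>2))"
    using A B by (intro sum_mono mat_vec_frob_le) auto
  also have "\<dots> = frob A * frob B"
    unfolding frob_carrier[OF B] sum_distrib_left[symmetric] using B
    by (subst (2) sum.swap) (auto intro!: sum.cong)
  finally show ?thesis .
qed

lemma frob_add_le:
  assumes A: "A \<in> carrier_mat n m" and B: "B \<in> carrier_mat n m"
  shows "frob (A + B) \<le> 2 * (frob A + frob B)"
proof -
  have 1: "(cmod (x + y))\<^sup>2 \<le> 2 * ((cmod x)\<^sup>2 + (cmod y)\<^sup>2)" for x y :: complex
  proof -
    have "(cmod (x + y))\<^sup>2 \<le> (cmod x + cmod y)\<^sup>2" by (intro power_mono norm_triangle_ineq) auto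
    also have "\<dots> \<le> 2 * ((cmod x)\<^sup>2 + (cmod y)\<^sup>2)"
      using sum_squares_bound[of "cmod x" "cmod y"] by (simp add: power2_sum)
    finally show ?thesis .
  qed
  have "frob (A + B) = (\<Sum>i<n. \<Sum>j<m. (cmod (A $$ (i, j) + B $$ (i, j)))\<^sup>2)"
    using A B by (subst frob_carrier[of _ n m]) auto
  also have "\<dots> \<le> (\<Sum>i<n. \<Sum>j<m. 2 * ((cmod (A $$ (i, j)))\<^sup>2 + (cmod (B $$ (i, j)))\<^sup>2))"
    by (intro sum_mono 1)
  also have "\<dots> = 2 * (frob A + frob B)"
    by (simp add: frob_carrier[OF A] frob_carrier[OF B] sum_distrib_left sum.distrib distrib_left)
  finally show ?thesis .
qed

lemma frob_smult: "frob (c \<cdot>\<^sub>m A) = (cmod c)\<^sup>2 * frob A"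
  by (simp add: frob_def norm_mult power_mult_distrib sum_distrib_left)

lemma frob_one: "frob (1\<^sub>m n) = real n"
proof -
  have "frob (1\<^sub>m n) = (\<Sum>i<n. \<Sum>j<n. if j = i then 1 else 0)"
    unfolding frob_def by (intro sum.cong) auto
  then show ?thesis by simp
qed

text \<open>One constant serves all degrees and all letters within the bound \<open>K\<close>, so it
  is uniform over the points of a field.\<close>

lemma frob_pev_bounded:
  "\<exists>C\<ge>0. \<forall>n L. (\<forall>s b. L s b \<in> carrier_mat n n) \<longrightarrow> real n \<le> K \<longrightarrow> (\<forall>s b. frob (L s b) \<le> K) \<longrightarrow> frob (pev n L p) \<le> C"
proof (induction p)
  case POne
  \<comment> \<open>The constant must be nonnegative even for negative \<open>K\<close>, where the
    bound is vacuous.\<close>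
  show ?case by (intro exI[of _ "max 0 K"]) (auto simp: frob_one)
next
  case (PLet s b p)
  then obtain C where C: "C \<ge> 0" "\<And>n L. (\<forall>s b. L s b \<in> carrier_mat n n) \<Longrightarrow> real n \<le> K \<Longrightarrow> (\<forall>s b. frob (L s b) \<le> K) \<Longrightarrow> frob (pev n L p) \<le> C"
    by blast
  have "frob (pev n L (PLet s b p)) \<le> max 0 K * C"
    if L: "\<forall>s b. L s b \<in> carrier_mat n n" and K: "real n \<le> K" "\<forall>s b. frob (L s b) \<le> K" for n L
  proof -
    have Lc: "\<And>s b. L s b \<in> carrier_mat n n" using L by blast
    have "frob (pev n L (PLet s b p)) \<le> frob (L s b) * frob (pev n L p)"
      using frob_mult_le[OF Lc pev_carrier[of L n p, OF Lc]] by simp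
    also have "\<dots> \<le> max 0 K * C" using C(1) C(2)[OF L K] K(2)
      by (intro mult_mono) (auto simp: le_max_iff_disj)
    finally show ?thesis .
  qed
  then show ?case using C(1) by (intro exI[of _ "max 0 K * C"]) auto
next
  case (PAdd p q)
  then obtain C D where C: "C \<ge> 0" "\<And>n L. (\<forall>s b. L s b \<in> carrier_mat n n) \<Longrightarrow> real n \<le> K \<Longrightarrow> (\<forall>s b. frob (L s b) \<le> K) \<Longrightarrow> frob (pev n L p) \<le> C"
    and D: "D \<ge> 0" "\<And>n L. (\<forall>s b. L s b \<in> carrier_mat n n) \<Longrightarrow> real n \<le> K \<Longrightarrow> (\<forall>s b. frob (L s b) \<le> K) \<Longrightarrow> frob (pev n L q) \<le> D"
    by blast
  have "frob (pev n L (PAdd p q)) \<le> 2 * (C + D)"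
    if L: "\<forall>s b. L s b \<in> carrier_mat n n" and K: "real n \<le> K" "\<forall>s b. frob (L s b) \<le> K" for n L
    using frob_add_le[OF pev_carrier[of L n p] pev_carrier[of L n q]] L C(2)[OF L K] D(2)[OF L K] by fastforce
  then show ?case using C(1) D(1) by (intro exI[of _ "2 * (C + D)"]) auto
next
  case (PSc a b p)
  then obtain C where C: "C \<ge> 0" "\<And>n L. (\<forall>s b. L s b \<in> carrier_mat n n) \<Longrightarrow> real n \<le> K \<Longrightarrow> (\<forall>s b. frob (L s b) \<le> K) \<Longrightarrow> frob (pev n L p) \<le> C"
    by blast
  let ?c = "(cmod (Complex (of_rat a) (of_rat b)))\<^sup>2"
  have "frob (pev n L (PSc a b p)) \<le> ?c * C"
    if L: "\<forall>s b. L s b \<in> carrier_mat n n" and K: "real n \<le> K" "\<forall>s b. frob (L s b) \<le> K" for n L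
    unfolding pev.simps frob_smult using C(2)[OF L K] by (intro mult_left_mono) auto
  then show ?case using C(1) by (intro exI[of _ "?c * C"]) auto
qed

section \<open>Borel inverses on standard measure spaces\<close>

text \<open>The image is a completely metrizable subspace of a metrizable space, hence a countable
  intersection of open sets.\<close>

lemma homeomorphic_maps_imp_borel:
  fixes \<iota> :: "'a \<Rightarrow> nat \<Rightarrow> real"
  assumes X: "completely_metrizable_space X"
    and h: "homeomorphic_map X (subtopology euclidean (\<iota> ` topspace X)) \<iota>"
  shows "\<iota> ` topspace X \<in> sets borel"
proof -
  have "completely_metrizable_space (subtopology euclidean (\<iota> ` topspace X))"
    using X h homeomorphic_completely_metrizable_space homeomorphic_map_imp_homeomorphic_space by blast
  then have "gdelta_in (euclidean :: (nat \<Rightarrow> real) topology) (\<iota> ` topspace X)"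
    by (intro completely_metrizable_space_imp_gdelta_in metrizable_space_euclidean) auto
  then obtain \<U> T where "countable \<U>" "\<U> \<subseteq> Collect (openin (euclidean :: (nat \<Rightarrow> real) topology))"
    "\<Inter> \<U> = T" "topspace (euclidean :: (nat \<Rightarrow> real) topology) \<inter> T = \<iota> ` topspace X"
    unfolding gdelta_in_def relative_to_def intersection_of_def by blast
  then have \<U>: "countable \<U>" "\<U> \<subseteq> Collect open" "\<iota> ` topspace X = UNIV \<inter> \<Inter> \<U>"
    by (simp_all add: open_openin)
  \<comment> \<open>Inserting the whole space makes the countable family nonempty without changing
    the intersection.\<close>
  have "UNIV \<inter> \<Inter> \<U> = (\<Inter>U\<in>insert UNIV \<U>. U)" by auto
  also have "\<dots> \<in> sets borel" using \<U>(1,2) by (intro sets.countable_INT') auto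
  finally show ?thesis using \<U>(3) by simp
qed

text \<open>A point is sent to its distances from a dense sequence, which embeds the space
  homeomorphically. The target is a type with a topology, on which inner regularity of finite Borel
  measures is available.\<close>

lemma polish_embedding:
  assumes X: "completely_metrizable_space X" and sc: "second_countable X"
  obtains \<iota> :: "'a \<Rightarrow> nat \<Rightarrow> real" where
    "inj_on \<iota> (topspace X)" "\<iota> ` topspace X \<in> sets borel"
    "\<And>V. open V \<Longrightarrow> openin X {x \<in> topspace X. \<iota> x \<in> V}"
    "\<And>U. openin X U \<Longrightarrow> \<exists>V. open V \<and> U = {x \<in> topspace X. \<iota> x \<in> V}"
proof (cases "topspace X = {}")
  case True
  show thesis
  proof (rule that[of "\<lambda>_ _. 0"])
    show "\<exists>V. open V \<and> U = {x \<in> topspace X. (\<lambda>_. 0) \<in> V}" if "openin X U" for U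
      using openin_subset[OF that] True by auto
  qed (auto simp: True)
next
  case False
  obtain M d where "Metric_space M d" and comp: "Metric_space.mcomplete M d"
    and XM: "X = Metric_space.mtopology M d"
    using X unfolding completely_metrizable_space_def by blast
  interpret Metric_space M d by fact
  have M: "topspace X = M" by (simp add: XM)
  obtain D where D: "countable D" "D \<subseteq> M" "X closure_of D = M"
    using second_countable_imp_separable_space[OF sc] unfolding separable_space_def M by blast
  then have D0: "D \<noteq> {}" using False M by auto
  define a where "a = from_nat_into D"
  have aD: "a i \<in> M" for i using D0 D from_nat_into[OF D0] by (auto simp: a_def)
  have near: "\<exists>i. d x (a i) < r" if xM: "x \<in> M" "r > 0" for x r
  proof -
    have "x \<in> mtopology closure_of D" using that D XM by simp
    then obtain y where "y \<in> D" "y \<in> mball x r"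
      using xM(2) unfolding metric_closure_of by blast
    then have "y \<in> D" "d x y < r" by simp_all
    moreover obtain i where "a i = y" using from_nat_into_surj[OF D(1) \<open>y \<in> D\<close>] by (auto simp: a_def)
    ultimately show ?thesis by auto
  qed
  define \<iota> where "\<iota> x i = d x (a i)" for x i
  have cont: "continuous_map X euclidean \<iota>"
  proof -
    have "continuous_map mtopology euclidean (\<lambda>x. \<iota> x i)" for i
      unfolding continuous_map_def
    proof (intro conjI allI impI)
      fix U :: "real set" assume "openin euclidean U"
      then have U: "open U" by (rule open_openin[THEN iffD2])
      have "\<exists>r>0. mball x r \<subseteq> {x \<in> M. \<iota> x i \<in> U}" if x: "x \<in> M" "\<iota> x i \<in> U" for x
      proof -
        obtain r where r: "r > 0" "\<And>t. dist t (\<iota> x i) < r \<Longrightarrow> t \<in> U" using U x(2) unfolding open_dist by blast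
        have "\<iota> y i \<in> U" if y: "y \<in> mball x r" for y
        proof (rule r(2))
          have yM: "y \<in> M" and yr: "d x y < r" using y by auto
          have "d x (a i) \<le> d x y + d y (a i)" "d y (a i) \<le> d y x + d x (a i)"
            using triangle x(1) yM aD by auto
          then show "dist (\<iota> y i) (\<iota> x i) < r"
            using yr commute[of x y] by (simp add: \<iota>_def dist_real_def abs_less_iff)
        qed
        then show ?thesis using r(1) by (intro exI[of _ r]) auto
      qed
      then show "openin mtopology {x \<in> topspace mtopology. \<iota> x i \<in> U}" by (auto simp: openin_mtopology)
    qed auto
    then have "continuous_map X (product_topology (\<lambda>_. euclidean) UNIV) \<iota>"
      unfolding XM by (subst continuous_map_componentwise_UNIV) (auto simp: \<iota>_def)
    then show ?thesis by (simp add: euclidean_product_topology)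
  qed
  have op: "openin X {x \<in> topspace X. \<iota> x \<in> V}" if V: "open V" for V
    using cont V by (simp add: continuous_map_def)
  have inv: "\<exists>V. open V \<and> U = {x \<in> topspace X. \<iota> x \<in> V}" if U: "openin X U" for U
  proof -
    \<comment> \<open>The union of all conditions "the distance to \<open>a i\<close> is less than
      \<open>r\<close>" that define subsets of \<open>U\<close>. A ball of half the radius around a
      nearby \<open>a i\<close> shows that every point of \<open>U\<close> is reached.\<close>
    define V where "V = \<Union> {{f. f i < r} | i r. {x \<in> M. d x (a i) < r} \<subseteq> U}"
    have "open {f :: nat \<Rightarrow> real. f i < r}" for i r
      using open_Collect_less[of "\<lambda>f :: nat \<Rightarrow> real. f i" "\<lambda>_. r"] by auto
    then have "open V" unfolding V_def by blast
    moreover have "U = {x \<in> topspace X. \<iota> x \<in> V}"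
    proof (intro equalityI subsetI)
      fix x assume x: "x \<in> U"
      then have xM: "x \<in> M" using U openin_subset M by blast
      obtain r where r: "r > 0" "mball x r \<subseteq> U" using U x unfolding XM openin_mtopology by blast
      obtain i where i: "d x (a i) < r / 2" using near[OF xM, of "r / 2"] r by auto
      have "{y \<in> M. d y (a i) < r / 2} \<subseteq> U"
      proof
        fix y assume y: "y \<in> {y \<in> M. d y (a i) < r / 2}"
        have "d x y \<le> d x (a i) + d (a i) y" using triangle xM y aD by auto
        then have "d x y < r" using y i commute[of y "a i"] by auto
        then show "y \<in> U" using r xM y by auto
      qed
      then have "\<iota> x \<in> V" using i unfolding V_def \<iota>_def by blast
      then show "x \<in> {x \<in> topspace X. \<iota> x \<in> V}" using xM M by simp
    next
      fix x assume "x \<in> {x \<in> topspace X. \<iota> x \<in> V}"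
      then show "x \<in> U" unfolding V_def \<iota>_def M by auto
    qed
    ultimately show ?thesis by blast
  qed
  have inj: "inj_on \<iota> (topspace X)"
  proof (rule inj_onI)
    fix x y assume xy: "x \<in> topspace X" "y \<in> topspace X" "\<iota> x = \<iota> y"
    show "x = y"
    proof (rule ccontr)
      assume "x \<noteq> y"
      then have "d x y > 0" using xy M by simp
      then obtain i where i: "d x (a i) < d x y / 2" using near[of x "d x y / 2"] xy M by auto
      have "d x y \<le> d x (a i) + d (a i) y" using triangle xy aD M by auto
      moreover have "d y (a i) = d x (a i)" using fun_cong[OF xy(3), of i] by (simp add: \<iota>_def)
      ultimately show False using i commute[of y "a i"] by auto
    qed
  qed
  have "homeomorphic_map X (subtopology euclidean (\<iota> ` topspace X)) \<iota>"
  proof (rule bijective_open_imp_homeomorphic_map)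
    show "continuous_map X (subtopology euclidean (\<iota> ` topspace X)) \<iota>"
      using cont by (auto simp: continuous_map_in_subtopology)
    show "open_map X (subtopology euclidean (\<iota> ` topspace X)) \<iota>"
      unfolding open_map_def
    proof (intro allI impI)
      fix U assume "openin X U"
      then obtain V where "open V" "U = {x \<in> topspace X. \<iota> x \<in> V}" using inv by blast
      then show "openin (top_of_set (\<iota> ` topspace X)) (\<iota> ` U)"
        by (auto simp: openin_open intro!: exI[of _ V])
    qed
  qed (use inj in auto)
  from homeomorphic_maps_imp_borel[OF X this] show thesis using that inj op inv by blast
qed

text \<open>By inner regularity the \<open>n\<close>-th compact set misses at most measure
  \<open>1 / (n + 1)\<close>; the part missed by all of them is null.\<close>

lemma compact_exhaustion:
  fixes m :: "'a::{second_countable_topology, complete_space} measure"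
  assumes "finite_measure m" and sb: "sets m = sets borel" and B: "B \<in> sets borel"
  obtains K where "\<And>n::nat. compact (K n)" "\<And>n. K n \<subseteq> B" "emeasure m (B - (\<Union>n. K n)) = 0"
proof -
  interpret finite_measure m by fact
  have "\<exists>K. compact K \<and> K \<subseteq> B \<and> emeasure m B \<le> emeasure m K + ennreal (1 / real (Suc n))" for n
  proof (rule ccontr)
    assume c: "\<not> ?thesis"
    have inner: "emeasure m B = (SUP K \<in> {K. K \<subseteq> B \<and> compact K}. emeasure m K)"
      by (rule inner_regular[OF sb _ B]) simp
    have "emeasure m B > 0"
    proof (rule ccontr)
      assume "\<not> ?thesis"
      then show False using c by (auto dest!: spec[of _ "{}"])
    qed
    then have "emeasure m B - ennreal (1 / real (Suc n)) < emeasure m B"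
      by (intro ennreal_between) (auto simp: less_top[symmetric])
    then have "emeasure m B - ennreal (1 / real (Suc n)) < (SUP K \<in> {K. K \<subseteq> B \<and> compact K}. emeasure m K)"
      unfolding inner .
    then obtain K where K: "K \<subseteq> B" "compact K" "emeasure m B - ennreal (1 / real (Suc n)) < emeasure m K"
      unfolding less_SUP_iff by auto
    then have "emeasure m B \<le> emeasure m K + ennreal (1 / real (Suc n))"
      using ennreal_minus_le_iff less_imp_le[OF K(3)] by (simp add: add.commute)
    then show False using c K by blast
  qed
  then obtain K where K: "\<And>n. compact (K n)" "\<And>n. K n \<subseteq> B"
    "\<And>n. emeasure m B \<le> emeasure m (K n) + ennreal (1 / real (Suc n))" by metis
  have Ks: "K n \<in> sets m" for n using K(1) sb by (simp add: borel_compact)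
  have Bs: "B \<in> sets m" using B sb by simp
  have "emeasure m (B - (\<Union>n. K n)) \<le> 0 + ennreal e" if e: "e > 0" for e
  proof -
    obtain n where n: "1 / real (Suc n) < e" using nat_approx_posE[OF e] by auto
    have "emeasure m (B - (\<Union>n. K n)) \<le> emeasure m (B - K n)"
      using Ks Bs by (intro emeasure_mono) auto
    also have "\<dots> = emeasure m B - emeasure m (K n)"
      using Ks Bs K by (intro emeasure_Diff) auto
    also have "\<dots> \<le> ennreal (1 / real (Suc n))"
      using K(3)[of n] by (simp add: ennreal_minus_le_iff)
    also have "\<dots> \<le> ennreal e" using n by (intro ennreal_leI) auto
    finally show ?thesis by simp
  qed
  then have "emeasure m (B - (\<Union>n. K n)) \<le> 0" by (rule ennreal_le_epsilon)
  then show thesis using K by (intro that[of K]) simp_all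
qed

text \<open>A Borel injection need not have a Borel image by elementary means; but after discarding a
  null set the graph is \<open>\<sigma>\<close>-compact, and projecting compact subsets of the graph keeps everything
  closed. This avoids the Lusin--Souslin theorem.\<close>

lemma standard_measure_space_Borel_inverse:
  fixes \<tau> :: "'a \<Rightarrow> nat \<Rightarrow> real"
  assumes std: "standard_measure_space M" and \<tau>: "\<tau> \<in> borel_measurable M" and inj: "inj_on \<tau> (space M)"
  obtains R \<sigma> where "R \<in> sets borel" "AE \<omega> in M. \<tau> \<omega> \<in> R"
    "\<And>y. y \<in> R \<Longrightarrow> \<sigma> y \<in> space M \<and> \<tau> (\<sigma> y) = y"
    "\<And>B. B \<in> sets M \<Longrightarrow> {y \<in> R. \<sigma> y \<in> B} \<in> sets borel"
proof -
  interpret sigma_finite_measure M using std by (simp add: standard_measure_space_def)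
  obtain N where N: "N \<in> null_sets M" "standard_borel (restrict_space M (space M - N))"
    using std by (auto simp: standard_measure_space_def)
  \<comment> \<open>Off the null set \<open>N\<close> the space carries a Polish topology; the
    embedding and its inverse live there.\<close>
  define M' where "M' = restrict_space M (space M - N)"
  obtain X where X: "completely_metrizable_space X" "second_countable X"
    and sp: "space M' = topspace X" and sX: "sets M' = sigma_sets (topspace X) {U. openin X U}"
    using N(2) unfolding standard_borel_def M'_def by blast
  define W where "W = topspace X"
  have Wsp: "W = space M - N" using sp N by (auto simp: W_def M'_def space_restrict_space dest: null_setsD2 sets.sets_into_space)
  have WM: "W \<in> sets M" using N Wsp by auto
  have opM: "U \<in> sets M'" if "openin X U" for U unfolding sX using that by auto
  obtain \<iota> :: "'a \<Rightarrow> nat \<Rightarrow> real" where \<iota>: "inj_on \<iota> W" "\<iota> ` W \<in> sets borel"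
    "\<And>V. open V \<Longrightarrow> openin X {x \<in> W. \<iota> x \<in> V}"
    "\<And>U. openin X U \<Longrightarrow> \<exists>V. open V \<and> U = {x \<in> W. \<iota> x \<in> V}"
    using polish_embedding[OF X] unfolding W_def by blast
  have spW: "space M' = W" by (simp add: sp W_def)
  have \<iota>m: "\<iota> \<in> borel_measurable M'"
  proof (rule borel_measurableI)
    fix S :: "(nat \<Rightarrow> real) set" assume "open S"
    from opM[OF \<iota>(3)[OF this]] show "\<iota> -` S \<inter> space M' \<in> sets M'"
      by (simp add: spW vimage_def Int_def conj_commute)
  qed
  have \<tau>m: "\<tau> \<in> borel_measurable M'" unfolding M'_def by (rule measurable_restrict_space1[OF \<tau>])
  define S where "S = \<iota> ` W"
  \<comment> \<open>The inverse of the embedding is Borel on the image, because every open set is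
    the preimage of an open set under \<open>\<iota>\<close>.\<close>
  define \<kappa> where "\<kappa> = inv_into W \<iota>"
  have \<kappa>: "\<kappa> (\<iota> x) = x" if "x \<in> W" for x unfolding \<kappa>_def using \<iota>(1) that by simp
  have \<kappa>m: "\<kappa> \<in> measurable (restrict_space borel S) M'"
    unfolding measurable_def
  proof (intro CollectI conjI)
    show "\<kappa> \<in> space (restrict_space borel S) \<rightarrow> space M'"
      using \<kappa> by (auto simp: space_restrict_space S_def spW)
    have "\<kappa> -` B \<inter> S \<in> sets borel" if "B \<in> sigma_sets W {U. openin X U}" for B
      using that
    proof induction
      case (Basic U)
      then obtain V where V: "open V" "U = {x \<in> W. \<iota> x \<in> V}" using \<iota>(4) by blast
      have "\<kappa> -` U \<inter> S = S \<inter> V" unfolding V S_def using \<kappa> by auto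
      then show ?case using V(1) \<iota>(2) by (simp add: S_def)
    next
      case (Compl B)
      have "\<kappa> -` (W - B) \<inter> S = S - (\<kappa> -` B \<inter> S)" unfolding S_def using \<kappa> by auto
      then show ?case using Compl \<iota>(2) by (simp add: S_def)
    next
      case (Union B)
      have "\<kappa> -` (\<Union>i. B i) \<inter> S = (\<Union>i. \<kappa> -` B i \<inter> S)" by auto
      moreover have "(\<Union>i. \<kappa> -` B i \<inter> S) \<in> sets borel" using Union(2) by (intro sets.countable_UN) auto
      ultimately show ?case by (simp only:)
    qed auto
    then show "\<forall>B\<in>sets M'. \<kappa> -` B \<inter> space (restrict_space borel S) \<in> sets (restrict_space borel S)"
      using \<iota>(2) by (auto simp: sX W_def space_restrict_space sets_restrict_space_iff S_def)
  qed
  define G where "G = (\<lambda>\<omega>. (\<tau> \<omega>, \<iota> \<omega>))"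
  have Gm: "G \<in> borel_measurable M'" unfolding G_def using \<tau>m \<iota>m by (rule borel_measurable_Pair)
  define \<Gamma> where "\<Gamma> = G ` W"
  \<comment> \<open>The graph consists of the pairs with second component \<open>z\<close> in
    \<open>S\<close> and first component \<open>\<tau> (\<kappa> z)\<close>. Equality of two
    sequences is a countable conjunction, so this is a Borel condition.\<close>
  have \<Gamma>: "\<Gamma> \<in> sets borel"
  proof -
    let ?N = "restrict_space borel (UNIV \<times> S) :: ((nat \<Rightarrow> real) \<times> (nat \<Rightarrow> real)) measure"
    have US: "UNIV \<times> S \<in> sets (borel :: ((nat \<Rightarrow> real) \<times> (nat \<Rightarrow> real)) measure)"
      unfolding borel_prod[symmetric] using \<iota>(2) by (intro pair_measureI) (auto simp: S_def)
    have sndm: "snd \<in> measurable ?N (restrict_space borel S)"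
      by (intro measurable_restrict_space2 measurable_restrict_space1)
        (auto simp: space_restrict_space intro!: borel_measurable_continuous_onI continuous_on_snd continuous_on_id)
    have fstm: "fst \<in> borel_measurable ?N"
      by (intro measurable_restrict_space1 borel_measurable_continuous_onI continuous_on_fst continuous_on_id)
    have a: "(\<lambda>p. \<tau> (\<kappa> (snd p))) \<in> borel_measurable ?N"
      using measurable_compose[OF measurable_compose[OF sndm \<kappa>m] \<tau>m] .
    have "{p \<in> space ?N. \<forall>i. fst p i = \<tau> (\<kappa> (snd p)) i} \<in> sets ?N"
      using measurable_compose[OF a measurable_product_coordinates]
        measurable_compose[OF fstm measurable_product_coordinates] by measurable
    moreover have "{p \<in> space ?N. \<forall>i. fst p i = \<tau> (\<kappa> (snd p)) i} = \<Gamma>"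
    proof (intro equalityI subsetI)
      fix p assume p: "p \<in> {p \<in> space ?N. \<forall>i. fst p i = \<tau> (\<kappa> (snd p)) i}"
      then obtain x where x: "x \<in> W" "snd p = \<iota> x" by (auto simp: space_restrict_space S_def)
      then have "p = G x" using p \<kappa>[of x] by (auto simp: G_def prod_eq_iff)
      then show "p \<in> \<Gamma>" using x by (auto simp: \<Gamma>_def)
    qed (auto simp: \<Gamma>_def G_def space_restrict_space S_def \<kappa>)
    ultimately have "\<Gamma> \<in> sets ?N" by simp
    then show ?thesis using US by (simp add: sets_restrict_space_iff)
  qed
  \<comment> \<open>Inner regularity is used for finite measures. A positive density with finite
    integral gives one with the same null sets.\<close>
  obtain h where h: "h \<in> borel_measurable M" "integral\<^sup>N M h \<noteq> \<infinity>" "\<forall>x\<in>space M. 0 < h x \<and> h x < \<infinity>"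
    using Ex_finite_integrable_function by blast
  define \<nu> where "\<nu> = density M' h"
  have hm: "h \<in> borel_measurable M'" unfolding M'_def by (rule measurable_restrict_space1[OF h(1)])
  have "(\<integral>\<^sup>+x. h x \<partial>M') \<le> (\<integral>\<^sup>+x. h x \<partial>M)"
    unfolding M'_def using WM Wsp by (subst nn_integral_restrict_space) (auto intro!: nn_integral_mono split: split_indicator)
  then have fin: "finite_measure \<nu>"
    using h(2) hm unfolding \<nu>_def
    by (intro finite_measureI) (auto simp: emeasure_density top_unique cong: nn_integral_cong)
  define m where "m = distr \<nu> borel G"
  have Gm': "G \<in> borel_measurable \<nu>" using Gm by (simp add: \<nu>_def)
  have finm: "finite_measure m" unfolding m_def using Gm' by (intro finite_measure.finite_measure_distr[OF fin])
  obtain K where K: "\<And>n::nat. compact (K n)" "\<And>n. K n \<subseteq> \<Gamma>" "emeasure m (\<Gamma> - (\<Union>n. K n)) = 0"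
    using compact_exhaustion[OF finm _ \<Gamma>] by (auto simp: m_def)
  have Kb: "K n \<in> sets borel" for n using K(1) by (simp add: borel_compact)
  \<comment> \<open>First projections of compact sets are compact, so \<open>R\<close> is Borel
    although the image of \<open>\<tau>\<close> itself need not be known to be.\<close>
  define R where "R = (\<Union>n. fst ` K n)"
  have cl: "compact (fst ` L)" if "compact L" for L :: "((nat \<Rightarrow> real) \<times> (nat \<Rightarrow> real)) set"
    using that by (intro compact_continuous_image continuous_on_fst continuous_on_id)
  have Rb: "R \<in> sets borel" unfolding R_def using cl[OF K(1)] by (auto intro: borel_compact)
  have AE: "AE \<omega> in M. \<tau> \<omega> \<in> R"
  proof -
    have "AE p in m. p \<notin> \<Gamma> - (\<Union>n. K n)"
      using K(3) \<Gamma> Kb by (intro AE_not_in) (auto simp: m_def null_sets_def)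
    then have "AE \<omega> in \<nu>. G \<omega> \<notin> \<Gamma> - (\<Union>n. K n)"
      unfolding m_def using AE_distrD[OF Gm'] by blast
    then have "AE \<omega> in M'. 0 < h \<omega> \<longrightarrow> G \<omega> \<notin> \<Gamma> - (\<Union>n. K n)"
      unfolding \<nu>_def by (simp add: AE_density[OF hm])
    then have "AE \<omega> in M'. \<tau> \<omega> \<in> R"
    proof (rule AE_mp, intro AE_I2 impI)
      fix \<omega> assume w: "\<omega> \<in> space M'" "0 < h \<omega> \<longrightarrow> G \<omega> \<notin> \<Gamma> - (\<Union>n. K n)"
      then have "0 < h \<omega>" "G \<omega> \<in> \<Gamma>" using h(3) spW Wsp by (auto simp: \<Gamma>_def)
      then obtain n where "G \<omega> \<in> K n" using w by blast
      then have "fst (G \<omega>) \<in> R" unfolding R_def by blast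
      then show "\<tau> \<omega> \<in> R" by (simp add: G_def)
    qed
    then have "AE \<omega> in M. \<omega> \<in> W \<longrightarrow> \<tau> \<omega> \<in> R"
      unfolding M'_def using WM Wsp by (simp add: AE_restrict_space_iff)
    moreover have "AE \<omega> in M. \<omega> \<in> W"
      using AE_not_in[OF N(1)] AE_space by eventually_elim (simp add: Wsp)
    ultimately show ?thesis by eventually_elim simp
  qed
  define \<sigma> where "\<sigma> = inv_into W \<tau>"
  have injW: "inj_on \<tau> W" using inj Wsp by (auto intro: inj_on_subset)
  have \<sigma>\<tau>: "\<sigma> (\<tau> x) = x" if "x \<in> W" for x unfolding \<sigma>_def using injW that by simp
  have RW: "\<exists>x\<in>W. y = \<tau> x" if "y \<in> R" for y
    using that K(2) by (fastforce simp: R_def \<Gamma>_def G_def)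
  \<comment> \<open>Induction over the generated sigma-algebra. Intersecting with one compact
    projection at a time makes the generators manageable; complements use injectivity of
    \<open>\<tau>\<close>.\<close>
  have img: "\<tau> ` B \<inter> fst ` K n \<in> sets borel" if "B \<in> sigma_sets W {U. openin X U}" for B n
    using that
  proof induction
    case (Basic U)
    then obtain V where V: "open V" "U = {x \<in> W. \<iota> x \<in> V}" using \<iota>(4) by blast
    \<comment> \<open>For open \<open>U\<close>, the rest of the projection of \<open>K n\<close> is
      the projection of those points of \<open>K n\<close> whose second coordinate avoids
      \<open>V\<close>, which is again compact. Injectivity of \<open>\<tau>\<close> keeps the two
      parts apart.\<close>
    have KW: "\<exists>x\<in>W. p = (\<tau> x, \<iota> x)" if "p \<in> K n" for p using K(2)[of n] that by (auto simp: \<Gamma>_def G_def)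
    have "\<tau> ` U \<inter> fst ` K n = fst ` K n - fst ` (K n \<inter> (UNIV \<times> - V))"
    proof (intro equalityI subsetI)
      fix y assume y: "y \<in> \<tau> ` U \<inter> fst ` K n"
      then obtain x where x: "x \<in> U" "y = \<tau> x" by auto
      have "y \<notin> fst ` (K n \<inter> (UNIV \<times> - V))"
      proof
        assume "y \<in> fst ` (K n \<inter> (UNIV \<times> - V))"
        then obtain z where z: "(y, z) \<in> K n" "z \<notin> V" by auto
        then obtain x' where x': "x' \<in> W" "y = \<tau> x'" "z = \<iota> x'" using KW by blast
        then have "x' = x" using x V injW by (auto dest: inj_onD)
        then show False using x' z x V by auto
      qed
      then show "y \<in> fst ` K n - fst ` (K n \<inter> (UNIV \<times> - V))" using y by auto
    next
      fix y assume y: "y \<in> fst ` K n - fst ` (K n \<inter> (UNIV \<times> - V))"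
      then obtain z where z: "(y, z) \<in> K n" by auto
      then obtain x' where x': "x' \<in> W" "y = \<tau> x'" "z = \<iota> x'" using KW by blast
      have "z \<in> V" using y z by (force simp: image_iff)
      then have "x' \<in> U" using x' V by simp
      then show "y \<in> \<tau> ` U \<inter> fst ` K n" using x' y by auto
    qed
    moreover have "compact (fst ` (K n \<inter> (UNIV \<times> - V)))"
    proof -
      have "closed ((UNIV :: (nat \<Rightarrow> real) set) \<times> - V)" using V(1) by (intro closed_Times) auto
      then show ?thesis using K(1) by (intro cl compact_Int_closed) auto
    qed
    ultimately show ?case using cl[OF K(1)] by (simp add: sets.Diff borel_compact)
  next
    case (Compl B)
    have "B \<subseteq> W" using Compl(1) by (intro sigma_sets_into_sp[of "{U. openin X U}"]) (auto simp: W_def dest: openin_subset)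
    then have "\<tau> ` (W - B) \<inter> fst ` K n = fst ` K n - (\<tau> ` B \<inter> fst ` K n)"
    proof -
      have "fst ` K n \<subseteq> \<tau> ` W" using K(2)[of n] by (auto simp: \<Gamma>_def G_def)
      moreover have "\<tau> ` (W - B) = \<tau> ` W - \<tau> ` B" using injW \<open>B \<subseteq> W\<close> by (intro inj_on_image_set_diff) auto
      ultimately show ?thesis by blast
    qed
    then show ?case using Compl cl[OF K(1)] by (simp add: sets.Diff borel_compact)
  next
    case (Union B)
    have "\<tau> ` (\<Union>i. B i) \<inter> fst ` K n = (\<Union>i. \<tau> ` B i \<inter> fst ` K n)" by auto
    moreover have "(\<Union>i. \<tau> ` B i \<inter> fst ` K n) \<in> sets borel" using Union(2) by (intro sets.countable_UN) auto
    ultimately show ?case by (simp only:)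
  qed auto
  show thesis
  proof (rule that[OF Rb AE, of \<sigma>])
    fix y assume "y \<in> R"
    then show "\<sigma> y \<in> space M \<and> \<tau> (\<sigma> y) = y" using RW \<sigma>\<tau> Wsp by force
  next
    fix B assume B: "B \<in> sets M"
    then have "B \<inter> W \<in> sets M'" using WM Wsp by (auto simp: M'_def sets_restrict_space_iff)
    then have "\<tau> ` (B \<inter> W) \<inter> fst ` K n \<in> sets borel" for n using img by (simp add: sX W_def)
    moreover have "{y \<in> R. \<sigma> y \<in> B} = (\<Union>n. \<tau> ` (B \<inter> W) \<inter> fst ` K n)"
    proof (intro equalityI subsetI)
      fix y assume y: "y \<in> {y \<in> R. \<sigma> y \<in> B}"
      then obtain x where x: "x \<in> W" "y = \<tau> x" using RW by blast
      then show "y \<in> (\<Union>n. \<tau> ` (B \<inter> W) \<inter> fst ` K n)" using y \<sigma>\<tau> by (auto simp: R_def)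
    next
      fix y assume "y \<in> (\<Union>n. \<tau> ` (B \<inter> W) \<inter> fst ` K n)"
      then obtain n x where nx: "x \<in> B" "x \<in> W" "y = \<tau> x" "y \<in> fst ` K n" by blast
      then show "y \<in> {y \<in> R. \<sigma> y \<in> B}" proof -
        have "y \<in> R" using nx(4) by (auto simp: R_def)
        then show ?thesis using nx(1-3) \<sigma>\<tau>[of x] by simp
      qed
    qed
    moreover have "(\<Union>n. \<tau> ` (B \<inter> W) \<inter> fst ` K n) \<in> sets borel" using calculation(1) by (intro sets.countable_UN) auto
    ultimately show "{y \<in> R. \<sigma> y \<in> B} \<in> sets borel" by (simp only:)
  qed
qed

section \<open>Square-integrable sections\<close>

definition vnorm2 :: "complex vec \<Rightarrow> real" where
  "vnorm2 v = (\<Sum>q<dim_vec v. (cmod (v $ q))\<^sup>2)"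

lemma vnorm2_nonneg [simp]: "0 \<le> vnorm2 v"
  by (auto simp: vnorm2_def intro!: sum_nonneg)

lemma vnorm2_zero [simp]: "vnorm2 (0\<^sub>v n) = 0"
  by (simp add: vnorm2_def)

lemma cscalar_vnorm2: "v \<bullet>c v = of_real (vnorm2 v)"
  using cscalar_self[of v "dim_vec v"] by (simp add: vnorm2_def)

lemma vnorm2_eq_0: "v \<in> carrier_vec n \<Longrightarrow> vnorm2 v = 0 \<Longrightarrow> v = 0\<^sub>v n"
  using cscalar_self_eq_0[of v n] by (simp add: cscalar_vnorm2)

text \<open>Cauchy-Schwarz with the arithmetic mean in place of the product of norms. It avoids
  square roots and passes unchanged to series, integrals and the form \<open>S\<close>.\<close>

lemma cscalar_le_vnorm2:
  assumes "v \<in> carrier_vec n" "w \<in> carrier_vec n"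
  shows "cmod (v \<bullet>c w) \<le> (vnorm2 v + vnorm2 w) / 2"
proof -
  have 1: "cmod (a * cnj b) \<le> ((cmod a)\<^sup>2 + (cmod b)\<^sup>2) / 2" for a b
    using sum_squares_bound[of "cmod a" "cmod b"] by (simp add: norm_mult)
  have "cmod (v \<bullet>c w) \<le> (\<Sum>q<n. ((cmod (v $ q))\<^sup>2 + (cmod (w $ q))\<^sup>2) / 2)"
    unfolding cscalar_index[OF assms(2)] by (intro sum_norm_le 1)
  also have "\<dots> = (vnorm2 v + vnorm2 w) / 2"
    using assms by (simp add: vnorm2_def sum.distrib sum_divide_distrib[symmetric] del: sum_divide_distrib)
  finally show ?thesis .
qed

lemma vnorm2_add_le:
  assumes "v \<in> carrier_vec n" "w \<in> carrier_vec n"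
  shows "vnorm2 (v + w) \<le> 2 * (vnorm2 v + vnorm2 w)"
proof -
  have 1: "(cmod (x + y))\<^sup>2 \<le> 2 * ((cmod x)\<^sup>2 + (cmod y)\<^sup>2)" for x y :: complex
  proof -
    have "(cmod (x + y))\<^sup>2 \<le> (cmod x + cmod y)\<^sup>2" by (intro power_mono norm_triangle_ineq) auto
    also have "\<dots> \<le> 2 * ((cmod x)\<^sup>2 + (cmod y)\<^sup>2)"
      using sum_squares_bound[of "cmod x" "cmod y"] by (simp add: power2_sum)
    finally show ?thesis .
  qed
  have "vnorm2 (v + w) \<le> (\<Sum>q<n. 2 * ((cmod (v $ q))\<^sup>2 + (cmod (w $ q))\<^sup>2))"
  proof -
    have "vnorm2 (v + w) = (\<Sum>q<n. (cmod (v $ q + w $ q))\<^sup>2)" using assms by (simp add: vnorm2_def)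
    then show ?thesis using 1 by (simp only:) (rule sum_mono)
  qed
  also have "\<dots> = 2 * (vnorm2 v + vnorm2 w)"
    using assms by (simp add: vnorm2_def sum.distrib sum_distrib_left[symmetric])
  finally show ?thesis .
qed

text \<open>The carrier of \<open>copies_space m (cspace n)\<close> in concrete form. With
  \<open>fip\<close> and \<open>fnorm2\<close> it replaces the record fields in all
  calculations.\<close>

definition fibre :: "nat \<Rightarrow> enat \<Rightarrow> (nat \<Rightarrow> complex vec) set" where
  "fibre n m = {v. (\<forall>j. v j \<in> carrier_vec n) \<and> (\<forall>j. m \<le> enat j \<longrightarrow> v j = 0\<^sub>v n) \<and> summable (\<lambda>j. vnorm2 (v j))}"

definition fip :: "(nat \<Rightarrow> complex vec) \<Rightarrow> (nat \<Rightarrow> complex vec) \<Rightarrow> complex" where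
  "fip v w = (\<Sum>j. v j \<bullet>c w j)"

definition fnorm2 :: "(nat \<Rightarrow> complex vec) \<Rightarrow> real" where
  "fnorm2 v = (\<Sum>j. vnorm2 (v j))"

lemma hcarrier_copies [simp]: "hcarrier (copies_space m (cspace n)) = fibre n m"
  by (simp add: copies_space_def cspace_def fibre_def hnorm2_def cscalar_vnorm2)

lemma hinner_copies [simp]: "hinner (copies_space m (cspace n)) v w = fip v w"
  by (simp add: copies_space_def cspace_def fip_def)

lemma fibreD:
  assumes "v \<in> fibre n m"
  shows "v j \<in> carrier_vec n" "m \<le> enat j \<Longrightarrow> v j = 0\<^sub>v n" "summable (\<lambda>j. vnorm2 (v j))"
  using assms by (auto simp: fibre_def)

lemma fip_summable:
  assumes v: "v \<in> fibre n m" and w: "w \<in> fibre n m'"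
  shows "summable (\<lambda>j. cmod (v j \<bullet>c w j))" "summable (\<lambda>j. v j \<bullet>c w j)"
proof -
  have "summable (\<lambda>j. (vnorm2 (v j) + vnorm2 (w j)) / 2)"
    by (intro summable_divide summable_add fibreD(3)[OF v] fibreD(3)[OF w])
  then show "summable (\<lambda>j. cmod (v j \<bullet>c w j))"
    by (rule summable_comparison_test') (use cscalar_le_vnorm2[OF fibreD(1)[OF v] fibreD(1)[OF w]] in auto)
  then show "summable (\<lambda>j. v j \<bullet>c w j)" by (rule summable_norm_cancel)
qed

lemma fip_le:
  assumes v: "v \<in> fibre n m" and w: "w \<in> fibre n m'"
  shows "cmod (fip v w) \<le> (fnorm2 v + fnorm2 w) / 2"
proof -
  have s: "summable (\<lambda>j. (vnorm2 (v j) + vnorm2 (w j)) / 2)"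
    by (intro summable_divide summable_add fibreD(3)[OF v] fibreD(3)[OF w])
  have "cmod (fip v w) \<le> (\<Sum>j. cmod (v j \<bullet>c w j))"
    unfolding fip_def by (rule summable_norm[OF fip_summable(1)[OF v w]])
  also have "\<dots> \<le> (\<Sum>j. (vnorm2 (v j) + vnorm2 (w j)) / 2)"
    by (rule suminf_le[OF _ fip_summable(1)[OF v w] s]) (rule cscalar_le_vnorm2[OF fibreD(1)[OF v] fibreD(1)[OF w]])
  also have "\<dots> = (fnorm2 v + fnorm2 w) / 2"
    unfolding fnorm2_def
    by (simp only: suminf_divide[OF summable_add[OF fibreD(3)[OF v] fibreD(3)[OF w]]]
        suminf_add[OF fibreD(3)[OF v] fibreD(3)[OF w]])
  finally show ?thesis .
qed

lemma fip_self: "v \<in> fibre n m \<Longrightarrow> fip v v = of_real (fnorm2 v)"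
  unfolding fip_def fnorm2_def cscalar_vnorm2 by (rule suminf_of_real[symmetric, OF fibreD(3)])

lemma fnorm2_nonneg: "v \<in> fibre n m \<Longrightarrow> 0 \<le> fnorm2 v"
  unfolding fnorm2_def by (intro suminf_nonneg fibreD(3)) auto

lemma fnorm2_eq_0: "v \<in> fibre n m \<Longrightarrow> fnorm2 v = 0 \<Longrightarrow> v = (\<lambda>_. 0\<^sub>v n)"
  unfolding fnorm2_def
  using suminf_eq_zero_iff[of "\<lambda>j. vnorm2 (v j)"] fibreD[of v n m] vnorm2_eq_0 by fastforce

lemma hnorm2_copies: "v \<in> fibre n m \<Longrightarrow> hnorm2 (copies_space m (cspace n)) v = fnorm2 v"
  by (simp add: hnorm2_def fip_self)

lemma fibre_add:
  assumes v: "v \<in> fibre n m" and w: "w \<in> fibre n m"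
  shows "(\<lambda>j. v j + w j) \<in> fibre n m" "fnorm2 (\<lambda>j. v j + w j) \<le> 2 * (fnorm2 v + fnorm2 w)"
    "u \<in> fibre n m' \<Longrightarrow> fip (\<lambda>j. v j + w j) u = fip v u + fip w u"
    "u \<in> fibre n m' \<Longrightarrow> fip u (\<lambda>j. v j + w j) = fip u v + fip u w"
proof -
  have s: "summable (\<lambda>j. 2 * (vnorm2 (v j) + vnorm2 (w j)))"
    by (intro summable_mult summable_add fibreD(3)[OF v] fibreD(3)[OF w])
  have le: "vnorm2 (v j + w j) \<le> 2 * (vnorm2 (v j) + vnorm2 (w j))" for j
    by (rule vnorm2_add_le[OF fibreD(1)[OF v] fibreD(1)[OF w]])
  have s': "summable (\<lambda>j. vnorm2 (v j + w j))"
    by (rule summable_comparison_test'[OF s]) (use le in auto)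
  show "(\<lambda>j. v j + w j) \<in> fibre n m"
    using s' fibreD[OF v] fibreD[OF w] by (auto simp: fibre_def)
  have "fnorm2 (\<lambda>j. v j + w j) \<le> (\<Sum>j. 2 * (vnorm2 (v j) + vnorm2 (w j)))"
    unfolding fnorm2_def by (rule suminf_le[OF le s' s])
  also have "\<dots> = 2 * (fnorm2 v + fnorm2 w)"
    unfolding fnorm2_def
    by (simp add: suminf_mult suminf_add[symmetric] summable_add fibreD(3)[OF v] fibreD(3)[OF w])
  finally show "fnorm2 (\<lambda>j. v j + w j) \<le> 2 * (fnorm2 v + fnorm2 w)" .
  show "fip (\<lambda>j. v j + w j) u = fip v u + fip w u" if u: "u \<in> fibre n m'"
  proof -
    have "(v j + w j) \<bullet>c u j = v j \<bullet>c u j + w j \<bullet>c u j" for j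
      by (rule add_scalar_prod_distrib[of _ n]) (use fibreD(1)[OF v] fibreD(1)[OF w] fibreD(1)[OF u] in auto)
    then show ?thesis
      unfolding fip_def by (simp add: suminf_add[symmetric] fip_summable(2)[OF v u] fip_summable(2)[OF w u])
  qed
  show "fip u (\<lambda>j. v j + w j) = fip u v + fip u w" if u: "u \<in> fibre n m'"
  proof -
    have "u j \<bullet>c (v j + w j) = u j \<bullet>c v j + u j \<bullet>c w j" for j
      using fibreD(1)[OF v, of j] fibreD(1)[OF w, of j] fibreD(1)[OF u, of j]
      by (simp add: conjugate_add_vec[of _ n] scalar_prod_add_distrib[of _ n])
    then show ?thesis
      unfolding fip_def by (simp add: suminf_add[symmetric] fip_summable(2)[OF u v] fip_summable(2)[OF u w])
  qed
qed

lemma fibre_mat: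
  assumes v: "v \<in> fibre n m" and A: "A \<in> carrier_mat n n"
    and C: "\<And>u. u \<in> carrier_vec n \<Longrightarrow> vnorm2 (A *\<^sub>v u) \<le> C * vnorm2 u"
  shows "(\<lambda>j. A *\<^sub>v v j) \<in> fibre n m" "fnorm2 (\<lambda>j. A *\<^sub>v v j) \<le> C * fnorm2 v"
proof -
  have s: "summable (\<lambda>j. C * vnorm2 (v j))" by (intro summable_mult fibreD(3)[OF v])
  have le: "vnorm2 (A *\<^sub>v v j) \<le> C * vnorm2 (v j)" for j by (rule C[OF fibreD(1)[OF v]])
  have s': "summable (\<lambda>j. vnorm2 (A *\<^sub>v v j))"
    by (rule summable_comparison_test'[OF s]) (use le in auto)
  have z: "A *\<^sub>v 0\<^sub>v n = 0\<^sub>v n" using A by (intro eq_vecI) auto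
  show "(\<lambda>j. A *\<^sub>v v j) \<in> fibre n m"
    using s' fibreD[OF v] A z by (auto simp: fibre_def intro!: mult_mat_vec_carrier)
  show "fnorm2 (\<lambda>j. A *\<^sub>v v j) \<le> C * fnorm2 v"
    unfolding fnorm2_def suminf_mult[OF fibreD(3)[OF v], symmetric] by (rule suminf_le[OF le s' s])
qed

lemma vnorm2_mat_frob:
  assumes A: "A \<in> carrier_mat n n" and u: "u \<in> carrier_vec n"
  shows "vnorm2 (A *\<^sub>v u) \<le> frob A * vnorm2 u"
  using mat_vec_frob_le[OF A u] A u by (simp add: vnorm2_def)

lemma fip_adjoint:
  assumes "\<And>j. v j \<in> carrier_vec n" "\<And>j. w j \<in> carrier_vec n" and A: "A \<in> carrier_mat n n"
  shows "fip (\<lambda>j. A *\<^sub>v v j) w = fip v (\<lambda>j. mat_adjoint A *\<^sub>v w j)"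
  unfolding fip_def using cscalar_adjoint[OF A assms(1,2)] by simp

lemma fip_smult:
  assumes "v \<in> fibre n m" "w \<in> fibre n m'"
  shows "fip (\<lambda>j. c \<cdot>\<^sub>v v j) w = c * fip v w"
proof -
  have "(c \<cdot>\<^sub>v v j) \<bullet>c w j = c * (v j \<bullet>c w j)" for j
    using fibreD(1)[OF assms(1), of j] fibreD(1)[OF assms(2), of j] by simp
  then show ?thesis unfolding fip_def using suminf_mult[OF fip_summable(2)[OF assms], of c] by simp
qed

text \<open>The graph only constrains the positions below \<open>m\<close>. Beyond them both
  sequences are zero and \<open>A\<close> maps zero to zero, so one equation holds at every
  position.\<close>

lemma copies_op_iff:
  assumes A: "A \<in> carrier_mat n n" and v: "v \<in> fibre n m" and w: "w \<in> fibre n m"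
  shows "(v, w) \<in> copies_op m (cspace n) (mat_op A) \<longleftrightarrow> w = (\<lambda>j. A *\<^sub>v v j)"
proof -
  have z: "A *\<^sub>v 0\<^sub>v n = 0\<^sub>v n" using A by (intro eq_vecI) auto
  have "w j = A *\<^sub>v v j" if "\<And>j. enat j < m \<Longrightarrow> w j = A *\<^sub>v v j" for j
  proof (cases "enat j < m")
    case False
    then show ?thesis using fibreD(2)[OF v, of j] fibreD(2)[OF w, of j] z by simp
  qed (use that in auto)
  then show ?thesis
    using v w fibreD(1)[OF v] A by (auto simp: copies_op_def mat_op_def)
qed

text \<open>Matrix entries are given as measurable on each set of constant degree only; countably
  many such sets cover the space.\<close>

lemma measurable_level_sets:
  assumes g: "g \<in> measurable M (count_space UNIV)"
    and h: "\<And>n::nat. h \<in> measurable (restrict_space M {\<omega> \<in> space M. g \<omega> = n}) N"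
  shows "h \<in> measurable M N"
proof (rule measurable_piecewise_restrict[of "range (\<lambda>n. {\<omega> \<in> space M. g \<omega> = n})"])
  show "space M \<subseteq> \<Union> (range (\<lambda>n. {\<omega> \<in> space M. g \<omega> = n}))" by auto
  fix \<Omega> assume "\<Omega> \<in> range (\<lambda>n. {\<omega> \<in> space M. g \<omega> = n})"
  then obtain n where n: "\<Omega> = {\<omega> \<in> space M. g \<omega> = n}" by auto
  have "g -` {n} \<inter> space M \<in> sets M" using g by (rule measurable_sets) simp
  also have "g -` {n} \<inter> space M = \<Omega>" unfolding n by auto
  finally show "\<Omega> \<inter> space M \<in> sets M" unfolding n by (simp add: Int_absorb2)
  show "h \<in> measurable (restrict_space M \<Omega>) N" unfolding n by (rule h)
qed auto

text \<open>The number of summands is the degree and varies with the point, but it takes countably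
  many values.\<close>

lemma measurable_sum_upto:
  fixes h :: "nat \<Rightarrow> 'w \<Rightarrow> 'b::{second_countable_topology, real_normed_vector}"
  assumes g: "g \<in> measurable M (count_space UNIV)" and h: "\<And>l. h l \<in> borel_measurable M"
  shows "(\<lambda>\<omega>. \<Sum>l<g \<omega>. h l \<omega>) \<in> borel_measurable M"
  by (rule measurable_compose_countable[OF _ g]) (use h in measurable)

lemma vnorm2_smult: "vnorm2 (c \<cdot>\<^sub>v u) = (cmod c)\<^sup>2 * vnorm2 u"
  by (simp add: vnorm2_def norm_mult power_mult_distrib sum_distrib_left)

lemma scalar_mat_vec: "u \<in> carrier_vec n \<Longrightarrow> (c \<cdot>\<^sub>m 1\<^sub>m n) *\<^sub>v u = c \<cdot>\<^sub>v (u :: complex vec)"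
  by (intro eq_vecI) (auto simp: smult_scalar_prod_distrib[of _ n])

lemma zero_mat_vec: "u \<in> carrier_vec n \<Longrightarrow> 0\<^sub>m n n *\<^sub>v u = 0\<^sub>v n"
  by (intro eq_vecI) auto

lemma fip_zero [simp]:
  "(\<And>j. v j \<in> carrier_vec n) \<Longrightarrow> fip v (\<lambda>_. 0\<^sub>v n) = 0"
  "(\<And>j. v j \<in> carrier_vec n) \<Longrightarrow> fip (\<lambda>_. 0\<^sub>v n) v = 0"
  by (simp_all add: fip_def)

lemma fip_cnj:
  assumes v: "v \<in> fibre n m" and w: "w \<in> fibre n m'"
  shows "fip w v = cnj (fip v w)"
proof -
  have "w j \<bullet>c v j = cnj (v j \<bullet>c w j)" for j
    using fibreD(1)[OF v, of j] fibreD(1)[OF w, of j] by (simp add: cscalar_index[of _ n] mult.commute)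
  then show ?thesis unfolding fip_def
    using sums_cnj[THEN iffD2, OF summable_sums[OF fip_summable(2)[OF v w]]] by (simp add: sums_iff)
qed

section \<open>Sections and matrix fields over one measure space\<close>

locale mult_field =
  fixes k :: nat and M :: "'w measure" and f :: "'w \<Rightarrow> enat" and X :: "nat \<Rightarrow> 'w \<Rightarrow> complex mat"
  assumes k: "k \<ge> 1" and X: "measurable_mat_tuple_field k M X"
    and f [measurable]: "f \<in> measurable M (count_space UNIV)"
begin

definition deg :: "'w \<Rightarrow> nat" where "deg \<omega> = tuple_degree (\<lambda>s. X s \<omega>)"

abbreviation "L2 \<equiv> L2_sections M (mult_fibre f X) (mult_frame f X)"
abbreviation "cls \<equiv> section_class M (mult_fibre f X) (mult_frame f X)"
abbreviation "HS \<equiv> mult_integral_space M f X"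

lemma tuple: "\<omega> \<in> space M \<Longrightarrow> mat_tuple k (\<lambda>s. X s \<omega>)"
  using X by (simp add: measurable_mat_tuple_field_def)

lemma X_carrier: "\<omega> \<in> space M \<Longrightarrow> s \<in> {1..k} \<Longrightarrow> X s \<omega> \<in> carrier_mat (deg \<omega>) (deg \<omega>)"
  using mat_tuple_carrier(1)[OF tuple k] by (simp add: deg_def)

lemma deg_ge_1: "\<omega> \<in> space M \<Longrightarrow> 1 \<le> deg \<omega>"
  using mat_tuple_carrier(2)[OF tuple k] by (simp add: deg_def)

lemma deg_measurable [measurable]: "deg \<in> measurable M (count_space UNIV)"
  using X k by (auto simp: measurable_mat_tuple_field_def measurable_mat_field_def deg_def[abs_def] tuple_degree_def)

lemma mult_fibre_eq: "mult_fibre f X \<omega> = copies_space (f \<omega>) (cspace (deg \<omega>))"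
  by (simp add: mult_fibre_def deg_def)

text \<open>The inner product with a vector of \<open>mult_frame\<close>: the coordinate where the
  fibre has it, extended by 0, so that measurability can be stated on the whole space.\<close>

definition crd :: "('w \<Rightarrow> nat \<Rightarrow> complex vec) \<Rightarrow> nat \<Rightarrow> nat \<Rightarrow> 'w \<Rightarrow> complex" where
  "crd \<xi> j i \<omega> = (if enat j < f \<omega> \<and> i < deg \<omega> then \<xi> \<omega> j $ i else 0)"

lemma frame_inner:
  assumes v: "v \<in> fibre (deg \<omega>) (f \<omega>)"
  shows "fip v (mult_frame f X (j, i) \<omega>) = (if enat j < f \<omega> \<and> i < deg \<omega> then v j $ i else 0)"
proof -
  have "fip v (mult_frame f X (j, i) \<omega>) = (\<Sum>l. if l = j then (if enat j < f \<omega> \<and> i < deg \<omega> then v j $ i else 0) else 0)"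
    unfolding fip_def
  proof (intro suminf_cong)
    fix l
    show "v l \<bullet>c mult_frame f X (j, i) \<omega> l = (if l = j then (if enat j < f \<omega> \<and> i < deg \<omega> then v j $ i else 0) else 0)"
      using fibreD(1)[OF v, of l] cscalar_unit[of "v l" "deg \<omega>" i]
      by (auto simp: mult_frame_def Let_def deg_def[symmetric])
  qed
  also have "\<dots> = (if enat j < f \<omega> \<and> i < deg \<omega> then v j $ i else 0)"
    by (subst suminf_finite[of "{j}"]) auto
  finally show ?thesis .
qed

lemma L2_iff: "\<xi> \<in> L2 \<longleftrightarrow> (\<forall>\<omega>\<in>space M. \<xi> \<omega> \<in> fibre (deg \<omega>) (f \<omega>)) \<and>
    (\<forall>j i. crd \<xi> j i \<in> borel_measurable M) \<and> (\<integral>\<^sup>+\<omega>. ennreal (fnorm2 (\<xi> \<omega>)) \<partial>M) < \<infinity>"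
proof (cases "\<forall>\<omega>\<in>space M. \<xi> \<omega> \<in> fibre (deg \<omega>) (f \<omega>)")
  case True
  have "(\<lambda>\<omega>. hinner (mult_fibre f X \<omega>) (\<xi> \<omega>) (mult_frame f X (j, i) \<omega>)) \<in> borel_measurable M
      \<longleftrightarrow> crd \<xi> j i \<in> borel_measurable M" for j i
    by (intro measurable_cong) (use True in \<open>simp add: mult_fibre_eq frame_inner crd_def\<close>)
  moreover have "(\<integral>\<^sup>+\<omega>. ennreal (hnorm2 (mult_fibre f X \<omega>) (\<xi> \<omega>)) \<partial>M) = (\<integral>\<^sup>+\<omega>. ennreal (fnorm2 (\<xi> \<omega>)) \<partial>M)"
    by (intro nn_integral_cong) (use True in \<open>simp add: mult_fibre_eq hnorm2_copies\<close>)
  ultimately show ?thesis using True unfolding L2_sections_def by (simp add: mult_fibre_eq split_paired_all)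
next
  case False
  then show ?thesis unfolding L2_sections_def mult_fibre_eq hcarrier_copies by blast
qed

lemma L2_fibre: "\<xi> \<in> L2 \<Longrightarrow> \<omega> \<in> space M \<Longrightarrow> \<xi> \<omega> \<in> fibre (deg \<omega>) (f \<omega>)"
  by (simp add: L2_iff)

lemma crd_measurable: "\<xi> \<in> L2 \<Longrightarrow> crd \<xi> j i \<in> borel_measurable M"
  by (simp add: L2_iff)

lemma crd_eq:
  assumes "\<xi> \<omega> \<in> fibre (deg \<omega>) (f \<omega>)" "i < deg \<omega>"
  shows "\<xi> \<omega> j $ i = crd \<xi> j i \<omega>"
  using assms fibreD(2)[OF assms(1), of j] by (auto simp: crd_def not_less)

text \<open>The inner product is a pointwise limit of finite sums of coordinate functions, the inner
  sums having variable length.\<close>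

lemma fip_measurable:
  assumes \<xi>: "\<And>\<omega>. \<omega> \<in> space M \<Longrightarrow> \<xi> \<omega> \<in> fibre (deg \<omega>) (f \<omega>)" "\<And>j i. crd \<xi> j i \<in> borel_measurable M"
    and \<eta>: "\<And>\<omega>. \<omega> \<in> space M \<Longrightarrow> \<eta> \<omega> \<in> fibre (deg \<omega>) (f \<omega>)" "\<And>j i. crd \<eta> j i \<in> borel_measurable M"
  shows "(\<lambda>\<omega>. fip (\<xi> \<omega>) (\<eta> \<omega>)) \<in> borel_measurable M"
proof (rule borel_measurable_LIMSEQ_metric)
  fix l
  have "(\<lambda>\<omega>. \<Sum>i<deg \<omega>. crd \<xi> j i \<omega> * cnj (crd \<eta> j i \<omega>)) \<in> borel_measurable M" for j
    using \<xi>(2) \<eta>(2)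
    by (intro measurable_sum_upto[OF deg_measurable] borel_measurable_times
        borel_measurable_continuous_on[OF continuous_on_cnj[OF continuous_on_id]])
  then show "(\<lambda>\<omega>. \<Sum>j<l. \<Sum>i<deg \<omega>. crd \<xi> j i \<omega> * cnj (crd \<eta> j i \<omega>)) \<in> borel_measurable M" by measurable
next
  fix \<omega> assume w: "\<omega> \<in> space M"
  have "\<xi> \<omega> j \<bullet>c \<eta> \<omega> j = (\<Sum>i<deg \<omega>. crd \<xi> j i \<omega> * cnj (crd \<eta> j i \<omega>))" for j
    unfolding cscalar_index[OF fibreD(1)[OF \<eta>(1)[OF w]]]
    by (intro sum.cong refl) (simp add: crd_eq[of \<xi>, OF \<xi>(1)[OF w]] crd_eq[of \<eta>, OF \<eta>(1)[OF w]])
  then show "(\<lambda>l. \<Sum>j<l. \<Sum>i<deg \<omega>. crd \<xi> j i \<omega> * cnj (crd \<eta> j i \<omega>)) \<longlonglongrightarrow> fip (\<xi> \<omega>) (\<eta> \<omega>)"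
    using summable_LIMSEQ[OF fip_summable(2)[OF \<xi>(1)[OF w] \<eta>(1)[OF w]]] by (simp add: fip_def)
qed

lemma fnorm2_measurable:
  assumes \<xi>: "\<And>\<omega>. \<omega> \<in> space M \<Longrightarrow> \<xi> \<omega> \<in> fibre (deg \<omega>) (f \<omega>)" "\<And>j i. crd \<xi> j i \<in> borel_measurable M"
  shows "(\<lambda>\<omega>. fnorm2 (\<xi> \<omega>)) \<in> borel_measurable M"
proof -
  have "(\<lambda>\<omega>. Re (fip (\<xi> \<omega>) (\<xi> \<omega>))) \<in> borel_measurable M"
    using fip_measurable[OF \<xi> \<xi>] by measurable
  then show ?thesis by (rule measurable_cong[THEN iffD1, rotated]) (simp add: fip_self[OF \<xi>(1)])
qed

lemma fnorm2_integrable: "\<xi> \<in> L2 \<Longrightarrow> integrable M (\<lambda>\<omega>. fnorm2 (\<xi> \<omega>))"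
  unfolding L2_iff
  by (intro integrableI_nonneg fnorm2_measurable) (auto intro!: AE_I2 fnorm2_nonneg)

lemma L2I:
  assumes "\<And>\<omega>. \<omega> \<in> space M \<Longrightarrow> \<xi> \<omega> \<in> fibre (deg \<omega>) (f \<omega>)" "\<And>j i. crd \<xi> j i \<in> borel_measurable M"
    and g: "integrable M g" and le: "AE \<omega> in M. fnorm2 (\<xi> \<omega>) \<le> g \<omega>"
  shows "\<xi> \<in> L2"
proof -
  have "integrable M (\<lambda>\<omega>. fnorm2 (\<xi> \<omega>))"
  proof (rule Bochner_Integration.integrable_bound[OF g fnorm2_measurable[OF assms(1,2)]])
    show "AE \<omega> in M. norm (fnorm2 (\<xi> \<omega>)) \<le> norm (g \<omega>)"
      using le AE_space by eventually_elim (use fnorm2_nonneg[OF assms(1)] in fastforce)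
  qed auto
  then have "(\<integral>\<^sup>+\<omega>. ennreal (fnorm2 (\<xi> \<omega>)) \<partial>M) < \<infinity>"
    by (subst nn_integral_eq_integral) (auto intro!: AE_I2 fnorm2_nonneg assms(1))
  then show ?thesis using assms(1,2) by (auto simp: L2_iff)
qed

definition ip :: "('w \<Rightarrow> nat \<Rightarrow> complex vec) \<Rightarrow> ('w \<Rightarrow> nat \<Rightarrow> complex vec) \<Rightarrow> complex" where
  "ip \<xi> \<eta> = (\<integral>\<omega>. fip (\<xi> \<omega>) (\<eta> \<omega>) \<partial>M)"

text \<open>The square of the norm of the direct integral.\<close>

definition nrm :: "('w \<Rightarrow> nat \<Rightarrow> complex vec) \<Rightarrow> real" where
  "nrm \<xi> = (\<integral>\<omega>. fnorm2 (\<xi> \<omega>) \<partial>M)"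

lemma fip_integrable:
  assumes "\<xi> \<in> L2" "\<eta> \<in> L2"
  shows "integrable M (\<lambda>\<omega>. fip (\<xi> \<omega>) (\<eta> \<omega>))"
proof (rule Bochner_Integration.integrable_bound)
  show "integrable M (\<lambda>\<omega>. (fnorm2 (\<xi> \<omega>) + fnorm2 (\<eta> \<omega>)) / 2)"
    by (intro integrable_divide_zero Bochner_Integration.integrable_add impI fnorm2_integrable assms)
  show "(\<lambda>\<omega>. fip (\<xi> \<omega>) (\<eta> \<omega>)) \<in> borel_measurable M"
    using assms by (intro fip_measurable) (auto simp: L2_iff)
  show "AE \<omega> in M. cmod (fip (\<xi> \<omega>) (\<eta> \<omega>)) \<le> norm ((fnorm2 (\<xi> \<omega>) + fnorm2 (\<eta> \<omega>)) / 2)"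
    by (intro AE_I2) (use fip_le[OF L2_fibre L2_fibre, OF assms(1) _ assms(2)] in fastforce)
qed

lemma ip_le:
  assumes "\<xi> \<in> L2" "\<eta> \<in> L2"
  shows "cmod (ip \<xi> \<eta>) \<le> (nrm \<xi> + nrm \<eta>) / 2"
proof -
  have "cmod (ip \<xi> \<eta>) \<le> (\<integral>\<omega>. cmod (fip (\<xi> \<omega>) (\<eta> \<omega>)) \<partial>M)"
    unfolding ip_def by (rule integral_norm_bound)
  also have "\<dots> \<le> (\<integral>\<omega>. (fnorm2 (\<xi> \<omega>) + fnorm2 (\<eta> \<omega>)) / 2 \<partial>M)"
  proof (rule integral_mono)
    show "cmod (fip (\<xi> \<omega>) (\<eta> \<omega>)) \<le> (fnorm2 (\<xi> \<omega>) + fnorm2 (\<eta> \<omega>)) / 2" if "\<omega> \<in> space M" for \<omega>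
      by (rule fip_le[OF L2_fibre[OF assms(1) that] L2_fibre[OF assms(2) that]])
  qed (use fip_integrable[OF assms] fnorm2_integrable[OF assms(1)] fnorm2_integrable[OF assms(2)] in auto)
  also have "\<dots> = (nrm \<xi> + nrm \<eta>) / 2"
    unfolding nrm_def using fnorm2_integrable[OF assms(1)] fnorm2_integrable[OF assms(2)] by simp
  finally show ?thesis .
qed

lemma ip_self: "\<xi> \<in> L2 \<Longrightarrow> ip \<xi> \<xi> = of_real (nrm \<xi>)"
  unfolding ip_def nrm_def
  by (subst integral_complex_of_real[symmetric]) (intro Bochner_Integration.integral_cong, auto simp: fip_self[OF L2_fibre])

lemma nrm_eq_0:
  assumes "\<xi> \<in> L2" "nrm \<xi> = 0"
  shows "AE \<omega> in M. \<xi> \<omega> = (\<lambda>_. 0\<^sub>v (deg \<omega>))"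
proof -
  have "AE \<omega> in M. 0 \<le> fnorm2 (\<xi> \<omega>)"
    by (intro AE_I2 fnorm2_nonneg[OF L2_fibre[OF assms(1)]])
  then have "AE \<omega> in M. fnorm2 (\<xi> \<omega>) = 0"
    using assms(2) integral_nonneg_eq_0_iff_AE[OF fnorm2_integrable[OF assms(1)]] by (simp add: nrm_def)
  with AE_space show ?thesis by eventually_elim (use fnorm2_eq_0[OF L2_fibre[OF assms(1)]] in blast)
qed

lemma L2_add:
  assumes "\<xi> \<in> L2" "\<eta> \<in> L2"
  shows "(\<lambda>\<omega> j. \<xi> \<omega> j + \<eta> \<omega> j) \<in> L2"
proof (rule L2I)
  show "(\<lambda>j. \<xi> \<omega> j + \<eta> \<omega> j) \<in> fibre (deg \<omega>) (f \<omega>)" if "\<omega> \<in> space M" for \<omega>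
    by (intro fibre_add L2_fibre assms that)
  show "crd (\<lambda>\<omega> j. \<xi> \<omega> j + \<eta> \<omega> j) j i \<in> borel_measurable M" for j i
  proof (subst measurable_cong)
    show "(\<lambda>\<omega>. crd \<xi> j i \<omega> + crd \<eta> j i \<omega>) \<in> borel_measurable M"
      using crd_measurable assms by measurable
    fix \<omega> assume "\<omega> \<in> space M"
    then show "crd (\<lambda>\<omega> j. \<xi> \<omega> j + \<eta> \<omega> j) j i \<omega> = crd \<xi> j i \<omega> + crd \<eta> j i \<omega>"
      using fibreD(1)[OF L2_fibre[OF assms(1)], of \<omega> j] fibreD(1)[OF L2_fibre[OF assms(2)], of \<omega> j]
      by (auto simp: crd_def)
  qed
  show "integrable M (\<lambda>\<omega>. 2 * (fnorm2 (\<xi> \<omega>) + fnorm2 (\<eta> \<omega>)))"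
    by (intro integrable_mult_right Bochner_Integration.integrable_add fnorm2_integrable assms)
  show "AE \<omega> in M. fnorm2 (\<lambda>j. \<xi> \<omega> j + \<eta> \<omega> j) \<le> 2 * (fnorm2 (\<xi> \<omega>) + fnorm2 (\<eta> \<omega>))"
    by (intro AE_I2 fibre_add(2)[OF L2_fibre[OF assms(1)] L2_fibre[OF assms(2)]])
qed

lemma ip_add:
  assumes "\<xi> \<in> L2" "\<eta> \<in> L2" "\<zeta> \<in> L2"
  shows "ip (\<lambda>\<omega> j. \<xi> \<omega> j + \<eta> \<omega> j) \<zeta> = ip \<xi> \<zeta> + ip \<eta> \<zeta>"
    "ip \<zeta> (\<lambda>\<omega> j. \<xi> \<omega> j + \<eta> \<omega> j) = ip \<zeta> \<xi> + ip \<zeta> \<eta>"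
proof -
  have "ip (\<lambda>\<omega> j. \<xi> \<omega> j + \<eta> \<omega> j) \<zeta> = (\<integral>\<omega>. fip (\<xi> \<omega>) (\<zeta> \<omega>) + fip (\<eta> \<omega>) (\<zeta> \<omega>) \<partial>M)"
    unfolding ip_def
    by (intro Bochner_Integration.integral_cong refl fibre_add(3)[OF L2_fibre L2_fibre L2_fibre] assms)
  then show "ip (\<lambda>\<omega> j. \<xi> \<omega> j + \<eta> \<omega> j) \<zeta> = ip \<xi> \<zeta> + ip \<eta> \<zeta>"
    unfolding ip_def using fip_integrable assms by simp
  have "ip \<zeta> (\<lambda>\<omega> j. \<xi> \<omega> j + \<eta> \<omega> j) = (\<integral>\<omega>. fip (\<zeta> \<omega>) (\<xi> \<omega>) + fip (\<zeta> \<omega>) (\<eta> \<omega>) \<partial>M)"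
    unfolding ip_def
    by (intro Bochner_Integration.integral_cong refl fibre_add(4)[OF L2_fibre L2_fibre L2_fibre] assms)
  then show "ip \<zeta> (\<lambda>\<omega> j. \<xi> \<omega> j + \<eta> \<omega> j) = ip \<zeta> \<xi> + ip \<zeta> \<eta>"
    unfolding ip_def using fip_integrable assms by simp
qed

definition act :: "('w \<Rightarrow> complex mat) \<Rightarrow> ('w \<Rightarrow> nat \<Rightarrow> complex vec) \<Rightarrow> 'w \<Rightarrow> nat \<Rightarrow> complex vec" where
  "act B \<xi> = (\<lambda>\<omega> j. B \<omega> *\<^sub>v \<xi> \<omega> j)"

text \<open>Entries extended by 0 beyond the degree. Sums, products and adjoints of fields then have
  measurable entries without a case distinction on the degree.\<close>

definition ment :: "('w \<Rightarrow> complex mat) \<Rightarrow> nat \<Rightarrow> nat \<Rightarrow> 'w \<Rightarrow> complex" where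
  "ment B i l \<omega> = (if i < deg \<omega> \<and> l < deg \<omega> then B \<omega> $$ (i, l) else 0)"

definition mfield :: "('w \<Rightarrow> complex mat) \<Rightarrow> bool" where
  "mfield B \<longleftrightarrow> (\<forall>\<omega>\<in>space M. B \<omega> \<in> carrier_mat (deg \<omega>) (deg \<omega>)) \<and> (\<forall>i l. ment B i l \<in> borel_measurable M)"

text \<open>\<open>C\<close> bounds the square of the operator norm, uniformly in the point.\<close>

definition opbound :: "('w \<Rightarrow> complex mat) \<Rightarrow> real \<Rightarrow> bool" where
  "opbound B C \<longleftrightarrow> (\<forall>\<omega>\<in>space M. \<forall>u\<in>carrier_vec (deg \<omega>). vnorm2 (B \<omega> *\<^sub>v u) \<le> C * vnorm2 u)"

lemma crd_act_measurable:
  assumes B: "mfield B" and \<xi>: "\<And>\<omega>. \<omega> \<in> space M \<Longrightarrow> \<xi> \<omega> \<in> fibre (deg \<omega>) (f \<omega>)" "\<And>j i. crd \<xi> j i \<in> borel_measurable M"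
  shows "crd (act B \<xi>) j i \<in> borel_measurable M"
proof (subst measurable_cong)
  show "(\<lambda>\<omega>. if enat j < f \<omega> \<and> i < deg \<omega> then (\<Sum>l<deg \<omega>. ment B i l \<omega> * crd \<xi> j l \<omega>) else 0) \<in> borel_measurable M"
  proof (intro measurable_If)
    show "(\<lambda>\<omega>. \<Sum>l<deg \<omega>. ment B i l \<omega> * crd \<xi> j l \<omega>) \<in> borel_measurable M"
      using B \<xi> by (intro measurable_sum_upto borel_measurable_times) (auto simp: mfield_def)
    show "{\<omega> \<in> space M. enat j < f \<omega> \<and> i < deg \<omega>} \<in> sets M" by measurable
  qed auto
  fix \<omega> assume w: "\<omega> \<in> space M"
  show "crd (act B \<xi>) j i \<omega> = (if enat j < f \<omega> \<and> i < deg \<omega> then (\<Sum>l<deg \<omega>. ment B i l \<omega> * crd \<xi> j l \<omega>) else 0)"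
  proof (cases "enat j < f \<omega> \<and> i < deg \<omega>")
    case True
    have "(B \<omega> *\<^sub>v \<xi> \<omega> j) $ i = (\<Sum>l<deg \<omega>. B \<omega> $$ (i, l) * \<xi> \<omega> j $ l)"
      using B w fibreD(1)[OF \<xi>(1)[OF w]] True by (intro mat_vec_index) (auto simp: mfield_def)
    then show ?thesis using True by (auto simp: crd_def act_def ment_def intro!: sum.cong)
  qed (auto simp: crd_def)
qed

lemma L2_act:
  assumes B: "mfield B" and C: "opbound B C" and \<xi>: "\<xi> \<in> L2"
  shows "act B \<xi> \<in> L2" "nrm (act B \<xi>) \<le> C * nrm \<xi>"
proof -
  have c: "act B \<xi> \<omega> \<in> fibre (deg \<omega>) (f \<omega>)" "fnorm2 (act B \<xi> \<omega>) \<le> C * fnorm2 (\<xi> \<omega>)" if "\<omega> \<in> space M" for \<omega>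
    unfolding act_def
    using fibre_mat[OF L2_fibre[OF \<xi> that], of "B \<omega>" C] B C that by (auto simp: mfield_def opbound_def)
  show a: "act B \<xi> \<in> L2"
  proof (rule L2I)
    show "integrable M (\<lambda>\<omega>. C * fnorm2 (\<xi> \<omega>))" using fnorm2_integrable[OF \<xi>] by simp
  qed (use c crd_act_measurable[OF B L2_fibre[OF \<xi>] crd_measurable[OF \<xi>]] in auto)
  have "nrm (act B \<xi>) \<le> (\<integral>\<omega>. C * fnorm2 (\<xi> \<omega>) \<partial>M)"
    unfolding nrm_def using fnorm2_integrable[OF a] fnorm2_integrable[OF \<xi>] c by (intro integral_mono) auto
  then show "nrm (act B \<xi>) \<le> C * nrm \<xi>" by (simp add: nrm_def)
qed

lemma mfield_scalar:
  assumes "\<phi> \<in> borel_measurable M"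
  shows "mfield (\<lambda>\<omega>. \<phi> \<omega> \<cdot>\<^sub>m 1\<^sub>m (deg \<omega>))"
proof -
  have "ment (\<lambda>\<omega>. \<phi> \<omega> \<cdot>\<^sub>m 1\<^sub>m (deg \<omega>)) i l = (\<lambda>\<omega>. if i < deg \<omega> \<and> l = i then \<phi> \<omega> else 0)" for i l
    by (auto simp: ment_def fun_eq_iff)
  then show ?thesis using assms unfolding mfield_def by (auto intro!: measurable_If)
qed

lemma opbound_scalar:
  assumes "\<And>\<omega>. \<omega> \<in> space M \<Longrightarrow> cmod (\<phi> \<omega>) \<le> c"
  shows "opbound (\<lambda>\<omega>. \<phi> \<omega> \<cdot>\<^sub>m 1\<^sub>m (deg \<omega>)) (c\<^sup>2)"
  unfolding opbound_def using assms
  by (auto simp: scalar_mat_vec vnorm2_smult intro!: mult_right_mono power_mono)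

lemma mfield_adjoint:
  assumes "mfield B"
  shows "mfield (\<lambda>\<omega>. mat_adjoint (B \<omega>))"
proof -
  have "ment (\<lambda>\<omega>. mat_adjoint (B \<omega>)) i l \<in> borel_measurable M" for i l
  proof (subst measurable_cong)
    show "(\<lambda>\<omega>. cnj (ment B l i \<omega>)) \<in> borel_measurable M"
      using assms by (intro borel_measurable_continuous_on[OF continuous_on_cnj[OF continuous_on_id]]) (auto simp: mfield_def)
  qed (use assms in \<open>auto simp: ment_def mfield_def\<close>)
  then show ?thesis using assms by (auto simp: mfield_def)
qed

lemma mfield_mult:
  assumes "mfield A" "mfield B"
  shows "mfield (\<lambda>\<omega>. A \<omega> * B \<omega>)"
proof -
  have "ment (\<lambda>\<omega>. A \<omega> * B \<omega>) i l \<in> borel_measurable M" for i l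
  proof (subst measurable_cong)
    show "(\<lambda>\<omega>. if i < deg \<omega> \<and> l < deg \<omega> then \<Sum>q<deg \<omega>. ment A i q \<omega> * ment B q l \<omega> else 0) \<in> borel_measurable M"
      using assms by (intro measurable_If measurable_sum_upto borel_measurable_times) (auto simp: mfield_def)
    fix \<omega> assume "\<omega> \<in> space M"
    then have c: "A \<omega> \<in> carrier_mat (deg \<omega>) (deg \<omega>)" "B \<omega> \<in> carrier_mat (deg \<omega>) (deg \<omega>)"
      using assms by (auto simp: mfield_def)
    show "ment (\<lambda>\<omega>. A \<omega> * B \<omega>) i l \<omega> = (if i < deg \<omega> \<and> l < deg \<omega> then \<Sum>q<deg \<omega>. ment A i q \<omega> * ment B q l \<omega> else 0)"
      unfolding ment_def using mat_mult_index[OF c, of i l] by (auto simp del: index_mult_mat intro!: sum.cong)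
  qed
  then show ?thesis using assms by (auto simp: mfield_def intro!: mult_carrier_mat)
qed

lemma mfield_add:
  assumes "mfield A" "mfield B"
  shows "mfield (\<lambda>\<omega>. A \<omega> + B \<omega>)"
proof -
  have "ment (\<lambda>\<omega>. A \<omega> + B \<omega>) i l \<in> borel_measurable M" for i l
  proof (subst measurable_cong)
    show "(\<lambda>\<omega>. ment A i l \<omega> + ment B i l \<omega>) \<in> borel_measurable M"
      using assms by (intro borel_measurable_add) (auto simp: mfield_def)
    fix \<omega> assume "\<omega> \<in> space M"
    then have c: "A \<omega> \<in> carrier_mat (deg \<omega>) (deg \<omega>)" "B \<omega> \<in> carrier_mat (deg \<omega>) (deg \<omega>)"
      using assms by (auto simp: mfield_def)
    then show "ment (\<lambda>\<omega>. A \<omega> + B \<omega>) i l \<omega> = ment A i l \<omega> + ment B i l \<omega>" by (auto simp: ment_def)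
  qed
  then show ?thesis using assms by (auto simp: mfield_def)
qed

lemma mfield_smult:
  assumes "\<phi> \<in> borel_measurable M" "mfield B"
  shows "mfield (\<lambda>\<omega>. \<phi> \<omega> \<cdot>\<^sub>m B \<omega>)"
proof -
  have "ment (\<lambda>\<omega>. \<phi> \<omega> \<cdot>\<^sub>m B \<omega>) i l \<in> borel_measurable M" for i l
  proof (subst measurable_cong)
    show "(\<lambda>\<omega>. \<phi> \<omega> * ment B i l \<omega>) \<in> borel_measurable M"
      using assms by (intro borel_measurable_times) (auto simp: mfield_def)
    fix \<omega> assume "\<omega> \<in> space M"
    then have "B \<omega> \<in> carrier_mat (deg \<omega>) (deg \<omega>)"
      using assms by (auto simp: mfield_def)
    then show "ment (\<lambda>\<omega>. \<phi> \<omega> \<cdot>\<^sub>m B \<omega>) i l \<omega> = \<phi> \<omega> * ment B i l \<omega>" by (auto simp: ment_def)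
  qed
  then show ?thesis using assms by (auto simp: mfield_def)
qed

lemma mfield_X:
  assumes s: "s \<in> {1..k}"
  shows "mfield (X s)"
proof -
  have "ment (X s) i l \<in> borel_measurable M" for i l
  proof (rule measurable_level_sets[OF deg_measurable])
    fix n
    let ?N = "restrict_space M {\<omega> \<in> space M. deg \<omega> = n}"
    have e: "{\<omega> \<in> space M. dim_row (X s \<omega>) = n} = {\<omega> \<in> space M. deg \<omega> = n}"
    proof -
      have "dim_row (X s \<omega>) = deg \<omega>" if "\<omega> \<in> space M" for \<omega> using X_carrier[OF that s] by simp
      then show ?thesis by auto
    qed
    show "ment (X s) i l \<in> borel_measurable ?N"
    proof (cases "i < n \<and> l < n")
      case True
      have "measurable_mat_field M (X s)" using X s by (simp add: measurable_mat_tuple_field_def)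
      then have "(\<lambda>\<omega>. X s \<omega> $$ (i, l)) \<in> borel_measurable (restrict_space M {\<omega> \<in> space M. dim_row (X s \<omega>) = n})"
        unfolding measurable_mat_field_def using True by blast
      then have "(\<lambda>\<omega>. X s \<omega> $$ (i, l)) \<in> borel_measurable ?N" unfolding e .
      then show ?thesis
        by (rule measurable_cong[THEN iffD1, rotated]) (use True in \<open>auto simp: space_restrict_space ment_def\<close>)
    next
      case False
      have "(\<lambda>\<omega>. 0) \<in> borel_measurable ?N" by simp
      then show ?thesis
        by (rule measurable_cong[THEN iffD1, rotated]) (use False in \<open>auto simp: space_restrict_space ment_def\<close>)
    qed
  qed
  then show ?thesis using X_carrier[OF _ s] by (auto simp: mfield_def)
qed

definition ev :: "pexp \<Rightarrow> 'w \<Rightarrow> complex mat" where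
  "ev p \<omega> = tev k (\<lambda>s. X s \<omega>) p"

lemma mfield_letters: "mfield (\<lambda>\<omega>. letters k (\<lambda>s. X s \<omega>) s b)"
  using mfield_X[OF Suc_mod_range[OF k]] mfield_adjoint[OF mfield_X[OF Suc_mod_range[OF k]]]
  by (cases b) (auto simp: letters_def Let_def)

lemma mfield_ev: "mfield (ev p)"
proof (induction p)
  case POne
  have "(\<lambda>\<omega>. 1 \<cdot>\<^sub>m 1\<^sub>m (deg \<omega>)) = ev POne"
    by (auto simp: ev_def deg_def fun_eq_iff intro!: eq_matI)
  then show ?case using mfield_scalar[of "\<lambda>_. 1"] by simp
next
  case (PLet s b p)
  then show ?case using mfield_mult[OF mfield_letters] unfolding ev_def by simp
next
  case (PAdd p q)
  then show ?case using mfield_add unfolding ev_def by simp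
next
  case (PSc a b p)
  then show ?case using mfield_smult[of "\<lambda>_. Complex (of_rat a) (of_rat b)"] unfolding ev_def by simp
qed

lemma frob_measurable:
  assumes "mfield B"
  shows "(\<lambda>\<omega>. frob (B \<omega>)) \<in> borel_measurable M"
proof (subst measurable_cong)
  show "(\<lambda>\<omega>. \<Sum>i<deg \<omega>. \<Sum>j<deg \<omega>. (cmod (ment B i j \<omega>))\<^sup>2) \<in> borel_measurable M"
    using assms by (intro measurable_sum_upto deg_measurable borel_measurable_power measurable_compose[OF _ borel_measurable_norm]) (auto simp: mfield_def)
  fix \<omega> assume "\<omega> \<in> space M"
  then have "B \<omega> \<in> carrier_mat (deg \<omega>) (deg \<omega>)" using assms by (auto simp: mfield_def)
  then show "frob (B \<omega>) = (\<Sum>i<deg \<omega>. \<Sum>j<deg \<omega>. (cmod (ment B i j \<omega>))\<^sup>2)"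
    by (auto simp: frob_carrier ment_def intro!: sum.cong)
qed

section \<open>Classes of sections and the operators on them\<close>

lemma cls_eq_iff:
  assumes "\<xi> \<in> L2" "\<eta> \<in> L2"
  shows "cls \<xi> = cls \<eta> \<longleftrightarrow> (AE \<omega> in M. \<xi> \<omega> = \<eta> \<omega>)"
proof
  assume "cls \<xi> = cls \<eta>"
  then have "\<xi> \<in> cls \<eta>" using assms by (auto simp: section_class_def)
  then show "AE \<omega> in M. \<xi> \<omega> = \<eta> \<omega>" by (simp add: section_class_def)
next
  assume a: "AE \<omega> in M. \<xi> \<omega> = \<eta> \<omega>"
  have "(AE \<omega> in M. \<zeta> \<omega> = \<xi> \<omega>) \<longleftrightarrow> (AE \<omega> in M. \<zeta> \<omega> = \<eta> \<omega>)" for \<zeta>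
  proof
    assume "AE \<omega> in M. \<zeta> \<omega> = \<xi> \<omega>"
    with a show "AE \<omega> in M. \<zeta> \<omega> = \<eta> \<omega>" by eventually_elim simp
  next
    assume "AE \<omega> in M. \<zeta> \<omega> = \<eta> \<omega>"
    with a show "AE \<omega> in M. \<zeta> \<omega> = \<xi> \<omega>" by eventually_elim simp
  qed
  then show "cls \<xi> = cls \<eta>" by (simp add: section_class_def)
qed

lemma cls_carrier: "\<xi> \<in> L2 \<Longrightarrow> cls \<xi> \<in> hcarrier HS"
  by (auto simp: mult_integral_space_def direct_integral_space_def)

lemma carrier_cls:
  assumes "A \<in> hcarrier HS"
  obtains \<xi> where "\<xi> \<in> L2" "A = cls \<xi>"
  using assms by (auto simp: mult_integral_space_def direct_integral_space_def)

lemma class_rep_cls: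
  assumes "\<xi> \<in> L2"
  shows "class_rep (cls \<xi>) \<in> L2" "AE \<omega> in M. class_rep (cls \<xi>) \<omega> = \<xi> \<omega>"
proof -
  have "\<xi> \<in> cls \<xi>" using assms by (simp add: section_class_def)
  then have "class_rep (cls \<xi>) \<in> cls \<xi>" unfolding class_rep_def by (rule someI[where P = "\<lambda>\<zeta>. \<zeta> \<in> cls \<xi>"])
  then show "class_rep (cls \<xi>) \<in> L2" "AE \<omega> in M. class_rep (cls \<xi>) \<omega> = \<xi> \<omega>"
    by (auto simp: section_class_def)
qed

lemma hinner_cls:
  assumes "\<xi> \<in> L2" "\<eta> \<in> L2"
  shows "hinner HS (cls \<xi>) (cls \<eta>) = ip \<xi> \<eta>"
proof -
  note r = class_rep_cls[OF assms(1)] class_rep_cls[OF assms(2)]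
  have "hinner HS (cls \<xi>) (cls \<eta>) = (\<integral>\<omega>. fip (class_rep (cls \<xi>) \<omega>) (class_rep (cls \<eta>) \<omega>) \<partial>M)"
    by (simp add: mult_integral_space_def direct_integral_space_def mult_fibre_eq)
  also have "\<dots> = ip \<xi> \<eta>"
    unfolding ip_def
  proof (rule integral_cong_AE)
    show "AE \<omega> in M. fip (class_rep (cls \<xi>) \<omega>) (class_rep (cls \<eta>) \<omega>) = fip (\<xi> \<omega>) (\<eta> \<omega>)"
      using r(2,4) by eventually_elim simp
  qed (use fip_integrable[OF r(1,3)] fip_integrable[OF assms] in auto)
  finally show ?thesis .
qed

lemma hadd_cls:
  assumes "\<xi> \<in> L2" "\<eta> \<in> L2"
  shows "hadd HS (cls \<xi>) (cls \<eta>) = cls (\<lambda>\<omega> j. \<xi> \<omega> j + \<eta> \<omega> j)"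
proof -
  note r = class_rep_cls[OF assms(1)] class_rep_cls[OF assms(2)]
  have "hadd HS (cls \<xi>) (cls \<eta>) = cls (\<lambda>\<omega> j. class_rep (cls \<xi>) \<omega> j + class_rep (cls \<eta>) \<omega> j)"
    by (simp add: mult_integral_space_def direct_integral_space_def mult_fibre_eq copies_space_def cspace_def)
  also have "\<dots> = cls (\<lambda>\<omega> j. \<xi> \<omega> j + \<eta> \<omega> j)"
  proof -
    have "AE \<omega> in M. (\<lambda>j. class_rep (cls \<xi>) \<omega> j + class_rep (cls \<eta>) \<omega> j) = (\<lambda>j. \<xi> \<omega> j + \<eta> \<omega> j)"
      using r(2,4) by eventually_elim simp
    then show ?thesis by (simp only: cls_eq_iff[OF L2_add[OF r(1,3)] L2_add[OF assms]])
  qed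
  finally show ?thesis .
qed

lemma hscale_cls:
  assumes "\<xi> \<in> L2"
  shows "hscale HS c (cls \<xi>) = cls (\<lambda>\<omega> j. c \<cdot>\<^sub>v \<xi> \<omega> j)" "(\<lambda>\<omega> j. c \<cdot>\<^sub>v \<xi> \<omega> j) \<in> L2"
proof -
  note r = class_rep_cls[OF assms(1)]
  have sc: "(\<lambda>\<omega> j. c \<cdot>\<^sub>v \<zeta> \<omega> j) \<in> L2" if "\<zeta> \<in> L2" for \<zeta>
  proof (rule L2I)
    \<comment> \<open>On the space, scaling is the action of a scalar matrix field, which is known
      to preserve \<open>L2\<close>. Off the space the two sections may differ, so membership is
      carried over by \<open>L2I\<close>.\<close>
    have a: "act (\<lambda>\<omega>. c \<cdot>\<^sub>m 1\<^sub>m (deg \<omega>)) \<zeta> \<in> L2"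
      using L2_act(1)[OF mfield_scalar opbound_scalar that, of "\<lambda>_. c" "cmod c"] by simp
    have e: "act (\<lambda>\<omega>. c \<cdot>\<^sub>m 1\<^sub>m (deg \<omega>)) \<zeta> \<omega> = (\<lambda>j. c \<cdot>\<^sub>v \<zeta> \<omega> j)" if "\<omega> \<in> space M" for \<omega>
      unfolding act_def using scalar_mat_vec[OF fibreD(1)[OF L2_fibre[OF \<open>\<zeta> \<in> L2\<close> that]]] by simp
    show "(\<lambda>j. c \<cdot>\<^sub>v \<zeta> \<omega> j) \<in> fibre (deg \<omega>) (f \<omega>)" if "\<omega> \<in> space M" for \<omega>
      using L2_fibre[OF a that] e[OF that] by simp
    show "crd (\<lambda>\<omega> j. c \<cdot>\<^sub>v \<zeta> \<omega> j) j i \<in> borel_measurable M" for j i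
      using crd_measurable[OF a, of j i]
      by (rule measurable_cong[THEN iffD1, rotated]) (simp add: crd_def e)
    show "integrable M (\<lambda>\<omega>. fnorm2 (act (\<lambda>\<omega>. c \<cdot>\<^sub>m 1\<^sub>m (deg \<omega>)) \<zeta> \<omega>))" by (rule fnorm2_integrable[OF a])
    show "AE \<omega> in M. fnorm2 (\<lambda>j. c \<cdot>\<^sub>v \<zeta> \<omega> j) \<le> fnorm2 (act (\<lambda>\<omega>. c \<cdot>\<^sub>m 1\<^sub>m (deg \<omega>)) \<zeta> \<omega>)"
      by (intro AE_I2) (simp add: e)
  qed
  show "(\<lambda>\<omega> j. c \<cdot>\<^sub>v \<xi> \<omega> j) \<in> L2" by (rule sc[OF assms])
  have "hscale HS c (cls \<xi>) = cls (\<lambda>\<omega> j. c \<cdot>\<^sub>v class_rep (cls \<xi>) \<omega> j)"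
    by (simp add: mult_integral_space_def direct_integral_space_def mult_fibre_eq copies_space_def cspace_def)
  also have "\<dots> = cls (\<lambda>\<omega> j. c \<cdot>\<^sub>v \<xi> \<omega> j)"
  proof -
    have "AE \<omega> in M. (\<lambda>j. c \<cdot>\<^sub>v class_rep (cls \<xi>) \<omega> j) = (\<lambda>j. c \<cdot>\<^sub>v \<xi> \<omega> j)"
      using r(2) by eventually_elim simp
    then show ?thesis by (simp only: cls_eq_iff[OF sc[OF r(1)] sc[OF assms]])
  qed
  finally show "hscale HS c (cls \<xi>) = cls (\<lambda>\<omega> j. c \<cdot>\<^sub>v \<xi> \<omega> j)" .
qed

text \<open>The domain condition sits in the requirement that the image section is square
  integrable; otherwise the graph is a pointwise equation almost everywhere.\<close>

lemma graph_iff: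
  assumes s: "s \<in> {1..k}"
  shows "mult_integral_tuple M f X s = {(cls \<xi>, cls \<eta>) | \<xi> \<eta>. \<xi> \<in> L2 \<and> \<eta> \<in> L2 \<and> (AE \<omega> in M. \<eta> \<omega> = (\<lambda>j. X s \<omega> *\<^sub>v \<xi> \<omega> j))}"
proof -
  have "(AE \<omega> in M. (\<xi> \<omega>, \<eta> \<omega>) \<in> copies_op (f \<omega>) (cspace (deg \<omega>)) (mat_op (X s \<omega>)))
      \<longleftrightarrow> (AE \<omega> in M. \<eta> \<omega> = (\<lambda>j. X s \<omega> *\<^sub>v \<xi> \<omega> j))" if "\<xi> \<in> L2" "\<eta> \<in> L2" for \<xi> \<eta>
    by (intro AE_cong copies_op_iff X_carrier s L2_fibre that)
  then show ?thesis unfolding mult_integral_tuple_def direct_integral_op_def deg_def[symmetric] by blast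
qed

text \<open>A field of generators may be unbounded. Set to 0 off a region where it is bounded, it
  acts on all of \<open>L2\<close>.\<close>

definition cut :: "'w set \<Rightarrow> ('w \<Rightarrow> complex mat) \<Rightarrow> 'w \<Rightarrow> complex mat" where
  "cut A B = (\<lambda>\<omega>. if \<omega> \<in> A then B \<omega> else 0\<^sub>m (deg \<omega>) (deg \<omega>))"

text \<open>Multiplication by the indicator function of \<open>A\<close>, written as a cut identity
  field so that the results on \<open>act\<close> apply.\<close>

definition rest :: "'w set \<Rightarrow> ('w \<Rightarrow> nat \<Rightarrow> complex vec) \<Rightarrow> 'w \<Rightarrow> nat \<Rightarrow> complex vec" where
  "rest A = act (cut A (\<lambda>\<omega>. 1\<^sub>m (deg \<omega>)))"

lemma mfield_cut:
  assumes A: "A \<in> sets M" and B: "mfield B"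
  shows "mfield (cut A B)"
proof -
  have "ment (cut A B) i l = (\<lambda>\<omega>. if \<omega> \<in> A then ment B i l \<omega> else 0)" for i l
    by (auto simp: ment_def cut_def fun_eq_iff)
  then show ?thesis using assms unfolding mfield_def
    by (auto simp: cut_def intro!: measurable_If_set sets.Int)
qed

lemma mfield_one: "mfield (\<lambda>\<omega>. 1\<^sub>m (deg \<omega>))"
proof -
  have "(\<lambda>\<omega>. 1 \<cdot>\<^sub>m 1\<^sub>m (deg \<omega>) :: complex mat) = (\<lambda>\<omega>. 1\<^sub>m (deg \<omega>))" by (auto simp: fun_eq_iff intro!: eq_matI)
  then show ?thesis using mfield_scalar[of "\<lambda>_. 1"] by simp
qed

lemma opbound_cut:
  assumes B: "mfield B" and C: "0 \<le> C" "\<And>\<omega> u. \<omega> \<in> space M \<Longrightarrow> \<omega> \<in> A \<Longrightarrow> u \<in> carrier_vec (deg \<omega>) \<Longrightarrow> vnorm2 (B \<omega> *\<^sub>v u) \<le> C * vnorm2 u"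
  shows "opbound (cut A B) C"
  unfolding opbound_def
proof (intro ballI)
  fix \<omega> and u :: "complex vec" assume "\<omega> \<in> space M" "u \<in> carrier_vec (deg \<omega>)"
  then show "vnorm2 (cut A B \<omega> *\<^sub>v u) \<le> C * vnorm2 u"
    using C by (cases "\<omega> \<in> A") (auto simp: cut_def zero_mat_vec)
qed

lemma opbound_cut_frob:
  assumes B: "mfield B" and C: "0 \<le> C" "\<And>\<omega>. \<omega> \<in> space M \<Longrightarrow> \<omega> \<in> A \<Longrightarrow> frob (B \<omega>) \<le> C"
  shows "opbound (cut A B) C"
proof (rule opbound_cut[OF B C(1)])
  fix \<omega> and u :: "complex vec" assume w: "\<omega> \<in> space M" "\<omega> \<in> A" "u \<in> carrier_vec (deg \<omega>)"
  have "vnorm2 (B \<omega> *\<^sub>v u) \<le> frob (B \<omega>) * vnorm2 u"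
    using B w by (intro vnorm2_mat_frob[of _ "deg \<omega>"]) (auto simp: mfield_def)
  also have "\<dots> \<le> C * vnorm2 u" using C w by (intro mult_right_mono) auto
  finally show "vnorm2 (B \<omega> *\<^sub>v u) \<le> C * vnorm2 u" .
qed

lemma act_cut:
  assumes "\<omega> \<in> space M" "\<xi> \<in> L2"
  shows "act (cut A B) \<xi> \<omega> = (if \<omega> \<in> A then (\<lambda>j. B \<omega> *\<^sub>v \<xi> \<omega> j) else (\<lambda>_. 0\<^sub>v (deg \<omega>)))"
  using fibreD(1)[OF L2_fibre[OF assms(2,1)]] by (auto simp: act_def cut_def zero_mat_vec)

lemma rest_apply:
  assumes "\<omega> \<in> space M" "\<xi> \<in> L2"
  shows "rest A \<xi> \<omega> = (if \<omega> \<in> A then \<xi> \<omega> else (\<lambda>_. 0\<^sub>v (deg \<omega>)))"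
  using fibreD(1)[OF L2_fibre[OF assms(2,1)]] by (simp add: rest_def act_cut[OF assms])

lemma rest_L2:
  assumes "A \<in> sets M" "\<xi> \<in> L2"
  shows "rest A \<xi> \<in> L2" "nrm (rest A \<xi>) \<le> nrm \<xi>"
proof -
  have "opbound (cut A (\<lambda>\<omega>. 1\<^sub>m (deg \<omega>))) 1" by (rule opbound_cut[OF mfield_one]) auto
  from L2_act[OF mfield_cut[OF assms(1) mfield_one] this assms(2)]
  show "rest A \<xi> \<in> L2" "nrm (rest A \<xi>) \<le> nrm \<xi>" by (simp_all add: rest_def)
qed

lemma cls_cong:
  assumes "AE \<omega> in M. \<xi> \<omega> = \<eta> \<omega>"
  shows "cls \<xi> = cls \<eta>"
proof -
  have "(AE \<omega> in M. \<zeta> \<omega> = \<xi> \<omega>) \<longleftrightarrow> (AE \<omega> in M. \<zeta> \<omega> = \<eta> \<omega>)" for \<zeta>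
  proof
    assume "AE \<omega> in M. \<zeta> \<omega> = \<xi> \<omega>"
    with assms show "AE \<omega> in M. \<zeta> \<omega> = \<eta> \<omega>" by eventually_elim simp
  next
    assume "AE \<omega> in M. \<zeta> \<omega> = \<eta> \<omega>"
    with assms show "AE \<omega> in M. \<zeta> \<omega> = \<xi> \<omega>" by eventually_elim simp
  qed
  then show ?thesis by (simp add: section_class_def)
qed

lemma ip_rest:
  assumes "\<xi> \<in> L2" "\<eta> \<in> L2"
  shows "ip (rest A \<xi>) \<eta> = ip \<xi> (rest A \<eta>)" "ip (rest A \<xi>) \<eta> = (\<integral>\<omega>. (if \<omega> \<in> A then fip (\<xi> \<omega>) (\<eta> \<omega>) else 0) \<partial>M)"
  unfolding ip_def
  by (intro Bochner_Integration.integral_cong refl;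
      use fibreD(1)[OF L2_fibre[OF assms(1)]] fibreD(1)[OF L2_fibre[OF assms(2)]] in \<open>simp add: rest_apply assms\<close>)+

text \<open>\<open>rest A\<close> is an orthogonal projection, so the hypothesis says that the
  squared norm of \<open>rest A \<zeta>\<close> vanishes.\<close>

lemma rest_zero_iff:
  assumes "\<zeta> \<in> L2" "A \<in> sets M" "ip (rest A \<zeta>) \<zeta> = 0"
  shows "AE \<omega> in M. \<omega> \<in> A \<longrightarrow> \<zeta> \<omega> = (\<lambda>_. 0\<^sub>v (deg \<omega>))"
proof -
  have "ip (rest A \<zeta>) (rest A \<zeta>) = ip (rest A \<zeta>) \<zeta>"
    unfolding ip_def
    by (intro Bochner_Integration.integral_cong refl)
      (use fibreD(1)[OF L2_fibre[OF assms(1)]] in \<open>simp add: rest_apply assms\<close>)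
  then have "nrm (rest A \<zeta>) = 0" using assms(3) ip_self[OF rest_L2(1)[OF assms(2,1)]] by simp
  from nrm_eq_0[OF rest_L2(1)[OF assms(2,1)] this] AE_space
  show ?thesis by eventually_elim (auto simp: rest_apply assms split: if_splits)
qed

lemma ip_rest_zero:
  assumes "\<xi> \<in> L2" "\<zeta> \<in> L2" "AE \<omega> in M. \<omega> \<in> A \<longrightarrow> \<zeta> \<omega> = (\<lambda>_. 0\<^sub>v (deg \<omega>))"
  shows "ip (rest A \<xi>) \<zeta> = 0" "ip \<zeta> (rest A \<xi>) = 0"
proof -
  have "AE \<omega> in M. fip (rest A \<xi> \<omega>) (\<zeta> \<omega>) = 0" "AE \<omega> in M. fip (\<zeta> \<omega>) (rest A \<xi> \<omega>) = 0"
    using assms(3) AE_space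
    by (eventually_elim; use fibreD(1)[OF L2_fibre[OF assms(1)]] fibreD(1)[OF L2_fibre[OF assms(2)]] in \<open>auto simp: rest_apply assms(1)\<close>)+
  then show "ip (rest A \<xi>) \<zeta> = 0" "ip \<zeta> (rest A \<xi>) = 0"
    unfolding ip_def by (auto intro!: integral_eq_zero_AE)
qed

end

section \<open>Unitaries intertwining two direct integrals\<close>

locale unitary_pair =
  A: mult_field k M1 f1 X1 + B: mult_field k M2 f2 X2
  for k :: nat and M1 :: "'a measure" and f1 X1 and M2 :: "'b measure" and f2 X2 +
  fixes U
  assumes U: "unitary_op (mult_integral_space M1 f1 X1) (mult_integral_space M2 f2 X2) U"
    and U_graph: "\<And>s. s \<in> {1..k} \<Longrightarrow> map_prod U U ` mult_integral_tuple M1 f1 X1 s = mult_integral_tuple M2 f2 X2 s"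
begin

text \<open>The unitary as a sesquilinear form on sections. Generators can then be moved between the
  two arguments, and representatives matter only up to null sets.\<close>

definition S :: "('a \<Rightarrow> nat \<Rightarrow> complex vec) \<Rightarrow> ('b \<Rightarrow> nat \<Rightarrow> complex vec) \<Rightarrow> complex" where
  "S \<xi> \<eta> = hinner B.HS (U (A.cls \<xi>)) (B.cls \<eta>)"

lemma U_rep:
  assumes "\<xi> \<in> A.L2"
  shows "\<exists>\<zeta>\<in>B.L2. U (A.cls \<xi>) = B.cls \<zeta> \<and> (\<forall>\<eta>\<in>B.L2. S \<xi> \<eta> = B.ip \<zeta> \<eta>)"
proof -
  have "U (A.cls \<xi>) \<in> hcarrier B.HS"
    using U A.cls_carrier[OF assms] by (auto simp: unitary_op_def bij_betw_def)
  then obtain \<zeta> where \<zeta>: "\<zeta> \<in> B.L2" "U (A.cls \<xi>) = B.cls \<zeta>" using B.carrier_cls by blast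
  then show ?thesis by (intro bexI[of _ \<zeta>]) (simp_all add: S_def B.hinner_cls)
qed

lemma U_isometric:
  assumes "\<xi> \<in> A.L2" "\<eta> \<in> A.L2"
  shows "hinner B.HS (U (A.cls \<xi>)) (U (A.cls \<eta>)) = A.ip \<xi> \<eta>"
  using U A.cls_carrier assms by (auto simp: unitary_op_def A.hinner_cls)

text \<open>\<open>\<zeta>\<close> represents the preimage of \<open>\<eta>\<close> under
  \<open>U\<close>. It makes the form an inner product over \<open>M1\<close>, just as
  \<open>U_rep\<close> makes it one over \<open>M2\<close>.\<close>

lemma U_preimage:
  assumes "\<eta> \<in> B.L2"
  shows "\<exists>\<zeta>\<in>A.L2. U (A.cls \<zeta>) = B.cls \<eta> \<and> (\<forall>\<xi>\<in>A.L2. S \<xi> \<eta> = A.ip \<xi> \<zeta>)"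
proof -
  have "B.cls \<eta> \<in> U ` hcarrier A.HS"
    using U B.cls_carrier[OF assms] by (auto simp: unitary_op_def bij_betw_def)
  then obtain Z where Z: "Z \<in> hcarrier A.HS" "B.cls \<eta> = U Z" by blast
  obtain \<zeta> where "\<zeta> \<in> A.L2" "Z = A.cls \<zeta>" using A.carrier_cls[OF Z(1)] .
  with Z have \<zeta>: "\<zeta> \<in> A.L2" "U (A.cls \<zeta>) = B.cls \<eta>" by simp_all
  then show ?thesis
    using U_isometric[OF _ \<zeta>(1)] by (intro bexI[of _ \<zeta>]) (auto simp: S_def)
qed

lemma S_cong:
  assumes "AE \<omega> in M1. \<xi> \<omega> = \<xi>' \<omega>" "AE \<omega> in M2. \<eta> \<omega> = \<eta>' \<omega>"
  shows "S \<xi> \<eta> = S \<xi>' \<eta>'"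
  unfolding S_def A.cls_cong[OF assms(1)] B.cls_cong[OF assms(2)] ..

lemma S_le:
  assumes "\<xi> \<in> A.L2" "\<eta> \<in> B.L2"
  shows "cmod (S \<xi> \<eta>) \<le> (A.nrm \<xi> + B.nrm \<eta>) / 2"
proof -
  obtain \<zeta> where \<zeta>: "\<zeta> \<in> B.L2" "U (A.cls \<xi>) = B.cls \<zeta>" "S \<xi> \<eta> = B.ip \<zeta> \<eta>"
    using U_rep[OF assms(1)] assms(2) by blast
  have "complex_of_real (B.nrm \<zeta>) = A.nrm \<xi>"
    using U_isometric[OF assms(1,1)] \<zeta> B.hinner_cls A.ip_self[OF assms(1)] B.ip_self by simp
  then show ?thesis using B.ip_le[OF \<zeta>(1) assms(2)] \<zeta>(3) by simp
qed

lemma S_add: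
  assumes "\<xi> \<in> A.L2" "\<xi>' \<in> A.L2" "\<eta> \<in> B.L2" "\<eta>' \<in> B.L2"
  shows "S (\<lambda>\<omega> j. \<xi> \<omega> j + \<xi>' \<omega> j) \<eta> = S \<xi> \<eta> + S \<xi>' \<eta>"
    "S \<xi> (\<lambda>\<omega> j. \<eta> \<omega> j + \<eta>' \<omega> j) = S \<xi> \<eta> + S \<xi> \<eta>'"
proof -
  obtain \<zeta> where \<zeta>: "\<zeta> \<in> A.L2" "\<And>\<xi>. \<xi> \<in> A.L2 \<Longrightarrow> S \<xi> \<eta> = A.ip \<xi> \<zeta>" using U_preimage[OF assms(3)] by blast
  show "S (\<lambda>\<omega> j. \<xi> \<omega> j + \<xi>' \<omega> j) \<eta> = S \<xi> \<eta> + S \<xi>' \<eta>"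
    using \<zeta> A.ip_add(1)[OF assms(1,2) \<zeta>(1)] A.L2_add[OF assms(1,2)] assms by simp
  obtain \<zeta>' where \<zeta>': "\<zeta>' \<in> B.L2" "\<And>\<eta>. \<eta> \<in> B.L2 \<Longrightarrow> S \<xi> \<eta> = B.ip \<zeta>' \<eta>" using U_rep[OF assms(1)] by blast
  show "S \<xi> (\<lambda>\<omega> j. \<eta> \<omega> j + \<eta>' \<omega> j) = S \<xi> \<eta> + S \<xi> \<eta>'"
    using \<zeta>' B.ip_add(2)[OF assms(3,4) \<zeta>'(1)] B.L2_add[OF assms(3,4)] assms by simp
qed

lemma S_scale:
  assumes "\<xi> \<in> A.L2" "\<eta> \<in> B.L2"
  shows "S (\<lambda>\<omega> j. c \<cdot>\<^sub>v \<xi> \<omega> j) \<eta> = c * S \<xi> \<eta>" "S \<xi> (\<lambda>\<omega> j. c \<cdot>\<^sub>v \<eta> \<omega> j) = cnj c * S \<xi> \<eta>"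
proof -
  obtain \<zeta> where \<zeta>: "\<zeta> \<in> A.L2" "\<And>\<xi>. \<xi> \<in> A.L2 \<Longrightarrow> S \<xi> \<eta> = A.ip \<xi> \<zeta>" using U_preimage[OF assms(2)] by blast
  have "A.ip (\<lambda>\<omega> j. c \<cdot>\<^sub>v \<xi> \<omega> j) \<zeta> = (\<integral>\<omega>. c * fip (\<xi> \<omega>) (\<zeta> \<omega>) \<partial>M1)"
    unfolding A.ip_def by (intro Bochner_Integration.integral_cong refl fip_smult[OF A.L2_fibre A.L2_fibre] assms \<zeta>)
  then show "S (\<lambda>\<omega> j. c \<cdot>\<^sub>v \<xi> \<omega> j) \<eta> = c * S \<xi> \<eta>"
    using \<zeta> A.hscale_cls(2)[OF assms(1), of c] assms by (simp add: A.ip_def)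
  obtain \<zeta>' where \<zeta>': "\<zeta>' \<in> B.L2" "\<And>\<eta>. \<eta> \<in> B.L2 \<Longrightarrow> S \<xi> \<eta> = B.ip \<zeta>' \<eta>" using U_rep[OF assms(1)] by blast
  have "B.ip \<zeta>' (\<lambda>\<omega> j. c \<cdot>\<^sub>v \<eta> \<omega> j) = (\<integral>\<omega>. cnj c * fip (\<zeta>' \<omega>) (\<eta> \<omega>) \<partial>M2)"
    unfolding B.ip_def
  proof (intro Bochner_Integration.integral_cong refl)
    fix \<omega> assume w: "\<omega> \<in> space M2"
    note f = B.L2_fibre[OF \<zeta>'(1) w] B.L2_fibre[OF assms(2) w] B.L2_fibre[OF B.hscale_cls(2)[OF assms(2), of c] w]
    show "fip (\<zeta>' \<omega>) (\<lambda>j. c \<cdot>\<^sub>v \<eta> \<omega> j) = cnj c * fip (\<zeta>' \<omega>) (\<eta> \<omega>)"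
      using fip_cnj[OF f(3,1)] fip_cnj[OF f(2,1)] fip_smult[OF f(2,1), of c] by simp
  qed
  then show "S \<xi> (\<lambda>\<omega> j. c \<cdot>\<^sub>v \<eta> \<omega> j) = cnj c * S \<xi> \<eta>"
    using \<zeta>' B.hscale_cls(2)[OF assms(2), of c] assms by (simp add: B.ip_def)
qed

text \<open>The corner of \<open>U\<close> from the sections supported on \<open>A\<close> to those
  supported on \<open>C\<close> is zero.\<close>

definition Null :: "'a set \<Rightarrow> 'b set \<Rightarrow> bool" where
  "Null A C \<longleftrightarrow> (\<forall>\<xi>\<in>A.L2. \<forall>\<eta>\<in>B.L2. S (A.rest A \<xi>) (B.rest C \<eta>) = 0)"

lemma Null_mono:
  assumes "Null A C" "A' \<subseteq> A" "C' \<subseteq> C" "A' \<in> sets M1" "C' \<in> sets M2"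
  shows "Null A' C'"
  unfolding Null_def
proof (intro ballI)
  fix \<xi> \<eta> assume h: "\<xi> \<in> A.L2" "\<eta> \<in> B.L2"
  have "S (A.rest A' \<xi>) (B.rest C' \<eta>) = S (A.rest A (A.rest A' \<xi>)) (B.rest C (B.rest C' \<eta>))"
    using assms h by (intro S_cong AE_I2) (auto simp: A.rest_apply B.rest_apply A.rest_L2 B.rest_L2)
  also have "\<dots> = 0" using assms h by (auto simp: Null_def A.rest_L2 B.rest_L2)
  finally show "S (A.rest A' \<xi>) (B.rest C' \<eta>) = 0" .
qed

text \<open>With the right argument fixed, the form is the inner product with one section
  \<open>\<zeta>\<close>. The corner over \<open>A i\<close> vanishes only if \<open>\<zeta>\<close>
  is zero almost everywhere on \<open>A i\<close>, and countably many exceptional sets can be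
  united; the \<open>A i\<close> may overlap.\<close>

lemma Null_UN_left:
  assumes I: "countable I" and N: "\<And>i. i \<in> I \<Longrightarrow> Null (A i) C" and A: "\<And>i. i \<in> I \<Longrightarrow> A i \<in> sets M1"
    and C: "C \<in> sets M2"
  shows "Null (\<Union>i\<in>I. A i) C"
  unfolding Null_def
proof (intro ballI)
  fix \<xi> \<eta> assume h: "\<xi> \<in> A.L2" "\<eta> \<in> B.L2"
  obtain \<zeta> where \<zeta>: "\<zeta> \<in> A.L2" "\<And>\<xi>. \<xi> \<in> A.L2 \<Longrightarrow> S \<xi> (B.rest C \<eta>) = A.ip \<xi> \<zeta>"
    using U_preimage[OF B.rest_L2(1)[OF C h(2)]] by blast
  have "AE \<omega> in M1. \<omega> \<in> A i \<longrightarrow> \<zeta> \<omega> = (\<lambda>_. 0\<^sub>v (A.deg \<omega>))" if i: "i \<in> I" for i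
  proof (rule A.rest_zero_iff[OF \<zeta>(1) A[OF i]])
    show "A.ip (A.rest (A i) \<zeta>) \<zeta> = 0"
    proof -
      have "S (A.rest (A i) \<zeta>) (B.rest C \<eta>) = 0" using N[OF i] \<zeta>(1) h(2) unfolding Null_def by blast
      then show ?thesis using \<zeta>(2)[OF A.rest_L2(1)[OF A[OF i] \<zeta>(1)]] by simp
    qed
  qed
  then have "AE \<omega> in M1. \<forall>i\<in>I. \<omega> \<in> A i \<longrightarrow> \<zeta> \<omega> = (\<lambda>_. 0\<^sub>v (A.deg \<omega>))"
    unfolding AE_ball_countable[OF I] by blast
  then have "AE \<omega> in M1. \<omega> \<in> (\<Union>i\<in>I. A i) \<longrightarrow> \<zeta> \<omega> = (\<lambda>_. 0\<^sub>v (A.deg \<omega>))"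
    by eventually_elim blast
  moreover have "(\<Union>i\<in>I. A i) \<in> sets M1" using I A by (intro sets.countable_UN') auto
  ultimately show "S (A.rest (\<Union>i\<in>I. A i) \<xi>) (B.rest C \<eta>) = 0"
    using \<zeta>(2) A.rest_L2(1) A.ip_rest_zero(1)[OF h(1) \<zeta>(1)] h by simp
qed

lemma Null_UN_right:
  assumes I: "countable I" and N: "\<And>i. i \<in> I \<Longrightarrow> Null A (C i)" and C: "\<And>i. i \<in> I \<Longrightarrow> C i \<in> sets M2"
    and A: "A \<in> sets M1"
  shows "Null A (\<Union>i\<in>I. C i)"
  unfolding Null_def
proof (intro ballI)
  fix \<xi> \<eta> assume h: "\<xi> \<in> A.L2" "\<eta> \<in> B.L2"
  obtain \<zeta> where \<zeta>: "\<zeta> \<in> B.L2" "\<And>\<eta>. \<eta> \<in> B.L2 \<Longrightarrow> S (A.rest A \<xi>) \<eta> = B.ip \<zeta> \<eta>"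
    using U_rep[OF A.rest_L2(1)[OF A h(1)]] by blast
  have "AE \<omega> in M2. \<omega> \<in> C i \<longrightarrow> \<zeta> \<omega> = (\<lambda>_. 0\<^sub>v (B.deg \<omega>))" if i: "i \<in> I" for i
  proof (rule B.rest_zero_iff[OF \<zeta>(1) C[OF i]])
    show "B.ip (B.rest (C i) \<zeta>) \<zeta> = 0"
    proof -
      have "S (A.rest A \<xi>) (B.rest (C i) \<zeta>) = 0" using N[OF i] \<zeta>(1) h(1) unfolding Null_def by blast
      then show ?thesis
        using \<zeta>(2)[OF B.rest_L2(1)[OF C[OF i] \<zeta>(1)]] by (simp add: B.ip_rest(1)[OF \<zeta>(1,1)])
    qed
  qed
  then have "AE \<omega> in M2. \<forall>i\<in>I. \<omega> \<in> C i \<longrightarrow> \<zeta> \<omega> = (\<lambda>_. 0\<^sub>v (B.deg \<omega>))"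
    unfolding AE_ball_countable[OF I] by blast
  then have "AE \<omega> in M2. \<omega> \<in> (\<Union>i\<in>I. C i) \<longrightarrow> \<zeta> \<omega> = (\<lambda>_. 0\<^sub>v (B.deg \<omega>))"
    by eventually_elim blast
  moreover have "(\<Union>i\<in>I. C i) \<in> sets M2" using I C by (intro sets.countable_UN') auto
  ultimately show "S (A.rest A \<xi>) (B.rest (\<Union>i\<in>I. C i) \<eta>) = 0"
    using \<zeta>(2) B.rest_L2(1) B.ip_rest_zero(2)[OF h(2) \<zeta>(1)] h by simp
qed

text \<open>The unitary maps the graph of the first generator onto that of the second. The first
  identity uses the images of points of the first graph, the second uses preimages of points of the
  second. In both the adjoint is moved inside each fibre, so the adjoint of the unbounded direct
  integral does not occur.\<close>

lemma S_generator:
  assumes s: "s \<in> {1..k}" and A: "A \<in> sets M1" and C: "C \<in> sets M2"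
    and h: "\<xi> \<in> A.L2" "\<eta> \<in> B.L2"
    and KA: "\<And>\<omega>. \<omega> \<in> A \<Longrightarrow> frob (X1 s \<omega>) \<le> K" and KC: "\<And>\<omega>. \<omega> \<in> C \<Longrightarrow> frob (X2 s \<omega>) \<le> K"
    and K: "0 \<le> K"
  shows "S (A.act (A.cut A (X1 s)) \<xi>) (B.rest C \<eta>)
      = S (A.rest A \<xi>) (B.act (B.cut C (\<lambda>\<omega>. mat_adjoint (X2 s \<omega>))) \<eta>)" (is ?t1)
    "S (A.act (A.cut A (\<lambda>\<omega>. mat_adjoint (X1 s \<omega>))) \<xi>) (B.rest C \<eta>)
      = S (A.rest A \<xi>) (B.act (B.cut C (X2 s)) \<eta>)" (is ?t2)
proof -
  note mA = A.mfield_X[OF s] A.mfield_adjoint[OF A.mfield_X[OF s]]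
  note mB = B.mfield_X[OF s] B.mfield_adjoint[OF B.mfield_X[OF s]]
  have LA: "A.act (A.cut A (X1 s)) \<xi> \<in> A.L2" "A.act (A.cut A (\<lambda>\<omega>. mat_adjoint (X1 s \<omega>))) \<xi> \<in> A.L2"
    using KA by (auto intro!: A.L2_act(1)[OF A.mfield_cut[OF A] A.opbound_cut_frob h(1)] mA K)
  have LB: "B.act (B.cut C (X2 s)) \<eta> \<in> B.L2" "B.act (B.cut C (\<lambda>\<omega>. mat_adjoint (X2 s \<omega>))) \<eta> \<in> B.L2"
    using KC by (auto intro!: B.L2_act(1)[OF B.mfield_cut[OF C] B.opbound_cut_frob h(2)] mB K)
  note RA = A.rest_L2(1)[OF A h(1)] and RB = B.rest_L2(1)[OF C h(2)]
  have zA: "X1 s \<omega> *\<^sub>v 0\<^sub>v (A.deg \<omega>) = 0\<^sub>v (A.deg \<omega>)" if "\<omega> \<in> space M1" for \<omega>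
    using A.X_carrier[OF that s] by (intro eq_vecI) auto
  have zB: "X2 s \<omega> *\<^sub>v 0\<^sub>v (B.deg \<omega>) = 0\<^sub>v (B.deg \<omega>)" if "\<omega> \<in> space M2" for \<omega>
    using B.X_carrier[OF that s] by (intro eq_vecI) auto
  show ?t1
  proof -
    \<comment> \<open>The bound on \<open>A\<close> makes the image section square integrable, so
      this pair belongs to the graph.\<close>
    have "(A.cls (A.rest A \<xi>), A.cls (A.act (A.cut A (X1 s)) \<xi>)) \<in> mult_integral_tuple M1 f1 X1 s"
      unfolding A.graph_iff[OF s] using RA LA(1)
      by (auto intro!: exI AE_I2 simp: A.act_cut h A.rest_apply zA)
    then have "(U (A.cls (A.rest A \<xi>)), U (A.cls (A.act (A.cut A (X1 s)) \<xi>))) \<in> mult_integral_tuple M2 f2 X2 s"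
      unfolding U_graph[OF s, symmetric] by (rule map_prod_imageI)
    then obtain \<zeta> \<zeta>' where \<zeta>: "U (A.cls (A.rest A \<xi>)) = B.cls \<zeta>" "U (A.cls (A.act (A.cut A (X1 s)) \<xi>)) = B.cls \<zeta>'"
      "\<zeta> \<in> B.L2" "\<zeta>' \<in> B.L2" "AE \<omega> in M2. \<zeta>' \<omega> = (\<lambda>j. X2 s \<omega> *\<^sub>v \<zeta> \<omega> j)"
      unfolding B.graph_iff[OF s] by blast
    have "B.ip \<zeta>' (B.rest C \<eta>) = B.ip \<zeta> (B.act (B.cut C (\<lambda>\<omega>. mat_adjoint (X2 s \<omega>))) \<eta>)"
      unfolding B.ip_def
    proof (rule integral_cong_AE)
      show "AE \<omega> in M2. fip (\<zeta>' \<omega>) (B.rest C \<eta> \<omega>) = fip (\<zeta> \<omega>) (B.act (B.cut C (\<lambda>\<omega>. mat_adjoint (X2 s \<omega>))) \<eta> \<omega>)"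
        using \<zeta>(5) AE_space
      proof eventually_elim
        case (elim \<omega>)
        note c = fibreD(1)[OF B.L2_fibre[OF \<zeta>(3) elim(2)]] fibreD(1)[OF B.L2_fibre[OF \<zeta>(4) elim(2)]]
          fibreD(1)[OF B.L2_fibre[OF h(2) elim(2)]]
        show ?case
          using c fip_adjoint[of "\<zeta> \<omega>" "B.deg \<omega>" "\<eta> \<omega>" "X2 s \<omega>"] B.X_carrier[OF elim(2) s] elim(1)
          by (cases "\<omega> \<in> C") (simp_all add: B.rest_apply B.act_cut elim(2) h)
      qed
    qed (use B.fip_integrable[OF \<zeta>(4) RB] B.fip_integrable[OF \<zeta>(3) LB(2)] in auto)
    then show ?t1 unfolding S_def \<zeta>(1,2) B.hinner_cls[OF \<zeta>(4) RB] B.hinner_cls[OF \<zeta>(3) LB(2)] .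
  qed
  show ?t2
  proof -
    have "(B.cls (B.rest C \<eta>), B.cls (B.act (B.cut C (X2 s)) \<eta>)) \<in> mult_integral_tuple M2 f2 X2 s"
      unfolding B.graph_iff[OF s] using RB LB(1)
      by (auto intro!: exI AE_I2 simp: B.act_cut h B.rest_apply zB)
    then have "(B.cls (B.rest C \<eta>), B.cls (B.act (B.cut C (X2 s)) \<eta>)) \<in> map_prod U U ` mult_integral_tuple M1 f1 X1 s"
      unfolding U_graph[OF s] .
    \<comment> \<open>Here the equality of graphs is used backwards: a point of the second graph
      comes from the first one.\<close>
    then obtain \<zeta> \<zeta>' where \<zeta>: "B.cls (B.rest C \<eta>) = U (A.cls \<zeta>)" "B.cls (B.act (B.cut C (X2 s)) \<eta>) = U (A.cls \<zeta>')"
      "\<zeta> \<in> A.L2" "\<zeta>' \<in> A.L2" "AE \<omega> in M1. \<zeta>' \<omega> = (\<lambda>j. X1 s \<omega> *\<^sub>v \<zeta> \<omega> j)"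
      unfolding A.graph_iff[OF s] by (auto simp: map_prod_def)
    have "A.ip (A.act (A.cut A (\<lambda>\<omega>. mat_adjoint (X1 s \<omega>))) \<xi>) \<zeta> = A.ip (A.rest A \<xi>) \<zeta>'"
      unfolding A.ip_def
    proof (rule integral_cong_AE)
      show "AE \<omega> in M1. fip (A.act (A.cut A (\<lambda>\<omega>. mat_adjoint (X1 s \<omega>))) \<xi> \<omega>) (\<zeta> \<omega>) = fip (A.rest A \<xi> \<omega>) (\<zeta>' \<omega>)"
        using \<zeta>(5) AE_space
      proof eventually_elim
        case (elim \<omega>)
        note c = fibreD(1)[OF A.L2_fibre[OF \<zeta>(3) elim(2)]] fibreD(1)[OF A.L2_fibre[OF \<zeta>(4) elim(2)]]
          fibreD(1)[OF A.L2_fibre[OF h(1) elim(2)]]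
        show ?case
          using c fip_adjoint[of "\<xi> \<omega>" "A.deg \<omega>" "\<zeta> \<omega>" "mat_adjoint (X1 s \<omega>)"] A.X_carrier[OF elim(2) s] elim(1)
          by (cases "\<omega> \<in> A") (simp_all add: A.rest_apply A.act_cut elim(2) h)
      qed
    qed (use A.fip_integrable[OF RA \<zeta>(4)] A.fip_integrable[OF LA(2) \<zeta>(3)] in auto)
    then show ?t2 unfolding S_def \<zeta>(1,2) U_isometric[OF RA \<zeta>(4)] U_isometric[OF LA(2) \<zeta>(3)] .
  qed
qed

end

text \<open>Bessel's inequality for each coordinate vector, summed over the coordinates: every
  normalised \<open>w c\<close> contributes 1 to the total and every coordinate receives at most
  1.\<close>

lemma card_orthogonal_le:
  fixes w :: "'c \<Rightarrow> 'x \<Rightarrow> complex"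
  assumes I: "finite I" and X: "finite X"
    and nz: "\<And>c. c \<in> I \<Longrightarrow> (\<Sum>x\<in>X. w c x * cnj (w c x)) \<noteq> 0"
    and orth: "\<And>c d. c \<in> I \<Longrightarrow> d \<in> I \<Longrightarrow> c \<noteq> d \<Longrightarrow> (\<Sum>x\<in>X. w c x * cnj (w d x)) = 0"
  shows "card I \<le> card X"
proof -
  define N where "N c = (\<Sum>x\<in>X. (cmod (w c x))\<^sup>2)" for c
  have Nc: "(\<Sum>x\<in>X. w c x * cnj (w c x)) = of_real (N c)" for c
    by (simp add: N_def complex_norm_square del: of_real_power)
  have N0: "N c > 0" if "c \<in> I" for c
  proof -
    have "N c \<noteq> 0" using nz[OF that] unfolding Nc by simp
    moreover have "N c \<ge> 0" unfolding N_def by (intro sum_nonneg) auto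
    ultimately show ?thesis by simp
  qed
  have bessel: "(\<Sum>c\<in>I. (cmod (w c y))\<^sup>2 / N c) \<le> 1" if y: "y \<in> X" for y
  proof -
    \<comment> \<open>The Fourier coefficients of the coordinate vector \<open>\<delta>\<close> at
      \<open>y\<close>; \<open>g\<close> is its projection onto the span of the \<open>w c\<close>,
      and \<open>s\<close> is the squared length of \<open>g\<close>.\<close>
    define a where "a c = cnj (w c y) / N c" for c
    define \<delta> where "\<delta> x = (if x = y then 1 else 0 :: complex)" for x
    define g where "g x = (\<Sum>c\<in>I. a c * w c x)" for x
    define s where "s = (\<Sum>c\<in>I. (cmod (w c y))\<^sup>2 / N c)"
    have aw: "a c * w c y = of_real ((cmod (w c y))\<^sup>2 / N c)" for c
      by (simp add: a_def complex_norm_square mult.commute del: of_real_power)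
    have gy: "g y = of_real s" unfolding g_def s_def using aw by simp
    have \<delta>1: "(\<Sum>x\<in>X. \<delta> x * cnj (g x)) = of_real s"
    proof -
      have "(\<Sum>x\<in>X. \<delta> x * cnj (g x)) = (\<Sum>x\<in>X. if x = y then cnj (g y) else 0)"
        by (intro sum.cong) (auto simp: \<delta>_def)
      then show ?thesis using X y gy by simp
    qed
    have \<delta>2: "(\<Sum>x\<in>X. g x * cnj (\<delta> x)) = of_real s"
    proof -
      have "(\<Sum>x\<in>X. g x * cnj (\<delta> x)) = (\<Sum>x\<in>X. if x = y then g y else 0)"
        by (intro sum.cong) (auto simp: \<delta>_def)
      then show ?thesis using X y gy by simp
    qed
    have \<delta>3: "(\<Sum>x\<in>X. \<delta> x * cnj (\<delta> x)) = 1"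
    proof -
      have "(\<Sum>x\<in>X. \<delta> x * cnj (\<delta> x)) = (\<Sum>x\<in>X. if x = y then 1 else 0)"
        by (intro sum.cong) (auto simp: \<delta>_def)
      then show ?thesis using X y by simp
    qed
    have gg: "(\<Sum>x\<in>X. g x * cnj (g x)) = of_real s"
    proof -
      have "(\<Sum>x\<in>X. g x * cnj (g x)) = (\<Sum>x\<in>X. \<Sum>c\<in>I. \<Sum>d\<in>I. a c * cnj (a d) * (w c x * cnj (w d x)))"
        unfolding g_def by (simp add: sum_product mult_ac)
      also have "\<dots> = (\<Sum>c\<in>I. \<Sum>x\<in>X. \<Sum>d\<in>I. a c * cnj (a d) * (w c x * cnj (w d x)))" by (rule sum.swap)
      also have "\<dots> = (\<Sum>c\<in>I. \<Sum>d\<in>I. \<Sum>x\<in>X. a c * cnj (a d) * (w c x * cnj (w d x)))"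
        by (intro sum.cong refl sum.swap)
      also have "\<dots> = (\<Sum>c\<in>I. \<Sum>d\<in>I. if d = c then a c * cnj (a c) * of_real (N c) else 0)"
        by (intro sum.cong refl) (auto simp: sum_distrib_left[symmetric] orth Nc)
      also have "\<dots> = (\<Sum>c\<in>I. a c * cnj (a c) * of_real (N c))" using I by simp
      also have "\<dots> = (\<Sum>c\<in>I. of_real ((cmod (w c y))\<^sup>2 / N c))"
      proof (intro sum.cong refl)
        fix c assume "c \<in> I"
        then have "N c \<noteq> 0" using N0[of c] by simp
        then show "a c * cnj (a c) * of_real (N c) = of_real ((cmod (w c y))\<^sup>2 / N c)"
          by (simp add: a_def complex_norm_square mult.commute del: of_real_power)
      qed
      finally show ?thesis by (simp add: s_def)
    qed
    \<comment> \<open>The squared distance from \<open>\<delta>\<close> to \<open>g\<close> is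
      \<open>1 - s\<close>, which is therefore nonnegative.\<close>
    have "of_real (\<Sum>x\<in>X. (cmod (\<delta> x - g x))\<^sup>2) = (\<Sum>x\<in>X. (\<delta> x - g x) * cnj (\<delta> x - g x))"
      by (simp only: of_real_sum complex_norm_square)
    also have "\<dots> = (\<Sum>x\<in>X. \<delta> x * cnj (\<delta> x)) - (\<Sum>x\<in>X. \<delta> x * cnj (g x)) - (\<Sum>x\<in>X. g x * cnj (\<delta> x)) + (\<Sum>x\<in>X. g x * cnj (g x))"
      by (simp add: algebra_simps sum.distrib sum_subtractf)
    also have "\<dots> = of_real (1 - s)" unfolding \<delta>1 \<delta>2 \<delta>3 gg by simp
    finally have "(\<Sum>x\<in>X. (cmod (\<delta> x - g x))\<^sup>2) = 1 - s" using of_real_eq_iff by blast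
    moreover have "0 \<le> (\<Sum>x\<in>X. (cmod (\<delta> x - g x))\<^sup>2)" by (intro sum_nonneg) auto
    ultimately show ?thesis by (simp add: s_def)
  qed
  have "real (card I) = (\<Sum>c\<in>I. N c / N c)" using N0 by (simp add: less_imp_neq[symmetric])
  also have "\<dots> = (\<Sum>c\<in>I. \<Sum>y\<in>X. (cmod (w c y))\<^sup>2 / N c)"
    unfolding sum_divide_distrib[symmetric] N_def[symmetric] ..
  also have "\<dots> = (\<Sum>y\<in>X. \<Sum>c\<in>I. (cmod (w c y))\<^sup>2 / N c)" by (rule sum.swap)
  also have "\<dots> \<le> (\<Sum>y\<in>X. 1)" by (intro sum_mono bessel)
  finally show ?thesis by simp
qed

lemma card_orthogonal_fibre:
  assumes I: "finite I" and w: "\<And>c. c \<in> I \<Longrightarrow> w c \<in> fibre n (enat m)"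
    and nz: "\<And>c. c \<in> I \<Longrightarrow> fnorm2 (w c) \<noteq> 0"
    and orth: "\<And>c d. c \<in> I \<Longrightarrow> d \<in> I \<Longrightarrow> c \<noteq> d \<Longrightarrow> fip (w c) (w d) = 0"
  shows "card I \<le> m * n"
proof -
  have fip: "fip (w c) (w d) = (\<Sum>x\<in>{..<m} \<times> {..<n}. w c (fst x) $ snd x * cnj (w d (fst x) $ snd x))"
    if "c \<in> I" "d \<in> I" for c d
  proof -
    have "fip (w c) (w d) = (\<Sum>j<m. w c j \<bullet>c w d j)"
      unfolding fip_def using fibreD(1,2)[OF w[OF that(1)]] fibreD(1,2)[OF w[OF that(2)]]
      by (intro suminf_finite) auto
    also have "\<dots> = (\<Sum>j<m. \<Sum>i<n. w c j $ i * cnj (w d j $ i))"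
      by (intro sum.cong refl cscalar_index fibreD(1)[OF w[OF that(2)]])
    finally show ?thesis by (simp add: sum.cartesian_product case_prod_unfold)
  qed
  have "card I \<le> card ({..<m} \<times> {..<n})"
  proof (rule card_orthogonal_le[where w = "\<lambda>c x. w c (fst x) $ snd x"])
    show "(\<Sum>x\<in>{..<m} \<times> {..<n}. w c (fst x) $ snd x * cnj (w c (fst x) $ snd x)) \<noteq> 0" if "c \<in> I" for c
      unfolding fip[OF that that, symmetric] using nz[OF that] fip_self[OF w[OF that]] by simp
    show "(\<Sum>x\<in>{..<m} \<times> {..<n}. w c (fst x) $ snd x * cnj (w d (fst x) $ snd x)) = 0" if "c \<in> I" "d \<in> I" "c \<noteq> d" for c d
      using orth[OF that] fip[OF that(1,2)] by simp
  qed (use I in auto)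
  then show ?thesis by simp
qed

section \<open>Regions of bounded degree and bounded generators\<close>

context mult_field
begin

text \<open>On such a set every polynomial in the generators and their adjoints is a bounded field,
  by \<open>frob_pev_bounded\<close>, so its cut acts on \<open>L2\<close>.\<close>

definition tame :: "nat \<Rightarrow> 'w set \<Rightarrow> bool" where
  "tame K A \<longleftrightarrow> A \<in> sets M \<and> (\<forall>\<omega>\<in>A. deg \<omega> \<le> K \<and> (\<forall>s\<in>{1..k}. frob (X s \<omega>) \<le> real K))"

lemma tame_letters: "tame K A \<Longrightarrow> \<omega> \<in> A \<Longrightarrow> frob (letters k (\<lambda>s. X s \<omega>) s b) \<le> real K"
  using Suc_mod_range[OF k, of s] by (auto simp: tame_def letters_def Let_def)

lemma tame_ev:
  assumes "tame K A"
  obtains C where "0 \<le> C" "\<And>\<omega>. \<omega> \<in> A \<Longrightarrow> frob (ev p \<omega>) \<le> C"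
proof -
  obtain C where C: "C \<ge> 0" "\<And>n L. (\<forall>s b. L s b \<in> carrier_mat n n) \<longrightarrow> real n \<le> real K \<longrightarrow>
      (\<forall>s b. frob (L s b) \<le> real K) \<longrightarrow> frob (pev n L p) \<le> C"
    using frob_pev_bounded[of "real K" p] by blast
  show thesis
  proof (rule that[OF C(1)])
    fix \<omega> assume w: "\<omega> \<in> A"
    then have sp: "\<omega> \<in> space M" using assms sets.sets_into_space by (auto simp: tame_def)
    have "\<forall>s b. letters k (\<lambda>s. X s \<omega>) s b \<in> carrier_mat (deg \<omega>) (deg \<omega>)"
      using letters_carrier[OF tuple[OF sp] k] by (simp add: deg_def)
    moreover have "\<forall>s b. frob (letters k (\<lambda>s. X s \<omega>) s b) \<le> real K" using tame_letters[OF assms w] by blast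
    moreover have "real (deg \<omega>) \<le> real K" using assms w by (auto simp: tame_def)
    ultimately show "frob (ev p \<omega>) \<le> C" using C(2) by (simp add: ev_def deg_def)
  qed
qed

lemma ev_L2:
  assumes "tame K A" "\<xi> \<in> L2"
  shows "act (cut A (ev p)) \<xi> \<in> L2" "act (cut A (\<lambda>\<omega>. mat_adjoint (ev p \<omega>))) \<xi> \<in> L2"
    "act (cut A (\<lambda>\<omega>. letters k (\<lambda>s. X s \<omega>) s b)) \<xi> \<in> L2"
proof -
  have A: "A \<in> sets M" using assms by (simp add: tame_def)
  obtain C where C: "0 \<le> C" "\<And>\<omega>. \<omega> \<in> A \<Longrightarrow> frob (ev p \<omega>) \<le> C" using tame_ev[OF assms(1)] by blast
  show "act (cut A (ev p)) \<xi> \<in> L2"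
    using C by (intro L2_act(1)[OF mfield_cut[OF A mfield_ev] opbound_cut_frob[OF mfield_ev] assms(2)]) auto
  show "act (cut A (\<lambda>\<omega>. mat_adjoint (ev p \<omega>))) \<xi> \<in> L2"
    using C by (intro L2_act(1)[OF mfield_cut[OF A mfield_adjoint[OF mfield_ev]] opbound_cut_frob[OF mfield_adjoint[OF mfield_ev]] assms(2)]) auto
  show "act (cut A (\<lambda>\<omega>. letters k (\<lambda>s. X s \<omega>) s b)) \<xi> \<in> L2"
    using tame_letters[OF assms(1)]
    by (intro L2_act(1)[OF mfield_cut[OF A mfield_letters] opbound_cut_frob[OF mfield_letters, of "real K"] assms(2)]) auto
qed

lemma nrm_smult:
  assumes "\<xi> \<in> L2"
  shows "nrm (\<lambda>\<omega> j. c \<cdot>\<^sub>v \<xi> \<omega> j) = (cmod c)\<^sup>2 * nrm \<xi>"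
proof -
  have "fnorm2 (\<lambda>j. c \<cdot>\<^sub>v \<xi> \<omega> j) = (cmod c)\<^sup>2 * fnorm2 (\<xi> \<omega>)" if "\<omega> \<in> space M" for \<omega>
    unfolding fnorm2_def vnorm2_smult by (rule suminf_mult[OF fibreD(3)[OF L2_fibre[OF assms that]]])
  then have "nrm (\<lambda>\<omega> j. c \<cdot>\<^sub>v \<xi> \<omega> j) = (\<integral>\<omega>. (cmod c)\<^sup>2 * fnorm2 (\<xi> \<omega>) \<partial>M)"
    unfolding nrm_def by (intro Bochner_Integration.integral_cong refl)
  then show ?thesis by (simp add: nrm_def)
qed

lemma ev_carrier: "\<omega> \<in> space M \<Longrightarrow> ev p \<omega> \<in> carrier_mat (deg \<omega>) (deg \<omega>)"
  using mfield_ev by (auto simp: mfield_def)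

lemma letters_deg: "\<omega> \<in> space M \<Longrightarrow> letters k (\<lambda>s. X s \<omega>) s b \<in> carrier_mat (deg \<omega>) (deg \<omega>)"
  using letters_carrier[OF tuple k] by (simp add: deg_def)

definition tames :: "nat \<Rightarrow> 'w set" where
  "tames K = {\<omega> \<in> space M. deg \<omega> \<le> K} \<inter> (\<Inter>s\<in>{1..k}. {\<omega> \<in> space M. frob (X s \<omega>) \<le> real K})"

lemma tames_sets: "tames K \<in> sets M"
  unfolding tames_def
proof (intro sets.Int sets.finite_INT)
  show "{\<omega> \<in> space M. deg \<omega> \<le> K} \<in> sets M" by measurable
  show "{\<omega> \<in> space M. frob (X s \<omega>) \<le> real K} \<in> sets M" if "s \<in> {1..k}" for s
    using frob_measurable[OF mfield_X[OF that]] by measurable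
qed (use k in auto)

lemma tames_UN: "space M = (\<Union>K. tames K)"
proof (intro equalityI subsetI)
  fix \<omega> assume w: "\<omega> \<in> space M"
  obtain K :: nat where K: "real (deg \<omega>) + (\<Sum>s\<in>{1..k}. frob (X s \<omega>)) \<le> real K" using real_arch_simple by blast
  have "frob (X s \<omega>) \<le> (\<Sum>s\<in>{1..k}. frob (X s \<omega>))" if "s \<in> {1..k}" for s
    using that by (intro member_le_sum) auto
  moreover have "0 \<le> (\<Sum>s\<in>{1..k}. frob (X s \<omega>))" by (intro sum_nonneg) auto
  ultimately have "\<omega> \<in> tames K" using K w by (force simp: tames_def)
  then show "\<omega> \<in> (\<Union>K. tames K)" by blast
qed (auto simp: tames_def)

text \<open>The slack between \<open>K\<close> and \<open>K'\<close> lets sets from both fields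
  share the larger of their bounds.\<close>

lemma tame_tames:
  assumes "A \<in> sets M" "K \<le> K'"
  shows "tame K' (A \<inter> tames K)"
  unfolding tame_def
proof (intro conjI ballI)
  show "A \<inter> tames K \<in> sets M" using assms tames_sets by auto
  fix \<omega> assume w: "\<omega> \<in> A \<inter> tames K"
  show "deg \<omega> \<le> K'" using w assms by (auto simp: tames_def)
  fix s assume "s \<in> {1..k}"
  then have "frob (X s \<omega>) \<le> real K" using w unfolding tames_def by blast
  then show "frob (X s \<omega>) \<le> real K'" using assms(2) by linarith
qed

end

context unitary_pair
begin

lemma S_letter:
  assumes A: "A.tame K A" and C: "B.tame K C" and h: "\<xi> \<in> A.L2" "\<eta> \<in> B.L2"
  shows "S (A.act (A.cut A (\<lambda>\<omega>. letters k (\<lambda>s. X1 s \<omega>) s b)) \<xi>) (B.rest C \<eta>)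
      = S (A.rest A \<xi>) (B.act (B.cut C (\<lambda>\<omega>. letters k (\<lambda>s. X2 s \<omega>) s (\<not> b))) \<eta>)"
proof -
  note r = Suc_mod_range[OF A.k, of s]
  have bA: "frob (X1 (Suc (s mod k)) \<omega>) \<le> real K" if "\<omega> \<in> A" for \<omega> using A r that by (auto simp: A.tame_def)
  have bC: "frob (X2 (Suc (s mod k)) \<omega>) \<le> real K" if "\<omega> \<in> C" for \<omega> using C r that by (auto simp: B.tame_def)
  have sA: "A \<in> sets M1" and sC: "C \<in> sets M2" using A C by (auto simp: A.tame_def B.tame_def)
  show ?thesis
    using S_generator[OF r sA sC h bA bC] by (cases b) (simp_all add: letters_def)
qed

text \<open>Induction on the polynomial. \<open>S_letter\<close> moves the outermost letter to the
  right argument, where its adjoint acts first, in accordance with the reversed order in the adjoint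
  of a product.\<close>

lemma S_ev:
  assumes A: "A.tame K A" and C: "B.tame K C" and h: "\<xi> \<in> A.L2" "\<eta> \<in> B.L2"
  shows "S (A.act (A.cut A (A.ev p)) \<xi>) (B.rest C \<eta>)
      = S (A.rest A \<xi>) (B.act (B.cut C (\<lambda>\<omega>. mat_adjoint (B.ev p \<omega>))) \<eta>)"
  using h
proof (induction p arbitrary: \<xi> \<eta>)
  case POne
  have "A.ev POne = (\<lambda>\<omega>. 1\<^sub>m (A.deg \<omega>))" by (simp add: A.ev_def A.deg_def fun_eq_iff)
  moreover have "(\<lambda>\<omega>. mat_adjoint (B.ev POne \<omega>)) = (\<lambda>\<omega>. 1\<^sub>m (B.deg \<omega>))" by (simp add: B.ev_def B.deg_def fun_eq_iff)
  ultimately show ?case by (simp add: A.rest_def B.rest_def)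
next
  case (PLet s b p)
  note h = PLet.prems
  define \<zeta> where "\<zeta> = A.act (A.cut A (A.ev p)) \<xi>"
  define \<theta> where "\<theta> = B.act (B.cut C (\<lambda>\<omega>. letters k (\<lambda>s. X2 s \<omega>) s (\<not> b))) \<eta>"
  have \<zeta>: "\<zeta> \<in> A.L2" unfolding \<zeta>_def by (rule A.ev_L2(1)[OF A h(1)])
  have \<theta>: "\<theta> \<in> B.L2" unfolding \<theta>_def by (rule B.ev_L2(3)[OF C h(2)])
  have "S (A.act (A.cut A (A.ev (PLet s b p))) \<xi>) (B.rest C \<eta>)
      = S (A.act (A.cut A (\<lambda>\<omega>. letters k (\<lambda>s. X1 s \<omega>) s b)) \<zeta>) (B.rest C \<eta>)"
  proof (intro S_cong AE_I2 refl)
    fix \<omega> assume w: "\<omega> \<in> space M1"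
    have "A.ev (PLet s b p) \<omega> *\<^sub>v \<xi> \<omega> j = letters k (\<lambda>s. X1 s \<omega>) s b *\<^sub>v (A.ev p \<omega> *\<^sub>v \<xi> \<omega> j)" for j
      using assoc_mult_mat_vec[OF A.letters_deg[OF w] A.ev_carrier[OF w] fibreD(1)[OF A.L2_fibre[OF h(1) w]], of s b p j]
      by (simp add: A.ev_def A.deg_def)
    then show "A.act (A.cut A (A.ev (PLet s b p))) \<xi> \<omega> = A.act (A.cut A (\<lambda>\<omega>. letters k (\<lambda>s. X1 s \<omega>) s b)) \<zeta> \<omega>"
      by (simp add: A.act_cut w h \<zeta>) (simp add: \<zeta>_def A.act_cut w h)
  qed
  also have "\<dots> = S (A.rest A \<zeta>) \<theta>" unfolding \<theta>_def by (rule S_letter[OF A C \<zeta> h(2)])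
  also have "\<dots> = S \<zeta> (B.rest C \<theta>)"
  proof (intro S_cong AE_I2)
    show "A.rest A \<zeta> \<omega> = \<zeta> \<omega>" if w: "\<omega> \<in> space M1" for \<omega>
      by (simp add: A.rest_apply \<zeta> w) (simp add: \<zeta>_def A.act_cut w h)
    show "\<theta> \<omega> = B.rest C \<theta> \<omega>" if w: "\<omega> \<in> space M2" for \<omega>
      by (simp add: B.rest_apply \<theta> w) (simp add: \<theta>_def B.act_cut w h)
  qed
  also have "\<dots> = S (A.rest A \<xi>) (B.act (B.cut C (\<lambda>\<omega>. mat_adjoint (B.ev p \<omega>))) \<theta>)"
    unfolding \<zeta>_def by (rule PLet.IH[OF h(1) \<theta>])
  also have "\<dots> = S (A.rest A \<xi>) (B.act (B.cut C (\<lambda>\<omega>. mat_adjoint (B.ev (PLet s b p) \<omega>))) \<eta>)"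
  proof (intro S_cong AE_I2 refl)
    fix \<omega> assume w: "\<omega> \<in> space M2"
    have "mat_adjoint (B.ev (PLet s b p) \<omega>) *\<^sub>v \<eta> \<omega> j = mat_adjoint (B.ev p \<omega>) *\<^sub>v (letters k (\<lambda>s. X2 s \<omega>) s (\<not> b) *\<^sub>v \<eta> \<omega> j)" for j
    proof -
      have "mat_adjoint (B.ev (PLet s b p) \<omega>) = mat_adjoint (B.ev p \<omega>) * letters k (\<lambda>s. X2 s \<omega>) s (\<not> b)"
        using mat_adjoint_mult[OF B.letters_deg[OF w] B.ev_carrier[OF w], of s b p]
        by (simp add: letters_not B.ev_def)
      then show ?thesis
        using assoc_mult_mat_vec[OF mat_adjoint_carrier[OF B.ev_carrier[OF w]] B.letters_deg[OF w] fibreD(1)[OF B.L2_fibre[OF h(2) w]]]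
        by simp
    qed
    then show "B.act (B.cut C (\<lambda>\<omega>. mat_adjoint (B.ev p \<omega>))) \<theta> \<omega> = B.act (B.cut C (\<lambda>\<omega>. mat_adjoint (B.ev (PLet s b p) \<omega>))) \<eta> \<omega>"
      by (simp add: B.act_cut w h \<theta>) (simp add: \<theta>_def B.act_cut w h)
  qed
  finally show ?case .
next
  case (PAdd p q)
  note h = PAdd.prems
  have "S (A.act (A.cut A (A.ev (PAdd p q))) \<xi>) (B.rest C \<eta>)
      = S (\<lambda>\<omega> j. A.act (A.cut A (A.ev p)) \<xi> \<omega> j + A.act (A.cut A (A.ev q)) \<xi> \<omega> j) (B.rest C \<eta>)"
  proof (intro S_cong AE_I2 refl)
    fix \<omega> assume w: "\<omega> \<in> space M1"
    have "A.ev (PAdd p q) \<omega> *\<^sub>v \<xi> \<omega> j = A.ev p \<omega> *\<^sub>v \<xi> \<omega> j + A.ev q \<omega> *\<^sub>v \<xi> \<omega> j" for j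
      using add_mult_distrib_mat_vec[OF A.ev_carrier[OF w] A.ev_carrier[OF w] fibreD(1)[OF A.L2_fibre[OF h(1) w]], of p q j]
      by (simp add: A.ev_def)
    then show "A.act (A.cut A (A.ev (PAdd p q))) \<xi> \<omega> = (\<lambda>j. A.act (A.cut A (A.ev p)) \<xi> \<omega> j + A.act (A.cut A (A.ev q)) \<xi> \<omega> j)"
      by (simp add: A.act_cut w h fun_eq_iff)
  qed
  also have "\<dots> = S (A.rest A \<xi>) (\<lambda>\<omega> j. B.act (B.cut C (\<lambda>\<omega>. mat_adjoint (B.ev p \<omega>))) \<eta> \<omega> j
      + B.act (B.cut C (\<lambda>\<omega>. mat_adjoint (B.ev q \<omega>))) \<eta> \<omega> j)"
    using S_add(1)[OF A.ev_L2(1)[OF A h(1), of p] A.ev_L2(1)[OF A h(1), of q] B.rest_L2(1)[OF _ h(2)] B.rest_L2(1)[OF _ h(2)], of C C]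
      S_add(2)[OF A.rest_L2(1)[OF _ h(1)] A.rest_L2(1)[OF _ h(1)] B.ev_L2(2)[OF C h(2), of p] B.ev_L2(2)[OF C h(2), of q], of A A]
      A C PAdd.IH[OF h] by (simp add: A.tame_def B.tame_def)
  also have "\<dots> = S (A.rest A \<xi>) (B.act (B.cut C (\<lambda>\<omega>. mat_adjoint (B.ev (PAdd p q) \<omega>))) \<eta>)"
  proof (intro S_cong AE_I2 refl)
    fix \<omega> assume w: "\<omega> \<in> space M2"
    have "mat_adjoint (B.ev (PAdd p q) \<omega>) *\<^sub>v \<eta> \<omega> j = mat_adjoint (B.ev p \<omega>) *\<^sub>v \<eta> \<omega> j + mat_adjoint (B.ev q \<omega>) *\<^sub>v \<eta> \<omega> j" for j
      using add_mult_distrib_mat_vec[OF mat_adjoint_carrier[OF B.ev_carrier[OF w]] mat_adjoint_carrier[OF B.ev_carrier[OF w]]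
          fibreD(1)[OF B.L2_fibre[OF h(2) w]], of p q j] mat_adjoint_add[OF B.ev_carrier[OF w] B.ev_carrier[OF w], of p q]
      by (simp add: B.ev_def)
    then show "(\<lambda>j. B.act (B.cut C (\<lambda>\<omega>. mat_adjoint (B.ev p \<omega>))) \<eta> \<omega> j + B.act (B.cut C (\<lambda>\<omega>. mat_adjoint (B.ev q \<omega>))) \<eta> \<omega> j)
        = B.act (B.cut C (\<lambda>\<omega>. mat_adjoint (B.ev (PAdd p q) \<omega>))) \<eta> \<omega>"
      by (simp add: B.act_cut w h fun_eq_iff)
  qed
  finally show ?case .
next
  case (PSc a b p)
  note h = PSc.prems
  let ?c = "Complex (of_rat a) (of_rat b)"
  have smv: "(c \<cdot>\<^sub>m P) *\<^sub>v u = c \<cdot>\<^sub>v (P *\<^sub>v u)" if "P \<in> carrier_mat n n" "u \<in> carrier_vec n" for c :: complex and P n u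
    using that by (intro eq_vecI) (auto simp: smult_scalar_prod_distrib[of _ n])
  have "S (A.act (A.cut A (A.ev (PSc a b p))) \<xi>) (B.rest C \<eta>)
      = S (\<lambda>\<omega> j. ?c \<cdot>\<^sub>v A.act (A.cut A (A.ev p)) \<xi> \<omega> j) (B.rest C \<eta>)"
  proof (intro S_cong AE_I2 refl)
    fix \<omega> assume w: "\<omega> \<in> space M1"
    have "A.ev (PSc a b p) \<omega> *\<^sub>v \<xi> \<omega> j = ?c \<cdot>\<^sub>v (A.ev p \<omega> *\<^sub>v \<xi> \<omega> j)" for j
      using smv[OF A.ev_carrier[OF w] fibreD(1)[OF A.L2_fibre[OF h(1) w]], of ?c p j] by (simp add: A.ev_def)
    then show "A.act (A.cut A (A.ev (PSc a b p))) \<xi> \<omega> = (\<lambda>j. ?c \<cdot>\<^sub>v A.act (A.cut A (A.ev p)) \<xi> \<omega> j)"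
      by (auto simp add: A.act_cut w h fun_eq_iff)
  qed
  also have "\<dots> = S (A.rest A \<xi>) (\<lambda>\<omega> j. cnj ?c \<cdot>\<^sub>v B.act (B.cut C (\<lambda>\<omega>. mat_adjoint (B.ev p \<omega>))) \<eta> \<omega> j)"
    using S_scale(1)[OF A.ev_L2(1)[OF A h(1), of p] B.rest_L2(1)[OF _ h(2)], of C ?c]
      S_scale(2)[OF A.rest_L2(1)[OF _ h(1)] B.ev_L2(2)[OF C h(2), of p], of A "cnj ?c"]
      A C PSc.IH[OF h] by (simp add: A.tame_def B.tame_def)
  also have "\<dots> = S (A.rest A \<xi>) (B.act (B.cut C (\<lambda>\<omega>. mat_adjoint (B.ev (PSc a b p) \<omega>))) \<eta>)"
  proof (intro S_cong AE_I2 refl)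
    fix \<omega> assume w: "\<omega> \<in> space M2"
    have "mat_adjoint (B.ev (PSc a b p) \<omega>) *\<^sub>v \<eta> \<omega> j = cnj ?c \<cdot>\<^sub>v (mat_adjoint (B.ev p \<omega>) *\<^sub>v \<eta> \<omega> j)" for j
      using smv[OF mat_adjoint_carrier[OF B.ev_carrier[OF w]] fibreD(1)[OF B.L2_fibre[OF h(2) w]], of "cnj ?c" p j]
      by (simp add: B.ev_def mat_adjoint_smult)
    then show "(\<lambda>j. cnj ?c \<cdot>\<^sub>v B.act (B.cut C (\<lambda>\<omega>. mat_adjoint (B.ev p \<omega>))) \<eta> \<omega> j)
        = B.act (B.cut C (\<lambda>\<omega>. mat_adjoint (B.ev (PSc a b p) \<omega>))) \<eta> \<omega>"
      by (auto simp add: B.act_cut w h fun_eq_iff)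
  qed
  finally show ?case .
qed

text \<open>With \<open>p\<close> close to \<open>1\<close> on the left and close to \<open>0\<close> on the right,
  \<open>S \<xi> \<eta> = S \<xi> (p\<^sup>* \<eta>) - S ((p - 1) \<xi>) \<eta>\<close> shows that any bound for \<open>S\<close> improves by the factor \<open>2/3\<close>.\<close>

lemma Null_tame:
  assumes A: "A.tame K A" and C: "B.tame K C"
    and q1: "\<And>\<omega>. \<omega> \<in> A \<Longrightarrow> frob (A.ev (PMinus1 q) \<omega>) \<le> 1 / 9"
    and q2: "\<And>\<omega>. \<omega> \<in> C \<Longrightarrow> frob (B.ev q \<omega>) \<le> 1 / 9"
  shows "Null A C"
proof -
  have sA: "A \<in> sets M1" and sC: "C \<in> sets M2" using A C by (auto simp: A.tame_def B.tame_def)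
  let ?D = "\<lambda>\<xi>. A.act (A.cut A (A.ev (PMinus1 q))) \<xi>"
  let ?E = "\<lambda>\<eta>. B.act (B.cut C (\<lambda>\<omega>. mat_adjoint (B.ev q \<omega>))) \<eta>"
  \<comment> \<open>The estimate is proved for all sections at once, because the induction step
    applies it to the corrected sections \<open>\<xi>'\<close> and \<open>\<eta>'\<close>.\<close>
  have bound: "\<forall>\<xi>\<in>A.L2. \<forall>\<eta>\<in>B.L2. cmod (S (A.rest A \<xi>) (B.rest C \<eta>)) \<le> (2 / 3) ^ t * ((A.nrm \<xi> + B.nrm \<eta>) / 2)" for t
  proof (induction t)
    case 0
    show ?case
    proof (intro ballI)
      fix \<xi> \<eta> assume h: "\<xi> \<in> A.L2" "\<eta> \<in> B.L2"
      show "cmod (S (A.rest A \<xi>) (B.rest C \<eta>)) \<le> (2 / 3) ^ 0 * ((A.nrm \<xi> + B.nrm \<eta>) / 2)"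
        using S_le[OF A.rest_L2(1)[OF sA h(1)] B.rest_L2(1)[OF sC h(2)]] A.rest_L2(2)[OF sA h(1)] B.rest_L2(2)[OF sC h(2)]
        by simp
    qed
  next
    case (Suc t)
    show ?case
    proof (intro ballI)
      fix \<xi> \<eta> assume h: "\<xi> \<in> A.L2" "\<eta> \<in> B.L2"
      have D: "?D \<xi> \<in> A.L2" by (rule A.ev_L2(1)[OF A h(1)])
      have E: "?E \<eta> \<in> B.L2" by (rule B.ev_L2(2)[OF C h(2)])
      have nD: "A.nrm (?D \<xi>) \<le> 1 / 9 * A.nrm \<xi>"
        using q1 by (intro A.L2_act(2)[OF A.mfield_cut[OF sA A.mfield_ev] A.opbound_cut_frob[OF A.mfield_ev] h(1)]) auto
      have nE: "B.nrm (?E \<eta>) \<le> 1 / 9 * B.nrm \<eta>"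
        using q2 by (intro B.L2_act(2)[OF B.mfield_cut[OF sC B.mfield_adjoint[OF B.mfield_ev]]
              B.opbound_cut_frob[OF B.mfield_adjoint[OF B.mfield_ev]] h(2)]) auto
      \<comment> \<open>The polynomial part shrinks squared norms by 1/9, so three times the result
        still has at most the original squared norm. The factor 1/3 taken out of each of the two
        terms gives 2/3 in total.\<close>
      define \<xi>' where "\<xi>' = (\<lambda>\<omega> j. 3 \<cdot>\<^sub>v ?D \<xi> \<omega> j)"
      define \<eta>' where "\<eta>' = (\<lambda>\<omega> j. 3 \<cdot>\<^sub>v ?E \<eta> \<omega> j)"
      have \<xi>': "\<xi>' \<in> A.L2" and \<eta>': "\<eta>' \<in> B.L2"
        unfolding \<xi>'_def \<eta>'_def by (rule A.hscale_cls(2)[OF D], rule B.hscale_cls(2)[OF E])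
      have n': "A.nrm \<xi>' \<le> A.nrm \<xi>" "B.nrm \<eta>' \<le> B.nrm \<eta>"
        using nD nE by (simp_all add: \<xi>'_def \<eta>'_def A.nrm_smult[OF D] B.nrm_smult[OF E])
      note RA = A.rest_L2(1)[OF sA h(1)] and RB = B.rest_L2(1)[OF sC h(2)]
      have "S (A.act (A.cut A (A.ev q)) \<xi>) (B.rest C \<eta>) = S (\<lambda>\<omega> j. A.rest A \<xi> \<omega> j + ?D \<xi> \<omega> j) (B.rest C \<eta>)"
      proof (intro S_cong AE_I2 refl)
        fix \<omega> assume w: "\<omega> \<in> space M1"
        have "A.ev q \<omega> *\<^sub>v u = u + A.ev (PMinus1 q) \<omega> *\<^sub>v u" if u: "u \<in> carrier_vec (A.deg \<omega>)" for u
        proof -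
          have e: "A.ev (PMinus1 q) \<omega> = A.ev q \<omega> - 1\<^sub>m (A.deg \<omega>)"
            using pev_PMinus1[of "letters k (\<lambda>s. X1 s \<omega>)" "A.deg \<omega>" q] A.letters_deg[OF w] by (simp add: A.ev_def A.deg_def)
          show ?thesis unfolding e using u A.ev_carrier[OF w, of q]
            by (intro eq_vecI) (auto simp: minus_scalar_prod_distrib[of _ "A.deg \<omega>"] minus_mult_distrib_mat_vec[of _ "A.deg \<omega>" "A.deg \<omega>"])
        qed
        then show "A.act (A.cut A (A.ev q)) \<xi> \<omega> = (\<lambda>j. A.rest A \<xi> \<omega> j + ?D \<xi> \<omega> j)"
          using fibreD(1)[OF A.L2_fibre[OF h(1) w]] by (auto simp: A.act_cut A.rest_apply w h fun_eq_iff)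
      qed
      also have "\<dots> = S (A.rest A \<xi>) (B.rest C \<eta>) + S (?D \<xi>) (B.rest C \<eta>)"
        by (rule S_add(1)[OF RA D RB RB])
      finally have e: "S (A.rest A \<xi>) (B.rest C \<eta>) = S (A.rest A \<xi>) (?E \<eta>) - S (?D \<xi>) (B.rest C \<eta>)"
        using S_ev[OF A C h, of q] by (simp add: algebra_simps)
      have "S (?D \<xi>) (B.rest C \<eta>) = S (\<lambda>\<omega> j. (1 / 3) \<cdot>\<^sub>v A.rest A \<xi>' \<omega> j) (B.rest C \<eta>)"
      proof (intro S_cong AE_I2 refl)
        fix \<omega> assume w: "\<omega> \<in> space M1"
        show "?D \<xi> \<omega> = (\<lambda>j. (1 / 3) \<cdot>\<^sub>v A.rest A \<xi>' \<omega> j)"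
          by (auto simp: A.rest_apply[OF w \<xi>'] fun_eq_iff) (auto simp: \<xi>'_def A.act_cut w h smult_smult_assoc)
      qed
      then have 1: "S (?D \<xi>) (B.rest C \<eta>) = 1 / 3 * S (A.rest A \<xi>') (B.rest C \<eta>)"
        using S_scale(1)[OF A.rest_L2(1)[OF sA \<xi>'] RB] by simp
      have "S (A.rest A \<xi>) (?E \<eta>) = S (A.rest A \<xi>) (\<lambda>\<omega> j. (1 / 3) \<cdot>\<^sub>v B.rest C \<eta>' \<omega> j)"
      proof (intro S_cong AE_I2 refl)
        fix \<omega> assume w: "\<omega> \<in> space M2"
        show "?E \<eta> \<omega> = (\<lambda>j. (1 / 3) \<cdot>\<^sub>v B.rest C \<eta>' \<omega> j)"
          by (auto simp: B.rest_apply[OF w \<eta>'] fun_eq_iff) (auto simp: \<eta>'_def B.act_cut w h smult_smult_assoc)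
      qed
      then have 2: "S (A.rest A \<xi>) (?E \<eta>) = 1 / 3 * S (A.rest A \<xi>) (B.rest C \<eta>')"
        using S_scale(2)[OF RA B.rest_L2(1)[OF sC \<eta>']] by simp
      have "cmod (S (A.rest A \<xi>) (B.rest C \<eta>)) \<le> cmod (S (A.rest A \<xi>) (?E \<eta>)) + cmod (S (?D \<xi>) (B.rest C \<eta>))"
        unfolding e by (rule norm_triangle_ineq4)
      also have "\<dots> = 1 / 3 * cmod (S (A.rest A \<xi>) (B.rest C \<eta>')) + 1 / 3 * cmod (S (A.rest A \<xi>') (B.rest C \<eta>))"
        unfolding 1 2 by (simp add: norm_mult)
      also have "\<dots> \<le> 1 / 3 * ((2 / 3) ^ t * ((A.nrm \<xi> + B.nrm \<eta>') / 2)) + 1 / 3 * ((2 / 3) ^ t * ((A.nrm \<xi>' + B.nrm \<eta>) / 2))"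
        using Suc.IH h \<xi>' \<eta>' by (intro add_mono mult_left_mono) auto
      also have "\<dots> \<le> 1 / 3 * ((2 / 3) ^ t * ((A.nrm \<xi> + B.nrm \<eta>) / 2)) + 1 / 3 * ((2 / 3) ^ t * ((A.nrm \<xi> + B.nrm \<eta>) / 2))"
        using n' by (intro add_mono mult_left_mono) auto
      also have "\<dots> = (2 / 3) ^ Suc t * ((A.nrm \<xi> + B.nrm \<eta>) / 2)" by (simp add: algebra_simps)
      finally show "cmod (S (A.rest A \<xi>) (B.rest C \<eta>)) \<le> (2 / 3) ^ Suc t * ((A.nrm \<xi> + B.nrm \<eta>) / 2)" .
    qed
  qed
  show ?thesis unfolding Null_def
  proof (intro ballI)
    fix \<xi> \<eta> assume h: "\<xi> \<in> A.L2" "\<eta> \<in> B.L2"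
    have lim: "(\<lambda>t. (2 / 3) ^ t * ((A.nrm \<xi> + B.nrm \<eta>) / 2)) \<longlonglongrightarrow> 0 * ((A.nrm \<xi> + B.nrm \<eta>) / 2)"
      by (intro tendsto_mult LIMSEQ_power_zero tendsto_const) auto
    have le: "cmod (S (A.rest A \<xi>) (B.rest C \<eta>)) \<le> (2 / 3) ^ t * ((A.nrm \<xi> + B.nrm \<eta>) / 2)" for t
      using bound[of t] h by blast
    have "cmod (S (A.rest A \<xi>) (B.rest C \<eta>)) \<le> 0 * ((A.nrm \<xi> + B.nrm \<eta>) / 2)"
      by (rule LIMSEQ_le_const[OF lim]) (use le in blast)
    then show "S (A.rest A \<xi>) (B.rest C \<eta>) = 0" by simp
  qed
qed

text \<open>The boundedness in \<open>Null_tame\<close> is removed by exhausting both sets with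
  countably many tame parts; the common bound is the maximum of \<open>K\<close> and
  \<open>K'\<close>.\<close>

lemma Null_pexp:
  "Null {\<omega> \<in> space M1. frob (A.ev (PMinus1 q) \<omega>) < 1 / 9} {\<omega> \<in> space M2. frob (B.ev q \<omega>) < 1 / 9}"
    (is "Null ?A ?C")
proof -
  have sA: "?A \<in> sets M1" using A.frob_measurable[OF A.mfield_ev[of "PMinus1 q"]] by measurable
  have sC: "?C \<in> sets M2" using B.frob_measurable[OF B.mfield_ev[of q]] by measurable
  have "Null (?A \<inter> A.tames K) (?C \<inter> B.tames K')" for K K'
    by (rule Null_tame[OF A.tame_tames[OF sA max.cobounded1] B.tame_tames[OF sC max.cobounded2], where q = q]) auto
  then have "Null (?A \<inter> A.tames K) (\<Union>K'. ?C \<inter> B.tames K')" for K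
    using sA sC A.tames_sets B.tames_sets by (intro Null_UN_right) auto
  moreover have "(\<Union>K'. ?C \<inter> B.tames K') = ?C" using B.tames_UN by auto
  ultimately have "Null (\<Union>K. ?A \<inter> A.tames K) ?C"
    using sA sC A.tames_sets by (intro Null_UN_left) auto
  moreover have "(\<Union>K. ?A \<inter> A.tames K) = ?A" using A.tames_UN by auto
  ultimately show ?thesis by simp
qed

end

section \<open>Test sections along one coordinate\<close>

context mult_field
begin

text \<open>The index \<open>c\<close> is a pair of copy and coordinate, as in
  \<open>mult_frame\<close>. For different indices the sections are orthogonal in every
  fibre.\<close>

definition bump :: "'w set \<Rightarrow> ('w \<Rightarrow> real) \<Rightarrow> nat \<times> nat \<Rightarrow> 'w \<Rightarrow> nat \<Rightarrow> complex vec" where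
  "bump A g c = (\<lambda>\<omega> j. if \<omega> \<in> A \<and> j = fst c
     then complex_of_real (g \<omega>) \<cdot>\<^sub>v unit_vec (deg \<omega>) (snd c) else 0\<^sub>v (deg \<omega>))"

lemma bump_cscalar:
  assumes "\<omega> \<in> A \<Longrightarrow> snd c < deg \<omega>"
  shows "bump A g c \<omega> j \<bullet>c bump A g d \<omega> j = (if j = fst c then (if \<omega> \<in> A \<and> c = d then of_real ((g \<omega>)\<^sup>2) else 0) else 0)"
proof -
  have u: "unit_vec n i \<bullet>c unit_vec n l = (if i = l then 1 else 0 :: complex)" if "i < n" for n i l
  proof (cases "l < n")
    case True
    then show ?thesis using that by (subst cscalar_unit) auto
  next
    case False
    \<comment> \<open>Only \<open>c\<close> is assumed to lie within the degree; a unit vector with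
      an index beyond it is zero.\<close>
    then have "unit_vec n l = (0\<^sub>v n :: complex vec)" by (intro eq_vecI) (auto simp: unit_vec_def)
    then show ?thesis using False that by auto
  qed
  show ?thesis
    using u[OF assms, of "snd d"] by (auto simp: bump_def prod_eq_iff power2_eq_square conjugate_smult_vec)
qed

lemma bump_fibre:
  assumes "\<omega> \<in> A \<Longrightarrow> enat (fst c) < f \<omega> \<and> snd c < deg \<omega>"
  shows "bump A g c \<omega> \<in> fibre (deg \<omega>) (f \<omega>)" "fnorm2 (bump A g c \<omega>) = (if \<omega> \<in> A then (g \<omega>)\<^sup>2 else 0)"
    "fip (bump A g c \<omega>) (bump A g d \<omega>) = (if \<omega> \<in> A \<and> c = d then of_real ((g \<omega>)\<^sup>2) else 0)"
proof -
  have "complex_of_real (vnorm2 (bump A g c \<omega> j)) = of_real (if j = fst c then (if \<omega> \<in> A then (g \<omega>)\<^sup>2 else 0) else 0)" for j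
    unfolding cscalar_vnorm2[symmetric] using assms by (subst bump_cscalar) auto
  then have v: "vnorm2 (bump A g c \<omega> j) = (if j = fst c then (if \<omega> \<in> A then (g \<omega>)\<^sup>2 else 0) else 0)" for j
    using of_real_eq_iff by blast
  have "summable (\<lambda>j. if j = fst c then (if \<omega> \<in> A then (g \<omega>)\<^sup>2 else 0) else 0)"
    by (rule summable_finite[of "{fst c}"]) auto
  then show "bump A g c \<omega> \<in> fibre (deg \<omega>) (f \<omega>)"
    unfolding fibre_def mem_Collect_eq v using assms by (auto simp: bump_def)
  show "fnorm2 (bump A g c \<omega>) = (if \<omega> \<in> A then (g \<omega>)\<^sup>2 else 0)"
    unfolding fnorm2_def v by (subst suminf_finite[of "{fst c}"]) auto
  have "fip (bump A g c \<omega>) (bump A g d \<omega>) = (\<Sum>j. if j = fst c then (if \<omega> \<in> A \<and> c = d then of_real ((g \<omega>)\<^sup>2) else 0) else 0)"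
    unfolding fip_def using assms by (subst bump_cscalar) auto
  also have "\<dots> = (if \<omega> \<in> A \<and> c = d then of_real ((g \<omega>)\<^sup>2) else 0)"
    by (subst suminf_finite[of "{fst c}"]) auto
  finally show "fip (bump A g c \<omega>) (bump A g d \<omega>) = (if \<omega> \<in> A \<and> c = d then of_real ((g \<omega>)\<^sup>2) else 0)" .
qed

lemma bump_L2:
  assumes A: "A \<in> sets M" "\<And>\<omega>. \<omega> \<in> A \<Longrightarrow> enat (fst c) < f \<omega> \<and> snd c < deg \<omega>"
    and g: "g \<in> borel_measurable M" "integrable M (\<lambda>\<omega>. (g \<omega>)\<^sup>2)"
  shows "bump A g c \<in> L2"
proof (rule L2I)
  show "bump A g c \<omega> \<in> fibre (deg \<omega>) (f \<omega>)" for \<omega> using bump_fibre(1) A(2) by blast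
  show "crd (bump A g c) j i \<in> borel_measurable M" for j i
  proof -
    have "crd (bump A g c) j i = (\<lambda>\<omega>. if \<omega> \<in> A then (if j = fst c \<and> i = snd c then complex_of_real (g \<omega>) else 0) else 0)"
      using A(2) by (auto simp: crd_def bump_def fun_eq_iff)
    moreover have "\<dots> \<in> borel_measurable M"
      using A(1) g(1) by (intro measurable_If_set) auto
    ultimately show ?thesis by simp
  qed
  show "integrable M (\<lambda>\<omega>. (g \<omega>)\<^sup>2)" by fact
  show "AE \<omega> in M. fnorm2 (bump A g c \<omega>) \<le> (g \<omega>)\<^sup>2"
    by (intro AE_I2) (use bump_fibre(2) A(2) in auto)
qed

end

text \<open>Constants need not be square integrable over a sigma-finite space. The root of a
  positive integrable function serves as a nowhere vanishing coefficient.\<close>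

lemma (in sigma_finite_measure) exists_square_integrable:
  "\<exists>g :: 'a \<Rightarrow> real. g \<in> borel_measurable M \<and> integrable M (\<lambda>\<omega>. (g \<omega>)\<^sup>2) \<and> (\<forall>\<omega>\<in>space M. 0 < g \<omega>)"
proof -
  obtain h where h: "h \<in> borel_measurable M" "integral\<^sup>N M h \<noteq> \<infinity>" "\<forall>x\<in>space M. 0 < h x \<and> h x < \<infinity>"
    using Ex_finite_integrable_function by blast
  have sq: "(sqrt (enn2real (h \<omega>)))\<^sup>2 = enn2real (h \<omega>)" for \<omega> by simp
  have "(\<integral>\<^sup>+\<omega>. ennreal (enn2real (h \<omega>)) \<partial>M) = integral\<^sup>N M h"
    using h(3) by (intro nn_integral_cong) auto
  then have "integrable M (\<lambda>\<omega>. enn2real (h \<omega>))"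
    using h by (intro integrableI_nonneg) (auto simp: less_top)
  then show ?thesis
    using h by (intro exI[of _ "\<lambda>\<omega>. sqrt (enn2real (h \<omega>))"]) (auto simp: enn2real_positive_iff)
qed

section \<open>The Borel isomorphism of two equivalent direct integrals\<close>

locale irreducible_field = mult_field +
  assumes std: "standard_measure_space M"
    and f_ge_1: "\<And>\<omega>. \<omega> \<in> space M \<Longrightarrow> 1 \<le> f \<omega>"
    and irr: "\<And>\<omega>. \<omega> \<in> space M \<Longrightarrow> irreducible_tuple k (\<lambda>s. X s \<omega>)"
    and ineq: "\<And>\<omega> \<omega>'. \<omega> \<in> space M \<Longrightarrow> \<omega>' \<in> space M \<Longrightarrow> \<omega> \<noteq> \<omega>' \<Longrightarrow>
      \<not> mats_unitarily_equivalent k (\<lambda>s. X s \<omega>) (\<lambda>s. X s \<omega>')"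
begin

sublocale sigma_finite_measure M
  using std by (simp add: standard_measure_space_def)

definition invar :: "'a \<Rightarrow> nat \<Rightarrow> real" where
  "invar \<omega> = tuple_invariant k (\<lambda>s. X s \<omega>)"

definition pre :: "(nat \<Rightarrow> real) set \<Rightarrow> 'a set" where
  "pre B = {\<omega> \<in> space M. invar \<omega> \<in> B}"

lemma invar_apply: "invar \<omega> i = frob (ev (from_nat i) \<omega>)"
  by (simp add: invar_def tuple_invariant_def ev_def)

lemma invar_measurable: "invar \<in> borel_measurable M"
  by (rule measurable_coordinatewise_then_product) (simp add: invar_apply frob_measurable[OF mfield_ev])

lemma pre_sets: "B \<in> sets borel \<Longrightarrow> pre B \<in> sets M"
  using measurable_sets[OF invar_measurable, of B] by (simp add: pre_def vimage_def Int_def conj_commute)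

lemma invar_inj: "inj_on invar (space M)"
proof (rule inj_onI)
  fix \<omega> \<omega>' assume h: "\<omega> \<in> space M" "\<omega>' \<in> space M" "invar \<omega> = invar \<omega>'"
  then show "\<omega> = \<omega>'"
    using tuple_invariant_eq_iff[OF k tuple tuple irr irr, of \<omega> \<omega>'] ineq[of \<omega>' \<omega>] unfolding invar_def by auto
qed

text \<open>The squared Frobenius norm of the identity is the degree, so points with the same
  invariant have the same degree.\<close>

lemma deg_invar: "real (deg \<omega>) = invar \<omega> (to_nat POne)"
  by (simp add: invar_apply ev_def deg_def frob_one)

lemma Borel_inverse:
  "\<exists>R \<sigma>. R \<in> sets borel \<and> (AE \<omega> in M. invar \<omega> \<in> R) \<and>
    (\<forall>y\<in>R. \<sigma> y \<in> space M \<and> invar (\<sigma> y) = y) \<and> (\<forall>B\<in>sets M. {y \<in> R. \<sigma> y \<in> B} \<in> sets borel)"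
proof (rule standard_measure_space_Borel_inverse[OF std invar_measurable invar_inj])
  fix R \<sigma>
  assume "R \<in> sets borel" "AE \<omega> in M. invar \<omega> \<in> R" "\<And>y. y \<in> R \<Longrightarrow> \<sigma> y \<in> space M \<and> invar (\<sigma> y) = y"
    "\<And>B. B \<in> sets M \<Longrightarrow> {y \<in> R. \<sigma> y \<in> B} \<in> sets borel"
  then show ?thesis by blast
qed

text \<open>Inner regularity is applied to the image, under the invariant, of a finite measure with
  the null sets of \<open>M\<close>.\<close>

lemma pre_compact_exhaustion:
  assumes C: "C \<in> sets borel"
  obtains K where "\<And>n::nat. compact (K n)" "\<And>n. K n \<subseteq> C" "AE \<omega> in M. invar \<omega> \<in> C \<longrightarrow> invar \<omega> \<in> (\<Union>n. K n)"
proof -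
  obtain h where h: "h \<in> borel_measurable M" "integral\<^sup>N M h \<noteq> \<infinity>" "\<forall>x\<in>space M. 0 < h x \<and> h x < \<infinity>"
    using Ex_finite_integrable_function by blast
  define m where "m = distr (density M h) borel invar"
  have im: "invar \<in> borel_measurable (density M h)" using invar_measurable by simp
  have "finite_measure (density M h)"
    using h by (intro finite_measureI) (auto simp: emeasure_density cong: nn_integral_cong)
  then have fm: "finite_measure m" unfolding m_def using im by (rule finite_measure.finite_measure_distr)
  obtain K where K: "\<And>n::nat. compact (K n)" "\<And>n. K n \<subseteq> C" "emeasure m (C - (\<Union>n. K n)) = 0"
    using compact_exhaustion[OF fm _ C] unfolding m_def by (metis sets_distr)
  have "(\<Union>n. K n) \<in> sets borel" using K(1) by (intro sets.countable_UN) (auto simp: borel_compact)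
  then have "AE y in m. y \<notin> C - (\<Union>n. K n)"
    using K(3) C by (intro AE_not_in) (auto simp: m_def null_sets_def)
  then have "AE \<omega> in density M h. invar \<omega> \<notin> C - (\<Union>n. K n)"
    unfolding m_def using AE_distrD[OF im] by blast
  then have "AE \<omega> in M. 0 < h \<omega> \<longrightarrow> invar \<omega> \<notin> C - (\<Union>n. K n)"
    unfolding AE_density[OF h(1)] .
  with AE_space have "AE \<omega> in M. invar \<omega> \<in> C \<longrightarrow> invar \<omega> \<in> (\<Union>n. K n)"
    by eventually_elim (use h(3) in auto)
  then show thesis by (rule that[OF K(1,2)])
qed

end

locale irreducible_pair =
  A: irreducible_field k M1 f1 X1 + B: irreducible_field k M2 f2 X2 + unitary_pair k M1 f1 X1 M2 f2 X2 U
  for k :: nat and M1 :: "'a measure" and f1 X1 and M2 :: "'b measure" and f2 X2 and U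
begin

text \<open>A point \<open>\<omega>\<close> over \<open>Bs\<close> is separated from each value in
  \<open>L\<close> by some polynomial, and smallness of that polynomial is an open condition on the
  value. By compactness a finite set \<open>G\<close> of polynomials serves \<open>\<omega>\<close>.
  There are only countably many finite sets of polynomials, so the points over \<open>Bs\<close>
  fall into countably many classes \<open>AG G\<close>, each treated with its own finite cover of
  \<open>L\<close>.\<close>

lemma Null_compact:
  assumes Bs: "Bs \<in> sets borel" and L: "compact L" "L \<subseteq> B.invar ` space M2" and disj: "Bs \<inter> L = {}"
  shows "Null (A.pre Bs) (B.pre L)"
proof -
  define AQ where "AQ q = {\<omega> \<in> space M1. frob (A.ev (PMinus1 q) \<omega>) < 1 / 9}" for q
  define CQ where "CQ q = {\<omega> \<in> space M2. frob (B.ev q \<omega>) < 1 / 9}" for q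
  \<comment> \<open>Coordinate \<open>to_nat q\<close> of an invariant is the value of
    \<open>frob\<close> at \<open>q\<close>, and coordinates are continuous.\<close>
  define Op where "Op q = {y :: nat \<Rightarrow> real. y (to_nat q) < 1 / 9}" for q :: pexp
  have AQ: "AQ q \<in> sets M1" for q unfolding AQ_def using A.frob_measurable[OF A.mfield_ev[of "PMinus1 q"]] by measurable
  have CQ: "CQ q \<in> sets M2" for q unfolding CQ_def using B.frob_measurable[OF B.mfield_ev[of q]] by measurable
  have NQ: "Null (AQ q) (CQ q)" for q unfolding AQ_def CQ_def by (rule Null_pexp)
  have Oo: "open (Op q)" for q
    unfolding Op_def using open_Collect_less[of "\<lambda>f :: nat \<Rightarrow> real. f (to_nat q)" "\<lambda>_. 1 / 9"] by auto
  have Lb: "L \<in> sets borel" using L(1) by (simp add: borel_compact)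
  note pB = A.pre_sets[OF Bs] and pL = B.pre_sets[OF Lb]
  define GG where "GG = {G :: pexp set. finite G \<and> L \<subseteq> (\<Union>q\<in>G. Op q)}"
  define AG where "AG G = {\<omega> \<in> A.pre Bs. \<forall>q\<in>G. \<omega> \<in> AQ q}" for G
  have AGs: "AG G \<in> sets M1" if "G \<in> GG" for G
  proof -
    have "finite G" using that by (simp add: GG_def)
    moreover have "AG G = A.pre Bs \<inter> (\<Inter>q\<in>G. AQ q)" if "G \<noteq> {}" using that by (auto simp: AG_def)
    moreover have "AG {} = A.pre Bs" by (auto simp: AG_def)
    ultimately show ?thesis using pB AQ by (cases "G = {}") (auto intro!: sets.Int sets.finite_INT)
  qed
  have "Null (AG G) (B.pre L)" if G: "G \<in> GG" for G
  proof -
    \<comment> \<open>Each piece on the right is treated with one \<open>q\<close> of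
      \<open>G\<close>; every point of \<open>AG G\<close> makes all of \<open>G\<close> close to
      1.\<close>
    have "Null (AG G) (\<Union>q\<in>G. B.pre L \<inter> CQ q)"
    proof (rule Null_UN_right)
      show "countable G" using G by (simp add: GG_def countable_finite)
      show "Null (AG G) (B.pre L \<inter> CQ q)" if "q \<in> G" for q
        using that by (intro Null_mono[OF NQ[of q]] AGs G sets.Int pL CQ) (auto simp: AG_def)
    qed (use AGs[OF G] pL CQ in auto)
    moreover have "(\<Union>q\<in>G. B.pre L \<inter> CQ q) = B.pre L"
    proof -
      have "\<exists>q\<in>G. \<omega> \<in> CQ q" if w: "\<omega> \<in> B.pre L" for \<omega>
      proof -
        obtain q where "q \<in> G" "B.invar \<omega> \<in> Op q" using G w by (auto simp: GG_def B.pre_def)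
        then show ?thesis using w by (auto simp: CQ_def Op_def B.invar_apply B.pre_def)
      qed
      then show ?thesis by blast
    qed
    ultimately show ?thesis by simp
  qed
  moreover have "countable GG" unfolding GG_def
    by (rule countable_subset[OF _ countable_Collect_finite]) auto
  ultimately have "Null (\<Union>G\<in>GG. AG G) (B.pre L)" by (intro Null_UN_left AGs pL)
  moreover have "A.pre Bs \<subseteq> (\<Union>G\<in>GG. AG G)"
  proof
    fix \<omega> assume w: "\<omega> \<in> A.pre Bs"
    then have ws: "\<omega> \<in> space M1" by (simp add: A.pre_def)
    have "L \<subseteq> (\<Union>q\<in>{q. \<omega> \<in> AQ q}. Op q)"
    proof
      fix y assume "y \<in> L"
      then obtain \<omega>' where w': "\<omega>' \<in> space M2" "y = B.invar \<omega>'" using L by auto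
      have "A.invar \<omega> \<noteq> B.invar \<omega>'" using w w' \<open>y \<in> L\<close> disj by (auto simp: A.pre_def)
      then have "\<not> mats_unitarily_equivalent k (\<lambda>s. X2 s \<omega>') (\<lambda>s. X1 s \<omega>)"
        using tuple_invariant_eq_iff[OF A.k A.tuple[OF ws] B.tuple[OF w'(1)] A.irr[OF ws] B.irr[OF w'(1)]]
        by (simp add: A.invar_def B.invar_def)
      then obtain p where p: "frob (tev k (\<lambda>s. X1 s \<omega>) (PMinus1 p)) < 1 / 9" "frob (tev k (\<lambda>s. X2 s \<omega>') p) < 1 / 9"
        using separating_tuple[OF A.k A.tuple[OF ws] B.tuple[OF w'(1)] A.irr[OF ws] B.irr[OF w'(1)]] by blast
      have "\<omega> \<in> AQ p" unfolding AQ_def A.ev_def using ws p(1) by blast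
      moreover have "y \<in> Op p" unfolding Op_def w'(2) B.invar_def tuple_invariant_def using p(2) by simp
      ultimately show "y \<in> (\<Union>q\<in>{q. \<omega> \<in> AQ q}. Op q)" by blast
    qed
    then obtain G where "G \<subseteq> {q. \<omega> \<in> AQ q}" "finite G" "L \<subseteq> (\<Union>q\<in>G. Op q)"
      using compactE_image[OF L(1), of "{q. \<omega> \<in> AQ q}" Op] Oo by blast
    then have "G \<in> GG" "\<omega> \<in> AG G" using w by (auto simp: GG_def AG_def)
    then show "\<omega> \<in> (\<Union>G\<in>GG. AG G)" by blast
  qed
  ultimately show ?thesis using pB pL by (rule Null_mono[OF _ _ order_refl])
qed

text \<open>Compact subsets exhaust \<open>C\<close> up to a set whose preimage is null, and the
  form does not see null sets.\<close>

lemma Null_Borel: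
  assumes Bs: "Bs \<in> sets borel" and C: "C \<in> sets borel" "C \<subseteq> B.invar ` space M2" and disj: "Bs \<inter> C = {}"
  shows "Null (A.pre Bs) (B.pre C)"
proof -
  obtain K where K: "\<And>n::nat. compact (K n)" "\<And>n. K n \<subseteq> C" "AE \<omega> in M2. B.invar \<omega> \<in> C \<longrightarrow> B.invar \<omega> \<in> (\<Union>n. K n)"
    using B.pre_compact_exhaustion[OF C(1)] by blast
  have Ks: "B.pre (K n) \<in> sets M2" for n using K(1) by (intro B.pre_sets) (simp add: borel_compact)
  have N: "Null (A.pre Bs) (\<Union>n. B.pre (K n))"
  proof (intro Null_UN_right Ks A.pre_sets Bs)
    show "Null (A.pre Bs) (B.pre (K n))" for n
      by (intro Null_compact Bs K) (use K(2)[of n] C(2) disj in auto)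
  qed auto
  show ?thesis unfolding Null_def
  proof (intro ballI)
    fix \<xi> \<eta> assume h: "\<xi> \<in> A.L2" "\<eta> \<in> B.L2"
    have "S (A.rest (A.pre Bs) \<xi>) (B.rest (B.pre C) \<eta>) = S (A.rest (A.pre Bs) \<xi>) (B.rest (\<Union>n. B.pre (K n)) \<eta>)"
    proof (rule S_cong[OF AE_I2[OF refl]])
      show "AE \<omega> in M2. B.rest (B.pre C) \<eta> \<omega> = B.rest (\<Union>n. B.pre (K n)) \<eta> \<omega>"
        using K(3) AE_space
      proof eventually_elim
        case (elim \<omega>)
        have "\<omega> \<in> B.pre C \<longleftrightarrow> \<omega> \<in> (\<Union>n. B.pre (K n))" using elim K(2) by (auto simp: B.pre_def)
        then show ?case by (simp only: B.rest_apply[OF elim(2) h(2)])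
      qed
    qed
    then show "S (A.rest (A.pre Bs) \<xi>) (B.rest (B.pre C) \<eta>) = 0" using N h by (simp add: Null_def)
  qed
qed

text \<open>The unitary commutes with restriction to sets defined by the invariant: the corners
  between \<open>Bs\<close> and its complement vanish in both orders. The complement is first
  reduced to the conull set \<open>R\<close> of attained values, as \<open>Null_Borel\<close>
  requires.\<close>

lemma S_commute:
  assumes Bs: "Bs \<in> sets borel" and h: "\<xi> \<in> A.L2" "\<eta> \<in> B.L2"
  shows "S (A.rest (A.pre Bs) \<xi>) \<eta> = S \<xi> (B.rest (B.pre Bs) \<eta>)"
proof -
  obtain R where R: "R \<in> sets borel" "AE \<omega> in M2. B.invar \<omega> \<in> R" "R \<subseteq> B.invar ` space M2"
  proof -
    obtain R \<sigma> where h: "R \<in> sets borel" "AE \<omega> in M2. B.invar \<omega> \<in> R" "\<forall>y\<in>R. \<sigma> y \<in> space M2 \<and> B.invar (\<sigma> y) = y"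
      using B.Borel_inverse by blast
    have "R \<subseteq> B.invar ` space M2" using h(3) by force
    then show thesis by (rule that[OF h(1,2)])
  qed
  have b: "R - Bs \<in> sets borel" "Bs \<inter> R \<in> sets borel" "- Bs \<in> sets borel" using Bs R by auto
  note RA = A.rest_L2(1)[OF A.pre_sets h(1)] and RB = B.rest_L2(1)[OF B.pre_sets h(2)]
  have "S (A.rest (A.pre Bs) \<xi>) \<eta> = S (A.rest (A.pre Bs) \<xi>) (\<lambda>\<omega> j. B.rest (B.pre Bs) \<eta> \<omega> j + B.rest (B.pre (R - Bs)) \<eta> \<omega> j)"
  proof (rule S_cong[OF AE_I2[OF refl]])
    show "AE \<omega> in M2. \<eta> \<omega> = (\<lambda>j. B.rest (B.pre Bs) \<eta> \<omega> j + B.rest (B.pre (R - Bs)) \<eta> \<omega> j)"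
      using R(2) AE_space
      by eventually_elim
        (use fibreD(1)[OF B.L2_fibre[OF h(2)]] in \<open>auto simp: B.rest_apply h B.pre_def fun_eq_iff\<close>)
  qed
  also have "\<dots> = S (A.rest (A.pre Bs) \<xi>) (B.rest (B.pre Bs) \<eta>)"
    using S_add(2)[OF RA[OF Bs] RA[OF Bs] RB[OF Bs] RB[OF b(1)]] Null_Borel[OF Bs b(1)] R(3) h
    by (simp add: Null_def subset_iff)
  also have "\<dots> = S (\<lambda>\<omega> j. A.rest (A.pre Bs) \<xi> \<omega> j + A.rest (A.pre (- Bs)) \<xi> \<omega> j) (B.rest (B.pre Bs) \<eta>)"
  proof -
    have "S (A.rest (A.pre (- Bs)) \<xi>) (B.rest (B.pre Bs) \<eta>) = S (A.rest (A.pre (- Bs)) \<xi>) (B.rest (B.pre (Bs \<inter> R)) \<eta>)"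
    proof (rule S_cong[OF AE_I2[OF refl]])
      show "AE \<omega> in M2. B.rest (B.pre Bs) \<eta> \<omega> = B.rest (B.pre (Bs \<inter> R)) \<eta> \<omega>"
        using R(2) AE_space by eventually_elim (auto simp: B.rest_apply h B.pre_def)
    qed
    also have "\<dots> = 0" using Null_Borel[OF b(3,2)] R(3) h by (auto simp: Null_def)
    finally show ?thesis
      using S_add(1)[OF RA[OF Bs] RA[OF b(3)] RB[OF Bs] RB[OF Bs]] by simp
  qed
  also have "\<dots> = S \<xi> (B.rest (B.pre Bs) \<eta>)"
  proof (intro S_cong AE_I2 refl)
    fix \<omega> assume w: "\<omega> \<in> space M1"
    show "(\<lambda>j. A.rest (A.pre Bs) \<xi> \<omega> j + A.rest (A.pre (- Bs)) \<xi> \<omega> j) = \<xi> \<omega>"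
      using w fibreD(1)[OF A.L2_fibre[OF h(1) w]] by (auto simp: A.rest_apply h A.pre_def fun_eq_iff)
  qed
  finally show ?thesis .
qed

text \<open>Take a nowhere zero section \<open>\<eta>\<close> over \<open>M2\<close> and cut it to
  the preimage of \<open>Bs\<close>. By \<open>S_commute\<close> the squared norm of the result
  equals a value of the form at a section over \<open>M1\<close> supported on a null set.\<close>

lemma null_pre_transfer:
  assumes Bs: "Bs \<in> sets borel" and null: "emeasure M1 (A.pre Bs) = 0"
  shows "emeasure M2 (B.pre Bs) = 0"
proof -
  obtain g :: "'b \<Rightarrow> real" where g: "g \<in> borel_measurable M2" "integrable M2 (\<lambda>\<omega>. (g \<omega>)\<^sup>2)" "\<And>\<omega>. \<omega> \<in> space M2 \<Longrightarrow> 0 < g \<omega>"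
    using B.exists_square_integrable by auto
  \<comment> \<open>Every fibre has a first copy and a first coordinate, since multiplicity and
    degree are at least 1.\<close>
  have c: "enat (fst (0, 0)) < f2 \<omega> \<and> snd (0::nat, 0) < B.deg \<omega>" if "\<omega> \<in> space M2" for \<omega>
    using B.f_ge_1[OF that] B.deg_ge_1[OF that] by (auto simp: zero_enat_def[symmetric] intro: less_le_trans)
  define \<eta> where "\<eta> = B.bump (space M2) g (0, 0)"
  have \<eta>: "\<eta> \<in> B.L2" unfolding \<eta>_def by (rule B.bump_L2[OF _ c g(1,2)]) auto
  note RB = B.rest_L2(1)[OF B.pre_sets[OF Bs] \<eta>]
  obtain \<zeta> where \<zeta>: "\<zeta> \<in> A.L2" "\<And>\<xi>. \<xi> \<in> A.L2 \<Longrightarrow> S \<xi> \<eta> = A.ip \<xi> \<zeta>" using U_preimage[OF \<eta>] by blast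
  \<comment> \<open>With this preimage in the left argument the form becomes the squared norm of the
    cut section.\<close>
  obtain \<theta> where \<theta>: "\<theta> \<in> A.L2" "U (A.cls \<theta>) = B.cls (B.rest (B.pre Bs) \<eta>)" using U_preimage[OF RB] by blast
  have "AE \<omega> in M1. \<omega> \<notin> A.pre Bs" using null A.pre_sets[OF Bs] by (intro AE_not_in) (simp add: null_sets_def)
  then have "AE \<omega> in M1. \<omega> \<in> A.pre Bs \<longrightarrow> \<zeta> \<omega> = (\<lambda>_. 0\<^sub>v (A.deg \<omega>))" by eventually_elim simp
  then have "S (A.rest (A.pre Bs) \<theta>) \<eta> = 0"
    using \<zeta>(2)[OF A.rest_L2(1)[OF A.pre_sets[OF Bs] \<theta>(1)]] A.ip_rest_zero(1)[OF \<theta>(1) \<zeta>(1)] by simp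
  then have "S \<theta> (B.rest (B.pre Bs) \<eta>) = 0" using S_commute[OF Bs \<theta>(1) \<eta>] by simp
  then have "B.nrm (B.rest (B.pre Bs) \<eta>) = 0"
    unfolding S_def \<theta>(2) B.hinner_cls[OF RB RB] B.ip_self[OF RB] by simp
  from B.nrm_eq_0[OF RB this] AE_space have "AE \<omega> in M2. \<omega> \<notin> B.pre Bs"
  proof eventually_elim
    case (elim \<omega>)
    show ?case
    proof
      assume "\<omega> \<in> B.pre Bs"
      then have "\<eta> \<omega> = (\<lambda>_. 0\<^sub>v (B.deg \<omega>))" using elim by (simp add: B.rest_apply \<eta>)
      then have "fnorm2 (\<eta> \<omega>) = 0" by (simp add: fnorm2_def)
      then show False using B.bump_fibre(2)[of \<omega> "space M2" "(0, 0)" g] c elim(2) g(3)[OF elim(2)] by (simp add: \<eta>_def)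
    qed
  qed
  then show ?thesis using AE_iff_null_sets[OF B.pre_sets[OF Bs]] null_setsD1 by blast
qed

lemma S_image:
  assumes "\<xi> \<in> A.L2" "\<xi>' \<in> A.L2" "U (A.cls \<xi>) = B.cls \<eta>"
  shows "S \<xi>' \<eta> = A.ip \<xi>' \<xi>"
  using U_isometric[OF assms(2,1)] assms(3) by (simp add: S_def)

text \<open>If the multiplicity dropped from more than \<open>m\<close> to \<open>m\<close> on a non-null set, the images of
  \<open>(m + 1) n\<close> orthogonal constant sections would be orthogonal and nonzero in fibres of dimension \<open>m n\<close>.\<close>

lemma multiplicity_le:
  "AE \<omega> in M2. \<forall>\<omega>1\<in>space M1. A.invar \<omega>1 = B.invar \<omega> \<longrightarrow> f1 \<omega>1 \<le> f2 \<omega>"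
proof -
  obtain R1 \<sigma>1 where R1: "R1 \<in> sets borel" "AE \<omega> in M1. A.invar \<omega> \<in> R1"
    "\<And>y. y \<in> R1 \<Longrightarrow> \<sigma>1 y \<in> space M1 \<and> A.invar (\<sigma>1 y) = y" "\<And>E. E \<in> sets M1 \<Longrightarrow> {y \<in> R1. \<sigma>1 y \<in> E} \<in> sets borel"
    using A.Borel_inverse by auto
  obtain R2 \<sigma>2 where R2: "R2 \<in> sets borel" "AE \<omega> in M2. B.invar \<omega> \<in> R2"
    "\<And>y. y \<in> R2 \<Longrightarrow> \<sigma>2 y \<in> space M2 \<and> B.invar (\<sigma>2 y) = y" "\<And>E. E \<in> sets M2 \<Longrightarrow> {y \<in> R2. \<sigma>2 y \<in> E} \<in> sets borel"
    using B.Borel_inverse by auto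
  have \<sigma>1: "\<sigma>1 (A.invar \<omega>) = \<omega>" if "\<omega> \<in> space M1" "A.invar \<omega> \<in> R1" for \<omega>
    using R1(3)[OF that(2)] that(1) A.invar_inj by (auto dest: inj_onD)
  have \<sigma>2: "\<sigma>2 (B.invar \<omega>) = \<omega>" if "\<omega> \<in> space M2" "B.invar \<omega> \<in> R2" for \<omega>
    using R2(3)[OF that(2)] that(1) B.invar_inj by (auto dest: inj_onD)
  \<comment> \<open>The forbidden situation, recorded in the common space of invariants: degree
    \<open>n\<close>, more than \<open>m\<close> copies on the left and exactly \<open>m\<close> on
    the right. Finite \<open>m\<close> suffices, because a smaller multiplicity is finite.\<close>
  define Bad where "Bad n m = {y \<in> R1. \<sigma>1 y \<in> {\<omega> \<in> space M1. A.deg \<omega> = n \<and> enat m < f1 \<omega>}}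
      \<inter> {y \<in> R2. \<sigma>2 y \<in> {\<omega> \<in> space M2. f2 \<omega> = enat m}}" for n m
  have sAd: "{\<omega> \<in> space M1. A.deg \<omega> = n \<and> enat m < f1 \<omega>} \<in> sets M1" for n m by measurable
  have sf: "{\<omega> \<in> space M2. f2 \<omega> = enat m} \<in> sets M2" for m by measurable
  have Bad: "Bad n m \<in> sets borel" for n m unfolding Bad_def by (intro sets.Int R1(4) R2(4) sAd sf)
  have "AE \<omega> in M2. \<omega> \<notin> B.pre (Bad n m)" for n m
  proof -
    obtain g :: "'a \<Rightarrow> real" where g: "g \<in> borel_measurable M1" "integrable M1 (\<lambda>\<omega>. (g \<omega>)\<^sup>2)" "\<And>\<omega>. \<omega> \<in> space M1 \<Longrightarrow> 0 < g \<omega>"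
      using A.exists_square_integrable by auto
    define D where "D = {\<omega> \<in> space M1. A.deg \<omega> = n \<and> enat m < f1 \<omega>}"
    \<comment> \<open>The range \<open>{..m}\<close> includes \<open>m\<close>, so this indexes
      \<open>m + 1\<close> copies of the \<open>n\<close> coordinates.\<close>
    define I where "I = {..m} \<times> {..<n}"
    define \<xi> where "\<xi> c = A.bump D g c" for c
    have cD: "enat (fst c) < f1 \<omega> \<and> snd c < A.deg \<omega>" if "c \<in> I" "\<omega> \<in> D" for c \<omega>
    proof -
      have "enat (fst c) \<le> enat m" using that(1) by (auto simp: I_def)
      also have "enat m < f1 \<omega>" using that(2) by (simp add: D_def)
      finally show ?thesis using that by (auto simp: I_def D_def)
    qed
    have \<xi>: "\<xi> c \<in> A.L2" if "c \<in> I" for c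
      unfolding \<xi>_def using cD[OF that] by (intro A.bump_L2 g) (auto simp: D_def intro: sAd)
    have fip\<xi>: "fip (\<xi> c \<omega>) (\<xi> d \<omega>) = (if \<omega> \<in> D \<and> c = d then of_real ((g \<omega>)\<^sup>2) else 0)" if "c \<in> I" for c d \<omega>
      unfolding \<xi>_def by (rule A.bump_fibre(3)) (rule cD[OF that])
    have "\<exists>w. \<forall>c\<in>I. w c \<in> B.L2 \<and> U (A.cls (\<xi> c)) = B.cls (w c)"
      by (rule bchoice) (use U_rep[OF \<xi>] in blast)
    then obtain w where w: "\<And>c. c \<in> I \<Longrightarrow> w c \<in> B.L2" "\<And>c. c \<in> I \<Longrightarrow> U (A.cls (\<xi> c)) = B.cls (w c)" by blast
    \<comment> \<open>The images \<open>w c\<close> have the same fibrewise inner products as the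
      sections \<open>\<xi> c\<close>, in the integrated sense over corresponding sets of
      invariants; this is \<open>S_commute\<close> together with isometry.\<close>
    have key: "(\<integral>\<omega>. (if \<omega> \<in> B.pre Bs then fip (w c \<omega>) (w d \<omega>) else 0) \<partial>M2)
        = (\<integral>\<omega>. (if \<omega> \<in> A.pre Bs then fip (\<xi> c \<omega>) (\<xi> d \<omega>) else 0) \<partial>M1)"
      if cd: "c \<in> I" "d \<in> I" and Bs: "Bs \<in> sets borel" for c d Bs
    proof -
      have "(\<integral>\<omega>. (if \<omega> \<in> B.pre Bs then fip (w c \<omega>) (w d \<omega>) else 0) \<partial>M2) = B.ip (w c) (B.rest (B.pre Bs) (w d))"
        using B.ip_rest[OF w(1)[OF cd(1)] w(1)[OF cd(2)], of "B.pre Bs"] by simp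
      also have "\<dots> = S (\<xi> c) (B.rest (B.pre Bs) (w d))"
        unfolding S_def w(2)[OF cd(1)] by (rule B.hinner_cls[symmetric, OF w(1)[OF cd(1)] B.rest_L2(1)[OF B.pre_sets[OF Bs] w(1)[OF cd(2)]]])
      also have "\<dots> = S (A.rest (A.pre Bs) (\<xi> c)) (w d)" by (rule S_commute[symmetric, OF Bs \<xi>[OF cd(1)] w(1)[OF cd(2)]])
      also have "\<dots> = A.ip (A.rest (A.pre Bs) (\<xi> c)) (\<xi> d)"
        by (rule S_image[OF \<xi>[OF cd(2)] A.rest_L2(1)[OF A.pre_sets[OF Bs] \<xi>[OF cd(1)]] w(2)[OF cd(2)]])
      finally show ?thesis using A.ip_rest(2)[OF \<xi>[OF cd(1)] \<xi>[OF cd(2)], of "A.pre Bs"] by simp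
    qed
    \<comment> \<open>Translates a set in \<open>M2\<close> into one of invariants whose preimage
      agrees with it up to a null set. So \<open>key\<close>, which only knows Borel sets of
      invariants, yields statements about all measurable sets.\<close>
    define tr where "tr E = {y \<in> R2. \<sigma>2 y \<in> E}" for E
    have tr: "AE \<omega> in M2. \<omega> \<in> B.pre (tr E) \<longleftrightarrow> \<omega> \<in> E" for E
      using R2(2) AE_space by eventually_elim (auto simp: tr_def B.pre_def \<sigma>2)
    \<comment> \<open>The integral over every measurable set vanishes, hence so does the integrand
      almost everywhere.\<close>
    have orth: "AE \<omega> in M2. fip (w c \<omega>) (w d \<omega>) = 0" if cd: "c \<in> I" "d \<in> I" "c \<noteq> d" for c d
    proof (rule B.density_zero)
      show int: "integrable M2 (\<lambda>\<omega>. fip (w c \<omega>) (w d \<omega>))" by (rule B.fip_integrable[OF w(1)[OF cd(1)] w(1)[OF cd(2)]])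
      fix E assume E: "E \<in> sets M2"
      then have trb: "tr E \<in> sets borel" unfolding tr_def by (rule R2(4))
      have m: "(\<lambda>\<omega>. if \<omega> \<in> E' then fip (w c \<omega>) (w d \<omega>) else 0) \<in> borel_measurable M2" if "E' \<in> sets M2" for E'
        using int that by (intro measurable_If_set) auto
      have "set_lebesgue_integral M2 E (\<lambda>\<omega>. fip (w c \<omega>) (w d \<omega>)) = (\<integral>\<omega>. (if \<omega> \<in> E then fip (w c \<omega>) (w d \<omega>) else 0) \<partial>M2)"
        unfolding set_lebesgue_integral_def by (intro Bochner_Integration.integral_cong) (auto simp: indicator_def)
      also have "\<dots> = (\<integral>\<omega>. (if \<omega> \<in> B.pre (tr E) then fip (w c \<omega>) (w d \<omega>) else 0) \<partial>M2)"
      proof (rule integral_cong_AE)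
        show "AE \<omega> in M2. (if \<omega> \<in> E then fip (w c \<omega>) (w d \<omega>) else 0) = (if \<omega> \<in> B.pre (tr E) then fip (w c \<omega>) (w d \<omega>) else 0)"
          using tr[of E] by eventually_elim simp
      qed (use m E B.pre_sets[OF trb] in auto)
      also have "\<dots> = 0" unfolding key[OF cd(1,2) trb] fip\<xi>[OF cd(1)] using cd(3) by (simp cong: if_cong)
      finally show "set_lebesgue_integral M2 E (\<lambda>\<omega>. fip (w c \<omega>) (w d \<omega>)) = 0" .
    qed
    \<comment> \<open>If \<open>w c\<close> vanished on part of the bad set, \<open>key\<close>
      would make the integral of the positive function \<open>g\<^sup>2\<close> over the
      corresponding part of \<open>D\<close> zero. That part would be null on the left, hence on the
      right.\<close>
    have nz: "AE \<omega> in M2. \<omega> \<in> B.pre (Bad n m) \<longrightarrow> fnorm2 (w c \<omega>) \<noteq> 0" if c: "c \<in> I" for c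
    proof -
      define Z where "Z = {\<omega> \<in> space M2. fnorm2 (w c \<omega>) = 0}"
      have fm: "(\<lambda>\<omega>. fnorm2 (w c \<omega>)) \<in> borel_measurable M2" using B.fnorm2_integrable[OF w(1)[OF c]] by auto
      have Z: "Z \<in> sets M2" unfolding Z_def using fm by measurable
      define Bs where "Bs = tr Z \<inter> Bad n m"
      have Bs: "Bs \<in> sets borel" unfolding Bs_def tr_def by (intro sets.Int R2(4) Z Bad)
      have sub: "A.pre Bs \<subseteq> D" using \<sigma>1 by (auto simp: A.pre_def Bs_def Bad_def D_def)
      have "(\<integral>\<omega>. (if \<omega> \<in> B.pre Bs then fip (w c \<omega>) (w c \<omega>) else 0) \<partial>M2) = 0"
      proof (rule integral_eq_zero_AE)
        show "AE \<omega> in M2. (if \<omega> \<in> B.pre Bs then fip (w c \<omega>) (w c \<omega>) else 0) = 0"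
          using tr[of Z] AE_space
        proof eventually_elim
          case (elim \<omega>)
          have "fnorm2 (w c \<omega>) = 0" if "\<omega> \<in> B.pre Bs" using that elim by (auto simp: Bs_def B.pre_def Z_def)
          then show ?case using fip_self[OF B.L2_fibre[OF w(1)[OF c] elim(2)]] by simp
        qed
      qed
      then have "(\<integral>\<omega>. (if \<omega> \<in> A.pre Bs then fip (\<xi> c \<omega>) (\<xi> c \<omega>) else 0) \<partial>M1) = 0"
        unfolding key[OF c c Bs] .
      also have "(\<integral>\<omega>. (if \<omega> \<in> A.pre Bs then fip (\<xi> c \<omega>) (\<xi> c \<omega>) else 0) \<partial>M1)
          = (\<integral>\<omega>. complex_of_real (if \<omega> \<in> A.pre Bs then (g \<omega>)\<^sup>2 else 0) \<partial>M1)"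
        using sub by (intro Bochner_Integration.integral_cong refl) (auto simp: fip\<xi>[OF c])
      finally have i0: "(\<integral>\<omega>. (if \<omega> \<in> A.pre Bs then (g \<omega>)\<^sup>2 else 0) \<partial>M1) = 0"
        unfolding integral_complex_of_real by simp
      have int: "integrable M1 (\<lambda>\<omega>. if \<omega> \<in> A.pre Bs then (g \<omega>)\<^sup>2 else 0)"
      proof (rule Bochner_Integration.integrable_bound[OF g(2)])
        show "(\<lambda>\<omega>. if \<omega> \<in> A.pre Bs then (g \<omega>)\<^sup>2 else 0) \<in> borel_measurable M1"
          using g(1) A.pre_sets[OF Bs] by (intro measurable_If_set) auto
      qed auto
      have "AE \<omega> in M1. (if \<omega> \<in> A.pre Bs then (g \<omega>)\<^sup>2 else 0) = 0"
        using i0 integral_nonneg_eq_0_iff_AE[OF int] by simp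
      with AE_space have "AE \<omega> in M1. \<omega> \<notin> A.pre Bs"
        by eventually_elim (use g(3) in \<open>force split: if_splits\<close>)
      then have "emeasure M1 (A.pre Bs) = 0"
        using AE_iff_null_sets[OF A.pre_sets[OF Bs]] null_setsD1 by blast
      then have "emeasure M2 (B.pre Bs) = 0" by (rule null_pre_transfer[OF Bs])
      then have "AE \<omega> in M2. \<omega> \<notin> B.pre Bs" using B.pre_sets[OF Bs] by (intro AE_not_in) (simp add: null_sets_def)
      with tr[of Z] AE_space show ?thesis
        by eventually_elim (auto simp: Bs_def B.pre_def Z_def)
    qed
    have cI: "countable I" by (simp add: I_def countable_finite)
    have "AE \<omega> in M2. \<forall>c\<in>I. \<forall>d\<in>I. c \<noteq> d \<longrightarrow> fip (w c \<omega>) (w d \<omega>) = 0"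
      unfolding AE_ball_countable[OF cI]
    proof (intro ballI)
      fix c d assume cd: "c \<in> I" "d \<in> I"
      show "AE \<omega> in M2. c \<noteq> d \<longrightarrow> fip (w c \<omega>) (w d \<omega>) = 0" using orth[OF cd] by (cases "c = d") auto
    qed
    moreover have "AE \<omega> in M2. \<forall>c\<in>I. \<omega> \<in> B.pre (Bad n m) \<longrightarrow> fnorm2 (w c \<omega>) \<noteq> 0"
      unfolding AE_ball_countable[OF cI] by (intro ballI nz)
    ultimately show ?thesis using AE_space
    proof eventually_elim
      case (elim \<omega>)
      show ?case
      proof
        assume b: "\<omega> \<in> B.pre (Bad n m)"
        define y where "y = B.invar \<omega>"
        have y: "y \<in> R1" "y \<in> R2" "A.deg (\<sigma>1 y) = n" "enat m < f1 (\<sigma>1 y)" "f2 (\<sigma>2 y) = enat m"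
          using b by (auto simp: B.pre_def Bad_def y_def)
        have "f2 \<omega> = enat m" using \<sigma>2[OF elim(3)] y(2,5) by (simp add: y_def)
        moreover have dn: "B.deg \<omega> = n"
          using R1(3)[OF y(1)] y(3) A.deg_invar[of "\<sigma>1 y"] B.deg_invar[of \<omega>] by (simp add: y_def)
        ultimately have fib: "w c \<omega> \<in> fibre n (enat m)" if "c \<in> I" for c
          using B.L2_fibre[OF w(1)[OF that] elim(3)] by simp
        have "card I \<le> m * n"
        proof (rule card_orthogonal_fibre[of I "\<lambda>c. w c \<omega>", OF _ fib])
          show "finite I" by (simp add: I_def)
          show "fnorm2 (w c \<omega>) \<noteq> 0" if "c \<in> I" for c using elim(2) b that by blast
          show "fip (w c \<omega>) (w d \<omega>) = 0" if "c \<in> I" "d \<in> I" "c \<noteq> d" for c d using elim(1) that by blast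
        qed
        moreover have "card I = (m + 1) * n" by (simp add: I_def)
        moreover have "n \<ge> 1" using B.deg_ge_1[OF elim(3)] dn by simp
        ultimately show False by simp
      qed
    qed
  qed
  then have nb: "AE \<omega> in M2. \<forall>n m. \<omega> \<notin> B.pre (Bad n m)" by (simp add: AE_all_countable)
  \<comment> \<open>\<open>Bad\<close> records only values in \<open>R1\<close>. The values outside
    are negligible on the left, hence on the right by transfer of null sets.\<close>
  have "AE \<omega> in M1. \<omega> \<notin> A.pre (- R1)" using R1(2) by eventually_elim (simp add: A.pre_def)
  moreover have R1c: "- R1 \<in> sets borel" using R1(1) by auto
  ultimately have "emeasure M1 (A.pre (- R1)) = 0" using AE_iff_null_sets[OF A.pre_sets[OF R1c]] null_setsD1 by blast
  then have "emeasure M2 (B.pre (- R1)) = 0" by (rule null_pre_transfer[OF R1c])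
  then have "AE \<omega> in M2. \<omega> \<notin> B.pre (- R1)" using B.pre_sets[OF R1c] by (intro AE_not_in) (simp add: null_sets_def)
  with nb R2(2) AE_space show ?thesis
  proof eventually_elim
    case (elim \<omega>)
    show ?case
    proof (intro ballI impI)
      fix \<omega>1 assume h: "\<omega>1 \<in> space M1" "A.invar \<omega>1 = B.invar \<omega>"
      have r: "B.invar \<omega> \<in> R1" using elim(3,4) by (auto simp: B.pre_def)
      have s: "\<sigma>1 (B.invar \<omega>) = \<omega>1" using \<sigma>1[OF h(1)] r h(2) by simp
      show "f1 \<omega>1 \<le> f2 \<omega>"
      proof (rule ccontr)
        assume "\<not> ?thesis"
        then have lt: "f2 \<omega> < f1 \<omega>1" by simp
        \<comment> \<open>The smaller side of a strict inequality in \<open>enat\<close> is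
          finite.\<close>
        then obtain m where m: "f2 \<omega> = enat m" by (cases "f2 \<omega>") auto
        have "\<omega> \<in> B.pre (Bad (A.deg \<omega>1) m)"
          using elim h r s \<sigma>2[OF elim(3) elim(2)] lt m by (auto simp: B.pre_def Bad_def)
        then show False using elim(1) by blast
      qed
    qed
  qed
qed

end

section \<open>The inverse of an intertwining unitary\<close>

context unitary_pair
begin

abbreviation "V \<equiv> inv_into (hcarrier A.HS) U"

lemma bij_U: "bij_betw U (hcarrier A.HS) (hcarrier B.HS)"
  using U by (simp add: unitary_op_def)

lemma V_inverse: "x \<in> hcarrier A.HS \<Longrightarrow> V (U x) = x"
  using bij_U by (simp add: bij_betw_def)

lemma unitary_inverse: "unitary_op B.HS A.HS V"
proof -
  have ex: "\<exists>x\<in>hcarrier A.HS. y = U x" if "y \<in> hcarrier B.HS" for y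
    using bij_U that by (auto simp: bij_betw_def)
  \<comment> \<open>The record carries no axioms, so closure of the carrier under the operations is
    obtained from representatives.\<close>
  have add: "hadd A.HS x y \<in> hcarrier A.HS" if xy: "x \<in> hcarrier A.HS" "y \<in> hcarrier A.HS" for x y
  proof -
    obtain \<xi> where \<xi>: "\<xi> \<in> A.L2" "x = A.cls \<xi>" by (rule A.carrier_cls[OF xy(1)])
    obtain \<eta> where \<eta>: "\<eta> \<in> A.L2" "y = A.cls \<eta>" by (rule A.carrier_cls[OF xy(2)])
    show ?thesis unfolding \<xi>(2) \<eta>(2) A.hadd_cls[OF \<xi>(1) \<eta>(1)] by (rule A.cls_carrier[OF A.L2_add[OF \<xi>(1) \<eta>(1)]])
  qed
  have sc: "hscale A.HS c x \<in> hcarrier A.HS" if x: "x \<in> hcarrier A.HS" for c x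
  proof -
    obtain \<xi> where \<xi>: "\<xi> \<in> A.L2" "x = A.cls \<xi>" by (rule A.carrier_cls[OF x])
    show ?thesis unfolding \<xi>(2) A.hscale_cls(1)[OF \<xi>(1)] by (rule A.cls_carrier[OF A.hscale_cls(2)[OF \<xi>(1)]])
  qed
  show ?thesis
    unfolding unitary_op_def
  proof (intro conjI ballI allI)
    show "bij_betw V (hcarrier B.HS) (hcarrier A.HS)" by (rule bij_betw_inv_into[OF bij_U])
    fix y y' assume y: "y \<in> hcarrier B.HS" "y' \<in> hcarrier B.HS"
    then obtain x x' where x: "x \<in> hcarrier A.HS" "y = U x" "x' \<in> hcarrier A.HS" "y' = U x'" using ex by blast
    have "hadd B.HS y y' = U (hadd A.HS x x')" using U x by (simp add: unitary_op_def)
    then show "V (hadd B.HS y y') = hadd A.HS (V y) (V y')" using V_inverse x add by simp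
    show "hinner A.HS (V y) (V y') = hinner B.HS y y'" using U x V_inverse by (simp add: unitary_op_def)
  next
    fix c y assume y: "y \<in> hcarrier B.HS"
    then obtain x where x: "x \<in> hcarrier A.HS" "y = U x" using ex by blast
    have "hscale B.HS c y = U (hscale A.HS c x)" using U x by (simp add: unitary_op_def)
    then show "V (hscale B.HS c y) = hscale A.HS c (V y)" using V_inverse x sc by simp
  qed
qed

lemma graph_inverse:
  assumes s: "s \<in> {1..k}"
  shows "map_prod V V ` mult_integral_tuple M2 f2 X2 s = mult_integral_tuple M1 f1 X1 s"
proof -
  have "fst p \<in> hcarrier A.HS \<and> snd p \<in> hcarrier A.HS" if "p \<in> mult_integral_tuple M1 f1 X1 s" for p
    using that A.cls_carrier unfolding A.graph_iff[OF s] by auto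
  then have "map_prod V V (map_prod U U p) = p" if "p \<in> mult_integral_tuple M1 f1 X1 s" for p
    using that V_inverse by (cases p) fastforce
  then have "(\<lambda>p. map_prod V V (map_prod U U p)) ` mult_integral_tuple M1 f1 X1 s = (\<lambda>p. p) ` mult_integral_tuple M1 f1 X1 s"
    by (rule image_cong[OF refl])
  then show ?thesis unfolding U_graph[OF s, symmetric] image_image image_ident .
qed

end

text \<open>The isomorphism sends a point of the first space to the point of the second with the
  same invariant. It is defined over the Borel set \<open>G\<close> of invariants where both Borel
  inverses are available and the multiplicities agree; the complement of \<open>G\<close> is
  negligible on both sides.\<close>

lemma unitarily_equivalent_imp_Borel_isomorphism:
  fixes M1 :: "'a measure" and M2 :: "'b measure"
  assumes "irreducible_field k M1 f1 X1" and "irreducible_field k M2 f2 X2"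
    and eq: "unitarily_equivalent k (mult_integral_space M1 f1 X1) (mult_integral_tuple M1 f1 X1)
           (mult_integral_space M2 f2 X2) (mult_integral_tuple M2 f2 X2)"
  shows "\<exists>Z1\<in>sets M1. \<exists>Z2\<in>sets M2. \<exists>\<Phi>.
            borel_isomorphism (restrict_space M1 (space M1 - Z1)) (restrict_space M2 (space M2 - Z2)) \<Phi> \<and>
            (emeasure M1 Z1 = 0 \<and> emeasure M2 Z2 = 0) \<and>
            (\<forall>B\<in>sets M1. B \<subseteq> space M1 - Z1 \<longrightarrow> (emeasure M2 (\<Phi> ` B) = 0 \<longleftrightarrow> emeasure M1 B = 0)) \<and>
            (\<forall>\<omega>\<in>space M1 - Z1.
               mats_unitarily_equivalent k (\<lambda>s. X2 s (\<Phi> \<omega>)) (\<lambda>s. X1 s \<omega>) \<and> f2 (\<Phi> \<omega>) = f1 \<omega>)"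
proof -
  interpret A: irreducible_field k M1 f1 X1 by fact
  interpret B: irreducible_field k M2 f2 X2 by fact
  obtain U where U: "unitary_op (mult_integral_space M1 f1 X1) (mult_integral_space M2 f2 X2) U"
    "\<And>s. s \<in> {1..k} \<Longrightarrow> map_prod U U ` mult_integral_tuple M1 f1 X1 s = mult_integral_tuple M2 f2 X2 s"
    using eq unfolding unitarily_equivalent_def by blast
  interpret P: irreducible_pair k M1 f1 X1 M2 f2 X2 U
    by unfold_locales (use U in auto)
  \<comment> \<open>The inverse unitary satisfies the same hypotheses, which turns the one-sided
    results on null sets and multiplicities into two-sided ones.\<close>
  interpret Q: irreducible_pair k M2 f2 X2 M1 f1 X1 P.V
    by unfold_locales (rule P.unitary_inverse, rule P.graph_inverse)
  obtain R1 \<sigma>1 where R1: "R1 \<in> sets borel" "AE \<omega> in M1. A.invar \<omega> \<in> R1"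
    "\<And>y. y \<in> R1 \<Longrightarrow> \<sigma>1 y \<in> space M1 \<and> A.invar (\<sigma>1 y) = y" "\<And>E. E \<in> sets M1 \<Longrightarrow> {y \<in> R1. \<sigma>1 y \<in> E} \<in> sets borel"
    using A.Borel_inverse by auto
  obtain R2 \<sigma>2 where R2: "R2 \<in> sets borel" "AE \<omega> in M2. B.invar \<omega> \<in> R2"
    "\<And>y. y \<in> R2 \<Longrightarrow> \<sigma>2 y \<in> space M2 \<and> B.invar (\<sigma>2 y) = y" "\<And>E. E \<in> sets M2 \<Longrightarrow> {y \<in> R2. \<sigma>2 y \<in> E} \<in> sets borel"
    using B.Borel_inverse by auto
  have \<sigma>1: "\<sigma>1 (A.invar \<omega>) = \<omega>" if "\<omega> \<in> space M1" "A.invar \<omega> \<in> R1" for \<omega>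
    using R1(3)[OF that(2)] that(1) A.invar_inj by (auto dest: inj_onD)
  have \<sigma>2: "\<sigma>2 (B.invar \<omega>) = \<omega>" if "\<omega> \<in> space M2" "B.invar \<omega> \<in> R2" for \<omega>
    using R2(3)[OF that(2)] that(1) B.invar_inj by (auto dest: inj_onD)
  have ac: "emeasure M1 (A.pre Bs) = 0 \<longleftrightarrow> emeasure M2 (B.pre Bs) = 0" if "Bs \<in> sets borel" for Bs
    using P.null_pre_transfer[OF that] Q.null_pre_transfer[OF that] by blast
  define Fs where "Fs P = {y \<in> R1 \<inter> R2. P (f1 (\<sigma>1 y)) (f2 (\<sigma>2 y))}" for P
  have Fs: "Fs P \<in> sets borel" for P
  proof -
    \<comment> \<open>There are countably many pairs of multiplicities, so any relation between them
      gives a countable union of Borel sets.\<close>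
    have "Fs P = (\<Union>p\<in>{p. P (fst p) (snd p)}. {y \<in> R1. \<sigma>1 y \<in> {\<omega> \<in> space M1. f1 \<omega> = fst p}} \<inter> {y \<in> R2. \<sigma>2 y \<in> {\<omega> \<in> space M2. f2 \<omega> = snd p}})"
      using R1(3) R2(3) by (fastforce simp: Fs_def)
    moreover have "\<dots> \<in> sets borel"
    proof -
      have s: "{\<omega> \<in> space M1. f1 \<omega> = e} \<in> sets M1" "{\<omega> \<in> space M2. f2 \<omega> = e} \<in> sets M2" for e
        by measurable
      show ?thesis
        by (rule sets.countable_UN'[OF countableI_type]) (rule image_subsetI, rule sets.Int[OF R1(4)[OF s(1)] R2(4)[OF s(2)]])
    qed
    ultimately show ?thesis by simp
  qed
  define G where "G = Fs (=)"
  have G: "G \<in> sets borel" unfolding G_def by (rule Fs)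
  have nullI2: "emeasure M2 (B.pre Bs) = 0" if "Bs \<in> sets borel" "AE \<omega> in M2. \<omega> \<notin> B.pre Bs" for Bs
    using AE_iff_null_sets[OF B.pre_sets[OF that(1)]] that(2) null_setsD1 by blast
  have nullI1: "emeasure M1 (A.pre Bs) = 0" if "Bs \<in> sets borel" "AE \<omega> in M1. \<omega> \<notin> A.pre Bs" for Bs
    using AE_iff_null_sets[OF A.pre_sets[OF that(1)]] that(2) null_setsD1 by blast
  have nullD2: "AE \<omega> in M2. \<omega> \<notin> B.pre Bs" if "Bs \<in> sets borel" "emeasure M2 (B.pre Bs) = 0" for Bs
    using that B.pre_sets[OF that(1)] by (intro AE_not_in) (simp add: null_sets_def)
  have cR: "- R1 \<in> sets borel" "- R2 \<in> sets borel" "- G \<in> sets borel" using R1(1) R2(1) G by auto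
  \<comment> \<open>\<open>R1\<close> is conull for the first field only; equivalence of the image
    measures carries this over.\<close>
  have "AE \<omega> in M2. \<omega> \<notin> B.pre (- R1)"
    by (intro nullD2 cR ac[THEN iffD1] nullI1) (use R1(2) in eventually_elim, simp add: A.pre_def)
  moreover have "AE \<omega> in M2. \<omega> \<notin> B.pre (Fs (<))"
  proof (intro nullD2 Fs ac[THEN iffD1] nullI1)
    show "AE \<omega> in M1. \<omega> \<notin> A.pre (Fs (<))"
      using Q.multiplicity_le AE_space
    proof eventually_elim
      case (elim \<omega>)
      show ?case
      proof
        assume "\<omega> \<in> A.pre (Fs (<))"
        then have y: "A.invar \<omega> \<in> R1" "A.invar \<omega> \<in> R2" "f1 (\<sigma>1 (A.invar \<omega>)) < f2 (\<sigma>2 (A.invar \<omega>))"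
          by (auto simp: A.pre_def Fs_def)
        then have "f2 (\<sigma>2 (A.invar \<omega>)) \<le> f1 \<omega>" using elim(1) R2(3)[OF y(2)] by auto
        then show False using y(3) \<sigma>1[OF elim(2) y(1)] by simp
      qed
    qed
  qed
  moreover have "AE \<omega> in M2. \<omega> \<notin> B.pre (Fs (>))"
    using P.multiplicity_le AE_space
  proof eventually_elim
    case (elim \<omega>)
    show ?case
    proof
      assume "\<omega> \<in> B.pre (Fs (>))"
      then have y: "B.invar \<omega> \<in> R1" "B.invar \<omega> \<in> R2" "f1 (\<sigma>1 (B.invar \<omega>)) > f2 (\<sigma>2 (B.invar \<omega>))"
        by (auto simp: B.pre_def Fs_def)
      then have "f1 (\<sigma>1 (B.invar \<omega>)) \<le> f2 \<omega>" using elim(1) R1(3)[OF y(1)] by auto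
      then show False using y(3) \<sigma>2[OF elim(2) y(2)] by simp
    qed
  qed
  \<comment> \<open>Outside \<open>G\<close> a value misses \<open>R1\<close> or \<open>R2\<close>,
    or one multiplicity is strictly larger than the other; all four cases are negligible.\<close>
  ultimately have "AE \<omega> in M2. \<omega> \<notin> B.pre (- G)"
    using R2(2) AE_space
    by eventually_elim (auto simp: B.pre_def G_def Fs_def not_less)
  then have n2: "emeasure M2 (B.pre (- G)) = 0" by (rule nullI2[OF cR(3)])
  then have n1: "emeasure M1 (A.pre (- G)) = 0" using ac[OF cR(3)] by simp
  define Z1 where "Z1 = A.pre (- G)"
  define Z2 where "Z2 = B.pre (- G)"
  have W1: "space M1 - Z1 = A.pre G" and W2: "space M2 - Z2 = B.pre G"
    by (auto simp: Z1_def Z2_def A.pre_def B.pre_def)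
  have sW1: "A.pre G \<in> sets M1" and sW2: "B.pre G \<in> sets M2" by (rule A.pre_sets[OF G], rule B.pre_sets[OF G])
  have sub1: "A.pre G \<subseteq> space M1" and sub2: "B.pre G \<subseteq> space M2" by (auto simp: A.pre_def B.pre_def)
  have sp1: "space (restrict_space M1 (A.pre G)) = A.pre G" and sp2: "space (restrict_space M2 (B.pre G)) = B.pre G"
    using sub1 sub2 by (auto simp: space_restrict_space)
  define \<Phi> where "\<Phi> \<omega> = \<sigma>2 (A.invar \<omega>)" for \<omega>
  define \<Psi> where "\<Psi> \<omega> = \<sigma>1 (B.invar \<omega>)" for \<omega>
  have \<Phi>: "\<Phi> \<omega> \<in> B.pre G \<and> B.invar (\<Phi> \<omega>) = A.invar \<omega> \<and> \<Psi> (\<Phi> \<omega>) = \<omega> \<and> f2 (\<Phi> \<omega>) = f1 \<omega>" if w: "\<omega> \<in> A.pre G" for \<omega>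
  proof -
    have y: "A.invar \<omega> \<in> R1" "A.invar \<omega> \<in> R2" "f1 (\<sigma>1 (A.invar \<omega>)) = f2 (\<sigma>2 (A.invar \<omega>))" "A.invar \<omega> \<in> G" "\<omega> \<in> space M1"
      using w by (auto simp: A.pre_def G_def Fs_def)
    then show ?thesis using R2(3)[OF y(2)] \<sigma>1[OF y(5,1)] by (simp add: \<Phi>_def \<Psi>_def B.pre_def)
  qed
  have \<Psi>: "\<Psi> \<omega> \<in> A.pre G \<and> A.invar (\<Psi> \<omega>) = B.invar \<omega> \<and> \<Phi> (\<Psi> \<omega>) = \<omega>" if w: "\<omega> \<in> B.pre G" for \<omega>
  proof -
    have y: "B.invar \<omega> \<in> R1" "B.invar \<omega> \<in> R2" "B.invar \<omega> \<in> G" "\<omega> \<in> space M2"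
      using w by (auto simp: B.pre_def G_def Fs_def)
    then show ?thesis using R1(3)[OF y(1)] \<sigma>2[OF y(4,2)] by (simp add: \<Phi>_def \<Psi>_def A.pre_def)
  qed
  have GR: "G \<subseteq> R1" "G \<subseteq> R2" by (auto simp: G_def Fs_def)
  have bij: "bij_betw \<Phi> (A.pre G) (B.pre G)"
    by (rule bij_betwI[where g = \<Psi>]) (use \<Phi> \<Psi> in auto)
  have m\<Phi>: "\<Phi> \<in> measurable (restrict_space M1 (A.pre G)) (restrict_space M2 (B.pre G))"
    unfolding measurable_def sp1 sp2
  proof (intro CollectI conjI ballI)
    show "\<Phi> \<in> A.pre G \<rightarrow> B.pre G" using \<Phi> by auto
    fix E assume "E \<in> sets (restrict_space M2 (B.pre G))"
    then have E: "E \<in> sets M2" "E \<subseteq> B.pre G" using sW2 sub2 by (auto simp: sets_restrict_space_iff)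
    have "\<Phi> -` E \<inter> A.pre G = A.pre ({y \<in> R2. \<sigma>2 y \<in> E} \<inter> G)"
      using GR by (auto simp: \<Phi>_def A.pre_def)
    moreover have "\<dots> \<in> sets M1" by (intro A.pre_sets sets.Int R2(4) E G)
    moreover have "A.pre ({y \<in> R2. \<sigma>2 y \<in> E} \<inter> G) \<subseteq> A.pre G" by (auto simp: A.pre_def)
    ultimately show "\<Phi> -` E \<inter> A.pre G \<in> sets (restrict_space M1 (A.pre G))"
      using sW1 sub1 by (simp add: sets_restrict_space_iff Int_absorb2)
  qed
  have m\<Psi>: "\<Psi> \<in> measurable (restrict_space M2 (B.pre G)) (restrict_space M1 (A.pre G))"
    unfolding measurable_def sp1 sp2
  proof (intro CollectI conjI ballI)
    show "\<Psi> \<in> B.pre G \<rightarrow> A.pre G" using \<Psi> by auto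
    fix E assume "E \<in> sets (restrict_space M1 (A.pre G))"
    then have E: "E \<in> sets M1" "E \<subseteq> A.pre G" using sW1 sub1 by (auto simp: sets_restrict_space_iff)
    have "\<Psi> -` E \<inter> B.pre G = B.pre ({y \<in> R1. \<sigma>1 y \<in> E} \<inter> G)"
      using GR by (auto simp: \<Psi>_def B.pre_def)
    moreover have "\<dots> \<in> sets M2" by (intro B.pre_sets sets.Int R1(4) E G)
    moreover have "B.pre ({y \<in> R1. \<sigma>1 y \<in> E} \<inter> G) \<subseteq> B.pre G" by (auto simp: B.pre_def)
    ultimately show "\<Psi> -` E \<inter> B.pre G \<in> sets (restrict_space M2 (B.pre G))"
      using sW2 sub2 by (simp add: sets_restrict_space_iff Int_absorb2)
  qed
  have inv: "inv_into (A.pre G) \<Phi> \<omega> = \<Psi> \<omega>" if "\<omega> \<in> B.pre G" for \<omega>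
    using bij \<Psi>[OF that] by (metis bij_betw_inv_into_left)
  have iso: "borel_isomorphism (restrict_space M1 (space M1 - Z1)) (restrict_space M2 (space M2 - Z2)) \<Phi>"
    unfolding borel_isomorphism_def W1 W2 sp1 sp2
  proof (intro conjI bij m\<Phi>)
    show "inv_into (A.pre G) \<Phi> \<in> measurable (restrict_space M2 (B.pre G)) (restrict_space M1 (A.pre G))"
      using m\<Psi> by (rule measurable_cong[THEN iffD1, rotated]) (simp add: sp2 inv)
  qed
  have e2: "emeasure M2 (\<Phi> ` E) = 0 \<longleftrightarrow> emeasure M1 E = 0" if E: "E \<in> sets M1" "E \<subseteq> A.pre G" for E
  proof -
    \<comment> \<open>\<open>E\<close> and its image under \<open>\<Phi>\<close> are preimages of
      the same Borel set of invariants, so \<open>ac\<close> compares their measures.\<close>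
    define Y where "Y = {y \<in> R1. \<sigma>1 y \<in> E} \<inter> G"
    have Y: "Y \<in> sets borel" unfolding Y_def by (intro sets.Int R1(4) E G)
    have "E = A.pre Y"
    proof (intro equalityI subsetI)
      fix \<omega> assume w: "\<omega> \<in> E"
      then have p: "\<omega> \<in> space M1" "A.invar \<omega> \<in> G" using E(2) by (auto simp: A.pre_def)
      then have "\<sigma>1 (A.invar \<omega>) = \<omega>" using \<sigma>1 GR by blast
      then show "\<omega> \<in> A.pre Y" using p w GR by (auto simp: Y_def A.pre_def)
    next
      fix \<omega> assume w: "\<omega> \<in> A.pre Y"
      then have "\<sigma>1 (A.invar \<omega>) = \<omega>" "\<sigma>1 (A.invar \<omega>) \<in> E" using \<sigma>1[of \<omega>] by (auto simp: Y_def A.pre_def)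
      then show "\<omega> \<in> E" by simp
    qed
    moreover have "\<Phi> ` E = B.pre Y"
    proof (intro equalityI subsetI)
      fix \<omega> assume "\<omega> \<in> \<Phi> ` E"
      then obtain x where x: "x \<in> E" "\<omega> = \<Phi> x" by blast
      then have "x \<in> A.pre G" using E(2) by blast
      then show "\<omega> \<in> B.pre Y" using \<Phi>[of x] x \<sigma>1[of x] GR by (auto simp: Y_def A.pre_def B.pre_def)
    next
      fix \<omega> assume w: "\<omega> \<in> B.pre Y"
      then have "\<omega> \<in> B.pre G" "\<Psi> \<omega> \<in> E" by (auto simp: Y_def B.pre_def \<Psi>_def)
      then show "\<omega> \<in> \<Phi> ` E" using \<Psi>[of \<omega>] by (metis imageI)
    qed
    ultimately show ?thesis using ac[OF Y] by simp
  qed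
  have e3: "mats_unitarily_equivalent k (\<lambda>s. X2 s (\<Phi> \<omega>)) (\<lambda>s. X1 s \<omega>)" if w: "\<omega> \<in> A.pre G" for \<omega>
  proof -
    have s: "\<omega> \<in> space M1" "\<Phi> \<omega> \<in> space M2" using w \<Phi>[OF w] by (auto simp: A.pre_def B.pre_def)
    show ?thesis
      using \<Phi>[OF w] tuple_invariant_eq_iff[OF A.k A.tuple[OF s(1)] B.tuple[OF s(2)] A.irr[OF s(1)] B.irr[OF s(2)]]
      by (simp add: A.invar_def B.invar_def)
  qed
  show ?thesis
  proof (intro bexI exI conjI ballI impI)
    show "Z1 \<in> sets M1" "Z2 \<in> sets M2" unfolding Z1_def Z2_def by (rule A.pre_sets[OF cR(3)], rule B.pre_sets[OF cR(3)])
    show "borel_isomorphism (restrict_space M1 (space M1 - Z1)) (restrict_space M2 (space M2 - Z2)) \<Phi>" by (rule iso)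
    show "emeasure M1 Z1 = 0" "emeasure M2 Z2 = 0" using n1 n2 by (simp_all add: Z1_def Z2_def)
    show "emeasure M2 (\<Phi> ` E) = 0 \<longleftrightarrow> emeasure M1 E = 0" if "E \<in> sets M1" "E \<subseteq> space M1 - Z1" for E
      using e2 that unfolding W1 by blast
    show "mats_unitarily_equivalent k (\<lambda>s. X2 s (\<Phi> \<omega>)) (\<lambda>s. X1 s \<omega>)" "f2 (\<Phi> \<omega>) = f1 \<omega>" if "\<omega> \<in> space M1 - Z1" for \<omega>
      using e3 \<Phi> that unfolding W1 by blast+
  qed
qed

section \<open>Measurable choice of intertwiners\<close>

text \<open>The residual of \<open>v\<close> after Gram--Schmidt; division by zero yields \<open>0\<close>, so linearly dependent
  vectors are skipped and the result depends measurably on the data.\<close>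

fun resid :: "'i set \<Rightarrow> ('i \<Rightarrow> complex) list \<Rightarrow> ('i \<Rightarrow> complex) \<Rightarrow> 'i \<Rightarrow> complex" where
  "resid I [] v = v"
| "resid I (r # rs) v = (\<lambda>x. resid I rs v x -
     (\<Sum>y\<in>I. resid I rs v y * cnj (resid I rs r y)) / (\<Sum>y\<in>I. resid I rs r y * cnj (resid I rs r y)) * resid I rs r x)"

text \<open>The two claims need a joint induction. Orthogonality to the head \<open>r\<close>
  follows from orthogonality to its own residual \<open>b\<close>, because the second claim, used
  with the new residual in the place of \<open>q\<close>, lets \<open>b\<close> be exchanged for
  \<open>r\<close>.\<close>

lemma resid_orthogonal:
  assumes I: "finite I"
  shows "\<And>v r. r \<in> set rs \<Longrightarrow> (\<Sum>x\<in>I. resid I rs v x * cnj (r x)) = 0"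
    "\<And>v q. (\<And>r. r \<in> set rs \<Longrightarrow> (\<Sum>x\<in>I. r x * cnj (q x)) = 0) \<Longrightarrow>
      (\<Sum>x\<in>I. resid I rs v x * cnj (q x)) = (\<Sum>x\<in>I. v x * cnj (q x))"
proof (induction rs)
  case Nil
  { case 1 then show ?case by simp }
  { case 2 then show ?case by simp }
next
  case (Cons r rs)
  define b where "b = resid I rs r"
  define t where "t v = (\<Sum>y\<in>I. resid I rs v y * cnj (b y)) / (\<Sum>y\<in>I. b y * cnj (b y))" for v
  have e: "resid I (r # rs) v = (\<lambda>x. resid I rs v x - t v * b x)" for v
    by (simp add: b_def t_def)
  have ipe: "(\<Sum>x\<in>I. resid I (r # rs) v x * cnj (q x)) = (\<Sum>x\<in>I. resid I rs v x * cnj (q x)) - t v * (\<Sum>x\<in>I. b x * cnj (q x))" for v q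
    unfolding e by (simp add: algebra_simps sum_subtractf sum_distrib_left)
  have sym: "(\<Sum>x\<in>I. u x * cnj (w x)) = cnj (\<Sum>x\<in>I. w x * cnj (u x))" for u w :: "'a \<Rightarrow> complex"
    by (simp add: mult.commute)
  have old: "(\<Sum>x\<in>I. resid I (r # rs) v x * cnj (r' x)) = 0" if "r' \<in> set rs" for v r'
    unfolding ipe using Cons.IH(1)[OF that] by (simp add: b_def)
  { case (1 v r')
    have "(\<Sum>x\<in>I. resid I (r # rs) v x * cnj (r x)) = 0"
    proof -
      have bb: "(\<Sum>x\<in>I. resid I (r # rs) v x * cnj (b x)) = 0"
      \<comment> \<open>If \<open>b\<close> has length 0 it vanishes on \<open>I\<close>, and
        orthogonality to it is trivial; this is the case in which the quotient is a division by
        zero.\<close>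
      proof (cases "(\<Sum>y\<in>I. b y * cnj (b y)) = 0")
        case True
        have "complex_of_real (\<Sum>y\<in>I. (cmod (b y))\<^sup>2) = (\<Sum>y\<in>I. b y * cnj (b y))"
          by (simp add: complex_norm_square del: of_real_power)
        then have "(\<Sum>y\<in>I. (cmod (b y))\<^sup>2) = 0" using True by (metis of_real_eq_0_iff)
        then have "b y = 0" if "y \<in> I" for y using that I by (simp add: sum_nonneg_eq_0_iff)
        then show ?thesis by simp
      next
        case False
        then show ?thesis unfolding ipe by (simp add: t_def)
      qed
      let ?w = "resid I (r # rs) v"
      have "(\<Sum>x\<in>I. b x * cnj (?w x)) = (\<Sum>x\<in>I. r x * cnj (?w x))"
        unfolding b_def
      proof (rule Cons.IH(2))
        fix r' assume "r' \<in> set rs"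
        then show "(\<Sum>x\<in>I. r' x * cnj (?w x)) = 0" using old[of r' v] sym[of r' ?w] by simp
      qed
      then show ?thesis using bb sym[of ?w b] sym[of ?w r] by (metis complex_cnj_zero)
    qed
    then show ?case using 1 old by (cases "r' = r") auto
  }
  { case (2 v q)
    have "(\<Sum>x\<in>I. b x * cnj (q x)) = 0" unfolding b_def using 2 by (subst Cons.IH(2)) auto
    then show ?case unfolding ipe using 2 by (subst Cons.IH(2)) auto
  }
qed

lemma resid_measurable:
  fixes rs :: "('w \<Rightarrow> 'i \<Rightarrow> complex) list"
  assumes "\<And>r x. r \<in> set rs \<Longrightarrow> (\<lambda>\<omega>. r \<omega> x) \<in> borel_measurable M" "\<And>x. (\<lambda>\<omega>. v \<omega> x) \<in> borel_measurable M"
  shows "(\<lambda>\<omega>. resid I (map (\<lambda>r. r \<omega>) rs) (v \<omega>) x) \<in> borel_measurable M"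
  using assms
proof (induction rs arbitrary: v x)
  case Nil
  then show ?case by simp
next
  case (Cons r rs)
  have cn: "(\<lambda>\<omega>. cnj (g \<omega>)) \<in> borel_measurable M" if "g \<in> borel_measurable M" for g
    using that by (rule borel_measurable_continuous_on[OF continuous_on_cnj[OF continuous_on_id]])
  have "(\<lambda>\<omega>. resid I (map (\<lambda>r. r \<omega>) rs) (v \<omega>) x) \<in> borel_measurable M"
    "(\<lambda>\<omega>. resid I (map (\<lambda>r. r \<omega>) rs) (r \<omega>) x) \<in> borel_measurable M" for x
    using Cons by auto
  then show ?case
    by (auto intro!: borel_measurable_diff borel_measurable_times borel_measurable_divide borel_measurable_sum cn)
qed

lemma pull_measurable:
  assumes W: "W \<in> sets M" and \<Phi>: "\<Phi> \<in> measurable (restrict_space M W) N" and g: "g \<in> borel_measurable N"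
  shows "(\<lambda>\<omega>. if \<omega> \<in> W then g (\<Phi> \<omega>) else a) \<in> borel_measurable M"
  using measurable_compose[OF \<Phi> g] W
  by (subst measurable_restrict_space_iff[symmetric]) auto

section \<open>Intertwiners as solutions of linear equations with measurable coefficients\<close>

locale matched_fields =
  A: mult_field k M1 f1 X1 + B: mult_field k M2 f2 X2
  for k :: nat and M1 :: "'a measure" and f1 X1 and M2 :: "'b measure" and f2 X2 +
  fixes W1 :: "'a set" and \<Phi> :: "'a \<Rightarrow> 'b"
  assumes W1: "W1 \<in> sets M1" and \<Phi>: "\<Phi> \<in> measurable (restrict_space M1 W1) M2"
    and equivalent: "\<And>\<omega>. \<omega> \<in> W1 \<Longrightarrow> mats_unitarily_equivalent k (\<lambda>s. X2 s (\<Phi> \<omega>)) (\<lambda>s. X1 s \<omega>)"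
    and irr1: "\<And>\<omega>. \<omega> \<in> space M1 \<Longrightarrow> irreducible_tuple k (\<lambda>s. X1 s \<omega>)"
    and irr2: "\<And>\<omega>. \<omega> \<in> space M2 \<Longrightarrow> irreducible_tuple k (\<lambda>s. X2 s \<omega>)"
    and f_eq: "\<And>\<omega>. \<omega> \<in> W1 \<Longrightarrow> f2 (\<Phi> \<omega>) = f1 \<omega>"
begin

lemma W1_space: "\<omega> \<in> W1 \<Longrightarrow> \<omega> \<in> space M1"
  using W1 sets.sets_into_space by blast

lemma \<Phi>_space: "\<omega> \<in> W1 \<Longrightarrow> \<Phi> \<omega> \<in> space M2"
  using measurable_space[OF \<Phi>, of \<omega>] W1_space by (simp add: space_restrict_space)

lemma deg_eq:
  assumes w: "\<omega> \<in> W1"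
  shows "B.deg (\<Phi> \<omega>) = A.deg \<omega>"
    and exists_intertwiner: "\<exists>V. unitary_mat (A.deg \<omega>) V \<and> (\<forall>s\<in>{1..k}. V * X2 s (\<Phi> \<omega>) = X1 s \<omega> * V)"
proof -
  note D = mats_unitarily_equivalentD[where k = k and A = "\<lambda>s. X2 s (\<Phi> \<omega>)" and B = "\<lambda>s. X1 s \<omega>",
      OF B.X_carrier[OF \<Phi>_space[OF w]] A.X_carrier[OF W1_space[OF w]] B.deg_def[symmetric] A.deg_def[symmetric] equivalent[OF w]]
  show e: "B.deg (\<Phi> \<omega>) = A.deg \<omega>" by (rule D(1)[symmetric])
  show "\<exists>V. unitary_mat (A.deg \<omega>) V \<and> (\<forall>s\<in>{1..k}. V * X2 s (\<Phi> \<omega>) = X1 s \<omega> * V)"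
    using D(2) unfolding e .
qed

definition lx :: "nat \<Rightarrow> bool \<Rightarrow> nat \<Rightarrow> nat \<Rightarrow> 'a \<Rightarrow> complex" where
  "lx s b i l = A.ment (\<lambda>\<omega>. letters k (\<lambda>s. X1 s \<omega>) s b) i l"

text \<open>The letters of the second tuple brought to \<open>M1\<close> along
  \<open>\<Phi>\<close>. The value 0 off \<open>W1\<close> makes them measurable on all of
  \<open>M1\<close>.\<close>

definition ly :: "nat \<Rightarrow> bool \<Rightarrow> nat \<Rightarrow> nat \<Rightarrow> 'a \<Rightarrow> complex" where
  "ly s b i l \<omega> = (if \<omega> \<in> W1 then B.ment (\<lambda>\<omega>. letters k (\<lambda>s. X2 s \<omega>) s b) i l (\<Phi> \<omega>) else 0)"

lemma lx_measurable: "lx s b i l \<in> borel_measurable M1"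
  unfolding lx_def using A.mfield_letters by (simp add: A.mfield_def)

lemma ly_measurable: "ly s b i l \<in> borel_measurable M1"
  unfolding ly_def[abs_def] by (rule pull_measurable[OF W1 \<Phi>]) (use B.mfield_letters in \<open>simp add: B.mfield_def\<close>)

text \<open>\<open>row (s, b, i, j)\<close> is orthogonal to a matrix \<open>Q\<close> iff \<open>Q Y\<close> and \<open>L Q\<close> agree in the entry \<open>(i, j)\<close>,
  for the letters \<open>L\<close> and \<open>Y\<close> with index \<open>(s, b)\<close> of the two tuples.\<close>

definition row :: "nat \<times> bool \<times> nat \<times> nat \<Rightarrow> 'a \<Rightarrow> nat \<times> nat \<Rightarrow> complex" where
  "row t \<omega> pq = (case t of (s, b, i, j) \<Rightarrow> case pq of (p, q) \<Rightarrow>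
     cnj ((if p = i then ly s b q j \<omega> else 0) - (if q = j then lx s b i p \<omega> else 0)))"

definition rows :: "nat \<Rightarrow> ('a \<Rightarrow> nat \<times> nat \<Rightarrow> complex) list" where
  "rows n = map row (List.product [0..<k] (List.product [False, True] (List.product [0..<n] [0..<n])))"

text \<open>At a point of \<open>W1\<close> with degree \<open>n\<close> this is the projection of
  the matrix unit \<open>e\<close> onto the space of intertwiners. The degree is a parameter here,
  so that measurability concerns a matrix of fixed size.\<close>

definition Qe :: "nat \<Rightarrow> nat \<times> nat \<Rightarrow> 'a \<Rightarrow> complex mat" where
  "Qe n e \<omega> = mat n n (resid ({..<n} \<times> {..<n}) (map (\<lambda>r. r \<omega>) (rows n)) (\<lambda>x. if x = e then 1 else 0))"

lemma Qe_measurable: "i < n \<Longrightarrow> l < n \<Longrightarrow> (\<lambda>\<omega>. Qe n e \<omega> $$ (i, l)) \<in> borel_measurable M1"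
proof -
  have cn: "(\<lambda>\<omega>. cnj (g \<omega>)) \<in> borel_measurable M1" if "g \<in> borel_measurable M1" for g
    using that by (rule borel_measurable_continuous_on[OF continuous_on_cnj[OF continuous_on_id]])
  have if_m: "(\<lambda>\<omega>. if P then g \<omega> else 0) \<in> borel_measurable M1" if "g \<in> borel_measurable M1" for P and g :: "'a \<Rightarrow> complex"
    using that by (cases P) auto
  have "(\<lambda>\<omega>. row t \<omega> x) \<in> borel_measurable M1" for t x
    unfolding row_def by (cases t; cases x) (auto intro!: cn borel_measurable_diff if_m lx_measurable ly_measurable)
  then have "(\<lambda>\<omega>. resid ({..<n} \<times> {..<n}) (map (\<lambda>r. r \<omega>) (rows n)) (\<lambda>x. if x = e then 1 else 0) (i, l)) \<in> borel_measurable M1"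
    by (intro resid_measurable) (auto simp: rows_def)
  then show "i < n \<Longrightarrow> l < n \<Longrightarrow> (\<lambda>\<omega>. Qe n e \<omega> $$ (i, l)) \<in> borel_measurable M1" by (simp add: Qe_def)
qed

lemma frob_Qe_measurable: "(\<lambda>\<omega>. frob (Qe n e \<omega>)) \<in> borel_measurable M1"
proof -
  have "(\<lambda>\<omega>. \<Sum>i<n. \<Sum>j<n. (cmod (Qe n e \<omega> $$ (i, j)))\<^sup>2) \<in> borel_measurable M1"
    by (intro borel_measurable_sum borel_measurable_power measurable_compose[OF Qe_measurable borel_measurable_norm]) auto
  moreover have "frob (Qe n e \<omega>) = (\<Sum>i<n. \<Sum>j<n. (cmod (Qe n e \<omega> $$ (i, j)))\<^sup>2)" for \<omega>
    by (rule frob_carrier) (simp add: Qe_def)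
  ultimately show ?thesis by simp
qed

lemma row_orthogonal:
  assumes w: "\<omega> \<in> W1" and Q: "Q \<in> carrier_mat (A.deg \<omega>) (A.deg \<omega>)" and ij: "i < A.deg \<omega>" "j < A.deg \<omega>"
  shows "(\<Sum>x\<in>{..<A.deg \<omega>} \<times> {..<A.deg \<omega>}. Q $$ x * cnj (row (s, b, i, j) \<omega> x))
    = (Q * letters k (\<lambda>s. X2 s (\<Phi> \<omega>)) s b) $$ (i, j) - (letters k (\<lambda>s. X1 s \<omega>) s b * Q) $$ (i, j)"
proof -
  let ?n = "A.deg \<omega>"
  have c: "letters k (\<lambda>s. X2 s (\<Phi> \<omega>)) s b \<in> carrier_mat ?n ?n" "letters k (\<lambda>s. X1 s \<omega>) s b \<in> carrier_mat ?n ?n"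
    using B.mfield_letters[of s b] A.mfield_letters[of s b] \<Phi>_space[OF w] W1_space[OF w] deg_eq[OF w]
    by (auto simp: A.mfield_def B.mfield_def)
  have ly: "ly s b q j \<omega> = letters k (\<lambda>s. X2 s (\<Phi> \<omega>)) s b $$ (q, j)" if "q < ?n" for q
    using that ij w deg_eq[OF w] by (simp add: ly_def B.ment_def)
  have lx: "lx s b i p \<omega> = letters k (\<lambda>s. X1 s \<omega>) s b $$ (i, p)" if "p < ?n" for p
    using that ij by (simp add: lx_def A.ment_def)
  have "(\<Sum>x\<in>{..<?n} \<times> {..<?n}. Q $$ x * cnj (row (s, b, i, j) \<omega> x))
      = (\<Sum>p<?n. \<Sum>q<?n. Q $$ (p, q) * ((if p = i then ly s b q j \<omega> else 0) - (if q = j then lx s b i p \<omega> else 0)))"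
  proof -
    have "(\<Sum>x\<in>{..<?n} \<times> {..<?n}. h x) = (\<Sum>p<?n. \<Sum>q<?n. h (p, q))" for h :: "nat \<times> nat \<Rightarrow> complex"
      by (simp add: sum.cartesian_product case_prod_unfold)
    then show ?thesis by (simp only:) (simp add: row_def)
  qed
  also have "\<dots> = (\<Sum>p<?n. \<Sum>q<?n. if p = i then Q $$ (i, q) * ly s b q j \<omega> else 0)
      - (\<Sum>p<?n. \<Sum>q<?n. if q = j then lx s b i p \<omega> * Q $$ (p, j) else 0)"
    unfolding sum_subtractf[symmetric] by (intro sum.cong refl) (auto simp: algebra_simps)
  also have "(\<Sum>p<?n. \<Sum>q<?n. if p = i then Q $$ (i, q) * ly s b q j \<omega> else 0) = (\<Sum>q<?n. Q $$ (i, q) * ly s b q j \<omega>)"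
    using ij by (subst sum.swap) simp
  also have "(\<Sum>p<?n. \<Sum>q<?n. if q = j then lx s b i p \<omega> * Q $$ (p, j) else 0) = (\<Sum>p<?n. lx s b i p \<omega> * Q $$ (p, j))"
    using ij by simp
  finally show ?thesis
    unfolding mat_mult_index[OF Q c(1) ij] mat_mult_index[OF c(2) Q ij] by (simp add: ly lx)
qed

lemma Qe_intertwines:
  assumes w: "\<omega> \<in> W1" and s: "s \<in> {1..k}"
  defines "n \<equiv> A.deg \<omega>"
  shows "Qe n e \<omega> * X2 s (\<Phi> \<omega>) = X1 s \<omega> * Qe n e \<omega>"
    "Qe n e \<omega> * mat_adjoint (X2 s (\<Phi> \<omega>)) = mat_adjoint (X1 s \<omega>) * Qe n e \<omega>"
proof -
  have Q: "Qe n e \<omega> \<in> carrier_mat n n" by (simp add: Qe_def)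
  have s1: "s - 1 < k" using s by auto
  then have ss: "Suc ((s - 1) mod k) = s" using s by simp
  have L: "Qe n e \<omega> * letters k (\<lambda>s. X2 s (\<Phi> \<omega>)) (s - 1) b = letters k (\<lambda>s. X1 s \<omega>) (s - 1) b * Qe n e \<omega>" for b
  proof (rule eq_matI)
    have c: "letters k (\<lambda>s. X2 s (\<Phi> \<omega>)) (s - 1) b \<in> carrier_mat n n" "letters k (\<lambda>s. X1 s \<omega>) (s - 1) b \<in> carrier_mat n n"
      using B.mfield_letters[of "s - 1" b] A.mfield_letters[of "s - 1" b] \<Phi>_space[OF w] W1_space[OF w] deg_eq[OF w]
      by (auto simp: A.mfield_def B.mfield_def n_def)
    show "dim_row (Qe n e \<omega> * letters k (\<lambda>s. X2 s (\<Phi> \<omega>)) (s - 1) b) = dim_row (letters k (\<lambda>s. X1 s \<omega>) (s - 1) b * Qe n e \<omega>)"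
      "dim_col (Qe n e \<omega> * letters k (\<lambda>s. X2 s (\<Phi> \<omega>)) (s - 1) b) = dim_col (letters k (\<lambda>s. X1 s \<omega>) (s - 1) b * Qe n e \<omega>)"
      using c Q by auto
    fix i j assume "i < dim_row (letters k (\<lambda>s. X1 s \<omega>) (s - 1) b * Qe n e \<omega>)" "j < dim_col (letters k (\<lambda>s. X1 s \<omega>) (s - 1) b * Qe n e \<omega>)"
    then have ij: "i < n" "j < n" using c Q by auto
    have "(s - 1, b, i, j) \<in> set (List.product [0..<k] (List.product [False, True] (List.product [0..<n] [0..<n])))"
      using ij s1 by (cases b) auto
    then have "row (s - 1, b, i, j) \<omega> \<in> set (map (\<lambda>r. r \<omega>) (rows n))"
      unfolding rows_def set_map image_image by (rule imageI)
    then have "(\<Sum>x\<in>{..<n} \<times> {..<n}. resid ({..<n} \<times> {..<n}) (map (\<lambda>r. r \<omega>) (rows n)) (\<lambda>x. if x = e then 1 else 0) x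
        * cnj (row (s - 1, b, i, j) \<omega> x)) = 0"
      by (intro resid_orthogonal(1)) auto
    moreover have "(\<Sum>x\<in>{..<n} \<times> {..<n}. Qe n e \<omega> $$ x * cnj (row (s - 1, b, i, j) \<omega> x))
        = (\<Sum>x\<in>{..<n} \<times> {..<n}. resid ({..<n} \<times> {..<n}) (map (\<lambda>r. r \<omega>) (rows n)) (\<lambda>x. if x = e then 1 else 0) x
        * cnj (row (s - 1, b, i, j) \<omega> x))"
      by (intro sum.cong refl) (auto simp: Qe_def)
    ultimately have "(\<Sum>x\<in>{..<n} \<times> {..<n}. Qe n e \<omega> $$ x * cnj (row (s - 1, b, i, j) \<omega> x)) = 0" by (rule trans[rotated])
    then show "(Qe n e \<omega> * letters k (\<lambda>s. X2 s (\<Phi> \<omega>)) (s - 1) b) $$ (i, j) = (letters k (\<lambda>s. X1 s \<omega>) (s - 1) b * Qe n e \<omega>) $$ (i, j)"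
      using row_orthogonal[OF w, of "Qe n e \<omega>" i j "s - 1" b] Q ij by (simp add: n_def)
  qed
  show "Qe n e \<omega> * X2 s (\<Phi> \<omega>) = X1 s \<omega> * Qe n e \<omega>"
    "Qe n e \<omega> * mat_adjoint (X2 s (\<Phi> \<omega>)) = mat_adjoint (X1 s \<omega>) * Qe n e \<omega>"
    using L[of False] L[of True] ss by (simp_all add: letters_def)
qed

text \<open>A unitary intertwiner \<open>V\<close> is orthogonal to all rows, so its inner product
  with the projected matrix unit is the same as with the matrix unit itself. For a position where
  \<open>V\<close> has a nonzero entry this is nonzero.\<close>

lemma exists_Qe_nonzero:
  assumes w: "\<omega> \<in> W1"
  shows "\<exists>e. frob (Qe (A.deg \<omega>) e \<omega>) \<noteq> 0"
proof -
  let ?n = "A.deg \<omega>"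
  let ?I = "{..<?n} \<times> {..<?n}"
  note dX = B.X_carrier[OF \<Phi>_space[OF w], unfolded deg_eq[OF w]] A.X_carrier[OF W1_space[OF w]]
  obtain V where V: "unitary_mat ?n V" and V': "\<forall>s\<in>{1..k}. V * X2 s (\<Phi> \<omega>) = X1 s \<omega> * V"
    using exists_intertwiner[OF w] by (elim exE conjE)
  have Vc: "V \<in> carrier_mat ?n ?n" using V by (simp add: unitary_mat_def)
  have n0: "0 < ?n" using A.deg_ge_1[OF W1_space[OF w]] by simp
  have "frob V \<noteq> 0"
  proof
    assume "frob V = 0"
    then have "V = 0\<^sub>m ?n ?n" by (rule frob_eq_0[OF Vc])
    moreover have "mat_adjoint V * V = 1\<^sub>m ?n" using V by (simp add: unitary_mat_def)
    ultimately have "1\<^sub>m ?n = mat_adjoint V * 0\<^sub>m ?n ?n" by simp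
    also have "\<dots> = 0\<^sub>m ?n ?n" using Vc by (intro right_mult_zero_mat) auto
    finally have "(1\<^sub>m ?n :: complex mat) $$ (0, 0) = 0\<^sub>m ?n ?n $$ (0, 0)" by simp
    then show False using n0 by simp
  qed
  then have "\<exists>a<?n. \<exists>b<?n. V $$ (a, b) \<noteq> 0"
    unfolding frob_carrier[OF Vc] by (rule contrapos_np) auto
  then obtain a b where ab: "a < ?n" "b < ?n" "V $$ (a, b) \<noteq> 0" by blast
  have LV: "V * letters k (\<lambda>s. X2 s (\<Phi> \<omega>)) s b = letters k (\<lambda>s. X1 s \<omega>) s b * V" for s b
  proof -
    note sr = Suc_mod_range[OF A.k, of s]
    note VX = bspec[OF V' sr]
    show ?thesis
      using VX intertwiner_adjoint[OF V dX(1)[OF sr] dX(2)[OF sr] VX] by (simp add: letters_def Let_def)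
  qed
  have orth: "(\<Sum>x\<in>?I. r x * cnj (V $$ x)) = 0" if "r \<in> set (map (\<lambda>r. r \<omega>) (rows ?n))" for r
  proof -
    obtain t where t: "t \<in> set (List.product [0..<k] (List.product [False, True] (List.product [0..<?n] [0..<?n])))" "r = row t \<omega>"
      using \<open>r \<in> _\<close> unfolding rows_def set_map image_image by (rule imageE)
    obtain s b i j where "t = (s, b, i, j)" by (cases t)
    then have r: "r = row (s, b, i, j) \<omega>" "i < ?n" "j < ?n" using t by auto
    have "(\<Sum>x\<in>?I. V $$ x * cnj (r x)) = 0"
      unfolding r(1) row_orthogonal[OF w Vc r(2,3)] LV by simp
    then have "cnj (\<Sum>x\<in>?I. V $$ x * cnj (r x)) = 0" by simp
    then show ?thesis by (simp add: mult.commute)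
  qed
  let ?E = "\<lambda>x. if x = (a, b) then 1 else 0 :: complex"
  have "(\<Sum>x\<in>?I. Qe ?n (a, b) \<omega> $$ x * cnj (V $$ x)) = (\<Sum>x\<in>?I. resid ?I (map (\<lambda>r. r \<omega>) (rows ?n)) ?E x * cnj (V $$ x))"
    unfolding Qe_def by (intro sum.cong) auto
  also have "\<dots> = (\<Sum>x\<in>?I. ?E x * cnj (V $$ x))"
    by (rule resid_orthogonal(2)) (use orth in auto)
  also have "\<dots> = (\<Sum>x\<in>?I. if x = (a, b) then cnj (V $$ (a, b)) else 0)" by (intro sum.cong) auto
  also have "\<dots> = cnj (V $$ (a, b))" using ab by simp
  finally have nz: "(\<Sum>x\<in>?I. Qe ?n (a, b) \<omega> $$ x * cnj (V $$ x)) \<noteq> 0" using ab by simp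
  have Qc: "Qe ?n (a, b) \<omega> \<in> carrier_mat ?n ?n" by (simp add: Qe_def)
  have "frob (Qe ?n (a, b) \<omega>) \<noteq> 0"
  proof
    assume "frob (Qe ?n (a, b) \<omega>) = 0"
    then have "Qe ?n (a, b) \<omega> = 0\<^sub>m ?n ?n" by (rule frob_eq_0[OF Qc])
    then have "(\<Sum>x\<in>?I. Qe ?n (a, b) \<omega> $$ x * cnj (V $$ x)) = 0" by (intro sum.neutral) auto
    then show False using nz by simp
  qed
  then show ?thesis by blast
qed

text \<open>The least index in a fixed enumeration makes the choice of a nonzero solution
  measurable.\<close>

definition sel :: "nat \<Rightarrow> 'a \<Rightarrow> nat" where
  "sel n \<omega> = (LEAST e. frob (Qe n (from_nat e) \<omega>) \<noteq> 0)"

text \<open>The factor is the one that turns a nonzero intertwiner into a unitary in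
  \<open>intertwiner_multiple_of_unitary\<close>.\<close>

definition T :: "'a \<Rightarrow> complex mat" where
  "T \<omega> = (let n = A.deg \<omega>; Q = Qe n (from_nat (sel n \<omega>)) \<omega> in complex_of_real (sqrt (real n / frob Q)) \<cdot>\<^sub>m Q)"

lemma T_carrier: "T \<omega> \<in> carrier_mat (A.deg \<omega>) (A.deg \<omega>)"
  by (simp add: T_def Let_def Qe_def)

lemma T_mfield: "A.mfield T"
proof -
  have sel: "sel n \<in> measurable M1 (count_space UNIV)" for n
    unfolding sel_def[abs_def] using frob_Qe_measurable by measurable
  have "A.ment T i l \<in> borel_measurable M1" for i l
  proof -
    \<comment> \<open>Degree and chosen index are first frozen as parameters. Substituting the
      measurable functions \<open>sel\<close> and \<open>A.deg\<close> with countably many values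
      then preserves measurability.\<close>
    define F where "F n e \<omega> = (if i < n \<and> l < n then complex_of_real (sqrt (real n / frob (Qe n (from_nat e) \<omega>))) * Qe n (from_nat e) \<omega> $$ (i, l) else 0)" for n e \<omega>
    have F: "F n e \<in> borel_measurable M1" for n e
    proof (cases "i < n \<and> l < n")
      case True
      have "(\<lambda>\<omega>. complex_of_real (sqrt (real n / frob (Qe n (from_nat e) \<omega>))) * Qe n (from_nat e) \<omega> $$ (i, l)) \<in> borel_measurable M1"
        using frob_Qe_measurable[of n "from_nat e"] Qe_measurable[of i n l "from_nat e", OF conjunct1[OF True] conjunct2[OF True]]
        by measurable
      then show ?thesis using True by (simp add: F_def[abs_def])
    qed (auto simp: F_def[abs_def])
    have "(\<lambda>\<omega>. F n (sel n \<omega>) \<omega>) \<in> borel_measurable M1" for n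
      by (rule measurable_compose_countable[OF F sel])
    then have "(\<lambda>\<omega>. F (A.deg \<omega>) (sel (A.deg \<omega>) \<omega>) \<omega>) \<in> borel_measurable M1"
      by (rule measurable_compose_countable[OF _ A.deg_measurable])
    moreover have "A.ment T i l = (\<lambda>\<omega>. F (A.deg \<omega>) (sel (A.deg \<omega>) \<omega>) \<omega>)"
      by (auto simp: A.ment_def F_def T_def Let_def Qe_def fun_eq_iff)
    ultimately show ?thesis by simp
  qed
  then show ?thesis using T_carrier by (simp add: A.mfield_def)
qed

lemma T_unitary_intertwiner:
  assumes w: "\<omega> \<in> W1"
  shows "unitary_mat (A.deg \<omega>) (T \<omega>)" "s \<in> {1..k} \<Longrightarrow> T \<omega> * X2 s (\<Phi> \<omega>) = X1 s \<omega> * T \<omega>"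
proof -
  let ?n = "A.deg \<omega>"
  define Q where "Q = Qe ?n (from_nat (sel ?n \<omega>)) \<omega>"
  obtain e where "frob (Qe ?n e \<omega>) \<noteq> 0" using exists_Qe_nonzero[OF w] by blast
  then have "frob (Qe ?n (from_nat (to_nat e)) \<omega>) \<noteq> 0" by simp
  then have "frob Q \<noteq> 0" unfolding Q_def sel_def by (rule LeastI)
  then have Q0: "Q \<noteq> 0\<^sub>m ?n ?n" by (auto simp: frob_def)
  have Qc: "Q \<in> carrier_mat ?n ?n" by (simp add: Q_def Qe_def)
  have T: "T \<omega> = complex_of_real (sqrt (real ?n / frob Q)) \<cdot>\<^sub>m Q" by (simp add: T_def Q_def Let_def)
  have dX: "X2 s (\<Phi> \<omega>) \<in> carrier_mat ?n ?n" "X1 s \<omega> \<in> carrier_mat ?n ?n" if "s \<in> {1..k}" for s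
    using B.X_carrier[OF \<Phi>_space[OF w] that] A.X_carrier[OF W1_space[OF w] that] deg_eq[OF w] by simp_all
  have d: "tuple_degree (\<lambda>s. X1 s \<omega>) = ?n" "tuple_degree (\<lambda>s. X2 s (\<Phi> \<omega>)) = ?n"
    using deg_eq[OF w] by (simp_all add: A.deg_def B.deg_def)
  have QX: "Q * X2 s (\<Phi> \<omega>) = X1 s \<omega> * Q" "Q * mat_adjoint (X2 s (\<Phi> \<omega>)) = mat_adjoint (X1 s \<omega>) * Q" if "s \<in> {1..k}" for s
    unfolding Q_def by (rule Qe_intertwines[OF w that])+
  show "unitary_mat ?n (T \<omega>)" unfolding T
    by (rule intertwiner_multiple_of_unitary(2)[OF irr1[OF W1_space[OF w]] irr2[OF \<Phi>_space[OF w]] d dX(2) dX(1) Qc Q0 QX])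
  show "T \<omega> * X2 s (\<Phi> \<omega>) = X1 s \<omega> * T \<omega>" if "s \<in> {1..k}"
    unfolding T mult_smult_assoc_mat[OF Qc dX(1)[OF that]] mult_smult_distrib[OF dX(2)[OF that] Qc] QX(1)[OF that] ..
qed

end

section \<open>Unitaries induced by Borel isomorphisms\<close>

lemma fibre_smult:
  assumes v: "v \<in> fibre n m"
  shows "(\<lambda>j. a \<cdot>\<^sub>v v j) \<in> fibre n m" "fnorm2 (\<lambda>j. a \<cdot>\<^sub>v v j) = (cmod a)\<^sup>2 * fnorm2 v"
proof -
  show "(\<lambda>j. a \<cdot>\<^sub>v v j) \<in> fibre n m"
    using fibreD[OF v] by (auto simp: fibre_def vnorm2_smult intro: summable_mult)
  show "fnorm2 (\<lambda>j. a \<cdot>\<^sub>v v j) = (cmod a)\<^sup>2 * fnorm2 v"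
    unfolding fnorm2_def vnorm2_smult by (rule suminf_mult[OF fibreD(3)[OF v]])
qed

lemma unitary_mat_inverse:
  assumes V: "unitary_mat n V" and u: "u \<in> carrier_vec n"
  shows "mat_adjoint V *\<^sub>v (V *\<^sub>v u) = u" "V *\<^sub>v (mat_adjoint V *\<^sub>v u) = u"
proof -
  have c: "V \<in> carrier_mat n n" "mat_adjoint V * V = 1\<^sub>m n" "V * mat_adjoint V = 1\<^sub>m n"
    using V by (simp_all add: unitary_mat_def)
  have a: "mat_adjoint V \<in> carrier_mat n n" using c(1) by auto
  show "mat_adjoint V *\<^sub>v (V *\<^sub>v u) = u" "V *\<^sub>v (mat_adjoint V *\<^sub>v u) = u"
    unfolding assoc_mult_mat_vec[OF a c(1) u, symmetric] assoc_mult_mat_vec[OF c(1) a u, symmetric] c(2,3)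
    using u by simp_all
qed

lemma unitary_fip:
  assumes V: "unitary_mat n V" and v: "v \<in> fibre n m" and w: "w \<in> fibre n m'"
  shows "fip (\<lambda>j. V *\<^sub>v v j) (\<lambda>j. V *\<^sub>v w j) = fip v w"
proof -
  have c: "V \<in> carrier_mat n n" using V by (simp add: unitary_mat_def)
  have "fip (\<lambda>j. V *\<^sub>v v j) (\<lambda>j. V *\<^sub>v w j) = fip v (\<lambda>j. mat_adjoint V *\<^sub>v (V *\<^sub>v w j))"
    by (rule fip_adjoint) (use fibreD(1)[OF v] fibreD(1)[OF w] c in auto)
  then show ?thesis by (simp add: unitary_mat_inverse(1)[OF V fibreD(1)[OF w]])
qed

lemma unitary_vnorm2:
  assumes V: "unitary_mat n V" and u: "u \<in> carrier_vec n"
  shows "vnorm2 (V *\<^sub>v u) = vnorm2 u"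
proof -
  have c: "V \<in> carrier_mat n n" using V by (simp add: unitary_mat_def)
  have "complex_of_real (vnorm2 (V *\<^sub>v u)) = u \<bullet>c (mat_adjoint V *\<^sub>v (V *\<^sub>v u))"
    unfolding cscalar_vnorm2[symmetric] by (rule cscalar_adjoint) (use c u in auto)
  also have "\<dots> = complex_of_real (vnorm2 u)"
    unfolding unitary_mat_inverse(1)[OF V u] cscalar_vnorm2 ..
  finally show ?thesis by (simp only: of_real_eq_iff)
qed

text \<open>The data for carrying sections over \<open>M2\<close> to sections over
  \<open>M1\<close>, for one direction only; a Borel isomorphism and its inverse give two instances.
  \<open>M2_eq\<close> is the change of variables: \<open>c\<^sup>2\<close> is the density on
  \<open>W1\<close> whose image under \<open>\<Phi>\<close> is \<open>M2\<close>.\<close>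

locale pullback =
  A: mult_field k M1 f1 X1 + B: mult_field k M2 f2 X2
  for k :: nat and M1 :: "'a measure" and f1 X1 and M2 :: "'b measure" and f2 X2 +
  fixes W1 :: "'a set" and \<Phi> :: "'a \<Rightarrow> 'b" and c :: "'a \<Rightarrow> real" and T :: "'a \<Rightarrow> complex mat"
  assumes W1: "W1 \<in> sets M1" and \<Phi>: "\<Phi> \<in> measurable (restrict_space M1 W1) M2"
    and deg_eq: "\<And>\<omega>. \<omega> \<in> W1 \<Longrightarrow> B.deg (\<Phi> \<omega>) = A.deg \<omega>"
    and f_eq: "\<And>\<omega>. \<omega> \<in> W1 \<Longrightarrow> f2 (\<Phi> \<omega>) = f1 \<omega>"
    and T: "A.mfield T" and T_unitary: "\<And>\<omega>. \<omega> \<in> W1 \<Longrightarrow> unitary_mat (A.deg \<omega>) (T \<omega>)"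
    and T_X: "\<And>\<omega> s. \<omega> \<in> W1 \<Longrightarrow> s \<in> {1..k} \<Longrightarrow> T \<omega> * X2 s (\<Phi> \<omega>) = X1 s \<omega> * T \<omega>"
    and c: "c \<in> borel_measurable M1"
    and M2_eq: "distr (density (restrict_space M1 W1) (\<lambda>\<omega>. ennreal ((c \<omega>)\<^sup>2))) M2 \<Phi> = M2"
begin

lemma W1_space: "\<omega> \<in> W1 \<Longrightarrow> \<omega> \<in> space M1"
  using W1 sets.sets_into_space by blast

lemma \<Phi>_space: "\<omega> \<in> W1 \<Longrightarrow> \<Phi> \<omega> \<in> space M2"
  using measurable_space[OF \<Phi>, of \<omega>] W1_space by (simp add: space_restrict_space)

lemma restricted: "W1 \<inter> space M1 \<in> sets M1" "(\<lambda>\<omega>. (c \<omega>)\<^sup>2) \<in> borel_measurable (restrict_space M1 W1)"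
  "(\<lambda>\<omega>. ennreal ((c \<omega>)\<^sup>2)) \<in> borel_measurable (restrict_space M1 W1)"
  "\<Phi> \<in> measurable (density (restrict_space M1 W1) (\<lambda>\<omega>. ennreal ((c \<omega>)\<^sup>2))) M2"
proof -
  show "W1 \<inter> space M1 \<in> sets M1" using W1 by auto
  show c2: "(\<lambda>\<omega>. (c \<omega>)\<^sup>2) \<in> borel_measurable (restrict_space M1 W1)"
    using c by (intro measurable_restrict_space1) measurable
  then show "(\<lambda>\<omega>. ennreal ((c \<omega>)\<^sup>2)) \<in> borel_measurable (restrict_space M1 W1)" by measurable
  show "\<Phi> \<in> measurable (density (restrict_space M1 W1) (\<lambda>\<omega>. ennreal ((c \<omega>)\<^sup>2))) M2"
    using \<Phi> by simp
qed

lemma transfer: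
  fixes F :: "'b \<Rightarrow> 'd::{banach, second_countable_topology}"
  assumes F: "F \<in> borel_measurable M2"
  shows "integrable M1 (\<lambda>\<omega>. indicator W1 \<omega> *\<^sub>R ((c \<omega>)\<^sup>2 *\<^sub>R F (\<Phi> \<omega>))) \<longleftrightarrow> integrable M2 F"
    "(\<integral>\<omega>. indicator W1 \<omega> *\<^sub>R ((c \<omega>)\<^sup>2 *\<^sub>R F (\<Phi> \<omega>)) \<partial>M1) = (\<integral>\<omega>. F \<omega> \<partial>M2)"
proof -
  let ?r = "restrict_space M1 W1"
  let ?d = "density ?r (\<lambda>\<omega>. ennreal ((c \<omega>)\<^sup>2))"
  have F\<Phi>: "(\<lambda>\<omega>. F (\<Phi> \<omega>)) \<in> borel_measurable ?r" by (rule measurable_compose[OF \<Phi> F])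
  have nn: "AE \<omega> in ?r. 0 \<le> (c \<omega>)\<^sup>2" by simp
  have "integrable M2 F \<longleftrightarrow> integrable (distr ?d M2 \<Phi>) F" unfolding M2_eq ..
  also have "\<dots> \<longleftrightarrow> integrable ?d (\<lambda>\<omega>. F (\<Phi> \<omega>))" by (rule integrable_distr_eq[OF restricted(4) F])
  also have "\<dots> \<longleftrightarrow> integrable ?r (\<lambda>\<omega>. (c \<omega>)\<^sup>2 *\<^sub>R F (\<Phi> \<omega>))" by (rule integrable_density[OF F\<Phi> restricted(2) nn])
  also have "\<dots> \<longleftrightarrow> integrable M1 (\<lambda>\<omega>. indicator W1 \<omega> *\<^sub>R ((c \<omega>)\<^sup>2 *\<^sub>R F (\<Phi> \<omega>)))"
    by (rule integrable_restrict_space[OF restricted(1)])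
  finally show "integrable M1 (\<lambda>\<omega>. indicator W1 \<omega> *\<^sub>R ((c \<omega>)\<^sup>2 *\<^sub>R F (\<Phi> \<omega>))) \<longleftrightarrow> integrable M2 F" by (rule sym)
  have "(\<integral>\<omega>. F \<omega> \<partial>M2) = integral\<^sup>L (distr ?d M2 \<Phi>) F" unfolding M2_eq ..
  also have "\<dots> = (\<integral>\<omega>. F (\<Phi> \<omega>) \<partial>?d)" by (rule integral_distr[OF restricted(4) F])
  also have "\<dots> = (\<integral>\<omega>. (c \<omega>)\<^sup>2 *\<^sub>R F (\<Phi> \<omega>) \<partial>?r)" by (rule integral_density[OF F\<Phi> restricted(2) nn])
  also have "\<dots> = (\<integral>\<omega>. indicator W1 \<omega> *\<^sub>R ((c \<omega>)\<^sup>2 *\<^sub>R F (\<Phi> \<omega>)) \<partial>M1)"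
    by (rule integral_restrict_space[OF restricted(1)])
  finally show "(\<integral>\<omega>. indicator W1 \<omega> *\<^sub>R ((c \<omega>)\<^sup>2 *\<^sub>R F (\<Phi> \<omega>)) \<partial>M1) = (\<integral>\<omega>. F \<omega> \<partial>M2)" by (rule sym)
qed

text \<open>Null sets of \<open>M2\<close> pull back to null sets only where the density is nonzero.
  Elsewhere the transported sections are zero in any case.\<close>

lemma AE_transfer:
  assumes "AE \<omega> in M2. P \<omega>"
  shows "AE \<omega> in M1. \<omega> \<in> W1 \<longrightarrow> c \<omega> \<noteq> 0 \<longrightarrow> P (\<Phi> \<omega>)"
proof -
  have "AE \<omega> in distr (density (restrict_space M1 W1) (\<lambda>\<omega>. ennreal ((c \<omega>)\<^sup>2))) M2 \<Phi>. P \<omega>"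
    unfolding M2_eq by (rule assms)
  then have "AE \<omega> in restrict_space M1 W1. 0 < ennreal ((c \<omega>)\<^sup>2) \<longrightarrow> P (\<Phi> \<omega>)"
    by (rule AE_distrD[OF restricted(4), unfolded AE_density[OF restricted(3)]])
  then have "AE \<omega> in M1. \<omega> \<in> W1 \<longrightarrow> 0 < ennreal ((c \<omega>)\<^sup>2) \<longrightarrow> P (\<Phi> \<omega>)"
    unfolding AE_restrict_space_iff[OF restricted(1)] .
  then show ?thesis by eventually_elim simp
qed

definition pull :: "('b \<Rightarrow> nat \<Rightarrow> complex vec) \<Rightarrow> 'a \<Rightarrow> nat \<Rightarrow> complex vec" where
  "pull \<eta> \<omega> = (if \<omega> \<in> W1 then (\<lambda>j. complex_of_real (c \<omega>) \<cdot>\<^sub>v \<eta> (\<Phi> \<omega>) j) else (\<lambda>_. 0\<^sub>v (A.deg \<omega>)))"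

text \<open>The transport operator, with fibrewise part \<open>T\<close> and weight
  \<open>c\<close>. Its form as the action of a cut field supplies measurability and
  boundedness.\<close>

definition R :: "('b \<Rightarrow> nat \<Rightarrow> complex vec) \<Rightarrow> 'a \<Rightarrow> nat \<Rightarrow> complex vec" where
  "R \<eta> = A.act (A.cut W1 T) (pull \<eta>)"

lemma fibre_\<Phi>: "\<eta> \<in> B.L2 \<Longrightarrow> \<omega> \<in> W1 \<Longrightarrow> \<eta> (\<Phi> \<omega>) \<in> fibre (A.deg \<omega>) (f1 \<omega>)"
  using B.L2_fibre[OF _ \<Phi>_space] deg_eq f_eq by simp

lemma pull_L2:
  assumes \<eta>: "\<eta> \<in> B.L2"
  shows "pull \<eta> \<in> A.L2"
proof (rule A.L2I)
  fix \<omega> assume "\<omega> \<in> space M1"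
  show "pull \<eta> \<omega> \<in> fibre (A.deg \<omega>) (f1 \<omega>)"
    using fibre_smult(1)[OF fibre_\<Phi>[OF \<eta>], of \<omega> "complex_of_real (c \<omega>)"] by (cases "\<omega> \<in> W1") (simp_all add: pull_def fibre_def)
next
  fix j i
  have e: "A.crd (pull \<eta>) j i \<omega> = complex_of_real (c \<omega>) * (if \<omega> \<in> W1 then B.crd \<eta> j i (\<Phi> \<omega>) else 0)" for \<omega>
    using deg_eq[of \<omega>] f_eq[of \<omega>] fibreD(1)[OF fibre_\<Phi>[OF \<eta>], of \<omega> j] by (auto simp: A.crd_def B.crd_def pull_def)
  have "(\<lambda>\<omega>. complex_of_real (c \<omega>) * (if \<omega> \<in> W1 then B.crd \<eta> j i (\<Phi> \<omega>) else 0)) \<in> borel_measurable M1"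
    using c pull_measurable[OF W1 \<Phi> B.crd_measurable[OF \<eta>, of j i], of 0] by measurable
  then show "A.crd (pull \<eta>) j i \<in> borel_measurable M1" unfolding e[symmetric] .
next
  show "integrable M1 (\<lambda>\<omega>. indicator W1 \<omega> *\<^sub>R ((c \<omega>)\<^sup>2 *\<^sub>R fnorm2 (\<eta> (\<Phi> \<omega>))))"
    using transfer(1)[OF borel_measurable_integrable[OF B.fnorm2_integrable[OF \<eta>]]] B.fnorm2_integrable[OF \<eta>] by blast
  show "AE \<omega> in M1. fnorm2 (pull \<eta> \<omega>) \<le> indicator W1 \<omega> *\<^sub>R ((c \<omega>)\<^sup>2 *\<^sub>R fnorm2 (\<eta> (\<Phi> \<omega>)))"
  proof (rule AE_I2)
    fix \<omega> assume "\<omega> \<in> space M1"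
    show "fnorm2 (pull \<eta> \<omega>) \<le> indicator W1 \<omega> *\<^sub>R ((c \<omega>)\<^sup>2 *\<^sub>R fnorm2 (\<eta> (\<Phi> \<omega>)))"
    proof (cases "\<omega> \<in> W1")
      case True
      then show ?thesis using fibre_smult(2)[OF fibre_\<Phi>[OF \<eta> True], of "complex_of_real (c \<omega>)"] by (simp add: pull_def)
    next
      case False
      then show ?thesis by (simp add: pull_def fnorm2_def)
    qed
  qed
qed

lemma R_apply:
  assumes "\<omega> \<in> space M1" "\<eta> \<in> B.L2"
  shows "R \<eta> \<omega> = (if \<omega> \<in> W1 then (\<lambda>j. complex_of_real (c \<omega>) \<cdot>\<^sub>v (T \<omega> *\<^sub>v \<eta> (\<Phi> \<omega>) j)) else (\<lambda>_. 0\<^sub>v (A.deg \<omega>)))"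
proof -
  have "T \<omega> *\<^sub>v (complex_of_real (c \<omega>) \<cdot>\<^sub>v \<eta> (\<Phi> \<omega>) j) = complex_of_real (c \<omega>) \<cdot>\<^sub>v (T \<omega> *\<^sub>v \<eta> (\<Phi> \<omega>) j)" if "\<omega> \<in> W1" for j
  proof -
    have Tc: "T \<omega> \<in> carrier_mat (A.deg \<omega>) (A.deg \<omega>)" using T assms(1) by (simp add: A.mfield_def)
    show ?thesis by (rule mult_mat_vec[OF Tc fibreD(1)[OF fibre_\<Phi>[OF assms(2) \<open>\<omega> \<in> W1\<close>]]])
  qed
  then show ?thesis
    unfolding R_def A.act_cut[OF assms(1) pull_L2[OF assms(2)]] by (simp add: pull_def)
qed

lemma R_L2: 
  assumes "\<eta> \<in> B.L2"
  shows "R \<eta> \<in> A.L2"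
proof -
  have "A.opbound (A.cut W1 T) 1"
    by (rule A.opbound_cut[OF T]) (simp_all add: unitary_vnorm2[OF T_unitary])
  then show ?thesis unfolding R_def by (rule A.L2_act(1)[OF A.mfield_cut[OF W1 T] _ pull_L2[OF assms]])
qed

text \<open>\<open>T\<close> preserves inner products in the fibre, and the two factors
  \<open>c\<close> combine to the density in the change of variables.\<close>

lemma R_isometric:
  assumes \<eta>: "\<eta> \<in> B.L2" and \<eta>': "\<eta>' \<in> B.L2"
  shows "A.ip (R \<eta>) (R \<eta>') = B.ip \<eta> \<eta>'"
proof -
  have "A.ip (R \<eta>) (R \<eta>') = (\<integral>\<omega>. indicator W1 \<omega> *\<^sub>R ((c \<omega>)\<^sup>2 *\<^sub>R fip (\<eta> (\<Phi> \<omega>)) (\<eta>' (\<Phi> \<omega>))) \<partial>M1)"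
    unfolding A.ip_def
  proof (rule Bochner_Integration.integral_cong[OF refl])
    fix \<omega> assume w: "\<omega> \<in> space M1"
    show "fip (R \<eta> \<omega>) (R \<eta>' \<omega>) = indicator W1 \<omega> *\<^sub>R ((c \<omega>)\<^sup>2 *\<^sub>R fip (\<eta> (\<Phi> \<omega>)) (\<eta>' (\<Phi> \<omega>)))"
    proof (cases "\<omega> \<in> W1")
      case True
      have Tc: "T \<omega> \<in> carrier_mat (A.deg \<omega>) (A.deg \<omega>)" using T_unitary[OF True] by (simp add: unitary_mat_def)
      have F: "(\<lambda>j. T \<omega> *\<^sub>v \<zeta> (\<Phi> \<omega>) j) \<in> fibre (A.deg \<omega>) (f1 \<omega>)" if "\<zeta> \<in> B.L2" for \<zeta>
        by (rule fibre_mat(1)[where C = 1, OF fibre_\<Phi>[OF that True] Tc]) (simp add: unitary_vnorm2[OF T_unitary[OF True]])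
      let ?a = "complex_of_real (c \<omega>)"
      have "fip (R \<eta> \<omega>) (R \<eta>' \<omega>) = ?a * fip (\<lambda>j. T \<omega> *\<^sub>v \<eta> (\<Phi> \<omega>) j) (\<lambda>j. ?a \<cdot>\<^sub>v (T \<omega> *\<^sub>v \<eta>' (\<Phi> \<omega>) j))"
        unfolding R_apply[OF w \<eta>] R_apply[OF w \<eta>'] if_P[OF True] by (rule fip_smult[OF F[OF \<eta>] fibre_smult(1)[OF F[OF \<eta>']]])
      also have "fip (\<lambda>j. T \<omega> *\<^sub>v \<eta> (\<Phi> \<omega>) j) (\<lambda>j. ?a \<cdot>\<^sub>v (T \<omega> *\<^sub>v \<eta>' (\<Phi> \<omega>) j))
          = cnj (?a * fip (\<lambda>j. T \<omega> *\<^sub>v \<eta>' (\<Phi> \<omega>) j) (\<lambda>j. T \<omega> *\<^sub>v \<eta> (\<Phi> \<omega>) j))"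
        unfolding fip_cnj[OF fibre_smult(1)[OF F[OF \<eta>']] F[OF \<eta>]] fip_smult[OF F[OF \<eta>'] F[OF \<eta>]] ..
      also have "\<dots> = ?a * fip (\<eta> (\<Phi> \<omega>)) (\<eta>' (\<Phi> \<omega>))"
        unfolding complex_cnj_mult fip_cnj[OF F[OF \<eta>'] F[OF \<eta>], symmetric]
          unitary_fip[OF T_unitary[OF True] fibre_\<Phi>[OF \<eta> True] fibre_\<Phi>[OF \<eta>' True]] by simp
      finally show ?thesis using True by (simp add: scaleR_conv_of_real power2_eq_square)
    next
      case False
      then show ?thesis unfolding R_apply[OF w \<eta>] R_apply[OF w \<eta>'] by simp
    qed
  qed
  also have "\<dots> = B.ip \<eta> \<eta>'" unfolding B.ip_def
    by (rule transfer(2)[OF borel_measurable_integrable[OF B.fip_integrable[OF \<eta> \<eta>']]])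
  finally show ?thesis .
qed

lemma R_add:
  assumes "\<omega> \<in> space M1" "\<eta> \<in> B.L2" "\<eta>' \<in> B.L2"
  shows "R (\<lambda>\<omega> j. \<eta> \<omega> j + \<eta>' \<omega> j) \<omega> = (\<lambda>j. R \<eta> \<omega> j + R \<eta>' \<omega> j)"
proof (cases "\<omega> \<in> W1")
  case True
  have Tc: "T \<omega> \<in> carrier_mat (A.deg \<omega>) (A.deg \<omega>)" using T_unitary[OF True] by (simp add: unitary_mat_def)
  have "a \<cdot>\<^sub>v (T \<omega> *\<^sub>v (\<eta> (\<Phi> \<omega>) j + \<eta>' (\<Phi> \<omega>) j)) = a \<cdot>\<^sub>v (T \<omega> *\<^sub>v \<eta> (\<Phi> \<omega>) j) + a \<cdot>\<^sub>v (T \<omega> *\<^sub>v \<eta>' (\<Phi> \<omega>) j)" for a j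
    unfolding mult_add_distrib_mat_vec[OF Tc fibreD(1)[OF fibre_\<Phi>[OF assms(2) True]] fibreD(1)[OF fibre_\<Phi>[OF assms(3) True]]]
    by (rule smult_add_distrib_vec[OF mult_mat_vec_carrier[OF Tc fibreD(1)[OF fibre_\<Phi>[OF assms(2) True]]]
        mult_mat_vec_carrier[OF Tc fibreD(1)[OF fibre_\<Phi>[OF assms(3) True]]]])
  then show ?thesis
    using True unfolding R_apply[OF assms(1) B.L2_add[OF assms(2,3)]] R_apply[OF assms(1,2)] R_apply[OF assms(1,3)] by simp
next
  case False
  then show ?thesis
    unfolding R_apply[OF assms(1) B.L2_add[OF assms(2,3)]] R_apply[OF assms(1,2)] R_apply[OF assms(1,3)] by simp
qed

lemma R_scale:
  assumes "\<omega> \<in> space M1" "\<eta> \<in> B.L2"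
  shows "R (\<lambda>\<omega> j. a \<cdot>\<^sub>v \<eta> \<omega> j) \<omega> = (\<lambda>j. a \<cdot>\<^sub>v R \<eta> \<omega> j)"
proof (cases "\<omega> \<in> W1")
  case True
  have Tc: "T \<omega> \<in> carrier_mat (A.deg \<omega>) (A.deg \<omega>)" using T_unitary[OF True] by (simp add: unitary_mat_def)
  have "b \<cdot>\<^sub>v (T \<omega> *\<^sub>v (a \<cdot>\<^sub>v \<eta> (\<Phi> \<omega>) j)) = a \<cdot>\<^sub>v (b \<cdot>\<^sub>v (T \<omega> *\<^sub>v \<eta> (\<Phi> \<omega>) j))" for b j
    unfolding mult_mat_vec[OF Tc fibreD(1)[OF fibre_\<Phi>[OF assms(2) True]]] by (simp add: smult_smult_assoc mult.commute)
  then show ?thesis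
    using True unfolding R_apply[OF assms(1) B.hscale_cls(2)[OF assms(2)]] R_apply[OF assms] by simp
next
  case False
  have "a \<cdot>\<^sub>v 0\<^sub>v (A.deg \<omega>) = 0\<^sub>v (A.deg \<omega>)" by (intro eq_vecI) auto
  then show ?thesis using False unfolding R_apply[OF assms(1) B.hscale_cls(2)[OF assms(2)]] R_apply[OF assms] by simp
qed

lemma R_cong:
  assumes "\<eta> \<in> B.L2" "\<eta>' \<in> B.L2" and ae: "AE \<omega> in M2. \<eta> \<omega> = \<eta>' \<omega>"
  shows "AE \<omega> in M1. R \<eta> \<omega> = R \<eta>' \<omega>"
  using AE_transfer[OF ae] AE_space
proof eventually_elim
  case (elim \<omega>)
  show ?case
  proof (cases "\<omega> \<in> W1 \<and> c \<omega> = 0")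
    case True
    have Tc: "T \<omega> \<in> carrier_mat (A.deg \<omega>) (A.deg \<omega>)" using T_unitary True by (simp add: unitary_mat_def)
    then have "(\<lambda>j. 0 \<cdot>\<^sub>v (T \<omega> *\<^sub>v \<eta> (\<Phi> \<omega>) j)) = (\<lambda>j. 0 \<cdot>\<^sub>v (T \<omega> *\<^sub>v \<eta>' (\<Phi> \<omega>) j))"
      by (intro ext eq_vecI) auto
    then show ?thesis using True unfolding R_apply[OF elim(2) assms(1)] R_apply[OF elim(2) assms(2)] by simp
  next
    case False
    then show ?thesis using elim(1) unfolding R_apply[OF elim(2) assms(1)] R_apply[OF elim(2) assms(2)] by auto
  qed
qed

lemma R_graph:
  assumes "\<eta> \<in> B.L2" "\<eta>' \<in> B.L2" and s: "s \<in> {1..k}" and ae: "AE \<omega> in M2. \<eta>' \<omega> = (\<lambda>j. X2 s \<omega> *\<^sub>v \<eta> \<omega> j)"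
  shows "AE \<omega> in M1. R \<eta>' \<omega> = (\<lambda>j. X1 s \<omega> *\<^sub>v R \<eta> \<omega> j)"
  using AE_transfer[OF ae] AE_space
proof eventually_elim
  case (elim \<omega>)
  note Xc = A.X_carrier[OF elim(2) s]
  show ?case
  proof (cases "\<omega> \<in> W1")
    case True
    have Tc: "T \<omega> \<in> carrier_mat (A.deg \<omega>) (A.deg \<omega>)" using T_unitary[OF True] by (simp add: unitary_mat_def)
    have Yc: "X2 s (\<Phi> \<omega>) \<in> carrier_mat (A.deg \<omega>) (A.deg \<omega>)" using B.X_carrier[OF \<Phi>_space[OF True] s] deg_eq[OF True] by simp
    have "complex_of_real (c \<omega>) \<cdot>\<^sub>v (T \<omega> *\<^sub>v \<eta>' (\<Phi> \<omega>) j) = X1 s \<omega> *\<^sub>v (complex_of_real (c \<omega>) \<cdot>\<^sub>v (T \<omega> *\<^sub>v \<eta> (\<Phi> \<omega>) j))" for j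
    proof -
      note u = fibreD(1)[OF fibre_\<Phi>[OF assms(1) True], of j]
      have Tu: "T \<omega> *\<^sub>v \<eta> (\<Phi> \<omega>) j \<in> carrier_vec (A.deg \<omega>)" by (rule mult_mat_vec_carrier[OF Tc u])
      show ?thesis
      proof (cases "c \<omega> = 0")
        case True
        then show ?thesis unfolding mult_mat_vec[OF Xc Tu] using Tc Xc by (intro eq_vecI) auto
      next
        case False
        then have e: "\<eta>' (\<Phi> \<omega>) j = X2 s (\<Phi> \<omega>) *\<^sub>v \<eta> (\<Phi> \<omega>) j" using elim(1) \<open>\<omega> \<in> W1\<close> by simp
        have "T \<omega> *\<^sub>v \<eta>' (\<Phi> \<omega>) j = X1 s \<omega> *\<^sub>v (T \<omega> *\<^sub>v \<eta> (\<Phi> \<omega>) j)"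
          unfolding e assoc_mult_mat_vec[OF Tc Yc u, symmetric] assoc_mult_mat_vec[OF Xc Tc u, symmetric] T_X[OF \<open>\<omega> \<in> W1\<close> s] ..
        then show ?thesis unfolding mult_mat_vec[OF Xc Tu] by simp
      qed
    qed
    then show ?thesis using True unfolding R_apply[OF elim(2) assms(1)] R_apply[OF elim(2) assms(2)] by simp
  next
    case False
    have "X1 s \<omega> *\<^sub>v 0\<^sub>v (A.deg \<omega>) = 0\<^sub>v (A.deg \<omega>)" using Xc by (intro eq_vecI) auto
    then show ?thesis using False unfolding R_apply[OF elim(2) assms(1)] R_apply[OF elim(2) assms(2)] by simp
  qed
qed

end

text \<open>\<open>c\<close> is the root of the Radon--Nikodym derivative, with respect to
  \<open>M1\<close>, of the measure \<open>M2\<close> transported to \<open>W1\<close>. Equality of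
  the null sets makes the derivative positive and finite almost everywhere, so its reciprocal serves
  the opposite direction.\<close>

lemma change_of_density:
  fixes M1 :: "'a measure" and M2 :: "'b measure"
  assumes sf1: "sigma_finite_measure M1" and sf2: "sigma_finite_measure M2"
    and W1: "W1 \<in> sets M1" and W2: "W2 \<in> sets M2" and ae1: "AE \<omega> in M1. \<omega> \<in> W1" and ae2: "AE \<omega> in M2. \<omega> \<in> W2"
    and \<Phi>: "\<Phi> \<in> measurable (restrict_space M1 W1) (restrict_space M2 W2)"
    and \<Psi>: "\<Psi> \<in> measurable (restrict_space M2 W2) (restrict_space M1 W1)"
    and \<Psi>\<Phi>: "\<And>\<omega>. \<omega> \<in> W1 \<Longrightarrow> \<Psi> (\<Phi> \<omega>) = \<omega>" and \<Phi>\<Psi>: "\<And>\<omega>. \<omega> \<in> W2 \<Longrightarrow> \<Phi> (\<Psi> \<omega>) = \<omega>"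
    and null: "\<And>E. E \<in> sets M1 \<Longrightarrow> E \<subseteq> W1 \<Longrightarrow> emeasure M2 (\<Phi> ` E) = 0 \<longleftrightarrow> emeasure M1 E = 0"
  shows "\<exists>c\<in>borel_measurable M1. (\<forall>\<omega>. 0 < c \<omega>) \<and>
      distr (density (restrict_space M1 W1) (\<lambda>\<omega>. ennreal ((c \<omega>)\<^sup>2))) M2 \<Phi> = M2 \<and>
      distr (density (restrict_space M2 W2) (\<lambda>\<omega>. ennreal ((1 / c (\<Psi> \<omega>))\<^sup>2))) M1 \<Psi> = M1"
proof -
  define r1 where "r1 = restrict_space M1 W1"
  define r2 where "r2 = restrict_space M2 W2"
  have sub: "W1 \<subseteq> space M1" "W2 \<subseteq> space M2" using W1 W2 sets.sets_into_space by blast+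
  have sp: "space r1 = W1" "space r2 = W2" using sub by (auto simp: r1_def r2_def space_restrict_space)
  have I: "W1 \<inter> space M1 \<in> sets M1" "W2 \<inter> space M2 \<in> sets M2" using W1 W2 by auto
  have \<Phi>r: "\<Phi> \<in> measurable r1 r2" and \<Psi>r: "\<Psi> \<in> measurable r2 r1" using \<Phi> \<Psi> by (simp_all add: r1_def r2_def)
  have id1: "(\<lambda>x. x) \<in> measurable r1 M1" and id2: "(\<lambda>x. x) \<in> measurable r2 M2"
    unfolding r1_def r2_def by (simp_all add: measurable_restrict_space1)
  \<comment> \<open>Restricting to a conull set and then pushing forward by inclusion returns the
    original measure.\<close>
  have restrict: "distr (restrict_space M W) M (\<lambda>x. x) = M" if W: "W \<in> sets M" and ae: "AE x in M. x \<in> W" for W and M :: "'c measure"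
  proof (rule measure_eqI)
    fix E assume "E \<in> sets (distr (restrict_space M W) M (\<lambda>x. x))"
    then have E: "E \<in> sets M" by simp
    have Ws: "W \<subseteq> space M" using W sets.sets_into_space by blast
    have "emeasure (distr (restrict_space M W) M (\<lambda>x. x)) E = emeasure (restrict_space M W) (E \<inter> W)"
      using E Ws by (subst emeasure_distr) (auto simp: space_restrict_space Int_absorb2 intro: measurable_restrict_space1)
    also have "\<dots> = emeasure M (E \<inter> W)" using W Ws by (intro emeasure_restrict_space) (auto simp: Int_absorb2)
    also have "\<dots> = emeasure M E"
      by (rule emeasure_eq_AE) (use ae E W in auto)
    finally show "emeasure (distr (restrict_space M W) M (\<lambda>x. x)) E = emeasure M E" .
  qed simp
  have M1: "distr r1 M1 (\<lambda>x. x) = M1" and M2: "distr r2 M2 (\<lambda>x. x) = M2"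
    unfolding r1_def r2_def by (rule restrict[OF W1 ae1], rule restrict[OF W2 ae2])
  interpret r1: sigma_finite_measure r1 unfolding r1_def by (rule sigma_finite_measure_restrict_space[OF sf1 W1])
  have r2sf: "sigma_finite_measure r2" unfolding r2_def by (rule sigma_finite_measure_restrict_space[OF sf2 W2])
  \<comment> \<open>\<open>M2\<close> transported to \<open>W1\<close>, where both measures can be
    compared.\<close>
  define N where "N = distr r2 r1 \<Psi>"
  have N\<Phi>: "distr N r2 \<Phi> = r2"
  proof -
    have "distr N r2 \<Phi> = distr r2 r2 (\<Phi> \<circ> \<Psi>)" unfolding N_def by (rule distr_distr[OF \<Phi>r \<Psi>r])
    also have "\<dots> = distr r2 r2 (\<lambda>x. x)" by (rule distr_cong) (simp_all add: sp \<Phi>\<Psi>)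
    finally show ?thesis by simp
  qed
  have sN: "sets N = sets r1" by (simp add: N_def)
  \<comment> \<open>The image of \<open>N\<close> under \<open>\<Phi>\<close> is the sigma-finite
    \<open>r2\<close>, and sigma-finiteness passes back from an image measure.\<close>
  have Nsf: "sigma_finite_measure N"
    by (rule sigma_finite_measure_distr[of N r2 \<Phi>]) (use r2sf N\<Phi> \<Phi>r in \<open>simp_all add: N_def\<close>)
  have r1_null: "E \<in> sets r1 \<longleftrightarrow> E \<in> sets M1 \<and> E \<subseteq> W1" "E \<subseteq> W1 \<Longrightarrow> emeasure r1 E = emeasure M1 E" for E
    unfolding r1_def using sets_restrict_space_iff[OF I(1)] emeasure_restrict_space[OF I(1)] by auto
  have N_E: "emeasure N E = 0 \<longleftrightarrow> emeasure r1 E = 0" if E: "E \<in> sets r1" for E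
  proof -
    have E': "E \<in> sets M1" "E \<subseteq> W1" using E r1_null(1) by auto
    have im: "\<Psi> -` E \<inter> space r2 = \<Phi> ` E"
    proof (intro equalityI subsetI)
      fix y assume "y \<in> \<Psi> -` E \<inter> space r2"
      then show "y \<in> \<Phi> ` E" using \<Phi>\<Psi>[of y] sp by (metis IntD1 IntD2 imageI vimageD)
    next
      fix y assume "y \<in> \<Phi> ` E"
      then obtain x where x: "x \<in> E" "y = \<Phi> x" by blast
      then show "y \<in> \<Psi> -` E \<inter> space r2" using E' \<Psi>\<Phi>[of x] measurable_space[OF \<Phi>r, of x] sp by auto
    qed
    have "emeasure N E = emeasure r2 (\<Phi> ` E)" unfolding N_def im[symmetric] by (rule emeasure_distr[OF \<Psi>r E])
    also have "\<dots> = emeasure M2 (\<Phi> ` E)"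
      unfolding r2_def by (rule emeasure_restrict_space[OF I(2)]) (use im sp in auto)
    finally show ?thesis using null[OF E'] r1_null(2)[OF E'(2)] by simp
  qed
  have ac: "absolutely_continuous r1 N"
    unfolding absolutely_continuous_def using N_E sN by (auto simp: null_sets_def)
  define h where "h = RN_deriv r1 N"
  have h: "h \<in> borel_measurable r1" and dh: "density r1 h = N"
    unfolding h_def by (rule borel_measurable_RN_deriv, rule r1.density_RN_deriv[OF ac sN])
  have hfin: "AE x in r1. h x \<noteq> \<infinity>" unfolding h_def by (rule r1.RN_deriv_finite[OF Nsf ac sN])
  have hpos: "AE x in r1. h x \<noteq> 0"
  proof -
    define E where "E = {x \<in> space r1. h x = 0}"
    have E: "E \<in> sets r1" unfolding E_def using h by measurable
    have "emeasure N E = (\<integral>\<^sup>+x. h x * indicator E x \<partial>r1)" unfolding dh[symmetric] by (rule emeasure_density[OF h E])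
    also have "\<dots> = (\<integral>\<^sup>+x. 0 \<partial>r1)" by (rule nn_integral_cong) (auto simp: E_def indicator_def)
    finally have "emeasure r1 E = 0" using N_E[OF E] by simp
    then have "E \<in> null_sets r1" using E by (simp add: null_sets_def)
    from AE_not_in[OF this] show ?thesis using AE_space by eventually_elim (simp add: E_def)
  qed
  \<comment> \<open>The value 1 off \<open>W1\<close> and where the derivative is 0 or infinite
    makes \<open>c\<close> positive everywhere. Within \<open>W1\<close> this changes it only on a
    null set.\<close>
  define c where "c x = (if x \<in> W1 then (if h x = 0 \<or> h x = \<infinity> then 1 else sqrt (enn2real (h x))) else 1)" for x
  have c: "c \<in> borel_measurable M1"
  proof -
    have "(\<lambda>x. if h x = 0 \<or> h x = \<infinity> then 1 else sqrt (enn2real (h x))) \<in> borel_measurable r1" using h by measurable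
    then show ?thesis unfolding c_def[abs_def] r1_def
      by (subst measurable_restrict_space_iff[OF I(1), symmetric]) auto
  qed
  have cr: "c \<in> borel_measurable r1" unfolding r1_def by (rule measurable_restrict_space1[OF c])
  have cpos: "0 < c x" for x
    unfolding c_def using enn2real_positive_iff[of "h x"] by (auto simp: less_top zero_less_iff_neq_zero)
  have "AE x in r1. h x = ennreal ((c x)\<^sup>2)"
    using hfin hpos AE_space
    by eventually_elim (auto simp: c_def sp less_top ennreal_enn2real)
  then have dc: "density r1 (\<lambda>x. ennreal ((c x)\<^sup>2)) = N"
    using density_cong[OF h, of "\<lambda>x. ennreal ((c x)\<^sup>2)"] cr dh by simp
  have 1: "distr (density r1 (\<lambda>\<omega>. ennreal ((c \<omega>)\<^sup>2))) M2 \<Phi> = M2"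
  proof -
    have "M2 = distr (distr N r2 \<Phi>) M2 (\<lambda>x. x)" unfolding N\<Phi> M2 ..
    also have "\<dots> = distr N M2 ((\<lambda>x. x) \<circ> \<Phi>)" by (rule distr_distr[OF id2]) (use \<Phi>r in \<open>simp add: N_def\<close>)
    finally show ?thesis unfolding dc by (simp add: comp_def)
  qed
  have 2: "distr (density r2 (\<lambda>\<omega>. ennreal ((1 / c (\<Psi> \<omega>))\<^sup>2))) M1 \<Psi> = M1"
  proof -
    let ?g = "\<lambda>x. ennreal ((1 / c x)\<^sup>2)"
    let ?d = "density r2 (\<lambda>\<omega>. ?g (\<Psi> \<omega>))"
    have g: "?g \<in> borel_measurable r1" using cr by measurable
    have "distr ?d r1 \<Psi> = density N ?g" unfolding N_def by (rule density_distr[OF g \<Psi>r, symmetric])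
    also have "\<dots> = density r1 (\<lambda>x. ennreal ((c x)\<^sup>2) * ?g x)"
      unfolding dc[symmetric] by (rule density_density_eq) (use cr g in measurable)
    also have "\<dots> = density r1 (\<lambda>x. 1)"
    proof (rule arg_cong[where f = "density r1"], rule ext)
      fix x
      have "(c x)\<^sup>2 * (1 / c x)\<^sup>2 = 1" using cpos[of x] by (simp add: power_divide)
      then show "ennreal ((c x)\<^sup>2) * ?g x = 1" by (simp add: ennreal_mult'[symmetric])
    qed
    finally have d: "distr ?d r1 \<Psi> = r1" by (simp add: density_1)
    have "M1 = distr (distr ?d r1 \<Psi>) M1 (\<lambda>x. x)" unfolding d M1 ..
    also have "\<dots> = distr ?d M1 ((\<lambda>x. x) \<circ> \<Psi>)" by (rule distr_distr[OF id1]) (use \<Psi>r in simp)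
    finally show ?thesis by (simp add: comp_def)
  qed
  show ?thesis using c cpos 1 2 unfolding r1_def r2_def by blast
qed

text \<open>States one composition only; exchanging the two sides gives the other, so that two
  interpretations provide a two-sided inverse.\<close>

locale pullback_retract =
  P: pullback k M1 f1 X1 M2 f2 X2 W1 \<Phi> c T + Q: pullback k M2 f2 X2 M1 f1 X1 W2 \<Psi> c' T'
  for k :: nat and M1 :: "'a measure" and f1 X1 and M2 :: "'b measure" and f2 X2 and W1 \<Phi> c T W2 \<Psi> c' T' +
  assumes conull: "AE \<omega> in M1. \<omega> \<in> W1"
    and inverse: "\<And>\<omega>. \<omega> \<in> W1 \<Longrightarrow> \<Phi> \<omega> \<in> W2 \<and> \<Psi> (\<Phi> \<omega>) = \<omega> \<and> c \<omega> * c' (\<Phi> \<omega>) = 1 \<and>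
      (\<forall>u\<in>carrier_vec (P.A.deg \<omega>). T \<omega> *\<^sub>v (T' (\<Phi> \<omega>) *\<^sub>v u) = u)"
begin

lemma R_inverse:
  assumes \<xi>: "\<xi> \<in> P.A.L2"
  shows "AE \<omega> in M1. P.R (Q.R \<xi>) \<omega> = \<xi> \<omega>"
  using conull AE_space
proof eventually_elim
  case (elim \<omega>)
  note i = inverse[OF elim(1)]
  have Tc: "T \<omega> \<in> carrier_mat (P.A.deg \<omega>) (P.A.deg \<omega>)"
    using P.T_unitary[OF elim(1)] by (simp add: unitary_mat_def)
  have T'c: "T' (\<Phi> \<omega>) \<in> carrier_mat (P.A.deg \<omega>) (P.A.deg \<omega>)"
    using Q.T_unitary[of "\<Phi> \<omega>"] i P.deg_eq[OF elim(1)] by (simp add: unitary_mat_def)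
  have "complex_of_real (c \<omega>) \<cdot>\<^sub>v (T \<omega> *\<^sub>v (complex_of_real (c' (\<Phi> \<omega>)) \<cdot>\<^sub>v (T' (\<Phi> \<omega>) *\<^sub>v \<xi> \<omega> j))) = \<xi> \<omega> j" for j
  proof -
    note u = fibreD(1)[OF P.A.L2_fibre[OF \<xi> elim(2)], of j]
    have "complex_of_real (c \<omega>) * complex_of_real (c' (\<Phi> \<omega>)) = 1" using i by (metis of_real_1 of_real_mult)
    moreover have "T \<omega> *\<^sub>v (T' (\<Phi> \<omega>) *\<^sub>v \<xi> \<omega> j) = \<xi> \<omega> j" using i u by blast
    ultimately show ?thesis
      unfolding mult_mat_vec[OF Tc mult_mat_vec_carrier[OF T'c u]] by (simp add: smult_smult_assoc)
  qed
  then show "P.R (Q.R \<xi>) \<omega> = \<xi> \<omega>"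
    unfolding P.R_apply[OF elim(2) Q.R_L2[OF \<xi>]] if_P[OF elim(1)] Q.R_apply[OF P.\<Phi>_space[OF elim(1)] \<xi>]
    using i by simp
qed

end

text \<open>Sections move against the direction of the maps: transport along \<open>\<Psi>\<close>
  leads from \<open>M1\<close> to \<open>M2\<close> and transport along \<open>\<Phi>\<close> leads
  back. The two operators are mutually inverse on classes.\<close>

lemma unitarily_equivalent_pullbacks:
  assumes "pullback_retract k M1 f1 X1 M2 f2 X2 W1 \<Phi> c T W2 \<Psi> c' T'"
    and "pullback_retract k M2 f2 X2 M1 f1 X1 W2 \<Psi> c' T' W1 \<Phi> c T"
  shows "unitarily_equivalent k (mult_integral_space M1 f1 X1) (mult_integral_tuple M1 f1 X1)
           (mult_integral_space M2 f2 X2) (mult_integral_tuple M2 f2 X2)"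
proof -
  interpret H: pullback_retract k M1 f1 X1 M2 f2 X2 W1 \<Phi> c T W2 \<Psi> c' T' by fact
  interpret H': pullback_retract k M2 f2 X2 M1 f1 X1 W2 \<Psi> c' T' W1 \<Phi> c T by fact
  \<comment> \<open>Defined on classes by a representative; by \<open>R_cong\<close> the resulting
    class does not depend on it.\<close>
  define U where "U C = H.P.B.cls (H.Q.R (class_rep C))" for C
  define V where "V C = H.P.A.cls (H.P.R (class_rep C))" for C
  have U: "U (H.P.A.cls \<xi>) = H.P.B.cls (H.Q.R \<xi>)" if "\<xi> \<in> H.P.A.L2" for \<xi>
    unfolding U_def
    by (rule H.P.B.cls_cong[OF H.Q.R_cong[OF H.P.A.class_rep_cls(1)[OF that] that H.P.A.class_rep_cls(2)[OF that]]])
  have V: "V (H.P.B.cls \<eta>) = H.P.A.cls (H.P.R \<eta>)" if "\<eta> \<in> H.P.B.L2" for \<eta>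
    unfolding V_def
    by (rule H.P.A.cls_cong[OF H.P.R_cong[OF H.P.B.class_rep_cls(1)[OF that] that H.P.B.class_rep_cls(2)[OF that]]])
  have VU: "V (U (H.P.A.cls \<xi>)) = H.P.A.cls \<xi>" if "\<xi> \<in> H.P.A.L2" for \<xi>
    unfolding U[OF that] V[OF H.Q.R_L2[OF that]] by (rule H.P.A.cls_cong[OF H.R_inverse[OF that]])
  have UV: "U (V (H.P.B.cls \<eta>)) = H.P.B.cls \<eta>" if "\<eta> \<in> H.P.B.L2" for \<eta>
    unfolding V[OF that] U[OF H.P.R_L2[OF that]] by (rule H.P.B.cls_cong[OF H'.R_inverse[OF that]])
  have bij: "bij_betw U (hcarrier H.P.A.HS) (hcarrier H.P.B.HS)"
  proof (rule bij_betwI[where g = V])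
    show "U \<in> hcarrier H.P.A.HS \<rightarrow> hcarrier H.P.B.HS"
    proof
      fix x assume "x \<in> hcarrier H.P.A.HS"
      then obtain \<xi> where x: "\<xi> \<in> H.P.A.L2" "x = H.P.A.cls \<xi>" by (rule H.P.A.carrier_cls)
      show "U x \<in> hcarrier H.P.B.HS" unfolding x(2) U[OF x(1)] by (rule H.P.B.cls_carrier[OF H.Q.R_L2[OF x(1)]])
    qed
    show "V \<in> hcarrier H.P.B.HS \<rightarrow> hcarrier H.P.A.HS"
    proof
      fix x assume "x \<in> hcarrier H.P.B.HS"
      then obtain \<xi> where x: "\<xi> \<in> H.P.B.L2" "x = H.P.B.cls \<xi>" by (rule H.P.B.carrier_cls)
      show "V x \<in> hcarrier H.P.A.HS" unfolding x(2) V[OF x(1)] by (rule H.P.A.cls_carrier[OF H.P.R_L2[OF x(1)]])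
    qed
    show "V (U x) = x" if "x \<in> hcarrier H.P.A.HS" for x
      using that by (rule H.P.A.carrier_cls) (simp only: VU)
    show "U (V x) = x" if "x \<in> hcarrier H.P.B.HS" for x
      using that by (rule H.P.B.carrier_cls) (simp only: UV)
  qed
  have un: "unitary_op H.P.A.HS H.P.B.HS U"
    unfolding unitary_op_def
  proof (intro conjI bij ballI allI)
    fix x y assume xy: "x \<in> hcarrier H.P.A.HS" "y \<in> hcarrier H.P.A.HS"
    obtain \<xi> where x: "\<xi> \<in> H.P.A.L2" "x = H.P.A.cls \<xi>" by (rule H.P.A.carrier_cls[OF xy(1)])
    obtain \<eta> where y: "\<eta> \<in> H.P.A.L2" "y = H.P.A.cls \<eta>" by (rule H.P.A.carrier_cls[OF xy(2)])
    note R = H.Q.R_L2[OF x(1)] H.Q.R_L2[OF y(1)]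
    show "U (hadd H.P.A.HS x y) = hadd H.P.B.HS (U x) (U y)"
      unfolding x(2) y(2) H.P.A.hadd_cls[OF x(1) y(1)] U[OF x(1)] U[OF y(1)] U[OF H.P.A.L2_add[OF x(1) y(1)]] H.P.B.hadd_cls[OF R]
      by (rule H.P.B.cls_cong[OF AE_I2]) (rule H.Q.R_add[OF _ x(1) y(1)])
    show "hinner H.P.B.HS (U x) (U y) = hinner H.P.A.HS x y"
      unfolding x(2) y(2) U[OF x(1)] U[OF y(1)] H.P.A.hinner_cls[OF x(1) y(1)] H.P.B.hinner_cls[OF R]
      by (rule H.Q.R_isometric[OF x(1) y(1)])
  next
    fix a x assume "x \<in> hcarrier H.P.A.HS"
    then obtain \<xi> where x: "\<xi> \<in> H.P.A.L2" "x = H.P.A.cls \<xi>" by (rule H.P.A.carrier_cls)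
    show "U (hscale H.P.A.HS a x) = hscale H.P.B.HS a (U x)"
      unfolding x(2) H.P.A.hscale_cls(1)[OF x(1)] U[OF x(1)] U[OF H.P.A.hscale_cls(2)[OF x(1)]]
        H.P.B.hscale_cls(1)[OF H.Q.R_L2[OF x(1)]]
      by (rule H.P.B.cls_cong[OF AE_I2]) (rule H.Q.R_scale[OF _ x(1)])
  qed
  have "map_prod U U ` mult_integral_tuple M1 f1 X1 s = mult_integral_tuple M2 f2 X2 s" if s: "s \<in> {1..k}" for s
  proof (intro equalityI subsetI)
    fix p assume "p \<in> map_prod U U ` mult_integral_tuple M1 f1 X1 s"
    then obtain \<xi> \<xi>' where x: "\<xi> \<in> H.P.A.L2" "\<xi>' \<in> H.P.A.L2" "AE \<omega> in M1. \<xi>' \<omega> = (\<lambda>j. X1 s \<omega> *\<^sub>v \<xi> \<omega> j)"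
      "p = (U (H.P.A.cls \<xi>), U (H.P.A.cls \<xi>'))"
      unfolding H.P.A.graph_iff[OF s] by auto
    show "p \<in> mult_integral_tuple M2 f2 X2 s"
      unfolding H.P.B.graph_iff[OF s] x(4) U[OF x(1)] U[OF x(2)]
      using H.Q.R_L2[OF x(1)] H.Q.R_L2[OF x(2)] H.Q.R_graph[OF x(1,2) s x(3)] by blast
  next
    fix p assume "p \<in> mult_integral_tuple M2 f2 X2 s"
    then obtain \<xi> \<xi>' where x: "\<xi> \<in> H.P.B.L2" "\<xi>' \<in> H.P.B.L2" "AE \<omega> in M2. \<xi>' \<omega> = (\<lambda>j. X2 s \<omega> *\<^sub>v \<xi> \<omega> j)"
      "p = (H.P.B.cls \<xi>, H.P.B.cls \<xi>')"
      unfolding H.P.B.graph_iff[OF s] by auto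
    \<comment> \<open>For the reverse inclusion the point is transported back by \<open>V\<close>,
      which respects the graphs too, and recovered by \<open>U\<close>.\<close>
    have "(V (H.P.B.cls \<xi>), V (H.P.B.cls \<xi>')) \<in> mult_integral_tuple M1 f1 X1 s"
      unfolding H.P.A.graph_iff[OF s] V[OF x(1)] V[OF x(2)]
      using H.P.R_L2[OF x(1)] H.P.R_L2[OF x(2)] H.P.R_graph[OF x(1,2) s x(3)] by blast
    moreover have "p = map_prod U U (V (H.P.B.cls \<xi>), V (H.P.B.cls \<xi>'))"
      unfolding x(4) map_prod_simp UV[OF x(1)] UV[OF x(2)] ..
    ultimately show "p \<in> map_prod U U ` mult_integral_tuple M1 f1 X1 s" by (rule image_eqI[rotated])
  qed
  then show ?thesis unfolding unitarily_equivalent_def using un by blast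
qed

lemma intertwiner_inverse:
  assumes V: "unitary_mat n V" and X: "X \<in> carrier_mat n n" and Y: "Y \<in> carrier_mat n n" and e: "V * Y = X * V"
  shows "mat_adjoint V * X = Y * mat_adjoint V"
proof -
  have c: "V \<in> carrier_mat n n" "mat_adjoint V * V = 1\<^sub>m n" "V * mat_adjoint V = 1\<^sub>m n"
    using V by (simp_all add: unitary_mat_def)
  have a: "mat_adjoint V \<in> carrier_mat n n" using c(1) by auto
  have "mat_adjoint V * X = mat_adjoint V * (X * (V * mat_adjoint V))" using X c(3) by simp
  also have "X * (V * mat_adjoint V) = V * Y * mat_adjoint V"
    unfolding assoc_mult_mat[OF X c(1) a, symmetric] e ..
  also have "mat_adjoint V * (V * Y * mat_adjoint V) = mat_adjoint V * V * (Y * mat_adjoint V)"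
    unfolding assoc_mult_mat[OF c(1) Y a] by (rule assoc_mult_mat[OF a c(1) mult_carrier_mat[OF Y a], symmetric])
  also have "\<dots> = Y * mat_adjoint V" unfolding c(2) by (rule left_mult_one_mat[OF mult_carrier_mat[OF Y a]])
  finally show ?thesis .
qed

text \<open>The intertwiner is chosen measurably for \<open>\<Phi>\<close> only. For the inverse map
  its adjoint is used, and the weight is replaced by its reciprocal, so that the two transports
  cancel exactly over \<open>W1\<close> and \<open>W2\<close>.\<close>

lemma Borel_isomorphism_imp_unitarily_equivalent:
  fixes M1 :: "'a measure" and M2 :: "'b measure"
  assumes A: "irreducible_field k M1 f1 X1" and B: "irreducible_field k M2 f2 X2"
    and Z: "Z1 \<in> sets M1" "Z2 \<in> sets M2" "emeasure M1 Z1 = 0" "emeasure M2 Z2 = 0"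
    and iso: "borel_isomorphism (restrict_space M1 (space M1 - Z1)) (restrict_space M2 (space M2 - Z2)) \<Phi>"
    and null: "\<And>E. E \<in> sets M1 \<Longrightarrow> E \<subseteq> space M1 - Z1 \<Longrightarrow> emeasure M2 (\<Phi> ` E) = 0 \<longleftrightarrow> emeasure M1 E = 0"
    and eq: "\<And>\<omega>. \<omega> \<in> space M1 - Z1 \<Longrightarrow>
      mats_unitarily_equivalent k (\<lambda>s. X2 s (\<Phi> \<omega>)) (\<lambda>s. X1 s \<omega>) \<and> f2 (\<Phi> \<omega>) = f1 \<omega>"
  shows "unitarily_equivalent k (mult_integral_space M1 f1 X1) (mult_integral_tuple M1 f1 X1)
           (mult_integral_space M2 f2 X2) (mult_integral_tuple M2 f2 X2)"
proof -
  interpret A: irreducible_field k M1 f1 X1 by fact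
  interpret B: irreducible_field k M2 f2 X2 by fact
  define W1 where "W1 = space M1 - Z1"
  define W2 where "W2 = space M2 - Z2"
  have W: "W1 \<in> sets M1" "W2 \<in> sets M2" using Z by (auto simp: W1_def W2_def)
  have sp: "space (restrict_space M1 W1) = W1" "space (restrict_space M2 W2) = W2"
    by (auto simp: W1_def W2_def space_restrict_space)
  have ae: "AE \<omega> in M1. \<omega> \<in> W1" "AE \<omega> in M2. \<omega> \<in> W2"
  proof -
    have n: "Z1 \<in> null_sets M1" "Z2 \<in> null_sets M2" using Z by (simp_all add: null_sets_def)
    show "AE \<omega> in M1. \<omega> \<in> W1" using AE_not_in[OF n(1)] AE_space by eventually_elim (simp add: W1_def)
    show "AE \<omega> in M2. \<omega> \<in> W2" using AE_not_in[OF n(2)] AE_space by eventually_elim (simp add: W2_def)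
  qed
  define \<Psi> where "\<Psi> = inv_into W1 \<Phi>"
  have bij: "bij_betw \<Phi> W1 W2" and \<Phi>: "\<Phi> \<in> measurable (restrict_space M1 W1) (restrict_space M2 W2)"
    and \<Psi>: "\<Psi> \<in> measurable (restrict_space M2 W2) (restrict_space M1 W1)"
    using iso unfolding borel_isomorphism_def W1_def[symmetric] W2_def[symmetric] sp \<Psi>_def by auto
  have \<Phi>M: "\<Phi> \<in> measurable (restrict_space M1 W1) M2" and \<Psi>M: "\<Psi> \<in> measurable (restrict_space M2 W2) M1"
    using \<Phi> \<Psi> by (simp_all add: measurable_restrict_space2_iff)
  have \<Phi>W: "\<Phi> \<omega> \<in> W2" "\<Psi> (\<Phi> \<omega>) = \<omega>" if "\<omega> \<in> W1" for \<omega>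
    using that bij by (auto simp: \<Psi>_def bij_betw_inv_into_left intro: bij_betwE[THEN bspec])
  have \<Psi>W: "\<Psi> \<omega> \<in> W1" "\<Phi> (\<Psi> \<omega>) = \<omega>" if "\<omega> \<in> W2" for \<omega>
    using that bij by (auto simp: \<Psi>_def bij_betw_inv_into_right intro: bij_betwE[OF bij_betw_inv_into, THEN bspec])
  have eq': "mats_unitarily_equivalent k (\<lambda>s. X2 s (\<Phi> \<omega>)) (\<lambda>s. X1 s \<omega>)" "f2 (\<Phi> \<omega>) = f1 \<omega>" if "\<omega> \<in> W1" for \<omega>
    using eq that unfolding W1_def by blast+
  interpret F: matched_fields k M1 f1 X1 M2 f2 X2 W1 \<Phi>
    by unfold_locales (use W \<Phi>M eq' A.irr B.irr in auto)
  have sf: "sigma_finite_measure M1" "sigma_finite_measure M2"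
    using A.std B.std by (simp_all add: standard_measure_space_def)
  obtain c where c: "c \<in> borel_measurable M1" "\<And>\<omega>. 0 < c \<omega>"
    "distr (density (restrict_space M1 W1) (\<lambda>\<omega>. ennreal ((c \<omega>)\<^sup>2))) M2 \<Phi> = M2"
    "distr (density (restrict_space M2 W2) (\<lambda>\<omega>. ennreal ((1 / c (\<Psi> \<omega>))\<^sup>2))) M1 \<Psi> = M1"
    using change_of_density[OF sf W ae \<Phi> \<Psi> \<Phi>W(2) \<Psi>W(2) null[folded W1_def]] by blast
  interpret P: pullback k M1 f1 X1 M2 f2 X2 W1 \<Phi> c F.T
    by unfold_locales (rule W(1) \<Phi>M F.deg_eq F.f_eq F.T_mfield F.T_unitary_intertwiner c(1,3) | assumption)+
  \<comment> \<open>Off \<open>W2\<close> the weight and the matrix take default values, with the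
    matrix of the right size, so that both are measurable on all of \<open>M2\<close>.\<close>
  define c' where "c' \<omega> = (if \<omega> \<in> W2 then 1 / c (\<Psi> \<omega>) else 1)" for \<omega>
  define T' where "T' \<omega> = (if \<omega> \<in> W2 then mat_adjoint (F.T (\<Psi> \<omega>)) else 0\<^sub>m (B.deg \<omega>) (B.deg \<omega>))" for \<omega>
  have degW: "A.deg (\<Psi> \<omega>) = B.deg \<omega>" if "\<omega> \<in> W2" for \<omega>
    using F.deg_eq[OF \<Psi>W(1)[OF that]] \<Psi>W(2)[OF that] by simp
  have T'u: "unitary_mat (B.deg \<omega>) (T' \<omega>)" if "\<omega> \<in> W2" for \<omega>
    using unitary_mat_adjoint[OF F.T_unitary_intertwiner(1)[OF \<Psi>W(1)[OF that]]] that degW[OF that] by (simp add: T'_def)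
  have T'm: "B.mfield T'"
    unfolding B.mfield_def
  proof (intro conjI ballI allI)
    fix \<omega>
    show "T' \<omega> \<in> carrier_mat (B.deg \<omega>) (B.deg \<omega>)"
      using T'u[of \<omega>] by (cases "\<omega> \<in> W2") (simp_all add: unitary_mat_def T'_def)
  next
    fix i l
    have "A.ment F.T l i \<in> borel_measurable M1" using F.T_mfield by (simp add: A.mfield_def)
    then have "(\<lambda>\<omega>. cnj (A.ment F.T l i \<omega>)) \<in> borel_measurable M1"
      by (rule borel_measurable_continuous_on[OF continuous_on_cnj[OF continuous_on_id]])
    from pull_measurable[OF W(2) \<Psi>M this, of 0]
    have "(\<lambda>\<omega>. if \<omega> \<in> W2 then cnj (A.ment F.T l i (\<Psi> \<omega>)) else 0) \<in> borel_measurable M2" .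
    moreover have "B.ment T' i l = (\<lambda>\<omega>. if \<omega> \<in> W2 then cnj (A.ment F.T l i (\<Psi> \<omega>)) else 0)"
    proof
      fix \<omega>
      show "B.ment T' i l \<omega> = (if \<omega> \<in> W2 then cnj (A.ment F.T l i (\<Psi> \<omega>)) else 0)"
        using F.T_carrier[of "\<Psi> \<omega>"] degW[of \<omega>]
        by (cases "\<omega> \<in> W2") (auto simp: A.ment_def B.ment_def T'_def)
    qed
    ultimately show "B.ment T' i l \<in> borel_measurable M2" by simp
  qed
  have T'X: "T' \<omega> * X1 s (\<Psi> \<omega>) = X2 s \<omega> * T' \<omega>" if w: "\<omega> \<in> W2" and s: "s \<in> {1..k}" for \<omega> s
  proof -
    note v = \<Psi>W(1)[OF w]
    have X: "X1 s (\<Psi> \<omega>) \<in> carrier_mat (A.deg (\<Psi> \<omega>)) (A.deg (\<Psi> \<omega>))" by (rule A.X_carrier[OF F.W1_space[OF v] s])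
    have Y: "X2 s \<omega> \<in> carrier_mat (A.deg (\<Psi> \<omega>)) (A.deg (\<Psi> \<omega>))"
      unfolding degW[OF w] by (rule B.X_carrier) (use w s in \<open>auto simp: W2_def\<close>)
    show ?thesis
      unfolding T'_def if_P[OF w]
      by (rule intertwiner_inverse[OF F.T_unitary_intertwiner(1)[OF v] X Y])
        (use F.T_unitary_intertwiner(2)[OF v s] \<Psi>W(2)[OF w] in simp)
  qed
  have c'm: "c' \<in> borel_measurable M2"
  proof -
    have "(\<lambda>\<omega>. 1 / c \<omega>) \<in> borel_measurable M1" using c(1) by measurable
    from pull_measurable[OF W(2) \<Psi>M this, of 1] show ?thesis unfolding c'_def[abs_def] .
  qed
  have c'd: "distr (density (restrict_space M2 W2) (\<lambda>\<omega>. ennreal ((c' \<omega>)\<^sup>2))) M1 \<Psi> = M1"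
  proof -
    have "density (restrict_space M2 W2) (\<lambda>\<omega>. ennreal ((c' \<omega>)\<^sup>2)) = density (restrict_space M2 W2) (\<lambda>\<omega>. ennreal ((1 / c (\<Psi> \<omega>))\<^sup>2))"
    proof (rule density_cong)
      show m: "(\<lambda>\<omega>. ennreal ((c' \<omega>)\<^sup>2)) \<in> borel_measurable (restrict_space M2 W2)"
        using measurable_restrict_space1[OF c'm] by measurable
      show "(\<lambda>\<omega>. ennreal ((1 / c (\<Psi> \<omega>))\<^sup>2)) \<in> borel_measurable (restrict_space M2 W2)"
        using m by (rule measurable_cong[THEN iffD1, rotated]) (simp add: sp c'_def)
      show "AE \<omega> in restrict_space M2 W2. ennreal ((c' \<omega>)\<^sup>2) = ennreal ((1 / c (\<Psi> \<omega>))\<^sup>2)"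
        by (rule AE_I2) (simp add: sp c'_def)
    qed
    then show ?thesis using c(4) by simp
  qed
  interpret Q: pullback k M2 f2 X2 M1 f1 X1 W2 \<Psi> c' T'
  proof unfold_locales
    show "f1 (\<Psi> \<omega>) = f2 \<omega>" if "\<omega> \<in> W2" for \<omega> using eq'(2)[OF \<Psi>W(1)[OF that]] \<Psi>W(2)[OF that] by simp
  qed (rule W(2) \<Psi>M degW T'm T'u T'X c'm c'd | assumption)+
  have r1: "pullback_retract k M1 f1 X1 M2 f2 X2 W1 \<Phi> c F.T W2 \<Psi> c' T'"
  proof unfold_locales
    show "AE \<omega> in M1. \<omega> \<in> W1" by (rule ae(1))
    fix \<omega> assume w: "\<omega> \<in> W1"
    have "c \<omega> * c' (\<Phi> \<omega>) = 1" using \<Phi>W[OF w] c(2)[of \<omega>] by (simp add: c'_def)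
    moreover have "T' (\<Phi> \<omega>) = mat_adjoint (F.T \<omega>)" using \<Phi>W[OF w] by (simp add: T'_def)
    ultimately show "\<Phi> \<omega> \<in> W2 \<and> \<Psi> (\<Phi> \<omega>) = \<omega> \<and> c \<omega> * c' (\<Phi> \<omega>) = 1 \<and>
      (\<forall>u\<in>carrier_vec (A.deg \<omega>). F.T \<omega> *\<^sub>v (T' (\<Phi> \<omega>) *\<^sub>v u) = u)"
      using \<Phi>W[OF w] unitary_mat_inverse(2)[OF F.T_unitary_intertwiner(1)[OF w]] by simp
  qed
  have r2: "pullback_retract k M2 f2 X2 M1 f1 X1 W2 \<Psi> c' T' W1 \<Phi> c F.T"
  proof unfold_locales
    show "AE \<omega> in M2. \<omega> \<in> W2" by (rule ae(2))
    fix \<omega> assume w: "\<omega> \<in> W2"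
    have "c' \<omega> * c (\<Psi> \<omega>) = 1" using w c(2)[of "\<Psi> \<omega>"] by (simp add: c'_def)
    moreover have "T' \<omega> = mat_adjoint (F.T (\<Psi> \<omega>))" using w by (simp add: T'_def)
    ultimately show "\<Psi> \<omega> \<in> W1 \<and> \<Phi> (\<Psi> \<omega>) = \<omega> \<and> c' \<omega> * c (\<Psi> \<omega>) = 1 \<and>
      (\<forall>u\<in>carrier_vec (B.deg \<omega>). T' \<omega> *\<^sub>v (F.T (\<Psi> \<omega>) *\<^sub>v u) = u)"
      using \<Psi>W[OF w] unitary_mat_inverse(1)[OF F.T_unitary_intertwiner(1)[OF \<Psi>W(1)[OF w]]] degW[OF w] by simp
  qed
  show ?thesis by (rule unitarily_equivalent_pullbacks[OF r1 r2])
qed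

theorem theorem3p1:
  fixes k :: nat
    and M1 :: "'a measure" and M2 :: "'b measure"
    and X1 :: "nat \<Rightarrow> 'a \<Rightarrow> complex mat" and X2 :: "nat \<Rightarrow> 'b \<Rightarrow> complex mat"
    and f1 :: "'a \<Rightarrow> enat" and f2 :: "'b \<Rightarrow> enat"
  assumes "k \<ge> 1"
    and "standard_measure_space M1" and "standard_measure_space M2"
    and "measurable_mat_tuple_field k M1 X1" and "measurable_mat_tuple_field k M2 X2"
    and "f1 \<in> measurable M1 (count_space UNIV)" and "f2 \<in> measurable M2 (count_space UNIV)"
    and "\<forall>\<omega>\<in>space M1. 1 \<le> f1 \<omega>" and "\<forall>\<omega>\<in>space M2. 1 \<le> f2 \<omega>"
    and F1_1: "\<forall>\<omega>\<in>space M1. irreducible_tuple k (\<lambda>s. X1 s \<omega>)"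
    and F1_2: "\<forall>\<omega>\<in>space M2. irreducible_tuple k (\<lambda>s. X2 s \<omega>)"
    and F2_1: "\<forall>\<omega>\<in>space M1. \<forall>\<omega>'\<in>space M1. \<omega> \<noteq> \<omega>' \<longrightarrow>
                 \<not> mats_unitarily_equivalent k (\<lambda>s. X1 s \<omega>) (\<lambda>s. X1 s \<omega>')"
    and F2_2: "\<forall>\<omega>\<in>space M2. \<forall>\<omega>'\<in>space M2. \<omega> \<noteq> \<omega>' \<longrightarrow>
                 \<not> mats_unitarily_equivalent k (\<lambda>s. X2 s \<omega>) (\<lambda>s. X2 s \<omega>')"
  shows "unitarily_equivalent k
           (mult_integral_space M1 f1 X1) (mult_integral_tuple M1 f1 X1)
           (mult_integral_space M2 f2 X2) (mult_integral_tuple M2 f2 X2)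
         \<longleftrightarrow>
         (\<exists>Z1\<in>sets M1. \<exists>Z2\<in>sets M2. \<exists>\<Phi> :: 'a \<Rightarrow> 'b.
            borel_isomorphism (restrict_space M1 (space M1 - Z1))
                              (restrict_space M2 (space M2 - Z2)) \<Phi> \<and>
            (emeasure M1 Z1 = 0 \<and> emeasure M2 Z2 = 0) \<and>
            (\<forall>B\<in>sets M1. B \<subseteq> space M1 - Z1 \<longrightarrow>
               (emeasure M2 (\<Phi> ` B) = 0 \<longleftrightarrow> emeasure M1 B = 0)) \<and>
            (\<forall>\<omega>\<in>space M1 - Z1.
               mats_unitarily_equivalent k (\<lambda>s. X2 s (\<Phi> \<omega>)) (\<lambda>s. X1 s \<omega>) \<and>
               f2 (\<Phi> \<omega>) = f1 \<omega>))"
  (is "?eq \<longleftrightarrow> ?iso")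
proof -
  have A: "irreducible_field k M1 f1 X1"
    by unfold_locales (use assms in auto)
  have B: "irreducible_field k M2 f2 X2"
    by unfold_locales (use assms in auto)
  show ?thesis
  proof
    assume ?eq
    then show ?iso by (rule unitarily_equivalent_imp_Borel_isomorphism[OF A B])
  next
    assume ?iso
    then obtain Z1 Z2 \<Phi> where Z: "Z1 \<in> sets M1" "Z2 \<in> sets M2"
      and *: "borel_isomorphism (restrict_space M1 (space M1 - Z1)) (restrict_space M2 (space M2 - Z2)) \<Phi> \<and>
            (emeasure M1 Z1 = 0 \<and> emeasure M2 Z2 = 0) \<and>
            (\<forall>B\<in>sets M1. B \<subseteq> space M1 - Z1 \<longrightarrow> (emeasure M2 (\<Phi> ` B) = 0 \<longleftrightarrow> emeasure M1 B = 0)) \<and>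
            (\<forall>\<omega>\<in>space M1 - Z1.
               mats_unitarily_equivalent k (\<lambda>s. X2 s (\<Phi> \<omega>)) (\<lambda>s. X1 s \<omega>) \<and> f2 (\<Phi> \<omega>) = f1 \<omega>)"
      by (elim bexE exE)
    show ?eq
      by (rule Borel_isomorphism_imp_unitarily_equivalent[OF A B Z, where \<Phi> = \<Phi>]) (use * in simp_all)
  qed
qed

end
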